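(* Let $T>0$, let $\gamma,\sigma>0$ and $W\in C^2(\mathbb{T})$. Let $\{(q_i,p_i)\}_{i=1}^N$ be the interacting particle system defined in the context, with Brownian motions $\beta_1,\dots,\beta_N$ and initial data as specified there, and let $\rho_\epsilon(x,t):=\frac1N\sum_{i=1}^Nw_\epsilon(x-q_i(t))$. Assume the scaling $N\epsilon^\theta=1$ with $\theta$ large enough. Define the noises $$\dot{\mathcal{Z}}_N(x,t):=\frac\sigma N\sum_{i=1}^Nw_\epsilon(x-q_i(t))\,\dot\beta_i(t),\qquad \dot{\mathcal{Y}}_N:=\sigma N^{-1/2}\sqrt{\rho_{\epsilon/\sqrt2}}\;Q_{\sqrt2\epsilon}^{1/2}\xi,$$ with $\mathcal{Z}_N(\cdot,0)=\mathcal{Y}_N(\cdot,0)=0$, where $\xi$ is space-time white noise and $Q_{\sqrt2\epsilon}:L^2(\mathbb{T})\to L^2(\mathbb{T})$ is the convolution operator with kernel $w_{\sqrt2\epsilon}$. Let $\alpha\in(0,1)$ be as in the context. Then there are positive $C=C(T)$, $c_1(\theta)$ and $c_2(\theta)$ such that, for all $x_1,x_2\in\mathbb{T}$ and $t\in[0,T]$, $$\big|\mathbb{E}[\mathcal{Z}_N(x_1,t)\mathcal{Z}_N(x_2,t)]-\mathbb{E}[\mathcal{Y}_N(x_1,t)\mathcal{Y}_N(x_2,t)]\big|$$ $$\le\frac{C\sigma^2}{N}\,w_{\sqrt2\epsilon}(x_1-x_2)\left\{|x_1-x_2|+\epsilon^{c_1(\theta)}+\epsilon^\alpha+\epsilo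n^{c_2(\theta)}|x_1-x_2|^{1/2}\right\}+\frac{C\sigma^2}{N}\epsilon^\alpha.$$
   Context: $\mathbb{T}=\mathbb{R}/2\pi\mathbb{Z}$, with $|x_1-x_2|$ the distance on $\mathbb{T}$; $\ast$ is convolution on $\mathbb{T}$. For $\epsilon>0$, $w_\epsilon(x):=Z_\epsilon^{-1}\exp\{-\sin^2(x/2)/(\epsilon^2/2)\}$, with $Z_\epsilon$ the normalising constant making $\int_{\mathbb{T}}w_\epsilon=1$ (von Mises density). Exponent $\alpha$: let $\gamma_\epsilon$ be the density of a centred Gaussian with variance $\epsilon^2$ and $r_\epsilon:=w_\epsilon-\gamma_\epsilon$ on $(-\pi,\pi)$; $\alpha\in(0,1)$ is a fixed exponent for which $\|r_\epsilon\|_{C^0(-\pi,\pi)}\le\epsilon^\alpha$ for all sufficiently small $\epsilon>0$. Noise $\mathcal{Y}_N$: $Q_{\sqrt2\epsilon}^{1/2}\xi$ is the formal time derivative of an $H^1(\mathbb{T})$-valued $Q$-Wiener process with covariance operator $Q_{\sqrt2\epsilon}$, and $\mathcal{Y}_N(x,t)$ is the It\^o integral in time over $[0,t]$ of $\sigma N^{-1/2}\sqrt{\rho_{\epsilon/\sqrt2}(x,\cdot)}$ against this Wiener process evaluated at $x$ (Wiener process and particles being adapted to a common filtration). Similarly, $\mathcal{Z}_N(x,t)=\int_0^t\frac\sigma N\sum_iw_\epsilon(x-q_i(u))\,d\beta_i(u)$. Interacting particles: $(q_i,p_i)\in\mathbb{T}\times\mathbb{R}$, $i=1,\dots,N$,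 solve $$\dot q_i=p_i,\qquad \dot p_i=-\gamma p_i-\frac1N\sum_{j=1}^NW'(q_i-q_j)+\sigma\dot\beta_i,$$ with $\beta_1,\dots,\beta_N$ independent Brownian motions and i.i.d. initial data $(q_{i,0},p_{i,0})$ (independent of the Brownian motions). Auxiliary (McKean--Vlasov) particles: a process $(\overline q,\overline p)$ solves $\dot{\overline q}=\overline p$, $\dot{\overline p}=-\gamma\overline p-W'\ast\mu_t(\overline q)+\sigma\dot\beta$, where $\mu_t$ is the law of $\overline q(t)$. Initial data: the common law of the initial data $(q_{i,0},p_{i,0})$ is the law of $(\overline q_{\mathrm{aux}}(t_0),\overline p_{\mathrm{aux}}(t_0))$ for some $t_0>0$, where $(\overline q_{\mathrm{aux}},\overline p_{\mathrm{aux}})$ solves the McKean--Vlasov dynamics above starting from a probability density $f_0$ on $\mathbb{T}\times\mathbb{R}$ with $\int_{\mathbb{T}}\int_{\mathbb{R}}f_0(q,p)(1+p^2)^k\,dp\,dq<\infty$ for all $k\in\mathbb{N}$. "$N\epsilon^\theta=1$ with $\theta$ large enough" means: there is $\theta_0$ such that the statement holds for every $\theta>\theta_0$, with $\epsilon\in(0,1]$ and $N\in\mathbb{N}$ linked by $N=\epsilon^{-\theta}$; $C$ does not depend on $\epsilon,N,x_1,x_2,t$ (dependence on the fixed data $W,\gamma,\sigma,t_0,f_0,\theta$ is suppressed). *)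

theory Defs
  imports "HOL-Probability.Probability" "HOL-Library.Real_Mod"
begin

text \<open>
  Functions on the torus are \<open>2\<pi>\<close>-periodic functions on \<open>real\<close>, and torus-valued processes are
  represented by real-valued lifts. Laws of torus-valued random variables are those of the
  representative in \<open>[-\<pi>, \<pi>)\<close>, so they do not depend on the choice of the lift.
\<close>

definition periodic :: "(real \<Rightarrow> real) \<Rightarrow> bool" where
  "periodic f \<longleftrightarrow> (\<forall>x. f (x + 2 * pi) = f x)"

definition wrap :: "real \<Rightarrow> real" where
  "wrap x = (x + pi) rmod (2 * pi) - pi"

definition torus :: "real measure" where
  "torus = restrict_space lborel {-pi..<pi}"

definition torus_dist :: "real \<Rightarrow> real \<Rightarrow> real" where
  "torus_dist x y = (INF k::int. \<bar>x - y - 2 * pi * of_int k\<bar>)"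

definition conv :: "(real \<Rightarrow> real) \<Rightarrow> (real \<Rightarrow> real) \<Rightarrow> real \<Rightarrow> real" where
  "conv f g x = (LINT y|torus. f (x - y) * g y)"

definition C2_torus :: "(real \<Rightarrow> real) \<Rightarrow> bool" where
  "C2_torus W \<longleftrightarrow> periodic W \<and> W differentiable_on UNIV \<and> deriv W differentiable_on UNIV \<and>
     continuous_on UNIV (deriv (deriv W))"

subsection \<open>The von Mises kernel\<close>

definition vm_unnorm :: "real \<Rightarrow> real \<Rightarrow> real" where
  "vm_unnorm \<epsilon> x = exp (- ((sin (x / 2))\<^sup>2 / (\<epsilon>\<^sup>2 / 2)))"

definition vm :: "real \<Rightarrow> real \<Rightarrow> real" where
  "vm \<epsilon> x = vm_unnorm \<epsilon> x / (LINT y|torus. vm_unnorm \<epsilon> y)"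

text \<open>\<open>normal_density\<close> takes the standard deviation, so the Gaussian below has variance \<open>\<epsilon>\<^sup>2\<close>.\<close>

definition vm_gauss_exponent :: "real \<Rightarrow> bool" where
  "vm_gauss_exponent \<alpha> \<longleftrightarrow> 0 < \<alpha> \<and> \<alpha> < 1 \<and>
     (\<forall>\<^sub>F \<epsilon> in at_right 0. \<forall>x\<in>{-pi<..<pi}. \<bar>vm \<epsilon> x - normal_density 0 \<epsilon> x\<bar> \<le> \<epsilon> powr \<alpha>)"

subsection \<open>The spaces \<open>L\<^sup>2\<close> and \<open>H\<^sup>1\<close> on the torus\<close>

definition L2_torus :: "(real \<Rightarrow> real) set" where
  "L2_torus = {g. periodic g \<and> g \<in> borel_measurable borel \<and> integrable torus (\<lambda>x. (g x)\<^sup>2)}"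

definition L2_inner :: "(real \<Rightarrow> real) \<Rightarrow> (real \<Rightarrow> real) \<Rightarrow> real" where
  "L2_inner g h = (LINT x|torus. g x * h x)"

definition is_weak_deriv :: "(real \<Rightarrow> real) \<Rightarrow> (real \<Rightarrow> real) \<Rightarrow> bool" where
  "is_weak_deriv g h \<longleftrightarrow> h \<in> L2_torus \<and>
     (\<forall>\<phi>. periodic \<phi> \<and> (\<forall>k. (deriv ^^ k) \<phi> differentiable_on UNIV) \<longrightarrow>
        L2_inner g (deriv \<phi>) = - L2_inner h \<phi>)"

text \<open>Elements of \<open>H\<^sup>1\<close> are represented by their continuous representatives, so that they can be
  evaluated at points.\<close>

definition H1_torus :: "(real \<Rightarrow> real) set" where
  "H1_torus = {g \<in> L2_torus. continuous_on UNIV g \<and> (\<exists>h. is_weak_deriv g h)}"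

definition H1_norm :: "(real \<Rightarrow> real) \<Rightarrow> real" where
  "H1_norm g = (let h = (SOME h. is_weak_deriv g h) in sqrt (L2_inner g g + L2_inner h h))"

subsection \<open>Wiener processes on a filtered probability space\<close>

definition filtered_prob_space :: "'a measure \<Rightarrow> (real \<Rightarrow> 'a measure) \<Rightarrow> bool" where
  "filtered_prob_space M F \<longleftrightarrow>
     prob_space M \<and> filtration (space M) F \<and> (\<forall>t. subalgebra M (F t))"

definition centred_normal :: "real \<Rightarrow> real measure" where
  "centred_normal v =
     (if v = 0 then return borel 0 else density lborel (\<lambda>x. ennreal (normal_density 0 (sqrt v) x)))"

definition has_law :: "'a measure \<Rightarrow> ('a \<Rightarrow> real) \<Rightarrow> real measure \<Rightarrow> bool" where
  "has_law M X \<mu> \<longleftrightarrow> X \<in> borel_measurable M \<and> distr M borel X = \<mu>"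

definition adapted :: "(real \<Rightarrow> 'a measure) \<Rightarrow> (real \<Rightarrow> 'a \<Rightarrow> real) \<Rightarrow> bool" where
  "adapted F X \<longleftrightarrow> (\<forall>t\<ge>0. X t \<in> borel_measurable (F t))"

definition brownian_motion ::
    "'a measure \<Rightarrow> (real \<Rightarrow> 'a measure) \<Rightarrow> (real \<Rightarrow> 'a \<Rightarrow> real) \<Rightarrow> bool" where
  "brownian_motion M F B \<longleftrightarrow>
     adapted F B \<and>
     (AE \<omega> in M. B 0 \<omega> = 0 \<and> continuous_on {0..} (\<lambda>t. B t \<omega>)) \<and>
     (\<forall>s\<ge>0. \<forall>t>s.
        has_law M (\<lambda>\<omega>. B t \<omega> - B s \<omega>) (centred_normal (t - s)) \<and>
        prob_space.indep_set M (sets (F s))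
          (sets (vimage_algebra (space M) (\<lambda>\<omega>. B t \<omega> - B s \<omega>) borel)))"

text \<open>
  An \<open>H\<^sup>1\<close>-valued \<open>Q\<close>-Wiener process \<open>V\<close>, with \<open>V t \<omega> x\<close> the value at \<open>x\<close> of \<open>V(t)\<close>. The covariance
  operator \<open>Q\<close> acts on \<open>L\<^sup>2\<close>: increments are centred Gaussian with
  \<open>E[\<langle>V(t) - V(s), h\<rangle>\<^sup>2] = (t - s) \<langle>Q h, h\<rangle>\<close> in the \<open>L\<^sup>2\<close> inner product.
  The Borel sigma-algebra of \<open>H\<^sup>1\<close> is generated by the point evaluations.
\<close>

definition Q_wiener_process ::
    "'a measure \<Rightarrow> (real \<Rightarrow> 'a measure) \<Rightarrow> ((real \<Rightarrow> real) \<Rightarrow> real \<Rightarrow> real) \<Rightarrow>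
     (real \<Rightarrow> 'a \<Rightarrow> real \<Rightarrow> real) \<Rightarrow> bool" where
  "Q_wiener_process M F Q V \<longleftrightarrow>
     (\<forall>x. adapted F (\<lambda>t \<omega>. V t \<omega> x)) \<and>
     (AE \<omega> in M. (\<forall>x. V 0 \<omega> x = 0) \<and> (\<forall>t\<ge>0. V t \<omega> \<in> H1_torus) \<and>
        (\<forall>t\<ge>0. ((\<lambda>s. H1_norm (\<lambda>x. V s \<omega> x - V t \<omega> x)) \<longlongrightarrow> 0) (at t within {0..}))) \<and>
     (\<forall>s\<ge>0. \<forall>t>s.
        (\<forall>h\<in>L2_torus. \<exists>X. (AE \<omega> in M. X \<omega> = L2_inner (\<lambda>x. V t \<omega> x - V s \<omega> x) h) \<and>
           has_law M X (centred_normal ((t - s) * L2_inner (Q h) h))) \<and>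
        prob_space.indep_set M (sets (F s))
          (sets (vimage_algebra (space M) (\<lambda>\<omega> x. V t \<omega> x - V s \<omega> x) (PiM UNIV (\<lambda>_. borel)))))"

subsection \<open>The Ito integral\<close>

text \<open>
  Elementary integrands \<open>\<Sum>k<n. \<xi> k * 1\<^bsub>(\<tau> k, \<tau> (k + 1)]\<^esub>\<close> with \<open>\<xi> k\<close> bounded and \<open>F (\<tau> k)\<close>-measurable.
  The general integral over \<open>[0, t]\<close> is the limit in \<open>L\<^sup>2\<close> of elementary integrals; it is used for
  integrators that are constant multiples of a Brownian motion, for which the \<open>L\<^sup>2(dt \<otimes> M)\<close>-norm is
  the right norm on integrands.
\<close>

definition elementary ::
    "'a measure \<Rightarrow> (real \<Rightarrow> 'a measure) \<Rightarrow> nat \<Rightarrow> (nat \<Rightarrow> real) \<Rightarrow> (nat \<Rightarrow> 'a \<Rightarrow> real) \<Rightarrow> bool" where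
  "elementary M F n \<tau> \<xi> \<longleftrightarrow>
     0 \<le> \<tau> 0 \<and>
     (\<forall>k<n. \<tau> k \<le> \<tau> (Suc k) \<and> \<xi> k \<in> borel_measurable (F (\<tau> k)) \<and>
        (\<exists>b. \<forall>\<omega>\<in>space M. \<bar>\<xi> k \<omega>\<bar> \<le> b))"

definition elementary_process ::
    "nat \<Rightarrow> (nat \<Rightarrow> real) \<Rightarrow> (nat \<Rightarrow> 'a \<Rightarrow> real) \<Rightarrow> real \<Rightarrow> 'a \<Rightarrow> real" where
  "elementary_process n \<tau> \<xi> u \<omega> = (\<Sum>k<n. \<xi> k \<omega> * indicator {\<tau> k<..\<tau> (Suc k)} u)"

definition elementary_integral ::
    "(real \<Rightarrow> 'a \<Rightarrow> real) \<Rightarrow> nat \<Rightarrow> (nat \<Rightarrow> real) \<Rightarrow> (nat \<Rightarrow> 'a \<Rightarrow> real) \<Rightarrow> real \<Rightarrow> 'a \<Rightarrow> real" where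
  "elementary_integral X n \<tau> \<xi> t \<omega> =
     (\<Sum>k<n. \<xi> k \<omega> * (X (min (\<tau> (Suc k)) t) \<omega> - X (min (\<tau> k) t) \<omega>))"

definition has_ito_integral ::
    "'a measure \<Rightarrow> (real \<Rightarrow> 'a measure) \<Rightarrow> (real \<Rightarrow> 'a \<Rightarrow> real) \<Rightarrow> (real \<Rightarrow> 'a \<Rightarrow> real) \<Rightarrow> real \<Rightarrow>
     ('a \<Rightarrow> real) \<Rightarrow> bool" where
  "has_ito_integral M F X f t I \<longleftrightarrow>
     I \<in> borel_measurable M \<and>
     (\<exists>n \<tau> \<xi>. (\<forall>m. elementary M F (n m) (\<tau> m) (\<xi> m)) \<and>
        (\<lambda>m. \<integral>\<^sup>+u\<in>{0..t}. (\<integral>\<^sup>+\<omega>. ennreal ((f u \<omega> - elementary_process (n m) (\<tau> m) (\<xi> m) u \<omega>)\<^sup>2) \<partial>M)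
            \<partial>lborel) \<longlonglongrightarrow> 0 \<and>
        (\<lambda>m. \<integral>\<^sup>+\<omega>. ennreal ((I \<omega> - elementary_integral X (n m) (\<tau> m) (\<xi> m) t \<omega>)\<^sup>2) \<partial>M)
            \<longlonglongrightarrow> 0)"

definition ito_integral ::
    "'a measure \<Rightarrow> (real \<Rightarrow> 'a measure) \<Rightarrow> (real \<Rightarrow> 'a \<Rightarrow> real) \<Rightarrow> (real \<Rightarrow> 'a \<Rightarrow> real) \<Rightarrow> real \<Rightarrow>
     'a \<Rightarrow> real" where
  "ito_integral M F X f t = (SOME I. has_ito_integral M F X f t I)"

subsection \<open>Particle dynamics\<close>

text \<open>The noise is additive, so the integrated form of the stochastic equation is pathwise.
  The process \<open>b\<close> is the force.\<close>

definition kinetic_sde ::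
    "'a measure \<Rightarrow> (real \<Rightarrow> 'a measure) \<Rightarrow> real \<Rightarrow> real \<Rightarrow> (real \<Rightarrow> 'a \<Rightarrow> real) \<Rightarrow>
     (real \<Rightarrow> 'a \<Rightarrow> real) \<Rightarrow> (real \<Rightarrow> 'a \<Rightarrow> real) \<Rightarrow> (real \<Rightarrow> 'a \<Rightarrow> real) \<Rightarrow> bool" where
  "kinetic_sde M F \<gamma> \<sigma> b \<beta> q p \<longleftrightarrow>
     adapted F q \<and> adapted F p \<and>
     (AE \<omega> in M. continuous_on {0..} (\<lambda>t. q t \<omega>) \<and> continuous_on {0..} (\<lambda>t. p t \<omega>) \<and>
        (\<forall>t\<ge>0. q t \<omega> = q 0 \<omega> + (LBINT s=0..t. p s \<omega>) \<and>
                p t \<omega> = p 0 \<omega> + (LBINT s=0..t. - \<gamma> * p s \<omega> + b s \<omega>) + \<sigma> * \<beta> t \<omega>))"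

definition torus_law :: "'a measure \<Rightarrow> ('a \<Rightarrow> real) \<Rightarrow> real measure" where
  "torus_law M X = distr M borel (\<lambda>\<omega>. wrap (X \<omega>))"

definition phase_law :: "'a measure \<Rightarrow> ('a \<Rightarrow> real) \<Rightarrow> ('a \<Rightarrow> real) \<Rightarrow> (real \<times> real) measure" where
  "phase_law M X Y = distr M borel (\<lambda>\<omega>. (wrap (X \<omega>), Y \<omega>))"

definition mckean_vlasov ::
    "'a measure \<Rightarrow> (real \<Rightarrow> 'a measure) \<Rightarrow> real \<Rightarrow> real \<Rightarrow> (real \<Rightarrow> real) \<Rightarrow>
     (real \<Rightarrow> 'a \<Rightarrow> real) \<Rightarrow> (real \<Rightarrow> 'a \<Rightarrow> real) \<Rightarrow> (real \<Rightarrow> 'a \<Rightarrow> real) \<Rightarrow> bool" where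
  "mckean_vlasov M F \<gamma> \<sigma> W \<beta> q p \<longleftrightarrow>
     filtered_prob_space M F \<and> brownian_motion M F \<beta> \<and>
     kinetic_sde M F \<gamma> \<sigma> (\<lambda>t \<omega>. - (LINT y|torus_law M (q t). deriv W (q t \<omega> - y))) \<beta> q p"

definition admissible_density :: "(real \<times> real \<Rightarrow> real) \<Rightarrow> bool" where
  "admissible_density f \<longleftrightarrow>
     f \<in> borel_measurable borel \<and> (\<forall>z. 0 \<le> f z) \<and> (\<forall>q p. f (q + 2 * pi, p) = f (q, p)) \<and>
     (\<integral>\<^sup>+q. \<integral>\<^sup>+p. ennreal (f (q, p)) \<partial>lborel \<partial>torus) = 1 \<and>
     (\<forall>k::nat. (\<integral>\<^sup>+q. \<integral>\<^sup>+p. ennreal (f (q, p) * (1 + p\<^sup>2) ^ k) \<partial>lborel \<partial>torus) < \<infinity>)"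

definition density_law :: "(real \<times> real \<Rightarrow> real) \<Rightarrow> (real \<times> real) measure" where
  "density_law f = density lborel (\<lambda>(q, p). ennreal (f (q, p)) * indicator {-pi..<pi} q)"

text \<open>\<open>\<mu>\<^sub>0\<close> is the common law of the initial data on the phase space.\<close>

definition particle_system ::
    "'a measure \<Rightarrow> (real \<Rightarrow> 'a measure) \<Rightarrow> nat \<Rightarrow> real \<Rightarrow> real \<Rightarrow> (real \<Rightarrow> real) \<Rightarrow> (real \<times> real) measure \<Rightarrow>
     (nat \<Rightarrow> real \<Rightarrow> 'a \<Rightarrow> real) \<Rightarrow> (nat \<Rightarrow> real \<Rightarrow> 'a \<Rightarrow> real) \<Rightarrow> (nat \<Rightarrow> real \<Rightarrow> 'a \<Rightarrow> real) \<Rightarrow> bool" where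
  "particle_system M F N \<gamma> \<sigma> W \<mu>\<^sub>0 \<beta> q p \<longleftrightarrow>
     filtered_prob_space M F \<and>
     (\<forall>i<N. brownian_motion M F (\<beta> i)) \<and>
     prob_space.indep_vars M (\<lambda>_. PiM {0..} (\<lambda>_. borel)) (\<lambda>i \<omega>. \<lambda>t\<in>{0..}. \<beta> i t \<omega>) {..<N} \<and>
     (\<forall>i<N. phase_law M (q i 0) (p i 0) = \<mu>\<^sub>0) \<and>
     prob_space.indep_vars M (\<lambda>_. borel) (\<lambda>i \<omega>. (wrap (q i 0 \<omega>), p i 0 \<omega>)) {..<N} \<and>
     prob_space.indep_set M
       (sets (vimage_algebra (space M) (\<lambda>\<omega>. \<lambda>i\<in>{..<N}. (wrap (q i 0 \<omega>), p i 0 \<omega>))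
          (PiM {..<N} (\<lambda>_. borel))))
       (sets (vimage_algebra (space M) (\<lambda>\<omega>. \<lambda>(i, t)\<in>{..<N} \<times> {0..}. \<beta> i t \<omega>)
          (PiM ({..<N} \<times> {0..}) (\<lambda>_. borel)))) \<and>
     (\<forall>i<N. kinetic_sde M F \<gamma> \<sigma> (\<lambda>t \<omega>. - (1 / real N) * (\<Sum>j<N. deriv W (q i t \<omega> - q j t \<omega>)))
        (\<beta> i) (q i) (p i))"

definition emp_density ::
    "nat \<Rightarrow> real \<Rightarrow> (nat \<Rightarrow> real \<Rightarrow> 'a \<Rightarrow> real) \<Rightarrow> real \<Rightarrow> real \<Rightarrow> 'a \<Rightarrow> real" where
  "emp_density N \<epsilon> q x t \<omega> = (1 / real N) * (\<Sum>i<N. vm \<epsilon> (x - q i t \<omega>))"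

definition noise_Z ::
    "'a measure \<Rightarrow> (real \<Rightarrow> 'a measure) \<Rightarrow> nat \<Rightarrow> real \<Rightarrow> real \<Rightarrow> (nat \<Rightarrow> real \<Rightarrow> 'a \<Rightarrow> real) \<Rightarrow>
     (nat \<Rightarrow> real \<Rightarrow> 'a \<Rightarrow> real) \<Rightarrow> real \<Rightarrow> real \<Rightarrow> 'a \<Rightarrow> real" where
  "noise_Z M F N \<epsilon> \<sigma> \<beta> q x t \<omega> =
     (\<Sum>i<N. ito_integral M F (\<beta> i) (\<lambda>u \<omega>. \<sigma> / real N * vm \<epsilon> (x - q i u \<omega>)) t \<omega>)"

definition noise_Y ::
    "'a measure \<Rightarrow> (real \<Rightarrow> 'a measure) \<Rightarrow> nat \<Rightarrow> real \<Rightarrow> real \<Rightarrow> (real \<Rightarrow> 'a \<Rightarrow> real \<Rightarrow> real) \<Rightarrow>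
     (nat \<Rightarrow> real \<Rightarrow> 'a \<Rightarrow> real) \<Rightarrow> real \<Rightarrow> real \<Rightarrow> 'a \<Rightarrow> real" where
  "noise_Y M F N \<epsilon> \<sigma> V q x t =
     ito_integral M F (\<lambda>u \<omega>. V u \<omega> x)
       (\<lambda>u \<omega>. \<sigma> * real N powr (-1/2) * sqrt (emp_density N (\<epsilon> / sqrt 2) q x u \<omega>)) t"

end

theory Submission
  imports Defs
begin

text \<open>
  By the isometry the two covariances are time integrals: the cross terms of \<open>Z\<close> vanish, and with
  \<open>d = x - y\<close> one compares the mean of \<open>w\<^sub>\<epsilon>(x - q\<^sub>i) w\<^sub>\<epsilon>(y - q\<^sub>i)\<close> with \<open>w\<^bsub>\<surd>2\<epsilon>\<^esub>(d)\<close> times the mean of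
  \<open>\<surd>\<rho>(x) \<surd>\<rho>(y)\<close>. For \<open>|d| \<le> \<epsilon>\<^bsup>7/8\<^esup>\<close> the product of kernels is, up to a relative error, \<open>w\<^bsub>\<surd>2\<epsilon>\<^esub>(d)\<close> times
  \<open>w\<^bsub>\<epsilon>/\<surd>2\<^esub>\<close> at the midpoint, whose mean is \<open>\<rho>\<close> at the midpoint. Propagation of chaos replaces \<open>\<rho>\<close> at
  all three points by its McKean--Vlasov mean, and this mean is Hoelder continuous uniformly in \<open>\<epsilon>\<close>,
  because after a positive time the Fourier coefficients of the law decay. For larger \<open>|d|\<close> both terms
  are of order \<open>\<epsilon>\<close> at most, since the kernels decay like Gaussians.
\<close>

section \<open>Ito integrals\<close>

text \<open>The constants come from three losses. Kernels at scale \<open>\<epsilon>\<close> are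
  given the Lipschitz constant \<open>O(\<epsilon>^-3)\<close> and chaos has rate
  \<open>N^(-1/2)\<close>, so \<open>\<theta> > 7\<close> leaves
  \<open>\<epsilon> powr (1/2)\<close>. For Gaussians the midpoint product formula is exact; for von
  Mises kernels the unnormalised error is of relative order \<open>d^2 + d^4 / \<epsilon>^2\<close>,
  and normalising costs one more power of \<open>\<epsilon>\<close>. The cutoff
  \<open>d = \<epsilon> powr (7/8)\<close> absorbs this, since
  \<open>d^4 / \<epsilon>^3 = \<epsilon> powr (1/2)\<close>, while
  \<open>d^2 / \<epsilon>^2 = \<epsilon> powr (-1/4)\<close> still diverges, so beyond it the
  kernels are tiny. The same lost power is recovered for the normalisers, which are Gaussian up to
  \<open>\<epsilon> powr (1 + \<alpha>)\<close>. Square roots of the density are not Lipschitz near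
  0; but \<open>\<surd>a \<surd>b\<close> lies between \<open>a\<close> and \<open>b\<close>, so no
  lower bound on the density enters. \<open>ito_integral\<close> is a choice, so existence has to
  precede the isometry. Joint measurability in time and chance is avoided: only expectations as
  functions of time are integrated. Euler chains serve as couplings and converge without a rate; the
  rate in \<open>N\<close> is uniform in the step and survives the limit.\<close>

definition L2 :: "'a measure \<Rightarrow> ('a \<Rightarrow> real) \<Rightarrow> bool" where
  "L2 M X \<longleftrightarrow> X \<in> borel_measurable M \<and> integrable M (\<lambda>w. (X w)\<^sup>2)"

lemma L2_mult:
  assumes "L2 M X" "L2 M Y"
  shows "integrable M (\<lambda>w. X w * Y w)"
proof (rule Bochner_Integration.integrable_bound)
  show "integrable M (\<lambda>w. (X w)\<^sup>2 + (Y w)\<^sup>2)" using assms by (auto simp: L2_def)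
  show "(\<lambda>w. X w * Y w) \<in> borel_measurable M" using assms by (auto simp: L2_def)
  have "\<bar>x * y\<bar> \<le> x\<^sup>2 + y\<^sup>2" for x y :: real
    using sum_squares_bound[of "\<bar>x\<bar>" "\<bar>y\<bar>"] mult_nonneg_nonneg[of "\<bar>x\<bar>" "\<bar>y\<bar>"]
    unfolding abs_mult power2_abs by linarith
  then show "AE w in M. norm (X w * Y w) \<le> norm ((X w)\<^sup>2 + (Y w)\<^sup>2)" by simp
qed

lemma L2_add:
  assumes "L2 M X" "L2 M Y"
  shows "L2 M (\<lambda>w. X w + Y w)"
  using assms L2_mult[OF assms] unfolding L2_def power2_sum
  by (auto simp: mult.assoc)

lemma L2_cmult: "L2 M X \<Longrightarrow> L2 M (\<lambda>w. c * X w)"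
  unfolding L2_def power_mult_distrib by auto

lemma L2_diff:
  assumes "L2 M X" "L2 M Y"
  shows "L2 M (\<lambda>w. X w - Y w)"
  using L2_add[OF assms(1) L2_cmult[OF assms(2), of "-1"]] by simp

lemma L2_zero: "L2 M (\<lambda>_. 0)"
  by (simp add: L2_def)

lemma L2_sum: "(\<And>i. i \<in> I \<Longrightarrow> L2 M (X i)) \<Longrightarrow> L2 M (\<lambda>w. \<Sum>i\<in>I. X i w)"
  by (induction I rule: infinite_finite_induct) (auto intro!: L2_add L2_zero)

lemma L2_bounded_mult:
  assumes "L2 M X" "\<xi> \<in> borel_measurable M" "\<And>w. w \<in> space M \<Longrightarrow> \<bar>\<xi> w\<bar> \<le> b"
  shows "L2 M (\<lambda>w. \<xi> w * X w)"
  unfolding L2_def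
proof
  show "(\<lambda>w. \<xi> w * X w) \<in> borel_measurable M" using assms by (auto simp: L2_def)
  show "integrable M (\<lambda>w. (\<xi> w * X w)\<^sup>2)"
  proof (rule Bochner_Integration.integrable_bound)
    show "integrable M (\<lambda>w. b\<^sup>2 * (X w)\<^sup>2)" using assms by (auto simp: L2_def)
    show "(\<lambda>w. (\<xi> w * X w)\<^sup>2) \<in> borel_measurable M" using assms by (auto simp: L2_def)
    have "(\<xi> w * X w)\<^sup>2 \<le> b\<^sup>2 * (X w)\<^sup>2" if "w \<in> space M" for w
      unfolding power_mult_distrib using assms(3)[OF that] abs_le_square_iff[of "\<xi> w" b]
      by (intro mult_right_mono) auto
    then show "AE w in M. norm ((\<xi> w * X w)\<^sup>2) \<le> norm (b\<^sup>2 * (X w)\<^sup>2)" by auto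
  qed
qed

lemma L2_cauchy_schwarz:
  assumes "L2 M X" "L2 M Y"
  shows "(LINT w|M. \<bar>X w * Y w\<bar>) \<le> sqrt (LINT w|M. (X w)\<^sup>2) * sqrt (LINT w|M. (Y w)\<^sup>2)"
proof -
  have m[measurable]: "X \<in> borel_measurable M" "Y \<in> borel_measurable M"
    using assms by (auto simp: L2_def)
  have i: "integrable M (\<lambda>w. (X w)\<^sup>2)" "integrable M (\<lambda>w. (Y w)\<^sup>2)"
    using assms by (auto simp: L2_def)
  have "(\<integral>\<^sup>+w. ennreal \<bar>X w\<bar> * ennreal \<bar>Y w\<bar> \<partial>M)\<^sup>2
      \<le> (\<integral>\<^sup>+w. (ennreal \<bar>X w\<bar>)\<^sup>2 \<partial>M) * (\<integral>\<^sup>+w. (ennreal \<bar>Y w\<bar>)\<^sup>2 \<partial>M)"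
    by (rule Cauchy_Schwarz_nn_integral) auto
  moreover have "(\<integral>\<^sup>+w. ennreal \<bar>X w\<bar> * ennreal \<bar>Y w\<bar> \<partial>M) = ennreal (LINT w|M. \<bar>X w * Y w\<bar>)"
    using integrable_abs[OF L2_mult[OF assms]]
    by (subst nn_integral_eq_integral[symmetric])
       (auto simp: ennreal_mult[symmetric] abs_mult intro!: nn_integral_cong)
  moreover have sq: "(\<integral>\<^sup>+w. (ennreal \<bar>X w\<bar>)\<^sup>2 \<partial>M) = ennreal (LINT w|M. (X w)\<^sup>2)"
    if "integrable M (\<lambda>w. (X w)\<^sup>2)" for X :: "_ \<Rightarrow> real"
    using that by (subst nn_integral_eq_integral[symmetric]) (auto simp: ennreal_power intro!: nn_integral_cong)
  ultimately have "(ennreal (LINT w|M. \<bar>X w * Y w\<bar>))\<^sup>2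
     \<le> ennreal (LINT w|M. (X w)\<^sup>2) * ennreal (LINT w|M. (Y w)\<^sup>2)"
    by (simp only: sq[OF i(1)] sq[OF i(2)])
  then have "(LINT w|M. \<bar>X w * Y w\<bar>)\<^sup>2 \<le> (LINT w|M. (X w)\<^sup>2) * (LINT w|M. (Y w)\<^sup>2)"
    by (simp add: ennreal_power ennreal_mult[symmetric])
  then show ?thesis
    by (simp add: real_le_rsqrt real_sqrt_mult[symmetric])
qed

lemma L2_bounded_CS:
  assumes "L2 M X" "L2 M Y"
  shows "\<bar>LINT w|M. X w * Y w\<bar> \<le> sqrt (LINT w|M. (X w)\<^sup>2) * sqrt (LINT w|M. (Y w)\<^sup>2)"
  using L2_cauchy_schwarz[OF assms] integral_abs_bound[of M "\<lambda>w. X w * Y w"] by linarith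

context prob_space
begin

lemma L2_const: "L2 M (\<lambda>_. c)"
  by (simp add: L2_def)

lemma L2_integrable: "L2 M X \<Longrightarrow> integrable M X"
  using L2_mult[OF _ L2_const[of 1]] by force

lemma L2_bounded:
  assumes "\<xi> \<in> borel_measurable M" "\<And>w. w \<in> space M \<Longrightarrow> \<bar>\<xi> w\<bar> \<le> b"
  shows "L2 M \<xi>"
  using L2_bounded_mult[OF L2_const[of 1] assms] by simp

lemma L1_le_L2:
  assumes "L2 M X"
  shows "(LINT w|M. \<bar>X w\<bar>) \<le> sqrt (LINT w|M. (X w)\<^sup>2)"
  using L2_cauchy_schwarz[OF assms L2_const[of 1]] by (simp add: prob_space)

end

locale filtered = prob_space M for M :: "'a measure" +
  fixes F :: "real \<Rightarrow> 'a measure"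
  assumes filt: "filtration (space M) F" and subalg: "\<And>t. subalgebra M (F t)"
begin

lemma space_F [simp]: "space (F t) = space M"
  using subalg[of t] by (simp add: subalgebra_def)

lemma sets_F_mono: "s \<le> t \<Longrightarrow> sets (F s) \<subseteq> sets (F t)"
  using filtration.sets_F_mono[OF filt] by auto

lemma measurable_F_M: "X \<in> measurable (F t) N \<Longrightarrow> X \<in> measurable M N"
  using subalg[of t] by (auto simp: subalgebra_def measurable_def)

lemma measurable_F_mono: "X \<in> measurable (F s) N \<Longrightarrow> s \<le> t \<Longrightarrow> X \<in> measurable (F t) N"
  using sets_F_mono[of s t] by (auto simp: measurable_def)

text \<open>The sigma-algebra generated by \<open>Y\<close> lies inside \<open>F s\<close>, and the
  vimage algebra of \<open>D\<close> is the one that \<open>indep_var\<close> uses; independence is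
  inherited by sub-families.\<close>

lemma indep_F:
  assumes ind: "indep_set (sets (F s)) (sets (vimage_algebra (space M) D N))"
    and Y: "Y \<in> measurable (F s) N'" and D: "D \<in> measurable M N"
  shows "indep_var N' Y N D"
  unfolding indep_var_eq
proof (intro conjI)
  show "Y \<in> measurable M N'" using Y by (rule measurable_F_M)
  show "D \<in> measurable M N" by fact
  have 1: "sigma_sets (space M) {Y -` A \<inter> space M |A. A \<in> sets N'} \<subseteq> sets (F s)"
    using Y sets.sigma_sets_subset[of "{Y -` A \<inter> space M |A. A \<in> sets N'}" "F s"]
    by (auto simp: measurable_def)
  have "D \<in> space M \<rightarrow> space N" using D by (auto simp: measurable_def)
  then have 2: "sigma_sets (space M) {D -` A \<inter> space M |A. A \<in> sets N} = sets (vimage_algebra (space M) D N)"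
    by (simp add: sets_vimage_algebra)
  show "indep_set (sigma_sets (space M) {Y -` A \<inter> space M |A. A \<in> sets N'})
     (sigma_sets (space M) {D -` A \<inter> space M |A. A \<in> sets N})"
    using ind 1 unfolding 2 indep_sets2_eq by blast
qed

end

lemma filtered_prob_spaceD: "filtered_prob_space M F \<Longrightarrow> filtered M F"
  by (auto simp: filtered_prob_space_def filtered_def filtered_axioms_def)

lemma integral_double_sum:
  fixes f :: "nat \<Rightarrow> nat \<Rightarrow> 'b \<Rightarrow> real"
  assumes "\<And>k l. k < n \<Longrightarrow> l < m \<Longrightarrow> integrable N (f k l)"
  shows "(LINT x|N. (\<Sum>k<n. \<Sum>l<m. f k l x)) = (\<Sum>k<n. \<Sum>l<m. LINT x|N. f k l x)"
proof -
  have "(LINT x|N. (\<Sum>k<n. \<Sum>l<m. f k l x)) = (\<Sum>k<n. LINT x|N. (\<Sum>l<m. f k l x))"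
    using assms by (intro Bochner_Integration.integral_sum Bochner_Integration.integrable_sum) auto
  also have "\<dots> = (\<Sum>k<n. \<Sum>l<m. LINT x|N. f k l x)"
    using assms by (intro sum.cong refl Bochner_Integration.integral_sum) auto
  finally show ?thesis .
qed

lemma restrict_lborel_indicator:
  fixes A :: "real set"
  assumes "A \<in> sets borel"
  shows "(LINT u|restrict_space lborel {0..t}. indicat_real A u) = measure lborel ({0..t} \<inter> A)"
    and "integrable (restrict_space lborel {0..t}) (indicat_real A)"
proof -
  let ?L = "restrict_space lborel {0..t}"
  have e: "(\<lambda>u. indicat_real {0..t} u *\<^sub>R indicat_real A u) = indicat_real ({0..t} \<inter> A)"
    by (auto simp: indicator_inter_arith)
  have fin: "emeasure lborel ({0..t} \<inter> A) < \<infinity>"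
    using assms emeasure_mono[of "{0..t} \<inter> A" "{0..t}" lborel]
    by (cases "0 \<le> t") (auto simp: le_less_trans)
  show "(LINT u|?L. indicat_real A u) = measure lborel ({0..t} \<inter> A)"
    using assms by (subst integral_restrict_space) (auto simp only: e integral_indicator space_lborel sets_lborel Int_UNIV_right, auto)
  show "integrable ?L (indicat_real A)"
    using assms fin by (subst integrable_restrict_space) (auto simp only: e space_lborel sets_lborel integrable_indicator_iff Int_UNIV_right, auto)
qed

section \<open>The isometry for elementary integrands\<close>

context filtered
begin

text \<open>The properties shared by a Brownian motion and by a Q-Wiener process evaluated at a
  point, so that a single isometry serves both noises.\<close>

definition incr :: "(real \<Rightarrow> 'a \<Rightarrow> real) \<Rightarrow> bool" where
  "incr X \<longleftrightarrow> adapted F X \<and> (\<forall>s\<ge>0. \<forall>t>s. L2 M (\<lambda>w. X t w - X s w) \<and>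
     (LINT w|M. X t w - X s w) = 0 \<and>
     indep_set (sets (F s)) (sets (vimage_algebra (space M) (\<lambda>w. X t w - X s w) borel)))"

text \<open>\<open>d\<langle>X, Y\<rangle> = c dt\<close>, tested against bounded variables of the past; it is all that the isometry
  needs to know about the joint law of two integrators.\<close>

definition cov_rate :: "(real \<Rightarrow> 'a \<Rightarrow> real) \<Rightarrow> (real \<Rightarrow> 'a \<Rightarrow> real) \<Rightarrow> real \<Rightarrow> bool" where
  "cov_rate X Y c \<longleftrightarrow> (\<forall>s\<ge>0. \<forall>t>s. \<forall>\<zeta> b. \<zeta> \<in> borel_measurable (F s) \<longrightarrow>
     (\<forall>w\<in>space M. \<bar>\<zeta> w\<bar> \<le> b) \<longrightarrow>
     (LINT w|M. \<zeta> w * ((X t w - X s w) * (Y t w - Y s w))) = c * (t - s) * (LINT w|M. \<zeta> w))"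

lemma cov_rate_sym: "cov_rate X Y c \<Longrightarrow> cov_rate Y X c"
  unfolding cov_rate_def by (simp add: mult.commute)

lemma incr_adapted: "incr X \<Longrightarrow> 0 \<le> t \<Longrightarrow> X t \<in> borel_measurable (F t)"
  by (simp add: incr_def adapted_def)

lemma incr_F:
  assumes "incr X" "0 \<le> s" "s \<le> t"
  shows "(\<lambda>w. X t w - X s w) \<in> borel_measurable (F t)"
  using incr_adapted[OF assms(1), of t] measurable_F_mono[OF incr_adapted[OF assms(1), of s], of t] assms
  by auto

lemma incr_L2:
  assumes "incr X" "0 \<le> s" "s \<le> t"
  shows "L2 M (\<lambda>w. X t w - X s w)"
  using assms by (cases "s = t") (auto simp: incr_def L2_zero)

lemma incr_mean_zero:
  assumes "incr X" "0 \<le> s" "s \<le> t" and Z: "L2 M Z" "Z \<in> borel_measurable (F s)"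
  shows "(LINT w|M. Z w * (X t w - X s w)) = 0"
proof (cases "s = t")
  case False
  have L: "L2 M (\<lambda>w. X t w - X s w)" using assms incr_L2 by blast
  have "indep_var borel Z borel (\<lambda>w. X t w - X s w)"
    using assms False L by (intro indep_F[of s]) (auto simp: incr_def L2_def)
  then show ?thesis
    using indep_var_lebesgue_integral[OF _ L2_integrable[OF Z(1)] L2_integrable[OF L]]
      assms False by (simp add: incr_def)
qed simp

text \<open>Split the longer increment at \<open>b\<close>. Everything up to \<open>b\<close> is
  known at that time, so the part of \<open>Y\<close> after \<open>b\<close> contributes 0 by the
  martingale property and \<open>cov_rate\<close> evaluates the rest.\<close>

lemma common_start_aux:
  assumes X: "incr X" and Y: "incr Y" and c: "cov_rate X Y c"
    and ab: "0 \<le> a" "a \<le> b" "b \<le> b'"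
    and z: "\<zeta> \<in> borel_measurable (F a)" "\<And>w. w \<in> space M \<Longrightarrow> \<bar>\<zeta> w\<bar> \<le> B"
  shows "(LINT w|M. \<zeta> w * ((X b w - X a w) * (Y b' w - Y a w))) = c * (b - a) * (LINT w|M. \<zeta> w)"
proof -
  note zM = measurable_F_M[OF z(1)]
  have zX: "L2 M (\<lambda>w. \<zeta> w * (X b w - X a w))"
    using L2_bounded_mult[OF incr_L2[OF X] zM z(2)] ab by auto
  have zXF: "(\<lambda>w. \<zeta> w * (X b w - X a w)) \<in> borel_measurable (F b)"
    using measurable_F_mono[OF z(1), of b] incr_F[OF X, of a b] ab by auto
  have Yl: "L2 M (\<lambda>w. Y b w - Y a w)" "L2 M (\<lambda>w. Y b' w - Y b w)"
    using incr_L2[OF Y] ab by auto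
  have "(LINT w|M. \<zeta> w * ((X b w - X a w) * (Y b' w - Y a w))) =
    (LINT w|M. (\<zeta> w * (X b w - X a w)) * (Y b w - Y a w) + (\<zeta> w * (X b w - X a w)) * (Y b' w - Y b w))"
    by (intro Bochner_Integration.integral_cong) (auto simp: algebra_simps)
  also have "\<dots> = (LINT w|M. (\<zeta> w * (X b w - X a w)) * (Y b w - Y a w)) +
     (LINT w|M. (\<zeta> w * (X b w - X a w)) * (Y b' w - Y b w))"
    by (intro Bochner_Integration.integral_add L2_mult zX Yl)
  also have "(LINT w|M. (\<zeta> w * (X b w - X a w)) * (Y b' w - Y b w)) = 0"
    using incr_mean_zero[OF Y _ _ zX zXF] ab by auto
  also have "(LINT w|M. (\<zeta> w * (X b w - X a w)) * (Y b w - Y a w)) = c * (b - a) * (LINT w|M. \<zeta> w)"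
  proof (cases "a = b")
    case False
    then have "(LINT w|M. \<zeta> w * ((X b w - X a w) * (Y b w - Y a w))) = c * (b - a) * (LINT w|M. \<zeta> w)"
      using c[unfolded cov_rate_def, rule_format, of a b \<zeta> B] z ab by auto
    then show ?thesis by (simp only: mult.assoc)
  qed simp
  finally show ?thesis by simp
qed

lemma common_start:
  assumes X: "incr X" and Y: "incr Y" and c: "cov_rate X Y c"
    and ab: "0 \<le> a" "a \<le> b" "a \<le> b'"
    and z: "\<zeta> \<in> borel_measurable (F a)" "\<And>w. w \<in> space M \<Longrightarrow> \<bar>\<zeta> w\<bar> \<le> B"
  shows "(LINT w|M. \<zeta> w * ((X b w - X a w) * (Y b' w - Y a w))) = c * (min b b' - a) * (LINT w|M. \<zeta> w)"
proof (cases "b \<le> b'")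
  case True
  then show ?thesis using common_start_aux[OF X Y c ab(1,2) True z] by (simp add: min_def)
next
  case False
  then show ?thesis
    using common_start_aux[OF Y X cov_rate_sym[OF c] ab(1,3) _ z, of b]
    by (simp add: min_def mult.commute)
qed

text \<open>The increment of \<open>X\<close> before \<open>a'\<close> is part of the past of the
  \<open>Y\<close> increment and drops out. What remains starts at \<open>a'\<close> on both sides,
  and \<open>max 0 (min b b' - a')\<close> is the length of the overlap.\<close>

lemma interval_pair_aux:
  assumes X: "incr X" and Y: "incr Y" and c: "cov_rate X Y c"
    and ab: "0 \<le> a" "a \<le> b" "a \<le> a'" "a' \<le> b'"
    and z: "\<xi> \<in> borel_measurable (F a)" "\<And>w. w \<in> space M \<Longrightarrow> \<bar>\<xi> w\<bar> \<le> B"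
    and z': "\<xi>' \<in> borel_measurable (F a')" "\<And>w. w \<in> space M \<Longrightarrow> \<bar>\<xi>' w\<bar> \<le> B'"
  shows "(LINT w|M. (\<xi> w * (X b w - X a w)) * (\<xi>' w * (Y b' w - Y a' w))) =
     c * max 0 (min b b' - a') * (LINT w|M. \<xi> w * \<xi>' w)"
proof -
  note zM = measurable_F_M[OF z(1)] and zM' = measurable_F_M[OF z'(1)]
  have prodB: "\<bar>\<xi> w * \<xi>' w\<bar> \<le> B * B'" if "w \<in> space M" for w
    unfolding abs_mult using z(2)[OF that] z'(2)[OF that] by (intro mult_mono) auto
  have prodF: "(\<lambda>w. \<xi> w * \<xi>' w) \<in> borel_measurable (F a')"
    using measurable_F_mono[OF z(1), of a'] z' ab by auto
  have Yl: "L2 M (\<lambda>w. Y b' w - Y a' w)" using incr_L2[OF Y] ab by auto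
  have key: "(LINT w|M. (\<xi> w * \<xi>' w * (X d w - X a w)) * (Y b' w - Y a' w)) = 0"
    and i: "L2 M (\<lambda>w. \<xi> w * \<xi>' w * (X d w - X a w))"
    if "a \<le> d" "d \<le> a'" for d
  proof -
    show l: "L2 M (\<lambda>w. \<xi> w * \<xi>' w * (X d w - X a w))"
      using L2_bounded_mult[OF incr_L2[OF X] measurable_F_M[OF prodF] prodB] ab that by auto
    have "(\<lambda>w. \<xi> w * \<xi>' w * (X d w - X a w)) \<in> borel_measurable (F a')"
      using prodF measurable_F_mono[OF incr_F[OF X, of a d], of a'] ab that by auto
    then show "(LINT w|M. (\<xi> w * \<xi>' w * (X d w - X a w)) * (Y b' w - Y a' w)) = 0"
      using incr_mean_zero[OF Y _ _ l] ab by auto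
  qed
  show ?thesis
  proof (cases "b \<le> a'")
    case True
    then have "max 0 (min b b' - a') = 0" by auto
    then show ?thesis using key[of b] ab True by (simp add: mult_ac)
  next
    case False
    have l2: "L2 M (\<lambda>w. \<xi> w * \<xi>' w * (X b w - X a' w))"
      using L2_bounded_mult[OF incr_L2[OF X] measurable_F_M[OF prodF] prodB] ab False by auto
    have "(LINT w|M. (\<xi> w * (X b w - X a w)) * (\<xi>' w * (Y b' w - Y a' w))) =
      (LINT w|M. (\<xi> w * \<xi>' w * (X a' w - X a w)) * (Y b' w - Y a' w)
        + (\<xi> w * \<xi>' w * (X b w - X a' w)) * (Y b' w - Y a' w))"
      by (intro Bochner_Integration.integral_cong) (auto simp: algebra_simps)
    also have "\<dots> = (LINT w|M. (\<xi> w * \<xi>' w * (X a' w - X a w)) * (Y b' w - Y a' w))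
       + (LINT w|M. (\<xi> w * \<xi>' w * (X b w - X a' w)) * (Y b' w - Y a' w))"
      using i[of a'] ab by (intro Bochner_Integration.integral_add L2_mult l2 Yl) auto
    also have "(LINT w|M. (\<xi> w * \<xi>' w * (X a' w - X a w)) * (Y b' w - Y a' w)) = 0"
      using key ab by auto
    also have "(LINT w|M. (\<xi> w * \<xi>' w * (X b w - X a' w)) * (Y b' w - Y a' w))
      = c * (min b b' - a') * (LINT w|M. \<xi> w * \<xi>' w)"
      using common_start[OF X Y c _ _ ab(4) prodF prodB, of b] ab False by (simp add: mult.assoc)
    finally show ?thesis using False ab by (simp add: max_def)
  qed
qed

lemma interval_pair:
  assumes X: "incr X" and Y: "incr Y" and c: "cov_rate X Y c"
    and ab: "0 \<le> a" "a \<le> b" "0 \<le> a'" "a' \<le> b'"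
    and z: "\<xi> \<in> borel_measurable (F a)" "\<And>w. w \<in> space M \<Longrightarrow> \<bar>\<xi> w\<bar> \<le> B"
    and z': "\<xi>' \<in> borel_measurable (F a')" "\<And>w. w \<in> space M \<Longrightarrow> \<bar>\<xi>' w\<bar> \<le> B'"
  shows "(LINT w|M. (\<xi> w * (X b w - X a w)) * (\<xi>' w * (Y b' w - Y a' w))) =
     c * max 0 (min b b' - max a a') * (LINT w|M. \<xi> w * \<xi>' w)"
proof (cases "a \<le> a'")
  case True
  then show ?thesis using interval_pair_aux[OF X Y c ab(1,2) True ab(4) z z'] by (simp add: max_def)
next
  case False
  then show ?thesis
    using interval_pair_aux[OF Y X cov_rate_sym[OF c] ab(3,4) _ ab(2) z' z]
    by (simp add: max_def mult.commute min.commute)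
qed

lemma elementaryD:
  assumes "elementary M F n \<tau> \<xi>"
  shows "k \<le> n \<Longrightarrow> 0 \<le> \<tau> k" "k < n \<Longrightarrow> \<tau> k \<le> \<tau> (Suc k)"
    "k < n \<Longrightarrow> \<xi> k \<in> borel_measurable (F (\<tau> k))" "k < n \<Longrightarrow> \<xi> k \<in> borel_measurable M"
    "k < n \<Longrightarrow> \<exists>b. \<forall>w\<in>space M. \<bar>\<xi> k w\<bar> \<le> b"
    "k < n \<Longrightarrow> L2 M (\<xi> k)"
proof -
  show "0 \<le> \<tau> k" if "k \<le> n" for k
    using that
  proof (induction k)
    case 0 then show ?case using assms by (simp add: elementary_def)
  next
    case (Suc k)
    then have "0 \<le> \<tau> k" "\<tau> k \<le> \<tau> (Suc k)" using assms by (auto simp: elementary_def)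
    then show ?case by linarith
  qed
  show "k < n \<Longrightarrow> \<tau> k \<le> \<tau> (Suc k)"
    and F: "k < n \<Longrightarrow> \<xi> k \<in> borel_measurable (F (\<tau> k))"
    and b: "k < n \<Longrightarrow> \<exists>b. \<forall>w\<in>space M. \<bar>\<xi> k w\<bar> \<le> b"
    using assms by (auto simp: elementary_def)
  show m: "k < n \<Longrightarrow> \<xi> k \<in> borel_measurable M" using F measurable_F_M by blast
  show "k < n \<Longrightarrow> L2 M (\<xi> k)" using m b L2_bounded by blast
qed

lemma elementary_term_L2:
  assumes X: "incr X" and e: "elementary M F n \<tau> \<xi>" and "0 \<le> t" "k < n"
  shows "L2 M (\<lambda>w. \<xi> k w * (X (min (\<tau> (Suc k)) t) w - X (min (\<tau> k) t) w))"
proof -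
  obtain b where "\<forall>w\<in>space M. \<bar>\<xi> k w\<bar> \<le> b" using elementaryD(5)[OF e] assms by blast
  moreover have "0 \<le> \<tau> k" "\<tau> k \<le> \<tau> (Suc k)" using elementaryD[OF e, of k] assms by auto
  ultimately show ?thesis
    using elementaryD(4)[OF e] assms
    by (intro L2_bounded_mult[of _ _ _ b] incr_L2[OF X]) (auto simp: min_def)
qed

lemma elementary_integral_L2:
  assumes "incr X" "elementary M F n \<tau> \<xi>" "0 \<le> t"
  shows "L2 M (elementary_integral X n \<tau> \<xi> t)"
proof -
  have "L2 M (\<lambda>w. elementary_integral X n \<tau> \<xi> t w)"
    unfolding elementary_integral_def
    using assms by (intro L2_sum elementary_term_L2) auto
  then show ?thesis by simp
qed

lemma elementary_term_pair:
  assumes X: "incr X" and Y: "incr Y" and c: "cov_rate X Y c" and t: "0 \<le> t"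
    and e: "elementary M F n \<tau> \<xi>" "k < n" and e': "elementary M F n' \<tau>' \<xi>'" "l < n'"
  shows "(LINT w|M. (\<xi> k w * (X (min (\<tau> (Suc k)) t) w - X (min (\<tau> k) t) w)) *
     (\<xi>' l w * (Y (min (\<tau>' (Suc l)) t) w - Y (min (\<tau>' l) t) w))) =
    c * max 0 (min (min (\<tau> (Suc k)) t) (min (\<tau>' (Suc l)) t) - max (min (\<tau> k) t) (min (\<tau>' l) t))
      * (LINT w|M. \<xi> k w * \<xi>' l w)"
\<comment> \<open>Truncation at \<open>t\<close> forces the case split: if
  \<open>\<tau> k > t\<close>, then \<open>\<xi> k\<close> need not be known at time
  \<open>min (\<tau> k) t = t\<close>. But then the truncated increment is 0, and so is the overlap
  on the right.\<close>
proof (cases "\<tau> k \<le> t \<and> \<tau>' l \<le> t")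
  case True
  obtain b where b: "\<forall>w\<in>space M. \<bar>\<xi> k w\<bar> \<le> b" using elementaryD(5)[OF e] by blast
  obtain b' where b': "\<forall>w\<in>space M. \<bar>\<xi>' l w\<bar> \<le> b'" using elementaryD(5)[OF e'] by blast
  show ?thesis
    using b b' elementaryD[OF e(1), of k] elementaryD[OF e'(1), of l] e(2) e'(2) True t
    by (intro interval_pair[OF X Y c, of _ _ _ _ _ b _ b']) (auto simp: min_def)
next
  case False
  then show ?thesis
    using elementaryD(2)[OF e] elementaryD(2)[OF e'] by (auto simp: min_def max_def)
qed

text \<open>Both sides expand into the same double sum over pairs of intervals, with overlap length
  times \<open>E[\<xi> k * \<xi>' l]\<close>. The two integrands may live on different partitions,
  so no common refinement is formed.\<close>

lemma elementary_isometry: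
  assumes X: "incr X" and Y: "incr Y" and c: "cov_rate X Y c" and t: "0 \<le> t"
    and e: "elementary M F n \<tau> \<xi>" and e': "elementary M F n' \<tau>' \<xi>'"
  shows "(LINT w|M. elementary_integral X n \<tau> \<xi> t w * elementary_integral Y n' \<tau>' \<xi>' t w) =
    c * (LINT u|restrict_space lborel {0..t}. LINT w|M. elementary_process n \<tau> \<xi> u w * elementary_process n' \<tau>' \<xi>' u w)"
proof -
  let ?L = "restrict_space lborel {0..t}"
  let ?a = "\<lambda>k. min (\<tau> k) t" and ?b = "\<lambda>l. min (\<tau>' l) t"
  let ?m = "\<lambda>k l. max 0 (min (?a (Suc k)) (?b (Suc l)) - max (?a k) (?b l))"
  have "(LINT w|M. elementary_integral X n \<tau> \<xi> t w * elementary_integral Y n' \<tau>' \<xi>' t w) =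
    (LINT w|M. (\<Sum>k<n. \<Sum>l<n'. (\<xi> k w * (X (?a (Suc k)) w - X (?a k) w)) *
     (\<xi>' l w * (Y (?b (Suc l)) w - Y (?b l) w))))"
    unfolding elementary_integral_def by (simp add: sum_product)
  also have "\<dots> = (\<Sum>k<n. \<Sum>l<n'. LINT w|M. (\<xi> k w * (X (?a (Suc k)) w - X (?a k) w)) *
     (\<xi>' l w * (Y (?b (Suc l)) w - Y (?b l) w)))"
    using elementary_term_L2[OF X e t] elementary_term_L2[OF Y e' t]
    by (intro integral_double_sum L2_mult)
  also have "\<dots> = (\<Sum>k<n. \<Sum>l<n'. c * ?m k l * (LINT w|M. \<xi> k w * \<xi>' l w))"
    using elementary_term_pair[OF X Y c t e _ e'] by (intro sum.cong refl) auto
  finally have 1: "(LINT w|M. elementary_integral X n \<tau> \<xi> t w * elementary_integral Y n' \<tau>' \<xi>' t w) = \<dots>" .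
  have int: "integrable M (\<lambda>w. \<xi> k w * \<xi>' l w)" if "k < n" "l < n'" for k l
    using elementaryD(6)[OF e that(1)] elementaryD(6)[OF e' that(2)] by (rule L2_mult)
  have 2: "(LINT w|M. elementary_process n \<tau> \<xi> u w * elementary_process n' \<tau>' \<xi>' u w) =
    (\<Sum>k<n. \<Sum>l<n'. indicator ({\<tau> k<..\<tau> (Suc k)} \<inter> {\<tau>' l<..\<tau>' (Suc l)}) u * (LINT w|M. \<xi> k w * \<xi>' l w))" for u
  proof -
    have "(LINT w|M. elementary_process n \<tau> \<xi> u w * elementary_process n' \<tau>' \<xi>' u w) =
      (LINT w|M. (\<Sum>k<n. \<Sum>l<n'. indicator ({\<tau> k<..\<tau> (Suc k)} \<inter> {\<tau>' l<..\<tau>' (Suc l)}) u * (\<xi> k w * \<xi>' l w)))"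
      unfolding elementary_process_def sum_product
      by (intro Bochner_Integration.integral_cong refl sum.cong) (simp only: indicator_inter_arith mult_ac)
    also have "\<dots> = (\<Sum>k<n. \<Sum>l<n'. LINT w|M. indicator ({\<tau> k<..\<tau> (Suc k)} \<inter> {\<tau>' l<..\<tau>' (Suc l)}) u * (\<xi> k w * \<xi>' l w))"
      using int by (intro integral_double_sum integrable_mult_right)
    finally show ?thesis by simp
  qed
  have 3: "(LINT u|?L. indicat_real ({\<tau> k<..\<tau> (Suc k)} \<inter> {\<tau>' l<..\<tau>' (Suc l)}) u) = ?m k l"
    "integrable ?L (indicator ({\<tau> k<..\<tau> (Suc k)} \<inter> {\<tau>' l<..\<tau>' (Suc l)}) :: real \<Rightarrow> real)"
    if "k < n" "l < n'" for k l
  proof -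
    have "\<tau> k \<ge> 0" "\<tau>' l \<ge> 0" "\<tau> k \<le> \<tau> (Suc k)" "\<tau>' l \<le> \<tau>' (Suc l)"
      using elementaryD[OF e, of k] elementaryD[OF e', of l] that by auto
    then have eq: "{0..t} \<inter> ({\<tau> k<..\<tau> (Suc k)} \<inter> {\<tau>' l<..\<tau>' (Suc l)})
       = {max (?a k) (?b l) <.. min (?a (Suc k)) (?b (Suc l))}"
      using t by (auto simp: min_def max_def)
    have m: "{\<tau> k<..\<tau> (Suc k)} \<inter> {\<tau>' l<..\<tau>' (Suc l)} \<in> sets borel" by auto
    show "(LINT u|?L. indicat_real ({\<tau> k<..\<tau> (Suc k)} \<inter> {\<tau>' l<..\<tau>' (Suc l)}) u) = ?m k l"
    proof -
      have "measure lborel {x<..y} = max 0 (y - x)" for x y :: real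
        by (cases "x \<le> y") auto
      then show ?thesis unfolding restrict_lborel_indicator(1)[OF m] eq by simp
    qed
    show "integrable ?L (indicator ({\<tau> k<..\<tau> (Suc k)} \<inter> {\<tau>' l<..\<tau>' (Suc l)}) :: real \<Rightarrow> real)"
      by (rule restrict_lborel_indicator(2)[OF m])
  qed
  have "(LINT u|?L. LINT w|M. elementary_process n \<tau> \<xi> u w * elementary_process n' \<tau>' \<xi>' u w)
    = (\<Sum>k<n. \<Sum>l<n'. ?m k l * (LINT w|M. \<xi> k w * \<xi>' l w))"
    unfolding 2 using 3 by (subst integral_double_sum) (auto intro!: integrable_mult_left sum.cong)
  then show ?thesis unfolding 1 by (simp add: sum_distrib_left mult.assoc)
qed

end

section \<open>Completeness of L2, and continuity in time of expectations\<close>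

context prob_space
begin

text \<open>The Riesz-Fischer argument: along a subsequence with squared distances below
  \<open>(1/4)^k\<close> the increments are summable in L1, hence the subsequence converges almost
  surely; Fatou's lemma turns this into L2 convergence of the whole sequence.\<close>

lemma L2_complete:
  assumes J: "\<And>m. L2 M (J m)"
    and C: "\<And>e. 0 < e \<Longrightarrow> \<exists>K::nat. \<forall>m\<ge>K. \<forall>l\<ge>K. (LINT w|M. (J m w - J l w)\<^sup>2) < e"
  shows "\<exists>I. L2 M I \<and> (\<lambda>m. LINT w|M. (I w - J m w)\<^sup>2) \<longlonglongrightarrow> 0"
proof -
  have [measurable]: "J m \<in> borel_measurable M" for m using J by (simp add: L2_def)
  have "\<forall>k. \<exists>K::nat. \<forall>m\<ge>K. \<forall>l\<ge>K. (LINT w|M. (J m w - J l w)\<^sup>2) < (1/4)^k"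
    using C by simp
  then obtain K where K: "\<And>k m l. m \<ge> K k \<Longrightarrow> l \<ge> K k \<Longrightarrow> (LINT w|M. (J m w - J l w)\<^sup>2) < (1/4)^k"
    by metis
  \<comment> \<open>Partial sums make \<open>r k\<close> at least \<open>K j\<close> for every
    \<open>j \<le> k\<close>, whatever the order of the values \<open>K j\<close>.\<close>
  define r where "r k = (\<Sum>i\<le>k. K i)" for k
  have rK: "K j \<le> r k" if "j \<le> k" for j k
    unfolding r_def using that by (intro member_le_sum) auto
  define D where "D k w = \<bar>J (r (Suc k)) w - J (r k) w\<bar>" for k w
  have [measurable]: "D k \<in> borel_measurable M" for k unfolding D_def by measurable
  have L: "L2 M (\<lambda>w. J (r (Suc k)) w - J (r k) w)" for k using J by (intro L2_diff)
  have D1: "(LINT w|M. D k w) \<le> (1/2)^k" for k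
  proof -
    have "(LINT w|M. D k w) \<le> sqrt (LINT w|M. (J (r (Suc k)) w - J (r k) w)\<^sup>2)"
      unfolding D_def by (rule L1_le_L2[OF L])
    also have "\<dots> \<le> sqrt ((1/4)^k)"
      using K[of k "r (Suc k)" "r k"] rK[of k "Suc k"] rK[of k k] by (intro real_sqrt_le_mono) auto
    also have "\<dots> = (1/2)^k"
      by (simp add: real_sqrt_power real_sqrt_divide)
    finally show ?thesis .
  qed
  have Di: "integrable M (D k)" for k unfolding D_def using L2_integrable[OF L] by auto
  have "(\<integral>\<^sup>+w. (\<Sum>k. ennreal (D k w)) \<partial>M) = (\<Sum>k. \<integral>\<^sup>+w. ennreal (D k w) \<partial>M)"
    by (rule nn_integral_suminf) auto
  also have "\<dots> = (\<Sum>k. ennreal (LINT w|M. D k w))"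
    using Di by (subst nn_integral_eq_integral) (auto simp: D_def)
  also have "\<dots> \<le> (\<Sum>k. ennreal ((1/2)^k))"
    using D1 by (intro suminf_le ennreal_leI) auto
  also have "\<dots> = ennreal (\<Sum>k. (1/2)^k)"
    by (intro suminf_ennreal2) (auto intro: summable_geometric)
  finally have "(\<integral>\<^sup>+w. (\<Sum>k. ennreal (D k w)) \<partial>M) \<noteq> \<infinity>"
    using top.extremum_uniqueI by fastforce
  then have "AE w in M. (\<Sum>k. ennreal (D k w)) \<noteq> \<infinity>"
    by (intro nn_integral_PInf_AE) auto
  then have conv: "AE w in M. convergent (\<lambda>k. J (r k) w)"
  proof eventually_elim
    case (elim w)
    have "summable (\<lambda>k. D k w)"
      using elim by (intro summable_suminf_not_top) (auto simp: D_def)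
    then have "summable (\<lambda>k. J (r (Suc k)) w - J (r k) w)"
      unfolding D_def by (rule summable_rabs_cancel)
    then have "convergent (\<lambda>k. J (r k) w - J (r 0) w)"
      unfolding summable_iff_convergent using sum_lessThan_telescope[of "\<lambda>k. J (r k) w"] by simp
    from convergent_add[OF this convergent_const[of "J (r 0) w"]] show ?case by simp
  qed
  define I where "I w = lim (\<lambda>k. J (r k) w)" for w
  have [measurable]: "I \<in> borel_measurable M" unfolding I_def by measurable
  have lim: "AE w in M. (\<lambda>k. J (r k) w) \<longlonglongrightarrow> I w"
    using conv by eventually_elim (simp add: I_def convergent_LIMSEQ_iff)
  have bound: "(\<integral>\<^sup>+w. ennreal ((I w - J m w)\<^sup>2) \<partial>M) \<le> ennreal ((1/4)^j)" if "m \<ge> K j" for m j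
  proof -
    have "(\<integral>\<^sup>+w. ennreal ((I w - J m w)\<^sup>2) \<partial>M) = (\<integral>\<^sup>+w. liminf (\<lambda>k. ennreal ((J (r k) w - J m w)\<^sup>2)) \<partial>M)"
    proof (rule nn_integral_cong_AE)
      show "AE w in M. ennreal ((I w - J m w)\<^sup>2) = liminf (\<lambda>k. ennreal ((J (r k) w - J m w)\<^sup>2))"
        using lim
      proof eventually_elim
        case (elim w)
        have "(\<lambda>k. ennreal ((J (r k) w - J m w)\<^sup>2)) \<longlonglongrightarrow> ennreal ((I w - J m w)\<^sup>2)"
          by (intro tendsto_ennrealI tendsto_intros elim)
        from lim_imp_Liminf[OF _ this] show ?case by simp
      qed
    qed
    also have "\<dots> \<le> liminf (\<lambda>k. \<integral>\<^sup>+w. ennreal ((J (r k) w - J m w)\<^sup>2) \<partial>M)"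
      by (rule nn_integral_liminf) auto
    also have "\<dots> \<le> ennreal ((1/4)^j)"
    proof (rule Liminf_le)
      have "(\<integral>\<^sup>+w. ennreal ((J (r k) w - J m w)\<^sup>2) \<partial>M) \<le> ennreal ((1/4)^j)" if "k \<ge> j" for k
      proof -
        have "L2 M (\<lambda>w. J (r k) w - J m w)" using J by (intro L2_diff)
        then have "(\<integral>\<^sup>+w. ennreal ((J (r k) w - J m w)\<^sup>2) \<partial>M) = ennreal (LINT w|M. (J (r k) w - J m w)\<^sup>2)"
          by (intro nn_integral_eq_integral) (auto simp: L2_def)
        then show ?thesis using K[of j "r k" m] rK[OF that] \<open>m \<ge> K j\<close> by (auto intro!: ennreal_leI)
      qed
      then show "\<forall>\<^sub>F k in sequentially. (\<integral>\<^sup>+w. ennreal ((J (r k) w - J m w)\<^sup>2) \<partial>M) \<le> ennreal ((1/4)^j)"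
        by (auto simp: eventually_sequentially)
    qed simp
    finally show ?thesis .
  qed
  have L2d: "L2 M (\<lambda>w. I w - J m w)" if "m \<ge> K j" for m j
    unfolding L2_def
  proof
    show "integrable M (\<lambda>w. (I w - J m w)\<^sup>2)"
      by (intro integrableI_nonneg) (use bound[OF that] in \<open>auto simp: le_less_trans\<close>)
  qed simp
  have "L2 M (\<lambda>w. (I w - J (K 0) w) + J (K 0) w)"
    using L2d[of 0 "K 0"] J by (intro L2_add) auto
  then have "L2 M I" by simp
  moreover have "(\<lambda>m. LINT w|M. (I w - J m w)\<^sup>2) \<longlonglongrightarrow> 0"
  proof (rule LIMSEQ_I)
    fix e :: real assume "0 < e"
    then obtain j where j: "(1/4::real)^j < e" using real_arch_pow_inv[of e "1/4"] by auto
    have "norm ((LINT w|M. (I w - J m w)\<^sup>2) - 0) < e" if "m \<ge> K j" for m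
    proof -
      have "ennreal (LINT w|M. (I w - J m w)\<^sup>2) = (\<integral>\<^sup>+w. ennreal ((I w - J m w)\<^sup>2) \<partial>M)"
        using L2d[OF that] by (intro nn_integral_eq_integral[symmetric]) (auto simp: L2_def)
      also have "\<dots> \<le> ennreal ((1/4)^j)" by (rule bound[OF that])
      finally have "(LINT w|M. (I w - J m w)\<^sup>2) \<le> (1/4)^j" by simp
      then show ?thesis using j by simp
    qed
    then show "\<exists>no. \<forall>n\<ge>no. norm ((LINT w|M. (I w - J n w)\<^sup>2) - 0) < e" by blast
  qed
  ultimately show ?thesis by blast
qed

lemma continuous_on_expectation:
  assumes m: "\<And>u. 0 \<le> u \<Longrightarrow> h u \<in> borel_measurable M"
    and b: "\<And>u w. w \<in> space M \<Longrightarrow> \<bar>h u w\<bar> \<le> (B::real)"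
    and c: "AE w in M. continuous_on {0::real..} (\<lambda>u. h u w)"
  shows "continuous_on {0..} (\<lambda>u. LINT w|M. h u w)"
  unfolding continuous_on_sequentially
proof (intro allI ballI impI)
  fix x :: "nat \<Rightarrow> real" and a assume a: "a \<in> {0..}" and x: "(\<forall>n. x n \<in> {0..}) \<and> x \<longlonglongrightarrow> a"
  show "((\<lambda>u. LINT w|M. h u w) \<circ> x) \<longlonglongrightarrow> (LINT w|M. h a w)"
    unfolding comp_def
  proof (rule integral_dominated_convergence[where w="\<lambda>_. B"])
    show "AE w in M. (\<lambda>n. h (x n) w) \<longlonglongrightarrow> h a w"
      using c
    proof eventually_elim
      case (elim w)
      then show ?case using x a unfolding continuous_on_sequentially comp_def by blast
    qed
  qed (use m b x a in auto)
qed

end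

lemma measurable_restrict_continuous:
  "continuous_on {0::real..} (f::real \<Rightarrow> real) \<Longrightarrow> f \<in> borel_measurable (restrict_space lborel {0..t})"
proof -
  assume "continuous_on {0..} f"
  then have "continuous_on {0..t} f" by (rule continuous_on_subset) auto
  then have "f \<in> borel_measurable (restrict_space borel {0..t})"
    by (rule borel_measurable_continuous_on_restrict)
  then show ?thesis using measurable_cong_sets[OF sets_restrict_space_cong[OF sets_lborel] refl] by blast
qed

section \<open>Bounded continuous integrands, and the isometry for them\<close>

context filtered
begin

text \<open>Adapted, bounded and almost surely continuous is what both noise integrands satisfy. By
  dominated convergence, second moments are then continuous in time, which is how the time integrals
  make sense without measurability on the product space.\<close>

definition regular :: "(real \<Rightarrow> 'a \<Rightarrow> real) \<Rightarrow> bool" where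
  "regular f \<longleftrightarrow> (\<forall>u\<ge>0. f u \<in> borel_measurable (F u)) \<and>
     (\<exists>B. \<forall>u. \<forall>w\<in>space M. \<bar>f u w\<bar> \<le> B) \<and> (AE w in M. continuous_on {0..} (\<lambda>u. f u w))"

lemma regular_measurable: "regular f \<Longrightarrow> 0 \<le> u \<Longrightarrow> f u \<in> borel_measurable M"
  unfolding regular_def using measurable_F_M by blast

lemma regular_bound:
  assumes "regular f"
  obtains B where "0 \<le> B" "\<And>u w. w \<in> space M \<Longrightarrow> \<bar>f u w\<bar> \<le> B"
proof -
  obtain B where B: "\<forall>u. \<forall>w\<in>space M. \<bar>f u w\<bar> \<le> B" using assms by (auto simp: regular_def)
  moreover have "0 \<le> B" using B not_empty by (meson abs_ge_zero equals0I order_trans)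
  ultimately show ?thesis using that by blast
qed

lemma regular_L2: "regular f \<Longrightarrow> 0 \<le> u \<Longrightarrow> L2 M (f u)"
  using regular_measurable regular_bound L2_bounded by metis

lemma regular_pair_continuous:
  assumes f: "regular f" and g: "regular g"
  shows "continuous_on {0..} (\<lambda>u. LINT w|M. f u w * g u w)"
proof -
  obtain B where B: "0 \<le> B" "\<And>u w. w \<in> space M \<Longrightarrow> \<bar>f u w\<bar> \<le> B" by (rule regular_bound[OF f]) blast
  obtain B' where B': "0 \<le> B'" "\<And>u w. w \<in> space M \<Longrightarrow> \<bar>g u w\<bar> \<le> B'" by (rule regular_bound[OF g]) blast
  show ?thesis
  proof (rule continuous_on_expectation[where B="B * B'"])
    show "AE w in M. continuous_on {0..} (\<lambda>u. f u w * g u w)"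
      using f g unfolding regular_def by (auto elim!: eventually_elim2 intro: continuous_on_mult)
    show "\<bar>f u w * g u w\<bar> \<le> B * B'" if "w \<in> space M" for u w
      unfolding abs_mult using B B' that by (intro mult_mono) auto
  qed (use regular_measurable[OF f] regular_measurable[OF g] in auto)
qed

lemma regular_mult_continuous:
  assumes f: "regular f" and x: "\<xi> \<in> borel_measurable M" "\<And>w. w \<in> space M \<Longrightarrow> \<bar>\<xi> w\<bar> \<le> b"
  shows "continuous_on {0..} (\<lambda>u. LINT w|M. f u w * \<xi> w)"
proof -
  obtain B where B: "0 \<le> B" "\<And>u w. w \<in> space M \<Longrightarrow> \<bar>f u w\<bar> \<le> B" by (rule regular_bound[OF f]) blast
  show ?thesis
  proof (rule continuous_on_expectation[where B="B * b"])
    show "AE w in M. continuous_on {0..} (\<lambda>u. f u w * \<xi> w)"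
      using f unfolding regular_def by (auto elim!: eventually_mono intro: continuous_on_mult)
    show "\<bar>f u w * \<xi> w\<bar> \<le> B * b" if "w \<in> space M" for u w
      unfolding abs_mult using B x that by (intro mult_mono) auto
  qed (use regular_measurable[OF f] x in auto)
qed

lemma elementary_process_L2:
  assumes e: "elementary M F n \<tau> \<xi>"
  shows "L2 M (elementary_process n \<tau> \<xi> u)"
proof -
  have "L2 M (\<lambda>w. \<Sum>k<n. indicator {\<tau> k<..\<tau> (Suc k)} u * \<xi> k w)"
    using elementaryD(6)[OF e] by (intro L2_sum L2_cmult) auto
  then show ?thesis by (simp add: elementary_process_def[abs_def] mult.commute)
qed

lemma elementary_process_bound:
  assumes e: "elementary M F n \<tau> \<xi>"
  obtains b where "0 \<le> b" "\<And>u w. w \<in> space M \<Longrightarrow> \<bar>elementary_process n \<tau> \<xi> u w\<bar> \<le> b"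
proof -
  have "\<forall>k. \<exists>b. k < n \<longrightarrow> (\<forall>w\<in>space M. \<bar>\<xi> k w\<bar> \<le> b)" using elementaryD(5)[OF e] by blast
  then obtain b where b: "\<And>k w. k < n \<Longrightarrow> w \<in> space M \<Longrightarrow> \<bar>\<xi> k w\<bar> \<le> b k" by metis
  have "\<bar>elementary_process n \<tau> \<xi> u w\<bar> \<le> (\<Sum>k<n. b k)" if "w \<in> space M" for u w
    unfolding elementary_process_def
    using b[OF _ that] by (intro order_trans[OF sum_abs] sum_mono) (auto simp: abs_mult indicator_def intro: order_trans[OF abs_ge_zero])
  moreover have "0 \<le> (\<Sum>k<n. b k)"
    using not_empty b by (intro sum_nonneg) (metis abs_ge_zero all_not_in_conv lessThan_iff order_trans)
  ultimately show ?thesis using that by blast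
qed

lemma elementary_pair_measurable:
  assumes e: "elementary M F n \<tau> \<xi>" and e': "elementary M F n' \<tau>' \<xi>'"
  shows "(\<lambda>u. LINT w|M. elementary_process n \<tau> \<xi> u w * elementary_process n' \<tau>' \<xi>' u w) \<in> borel_measurable borel"
proof -
  have int: "integrable M (\<lambda>w. \<xi> k w * \<xi>' l w)" if "k < n" "l < n'" for k l
    using elementaryD(6)[OF e that(1)] elementaryD(6)[OF e' that(2)] by (rule L2_mult)
  have "(LINT w|M. elementary_process n \<tau> \<xi> u w * elementary_process n' \<tau>' \<xi>' u w) =
     (LINT w|M. (\<Sum>k<n. \<Sum>l<n'. indicator {\<tau> k<..\<tau> (Suc k)} u * indicator {\<tau>' l<..\<tau>' (Suc l)} u * (\<xi> k w * \<xi>' l w)))" for u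
      unfolding elementary_process_def sum_product
      by (intro Bochner_Integration.integral_cong refl sum.cong) (simp only: mult_ac)
  also have "\<dots> u = (\<Sum>k<n. \<Sum>l<n'. indicator {\<tau> k<..\<tau> (Suc k)} u * indicator {\<tau>' l<..\<tau>' (Suc l)} u * (LINT w|M. \<xi> k w * \<xi>' l w))" for u
    using int by (subst integral_double_sum) auto
  finally have "(\<lambda>u. LINT w|M. elementary_process n \<tau> \<xi> u w * elementary_process n' \<tau>' \<xi>' u w) =
    (\<lambda>u. \<Sum>k<n. \<Sum>l<n'. indicator {\<tau> k<..\<tau> (Suc k)} u * indicator {\<tau>' l<..\<tau>' (Suc l)} u * (LINT w|M. \<xi> k w * \<xi>' l w))" by blast
  then show ?thesis by simp
qed

text \<open>As a function of \<open>u\<close> the expectation is a finite sum of indicators times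
  continuous functions.\<close>

lemma regular_elementary_measurable:
  assumes f: "regular f" and e: "elementary M F n \<tau> \<xi>"
  shows "(\<lambda>u. LINT w|M. f u w * elementary_process n \<tau> \<xi> u w) \<in> borel_measurable (restrict_space lborel {0..t})"
proof -
  have "(LINT w|M. f u w * elementary_process n \<tau> \<xi> u w) =
      (\<Sum>k<n. indicator {\<tau> k<..\<tau> (Suc k)} u * (LINT w|M. f u w * \<xi> k w))" if "0 \<le> u" for u
  proof -
    have "(LINT w|M. f u w * elementary_process n \<tau> \<xi> u w) =
      (LINT w|M. (\<Sum>k<n. indicator {\<tau> k<..\<tau> (Suc k)} u * (f u w * \<xi> k w)))"
      unfolding elementary_process_def sum_distrib_left
      by (intro Bochner_Integration.integral_cong refl sum.cong) (simp only: mult_ac)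
    also have "\<dots> = (\<Sum>k<n. LINT w|M. indicator {\<tau> k<..\<tau> (Suc k)} u * (f u w * \<xi> k w))"
      using L2_mult[OF regular_L2[OF f that] elementaryD(6)[OF e]]
      by (intro Bochner_Integration.integral_sum integrable_mult_right) auto
    finally show ?thesis by simp
  qed
  moreover have "(\<lambda>u. \<Sum>k<n. indicator {\<tau> k<..\<tau> (Suc k)} u * (LINT w|M. f u w * \<xi> k w))
     \<in> borel_measurable (restrict_space lborel {0..t})"
  proof (intro borel_measurable_sum borel_measurable_times)
    fix k assume k: "k \<in> {..<n}"
    obtain b where b: "\<forall>w\<in>space M. \<bar>\<xi> k w\<bar> \<le> b" using elementaryD(5)[OF e] k by blast
    show "(\<lambda>u. LINT w|M. f u w * \<xi> k w) \<in> borel_measurable (restrict_space lborel {0..t})"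
      using elementaryD(4)[OF e] k b
      by (intro measurable_restrict_continuous regular_mult_continuous[OF f, of _ b]) auto
  qed (auto intro!: measurable_restrict_space1)
  ultimately show ?thesis
    by (subst measurable_cong) (auto simp: space_restrict_space)
qed

end

context filtered
begin

abbreviation "Leb t \<equiv> restrict_space lborel {0..t::real}"

definition err :: "(real \<Rightarrow> 'a \<Rightarrow> real) \<Rightarrow> nat \<Rightarrow> (nat \<Rightarrow> real) \<Rightarrow> (nat \<Rightarrow> 'a \<Rightarrow> real) \<Rightarrow> real \<Rightarrow> real" where
  "err f n \<tau> \<xi> u = (LINT w|M. (f u w - elementary_process n \<tau> \<xi> u w)\<^sup>2)"

lemma err_nonneg: "0 \<le> err f n \<tau> \<xi> u"
  unfolding err_def by simp

lemma finite_Leb: "finite_measure (Leb t)"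
proof
  show "emeasure (Leb t) (space (Leb t)) \<noteq> \<infinity>"
    by (cases "0 \<le> t") (auto simp: space_restrict_space emeasure_restrict_space)
qed

lemma integrable_Leb:
  assumes "g \<in> borel_measurable (Leb t)" "\<And>u. 0 \<le> u \<Longrightarrow> \<bar>g u\<bar> \<le> (B::real)"
  shows "integrable (Leb t) g"
proof -
  interpret L: finite_measure "Leb t" by (rule finite_Leb)
  show ?thesis
    using assms by (intro L.integrable_const_bound[where B=B]) (auto simp: space_restrict_space intro!: AE_I2)
qed

lemma err_measurable:
  assumes f: "regular f" and e: "elementary M F n \<tau> \<xi>"
  shows "err f n \<tau> \<xi> \<in> borel_measurable (Leb t)"
proof -
  have "err f n \<tau> \<xi> u = (LINT w|M. f u w * f u w) - 2 * (LINT w|M. f u w * elementary_process n \<tau> \<xi> u w)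
    + (LINT w|M. elementary_process n \<tau> \<xi> u w * elementary_process n \<tau> \<xi> u w)" if "0 \<le> u" for u
  proof -
    note fi = regular_L2[OF f that] and ei = elementary_process_L2[OF e, of u]
    have "err f n \<tau> \<xi> u = (LINT w|M. (f u w * f u w - 2 * (f u w * elementary_process n \<tau> \<xi> u w))
       + elementary_process n \<tau> \<xi> u w * elementary_process n \<tau> \<xi> u w)"
      unfolding err_def by (intro Bochner_Integration.integral_cong) (auto simp: power2_eq_square algebra_simps)
    then show ?thesis
      using L2_mult[OF fi fi] L2_mult[OF fi ei] L2_mult[OF ei ei] by simp
  qed
  moreover have "(\<lambda>u. (LINT w|M. f u w * f u w) - 2 * (LINT w|M. f u w * elementary_process n \<tau> \<xi> u w)
    + (LINT w|M. elementary_process n \<tau> \<xi> u w * elementary_process n \<tau> \<xi> u w)) \<in> borel_measurable (Leb t)"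
    using measurable_restrict_continuous[OF regular_pair_continuous[OF f f]] regular_elementary_measurable[OF f e]
      measurable_restrict_space1[OF elementary_pair_measurable[OF e e, folded measurable_lborel1]]
    by (intro borel_measurable_add borel_measurable_diff borel_measurable_times) auto
  ultimately show ?thesis
    by (subst measurable_cong) (auto simp: space_restrict_space)
qed

lemma err_L2:
  assumes f: "regular f" and e: "elementary M F n \<tau> \<xi>" and "0 \<le> u"
  shows "L2 M (\<lambda>w. f u w - elementary_process n \<tau> \<xi> u w)"
  using regular_L2[OF f assms(3)] elementary_process_L2[OF e] by (rule L2_diff)

lemma err_integrable:
  assumes f: "regular f" and e: "elementary M F n \<tau> \<xi>"
  shows "integrable (Leb t) (err f n \<tau> \<xi>)"
proof -
  obtain B where B: "0 \<le> B" "\<And>u w. w \<in> space M \<Longrightarrow> \<bar>f u w\<bar> \<le> B" by (rule regular_bound[OF f]) blast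
  obtain b where b: "0 \<le> b" "\<And>u w. w \<in> space M \<Longrightarrow> \<bar>elementary_process n \<tau> \<xi> u w\<bar> \<le> b"
    by (rule elementary_process_bound[OF e]) blast
  have "\<bar>err f n \<tau> \<xi> u\<bar> \<le> (B + b)\<^sup>2" if "0 \<le> u" for u
  proof -
    have "(f u w - elementary_process n \<tau> \<xi> u w)\<^sup>2 \<le> (B + b)\<^sup>2" if "w \<in> space M" for w
      using B(2)[OF that, of u] b(2)[OF that, of u] by (intro abs_le_square_iff[THEN iffD1]) auto
    then have "err f n \<tau> \<xi> u \<le> (LINT w|M. (B + b)\<^sup>2)"
      unfolding err_def using err_L2[OF f e that] by (intro integral_mono) (auto simp: L2_def)
    then show ?thesis using err_nonneg[of f n \<tau> \<xi> u] by (simp add: prob_space)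
  qed
  then show ?thesis using err_measurable[OF f e] by (intro integrable_Leb)
qed

lemma err_nn_integral:
  assumes f: "regular f" and e: "elementary M F n \<tau> \<xi>"
  shows "(\<integral>\<^sup>+u\<in>{0..t}. (\<integral>\<^sup>+w. ennreal ((f u w - elementary_process n \<tau> \<xi> u w)\<^sup>2) \<partial>M) \<partial>lborel)
    = ennreal (LINT u|Leb t. err f n \<tau> \<xi> u)"
proof -
  have "(\<integral>\<^sup>+u\<in>{0..t}. (\<integral>\<^sup>+w. ennreal ((f u w - elementary_process n \<tau> \<xi> u w)\<^sup>2) \<partial>M) \<partial>lborel)
    = (\<integral>\<^sup>+u\<in>{0..t}. ennreal (err f n \<tau> \<xi> u) \<partial>lborel)"
  proof (intro nn_integral_cong)
    fix u
    show "(\<integral>\<^sup>+w. ennreal ((f u w - elementary_process n \<tau> \<xi> u w)\<^sup>2) \<partial>M) * indicator {0..t} u = ennreal (err f n \<tau> \<xi> u) * indicator {0..t} u"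
    proof (cases "u \<in> {0..t}")
      case True
      then have "(\<integral>\<^sup>+w. ennreal ((f u w - elementary_process n \<tau> \<xi> u w)\<^sup>2) \<partial>M) = ennreal (err f n \<tau> \<xi> u)"
        unfolding err_def using err_L2[OF f e, of u] by (intro nn_integral_eq_integral) (auto simp: L2_def)
      then show ?thesis by simp
    qed simp
  qed
  also have "\<dots> = (\<integral>\<^sup>+u. ennreal (err f n \<tau> \<xi> u) \<partial>Leb t)"
    by (subst nn_integral_restrict_space) auto
  also have "\<dots> = ennreal (LINT u|Leb t. err f n \<tau> \<xi> u)"
    using err_integrable[OF f e] err_nonneg by (intro nn_integral_eq_integral) auto
  finally show ?thesis .
qed

text \<open>Young's inequality with weight \<open>\<delta>\<close> in place of Cauchy-Schwarz: the
  errors then enter linearly through \<open>err\<close>, whose time integrals are what tends to 0.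
  The additive \<open>\<delta>\<close> is made small at the end.\<close>

lemma pair_error_bound:
  assumes f: "regular f" and g: "regular g" and e: "elementary M F n \<tau> \<xi>" and e': "elementary M F n' \<tau>' \<xi>'"
    and B: "\<And>u w. w \<in> space M \<Longrightarrow> \<bar>f u w\<bar> \<le> B" "\<And>u w. w \<in> space M \<Longrightarrow> \<bar>g u w\<bar> \<le> B"
    and u: "0 \<le> u" and d: "0 < \<delta>"
  shows "\<bar>(LINT w|M. f u w * g u w) -
     (LINT w|M. elementary_process n \<tau> \<xi> u w * elementary_process n' \<tau>' \<xi>' u w)\<bar>
     \<le> \<delta> + (B\<^sup>2 / \<delta> + 1) * (err f n \<tau> \<xi> u + err g n' \<tau>' \<xi>' u)"
proof -
  let ?e = "elementary_process n \<tau> \<xi> u" and ?e' = "elementary_process n' \<tau>' \<xi>' u"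
  note L = regular_L2[OF f u] regular_L2[OF g u] elementary_process_L2[OF e, of u] elementary_process_L2[OF e', of u]
  have D: "L2 M (\<lambda>w. f u w - ?e w)" "L2 M (\<lambda>w. g u w - ?e' w)"
    using L by (auto intro: L2_diff)
  have pw: "\<bar>f u w * g u w - ?e w * ?e' w\<bar> \<le> \<delta> + (B\<^sup>2 / \<delta> + 1) * ((f u w - ?e w)\<^sup>2 + (g u w - ?e' w)\<^sup>2)"
    if w: "w \<in> space M" for w
  proof -
    define a b x y where "a = f u w" "b = g u w" "x = f u w - ?e w" "y = g u w - ?e' w"
    have "a * b - ?e w * ?e' w = a * y + b * x - x * y"
      unfolding a_b_x_y_def by (simp add: algebra_simps)
    then have "\<bar>a * b - ?e w * ?e' w\<bar> \<le> \<bar>a * y\<bar> + \<bar>b * x\<bar> + \<bar>x * y\<bar>" by linarith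
    then have "\<bar>a * b - ?e w * ?e' w\<bar> \<le> \<bar>a\<bar> * \<bar>y\<bar> + \<bar>b\<bar> * \<bar>x\<bar> + \<bar>x\<bar> * \<bar>y\<bar>"
      unfolding abs_mult .
    also have "\<dots> \<le> B * \<bar>y\<bar> + B * \<bar>x\<bar> + \<bar>x\<bar> * \<bar>y\<bar>"
      using B[OF w, of u] unfolding a_b_x_y_def by (intro add_mono mult_right_mono) auto
    finally have ab: "\<bar>a * b - ?e w * ?e' w\<bar> \<le> B * \<bar>y\<bar> + B * \<bar>x\<bar> + \<bar>x\<bar> * \<bar>y\<bar>" .
    have AG: "B * \<bar>z\<bar> \<le> \<delta> / 2 + B\<^sup>2 / \<delta> * z\<^sup>2" for z
    proof -
      have "0 \<le> (\<delta> / 2 - B * \<bar>z\<bar>)\<^sup>2 / \<delta> + \<delta> / 4" using d by (intro add_nonneg_nonneg divide_nonneg_nonneg) auto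
      also have "\<dots> = \<delta> / 2 + B\<^sup>2 / \<delta> * z\<^sup>2 - B * \<bar>z\<bar>"
        unfolding power2_diff power_mult_distrib power2_abs using d by (simp add: field_simps) (simp add: power2_eq_square)
      finally show ?thesis by simp
    qed
    have "\<bar>x\<bar> * \<bar>y\<bar> \<le> x\<^sup>2 + y\<^sup>2"
      using sum_squares_bound[of "\<bar>x\<bar>" "\<bar>y\<bar>"] mult_nonneg_nonneg[of "\<bar>x\<bar>" "\<bar>y\<bar>"]
      unfolding power2_abs by linarith
    then have "\<bar>a * b - ?e w * ?e' w\<bar> \<le> (\<delta> / 2 + B\<^sup>2 / \<delta> * y\<^sup>2) + (\<delta> / 2 + B\<^sup>2 / \<delta> * x\<^sup>2) + (x\<^sup>2 + y\<^sup>2)"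
      using ab AG[of x] AG[of y] by linarith
    also have "\<dots> = \<delta> + (B\<^sup>2 / \<delta> + 1) * (x\<^sup>2 + y\<^sup>2)" by (simp add: algebra_simps)
    finally show ?thesis unfolding a_b_x_y_def .
  qed
  have i: "integrable M (\<lambda>w. f u w * g u w)" "integrable M (\<lambda>w. ?e w * ?e' w)"
    using L by (auto intro: L2_mult)
  have "\<bar>(LINT w|M. f u w * g u w) - (LINT w|M. ?e w * ?e' w)\<bar> = \<bar>LINT w|M. f u w * g u w - ?e w * ?e' w\<bar>"
    using i by simp
  also have "\<dots> \<le> (LINT w|M. \<bar>f u w * g u w - ?e w * ?e' w\<bar>)" by (rule integral_abs_bound)
  also have "\<dots> \<le> (LINT w|M. \<delta> + (B\<^sup>2 / \<delta> + 1) * ((f u w - ?e w)\<^sup>2 + (g u w - ?e' w)\<^sup>2))"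
    using i D pw by (intro integral_mono) (auto simp: L2_def)
  also have "\<dots> = \<delta> + (B\<^sup>2 / \<delta> + 1) * (err f n \<tau> \<xi> u + err g n' \<tau>' \<xi>' u)"
    using D unfolding err_def by (simp add: L2_def prob_space)
  finally show ?thesis .
qed

text \<open>The definition asks only that \<open>I\<close> be measurable. Square integrability
  follows because the distance to some elementary integral is finite; after that both extended
  integrals can be read as real ones.\<close>

lemma has_ito_integralD:
  assumes I: "has_ito_integral M F X f t I" and X: "incr X" and f: "regular f" and t: "0 \<le> t"
  shows "L2 M I" "\<exists>n \<tau> \<xi>. (\<forall>m::nat. elementary M F (n m) (\<tau> m) (\<xi> m)) \<and>
    (\<lambda>m. LINT u|Leb t. err f (n m) (\<tau> m) (\<xi> m) u) \<longlonglongrightarrow> 0 \<and>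
    (\<lambda>m. LINT w|M. (I w - elementary_integral X (n m) (\<tau> m) (\<xi> m) t w)\<^sup>2) \<longlonglongrightarrow> 0"
proof -
  have Im: "I \<in> borel_measurable M" using I by (simp add: has_ito_integral_def)
  obtain n \<tau> \<xi> where e: "\<And>m::nat. elementary M F (n m) (\<tau> m) (\<xi> m)"
    and l1: "(\<lambda>m. \<integral>\<^sup>+u\<in>{0..t}. (\<integral>\<^sup>+w. ennreal ((f u w - elementary_process (n m) (\<tau> m) (\<xi> m) u w)\<^sup>2) \<partial>M) \<partial>lborel) \<longlonglongrightarrow> 0"
    and l2: "(\<lambda>m. \<integral>\<^sup>+w. ennreal ((I w - elementary_integral X (n m) (\<tau> m) (\<xi> m) t w)\<^sup>2) \<partial>M) \<longlonglongrightarrow> 0"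
    using I unfolding has_ito_integral_def by blast
  let ?J = "\<lambda>m. elementary_integral X (n m) (\<tau> m) (\<xi> m) t"
  note JL = elementary_integral_L2[OF X e t]
  have [measurable]: "?J m \<in> borel_measurable M" for m using JL by (simp add: L2_def)
  have A: "(\<lambda>m. LINT u|Leb t. err f (n m) (\<tau> m) (\<xi> m) u) \<longlonglongrightarrow> 0"
    using l1 unfolding err_nn_integral[OF f e] ennreal_0[symmetric]
    by (subst (asm) tendsto_ennreal_iff) (auto intro!: always_eventually integral_nonneg_AE AE_I2 err_nonneg)
  have "\<forall>\<^sub>F m in sequentially. (\<integral>\<^sup>+w. ennreal ((I w - ?J m w)\<^sup>2) \<partial>M) < \<infinity>"
    using order_tendstoD(2)[OF l2] by auto
  then obtain m0 where m0: "\<And>m. m \<ge> m0 \<Longrightarrow> (\<integral>\<^sup>+w. ennreal ((I w - ?J m w)\<^sup>2) \<partial>M) < \<infinity>"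
    by (auto simp: eventually_sequentially)
  have DL: "L2 M (\<lambda>w. I w - ?J m w)" if "m \<ge> m0" for m
    unfolding L2_def
  proof
    show "integrable M (\<lambda>w. (I w - ?J m w)\<^sup>2)"
      by (intro integrableI_nonneg) (use m0[OF that] Im in auto)
  qed (use Im in auto)
  have "L2 M (\<lambda>w. (I w - ?J m0 w) + ?J m0 w)"
    using DL[of m0] JL by (intro L2_add) auto
  then show IL: "L2 M I" by simp
  have "L2 M (\<lambda>w. I w - ?J m w)" for m using IL JL by (rule L2_diff)
  then have eq: "(\<integral>\<^sup>+w. ennreal ((I w - ?J m w)\<^sup>2) \<partial>M) = ennreal (LINT w|M. (I w - ?J m w)\<^sup>2)" for m
    by (intro nn_integral_eq_integral) (auto simp: L2_def)
  have "(\<lambda>m. LINT w|M. (I w - ?J m w)\<^sup>2) \<longlonglongrightarrow> 0"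
    using l2 unfolding eq ennreal_0[symmetric] by (subst (asm) tendsto_ennreal_iff) auto
  with A e show "\<exists>n \<tau> \<xi>. (\<forall>m::nat. elementary M F (n m) (\<tau> m) (\<xi> m)) \<and>
    (\<lambda>m. LINT u|Leb t. err f (n m) (\<tau> m) (\<xi> m) u) \<longlonglongrightarrow> 0 \<and>
    (\<lambda>m. LINT w|M. (I w - elementary_integral X (n m) (\<tau> m) (\<xi> m) t w)\<^sup>2) \<longlonglongrightarrow> 0"
    by blast
qed

lemma elementary_pair_integrable:
  assumes e: "elementary M F n \<tau> \<xi>" and e': "elementary M F n' \<tau>' \<xi>'"
  shows "integrable (Leb t) (\<lambda>u. LINT w|M. elementary_process n \<tau> \<xi> u w * elementary_process n' \<tau>' \<xi>' u w)"
proof -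
  let ?e = "elementary_process n \<tau> \<xi>" and ?e' = "elementary_process n' \<tau>' \<xi>'"
  obtain b where b: "0 \<le> b" "\<And>u w. w \<in> space M \<Longrightarrow> \<bar>?e u w\<bar> \<le> b" by (rule elementary_process_bound[OF e]) blast
  obtain b' where b': "0 \<le> b'" "\<And>u w. w \<in> space M \<Longrightarrow> \<bar>?e' u w\<bar> \<le> b'" by (rule elementary_process_bound[OF e']) blast
  show ?thesis
  proof (rule integrable_Leb)
    show "(\<lambda>u. LINT w|M. ?e u w * ?e' u w) \<in> borel_measurable (Leb t)"
      using measurable_restrict_space1[OF elementary_pair_measurable[OF e e', folded measurable_lborel1]] by auto
    show "\<bar>LINT w|M. ?e u w * ?e' u w\<bar> \<le> b * b'" if "0 \<le> u" for u
    proof -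
      have "\<bar>LINT w|M. ?e u w * ?e' u w\<bar> \<le> (LINT w|M. \<bar>?e u w * ?e' u w\<bar>)" by (rule integral_abs_bound)
      also have "\<dots> \<le> (LINT w|M. b * b')"
      proof (rule integral_mono)
        show "integrable M (\<lambda>w. \<bar>?e u w * ?e' u w\<bar>)"
          using L2_mult[OF elementary_process_L2[OF e] elementary_process_L2[OF e']] by (rule integrable_abs)
        show "\<bar>?e u w * ?e' u w\<bar> \<le> b * b'" if "w \<in> space M" for w
          unfolding abs_mult using b b' that by (intro mult_mono) auto
      qed simp
      finally show ?thesis by (simp add: prob_space)
    qed
  qed
qed

text \<open>Both sides are limits of the elementary isometry: the left by Cauchy-Schwarz and L2
  convergence of the integrals, the right by \<open>pair_error_bound\<close>. Every integral in the
  sense of \<open>has_ito_integral\<close> is covered, so the choice made by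
  \<open>ito_integral\<close> is immaterial.\<close>

theorem ito_isometry:
  assumes X: "incr X" and Y: "incr Y" and c: "cov_rate X Y c" and t: "0 \<le> t"
    and f: "regular f" and g: "regular g"
    and I: "has_ito_integral M F X f t I" and J: "has_ito_integral M F Y g t J"
  shows "integrable M (\<lambda>w. I w * J w)"
    and "(LINT w|M. I w * J w) = c * (LINT u|Leb t. LINT w|M. f u w * g u w)"
proof -
  obtain n \<tau> \<xi> where e: "\<And>m::nat. elementary M F (n m) (\<tau> m) (\<xi> m)"
    and A: "(\<lambda>m. LINT u|Leb t. err f (n m) (\<tau> m) (\<xi> m) u) \<longlonglongrightarrow> 0"
    and D: "(\<lambda>m. LINT w|M. (I w - elementary_integral X (n m) (\<tau> m) (\<xi> m) t w)\<^sup>2) \<longlonglongrightarrow> 0"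
    using has_ito_integralD(2)[OF I X f t] by blast
  have IL: "L2 M I" and JL: "L2 M J" using has_ito_integralD(1)[OF I X f t] has_ito_integralD(1)[OF J Y g t] by auto
  obtain n' \<tau>' \<xi>' where e': "\<And>m::nat. elementary M F (n' m) (\<tau>' m) (\<xi>' m)"
    and A': "(\<lambda>m. LINT u|Leb t. err g (n' m) (\<tau>' m) (\<xi>' m) u) \<longlonglongrightarrow> 0"
    and D': "(\<lambda>m. LINT w|M. (J w - elementary_integral Y (n' m) (\<tau>' m) (\<xi>' m) t w)\<^sup>2) \<longlonglongrightarrow> 0"
    using has_ito_integralD(2)[OF J Y g t] by blast
  show "integrable M (\<lambda>w. I w * J w)" using IL JL by (rule L2_mult)
  let ?I = "\<lambda>m. elementary_integral X (n m) (\<tau> m) (\<xi> m) t"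
  let ?J = "\<lambda>m. elementary_integral Y (n' m) (\<tau>' m) (\<xi>' m) t"
  let ?e = "\<lambda>m u. elementary_process (n m) (\<tau> m) (\<xi> m) u" and ?e' = "\<lambda>m u. elementary_process (n' m) (\<tau>' m) (\<xi>' m) u"
  let ?a = "\<lambda>m. LINT w|M. (I w - ?I m w)\<^sup>2" and ?b = "\<lambda>m. LINT w|M. (J w - ?J m w)\<^sup>2"
  let ?S = "\<lambda>K. sqrt (LINT w|M. (K w)\<^sup>2)"
  have IL': "L2 M (?I m)" "L2 M (?J m)" for m
    using elementary_integral_L2[OF X e t] elementary_integral_L2[OF Y e' t] by auto
  have dL: "L2 M (\<lambda>w. I w - ?I m w)" "L2 M (\<lambda>w. J w - ?J m w)" for m
    using IL JL IL' by (auto intro: L2_diff)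
  have lim1: "(\<lambda>m. LINT w|M. ?I m w * ?J m w) \<longlonglongrightarrow> (LINT w|M. I w * J w)"
  proof (rule LIM_zero_cancel, rule Lim_null_comparison)
    show "\<forall>\<^sub>F m in sequentially. norm ((LINT w|M. ?I m w * ?J m w) - (LINT w|M. I w * J w))
       \<le> ?S I * sqrt (?b m) + ?S J * sqrt (?a m) + sqrt (?a m) * sqrt (?b m)"
    proof (intro always_eventually allI)
      fix m
      have "(LINT w|M. ?I m w * ?J m w) - (LINT w|M. I w * J w) = (LINT w|M. ?I m w * ?J m w - I w * J w)"
        using L2_mult[OF IL JL] L2_mult[OF IL'] by simp
      also have "\<dots> = (LINT w|M. (I w - ?I m w) * (J w - ?J m w) - I w * (J w - ?J m w) - J w * (I w - ?I m w))"
        by (intro Bochner_Integration.integral_cong) (auto simp: algebra_simps)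
      also have "\<dots> = (LINT w|M. (I w - ?I m w) * (J w - ?J m w)) - (LINT w|M. I w * (J w - ?J m w)) - (LINT w|M. J w * (I w - ?I m w))"
        using L2_mult[OF dL] L2_mult[OF IL dL(2)] L2_mult[OF JL dL(1)] by simp
      finally show "norm ((LINT w|M. ?I m w * ?J m w) - (LINT w|M. I w * J w))
         \<le> ?S I * sqrt (?b m) + ?S J * sqrt (?a m) + sqrt (?a m) * sqrt (?b m)"
        using L2_bounded_CS[OF dL(1)[of m] dL(2)[of m]] L2_bounded_CS[OF IL dL(2)[of m]] L2_bounded_CS[OF JL dL(1)[of m]]
        unfolding real_norm_def by linarith
    qed
    show "(\<lambda>m. ?S I * sqrt (?b m) + ?S J * sqrt (?a m) + sqrt (?a m) * sqrt (?b m)) \<longlonglongrightarrow> 0"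
      using tendsto_real_sqrt[OF D] tendsto_real_sqrt[OF D']
      by (auto intro!: tendsto_add_zero tendsto_mult_right_zero tendsto_mult_zero)
  qed
  obtain B1 where B1: "0 \<le> B1" "\<And>u w. w \<in> space M \<Longrightarrow> \<bar>f u w\<bar> \<le> B1" by (rule regular_bound[OF f]) blast
  obtain B2 where B2: "0 \<le> B2" "\<And>u w. w \<in> space M \<Longrightarrow> \<bar>g u w\<bar> \<le> B2" by (rule regular_bound[OF g]) blast
  define B where "B = max B1 B2"
  have B: "\<And>u w. w \<in> space M \<Longrightarrow> \<bar>f u w\<bar> \<le> B" "\<And>u w. w \<in> space M \<Longrightarrow> \<bar>g u w\<bar> \<le> B"
    unfolding B_def using order_trans[OF B1(2) max.cobounded1] order_trans[OF B2(2) max.cobounded2] by blast+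
  let ?G = "\<lambda>u. LINT w|M. f u w * g u w" and ?E = "\<lambda>m u. LINT w|M. ?e m u w * ?e' m u w"
  have Gi: "integrable (Leb t) ?G"
  proof (rule integrable_Leb)
    show "?G \<in> borel_measurable (Leb t)" by (rule measurable_restrict_continuous[OF regular_pair_continuous[OF f g]])
    show "\<bar>?G u\<bar> \<le> B * B" if "0 \<le> u" for u
    proof -
      have "\<bar>?G u\<bar> \<le> (LINT w|M. \<bar>f u w * g u w\<bar>)" by (rule integral_abs_bound)
      also have "\<dots> \<le> (LINT w|M. B * B)"
      proof (rule integral_mono)
        show "integrable M (\<lambda>w. \<bar>f u w * g u w\<bar>)"
          using L2_mult[OF regular_L2[OF f that] regular_L2[OF g that]] by auto
        show "\<bar>f u w * g u w\<bar> \<le> B * B" if "w \<in> space M" for w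
          unfolding abs_mult using B[OF that, of u] by (intro mult_mono) auto
      qed simp
      finally show ?thesis by (simp add: prob_space)
    qed
  qed
  note Ei = elementary_pair_integrable[OF e e']
  have lim2: "(\<lambda>m. LINT u|Leb t. ?E m u) \<longlonglongrightarrow> (LINT u|Leb t. ?G u)"
  proof (rule LIMSEQ_I)
    fix r :: real assume r: "0 < r"
    let ?V = "measure lborel {0..t}"
    \<comment> \<open>Chosen so that \<open>\<delta>\<close> times the length of the time interval
      stays below \<open>r\<close>; the \<open>+ 1\<close> covers length 0.\<close>
    define \<delta> where "\<delta> = r / (2 * (?V + 1))"
    have V: "0 \<le> ?V" by simp
    have d: "0 < \<delta>" "\<delta> * ?V < r" using r V unfolding \<delta>_def by (auto simp: field_simps add_strict_increasing2)
    let ?K = "B\<^sup>2 / \<delta> + 1"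
    let ?R = "\<lambda>m. (LINT u|Leb t. err f (n m) (\<tau> m) (\<xi> m) u) + (LINT u|Leb t. err g (n' m) (\<tau>' m) (\<xi>' m) u)"
    have "(\<lambda>m. \<delta> * ?V + ?K * ?R m) \<longlonglongrightarrow> \<delta> * ?V + ?K * (0 + 0)"
      by (intro tendsto_intros A A')
    then have "(\<lambda>m. \<delta> * ?V + ?K * ?R m) \<longlonglongrightarrow> \<delta> * ?V" by simp
    from order_tendstoD(2)[OF this d(2)] obtain N where N: "\<And>m. m \<ge> N \<Longrightarrow> \<delta> * ?V + ?K * ?R m < r"
      by (auto simp: eventually_sequentially)
    have "norm ((LINT u|Leb t. ?E m u) - (LINT u|Leb t. ?G u)) < r" if "m \<ge> N" for m
    proof -
      have "\<bar>(LINT u|Leb t. ?E m u) - (LINT u|Leb t. ?G u)\<bar> = \<bar>LINT u|Leb t. ?G u - ?E m u\<bar>"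
        using Gi Ei by simp
      also have "\<dots> \<le> (LINT u|Leb t. \<bar>?G u - ?E m u\<bar>)" by (rule integral_abs_bound)
      also have "\<dots> \<le> (LINT u|Leb t. \<delta> + ?K * (err f (n m) (\<tau> m) (\<xi> m) u + err g (n' m) (\<tau>' m) (\<xi>' m) u))"
        using Gi Ei err_integrable[OF f e] err_integrable[OF g e'] pair_error_bound[OF f g e e' B _ d(1)]
        by (intro integral_mono) (auto simp: space_restrict_space finite_measure.integrable_const[OF finite_Leb])
      also have "\<dots> = \<delta> * ?V + ?K * ?R m"
        using err_integrable[OF f e] err_integrable[OF g e']
        by (simp add: finite_measure.integrable_const[OF finite_Leb] measure_restrict_space space_restrict_space)
      finally show ?thesis using N[OF that] by simp
    qed
    then show "\<exists>no. \<forall>m\<ge>no. norm ((LINT u|Leb t. ?E m u) - (LINT u|Leb t. ?G u)) < r" by blast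
  qed
  have "(\<lambda>m. c * (LINT u|Leb t. ?E m u)) \<longlonglongrightarrow> (LINT w|M. I w * J w)"
    using lim1 unfolding elementary_isometry[OF X Y c t e e'] .
  moreover have "(\<lambda>m. c * (LINT u|Leb t. ?E m u)) \<longlonglongrightarrow> c * (LINT u|Leb t. ?G u)"
    by (intro tendsto_intros lim2)
  ultimately show "(LINT w|M. I w * J w) = c * (LINT u|Leb t. ?G u)" by (rule LIMSEQ_unique)
qed

end

section \<open>Existence of the Ito integral through left-endpoint sums\<close>

context filtered
begin

lemma grid_process:
  fixes f :: "real \<Rightarrow> 'a \<Rightarrow> real"
  assumes u: "0 < u" "u \<le> t"
  shows "\<exists>s. 0 \<le> s \<and> \<bar>u - s\<bar> \<le> t / Suc m \<and>
    (\<forall>w. elementary_process (Suc m) (\<lambda>k. t * real k / real (Suc m)) (\<lambda>k. f (t * real k / real (Suc m))) u w = f s w)"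
proof -
  define x where "x = u * Suc m / t"
  \<comment> \<open>The intervals of an elementary process are open on the left and closed on the
    right, so the one that contains \<open>u\<close> has index \<open>\<lceil>x\<rceil> - 1\<close>,
    not \<open>\<lfloor>x\<rfloor>\<close>.\<close>
  define k where "k = nat (\<lceil>x\<rceil> - 1)"
  have t: "0 < t" using u by linarith
  have x: "0 < x" "x \<le> Suc m" using u t unfolding x_def by (auto simp: divide_simps mult_right_mono)
  then have c: "0 < \<lceil>x\<rceil>" "\<lceil>x\<rceil> \<le> Suc m" by (auto simp: ceiling_le_iff)
  have k: "real k = of_int \<lceil>x\<rceil> - 1" "k < Suc m" using c unfolding k_def by auto
  then have kx: "real k < x" "x \<le> real (Suc k)" using ceiling_correct[of x] by auto
  have iff: "t * real j / real (Suc m) < u \<and> u \<le> t * real (Suc j) / real (Suc m) \<longleftrightarrow> real j < x \<and> x \<le> Suc j" for j :: nat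
    using t unfolding x_def by (auto simp: field_simps)
  have ind: "indicator {t * real j / real (Suc m)<..t * real (Suc j) / real (Suc m)} u = (if j = k then 1 else 0 :: real)" for j
  proof -
    have "real j < x \<and> x \<le> Suc j \<longleftrightarrow> j = k" using kx by auto
    then show ?thesis using iff[of j] by (auto simp: indicator_def)
  qed
  have "elementary_process (Suc m) (\<lambda>k. t * real k / real (Suc m)) (\<lambda>k. f (t * real k / real (Suc m))) u w = f (t * real k / real (Suc m)) w" for w
    unfolding elementary_process_def ind using k(2) by (simp only: mult_if_delta if_distrib[of "\<lambda>z. _ * z"] mult_1_right mult_zero_right sum.delta finite_lessThan lessThan_iff if_True)
  moreover have "t * real k / real (Suc m) < u" "u \<le> t * real (Suc k) / real (Suc m)" using iff[of k] kx by auto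
  moreover have "t * real (Suc k) / real (Suc m) = t * real k / real (Suc m) + t / Suc m"
    unfolding add_divide_distrib[symmetric] by (simp add: distrib_left)
  ultimately show ?thesis using t by (intro exI[of _ "t * real k / real (Suc m)"]) auto
qed

lemma grid_elementary:
  assumes f: "regular f" and t: "0 \<le> t"
  shows "elementary M F (Suc m) (\<lambda>k. t * real k / real (Suc m)) (\<lambda>k. f (t * real k / real (Suc m)))"
  unfolding elementary_def
proof (intro conjI allI impI)
  fix k assume "k < Suc m"
  show "t * real k / real (Suc m) \<le> t * real (Suc k) / real (Suc m)"
    using t by (intro divide_right_mono mult_left_mono) auto
  show "f (t * real k / real (Suc m)) \<in> borel_measurable (F (t * real k / real (Suc m)))" using f t by (auto simp: regular_def)
  show "\<exists>b. \<forall>w\<in>space M. \<bar>f (t * real k / real (Suc m)) w\<bar> \<le> b" using f unfolding regular_def by blast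
qed simp

lemma grid_err_tendsto:
  assumes f: "regular f" and t: "0 \<le> t"
  shows "(\<lambda>m. LINT u|Leb t. err f (Suc m) (\<lambda>k. t * real k / real (Suc m)) (\<lambda>k. f (t * real k / real (Suc m))) u) \<longlonglongrightarrow> 0"
proof -
  obtain B where B: "0 \<le> B" "\<And>u w. w \<in> space M \<Longrightarrow> \<bar>f u w\<bar> \<le> B" by (rule regular_bound[OF f]) blast
  let ?err = "\<lambda>m. err f (Suc m) (\<lambda>k. t * real k / real (Suc m)) (\<lambda>k. f (t * real k / real (Suc m)))"
  have sq: "(f u w - f s w)\<^sup>2 \<le> (2 * B)\<^sup>2" if "w \<in> space M" for u s w
    using B(2)[OF that, of u] B(2)[OF that, of s] by (intro abs_le_square_iff[THEN iffD1]) auto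
  have pw: "?err m u \<le> (2 * B)\<^sup>2" "(\<lambda>m. ?err m u) \<longlonglongrightarrow> 0" if u: "0 < u" "u \<le> t" for m u
  proof -
    obtain s where s: "\<And>m. 0 \<le> s m" "\<And>m. \<bar>u - s m\<bar> \<le> t / Suc m"
      "\<And>m w. elementary_process (Suc m) (\<lambda>k. t * real k / real (Suc m)) (\<lambda>k. f (t * real k / real (Suc m))) u w = f (s m) w"
      using grid_process[OF u, of _ f] by metis
    have e: "?err m u = (LINT w|M. (f u w - f (s m) w)\<^sup>2)" for m unfolding err_def s(3) ..
    have m: "f u \<in> borel_measurable M" "f (s m) \<in> borel_measurable M" for m
      using regular_measurable[OF f] s(1) u by auto
    have "?err m u \<le> (LINT w|M. (2 * B)\<^sup>2)"
      unfolding e using sq m L2_diff[OF regular_L2[OF f] regular_L2[OF f], of u "s m"] s(1) u by (intro integral_mono) (auto simp: L2_def)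
    then show "?err m u \<le> (2 * B)\<^sup>2" by (simp add: prob_space)
    have "s \<longlonglongrightarrow> u"
    proof (rule LIM_zero_cancel, rule Lim_null_comparison)
      show "\<forall>\<^sub>F m in sequentially. norm (s m - u) \<le> t / Suc m" using s(2) by (auto simp: abs_minus_commute)
      show "(\<lambda>m. t / Suc m) \<longlonglongrightarrow> 0" using LIMSEQ_Suc[OF lim_const_over_n[of t]] by simp
    qed
    have "(\<lambda>m. LINT w|M. (f u w - f (s m) w)\<^sup>2) \<longlonglongrightarrow> (LINT w|M. 0)"
    proof (rule integral_dominated_convergence[where w="\<lambda>_. (2 * B)\<^sup>2"])
      have "AE w in M. continuous_on {0..} (\<lambda>u. f u w)" using f by (simp add: regular_def)
      then show "AE w in M. (\<lambda>m. (f u w - f (s m) w)\<^sup>2) \<longlonglongrightarrow> 0"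
      proof eventually_elim
        case (elim w)
        then have "(\<lambda>m. f (s m) w) \<longlonglongrightarrow> f u w"
          using \<open>s \<longlonglongrightarrow> u\<close> s(1) u unfolding continuous_on_sequentially comp_def by (meson atLeast_iff less_imp_le)
        then have "(\<lambda>m. (f u w - f (s m) w)\<^sup>2) \<longlonglongrightarrow> (f u w - f u w)\<^sup>2" by (intro tendsto_intros)
        then show ?case by simp
      qed
    qed (use m sq in auto)
    then show "(\<lambda>m. ?err m u) \<longlonglongrightarrow> 0" unfolding e by simp
  qed
  \<comment> \<open>At \<open>u = 0\<close> the elementary process vanishes, since its intervals are
    open on the left; the grid approximates \<open>f\<close> only off this null set.\<close>
  have AE0: "AE u in Leb t. 0 < u \<and> u \<le> t"
    using AE_lborel_singleton[of 0] by (subst AE_restrict_space_iff) (auto elim!: eventually_mono)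
  have "(\<lambda>m. LINT u|Leb t. ?err m u) \<longlonglongrightarrow> (LINT u|Leb t. 0)"
  proof (rule integral_dominated_convergence[where w="\<lambda>_. (2 * B)\<^sup>2"])
    show "AE u in Leb t. (\<lambda>m. ?err m u) \<longlonglongrightarrow> 0" using AE0 by eventually_elim (use pw in auto)
    show "AE u in Leb t. norm (?err m u) \<le> (2 * B)\<^sup>2" for m using AE0 by eventually_elim (use pw err_nonneg in auto)
    show "?err m \<in> borel_measurable (Leb t)" for m by (rule err_measurable[OF f grid_elementary[OF f t]])
  qed (auto simp: finite_measure.integrable_const[OF finite_Leb])
  then show ?thesis by simp
qed

text \<open>Expanding the square and applying the elementary isometry three times gives the isometry
  for a difference over two unrelated partitions. It makes the grid sums a Cauchy sequence.\<close>

lemma elementary_integral_diff: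
  assumes X: "incr X" and c: "cov_rate X X c" and f: "regular f" and t: "0 \<le> t"
    and e: "elementary M F n \<tau> \<xi>" and e': "elementary M F n' \<tau>' \<xi>'"
  shows "(LINT w|M. (elementary_integral X n \<tau> \<xi> t w - elementary_integral X n' \<tau>' \<xi>' t w)\<^sup>2)
    \<le> 2 * \<bar>c\<bar> * ((LINT u|Leb t. err f n \<tau> \<xi> u) + (LINT u|Leb t. err f n' \<tau>' \<xi>' u))"
proof -
  let ?J = "elementary_integral X n \<tau> \<xi> t" and ?J' = "elementary_integral X n' \<tau>' \<xi>' t"
  let ?e = "elementary_process n \<tau> \<xi>" and ?e' = "elementary_process n' \<tau>' \<xi>'"
  note J = elementary_integral_L2[OF X e t] and J' = elementary_integral_L2[OF X e' t]
  note el = elementary_process_L2[OF e] and el' = elementary_process_L2[OF e']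
  note pi = elementary_pair_integrable[OF e e, of t] elementary_pair_integrable[OF e e', of t] elementary_pair_integrable[OF e' e', of t]
  have "(LINT w|M. (?J w - ?J' w)\<^sup>2) = (LINT w|M. ?J w * ?J w - 2 * (?J w * ?J' w) + ?J' w * ?J' w)"
    by (intro Bochner_Integration.integral_cong) (auto simp: power2_eq_square algebra_simps)
  also have "\<dots> = (LINT w|M. ?J w * ?J w) - 2 * (LINT w|M. ?J w * ?J' w) + (LINT w|M. ?J' w * ?J' w)"
    using L2_mult[OF J J] L2_mult[OF J J'] L2_mult[OF J' J'] by simp
  also have "\<dots> = c * (LINT u|Leb t. (LINT w|M. ?e u w * ?e u w) - 2 * (LINT w|M. ?e u w * ?e' u w) + (LINT w|M. ?e' u w * ?e' u w))"
    unfolding elementary_isometry[OF X X c t e e] elementary_isometry[OF X X c t e e'] elementary_isometry[OF X X c t e' e']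
    using pi by (simp add: algebra_simps)
  also have "\<dots> = c * (LINT u|Leb t. LINT w|M. (?e u w - ?e' u w)\<^sup>2)"
  proof (intro arg_cong[of _ _ "\<lambda>z. c * z"] Bochner_Integration.integral_cong refl)
    fix u
    have "(LINT w|M. (?e u w - ?e' u w)\<^sup>2) = (LINT w|M. ?e u w * ?e u w - 2 * (?e u w * ?e' u w) + ?e' u w * ?e' u w)"
      by (intro Bochner_Integration.integral_cong) (auto simp: power2_eq_square algebra_simps)
    also have "\<dots> = (LINT w|M. ?e u w * ?e u w) - 2 * (LINT w|M. ?e u w * ?e' u w) + (LINT w|M. ?e' u w * ?e' u w)"
      using L2_mult[OF el el, of u] L2_mult[OF el el', of u] L2_mult[OF el' el', of u] by simp
    finally show "(LINT w|M. ?e u w * ?e u w) - 2 * (LINT w|M. ?e u w * ?e' u w) + (LINT w|M. ?e' u w * ?e' u w) = (LINT w|M. (?e u w - ?e' u w)\<^sup>2)" by simp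
  qed
  also have "\<dots> \<le> \<bar>c\<bar> * (LINT u|Leb t. LINT w|M. (?e u w - ?e' u w)\<^sup>2)"
    by (intro mult_right_mono integral_nonneg_AE) auto
  also have "\<dots> \<le> \<bar>c\<bar> * (LINT u|Leb t. 2 * (err f n \<tau> \<xi> u + err f n' \<tau>' \<xi>' u))"
  proof (intro mult_left_mono integral_mono')
    show "integrable (Leb t) (\<lambda>u. 2 * (err f n \<tau> \<xi> u + err f n' \<tau>' \<xi>' u))"
      using err_integrable[OF f e] err_integrable[OF f e'] by auto
    fix u assume "u \<in> space (Leb t)"
    then have u: "0 \<le> u" by (auto simp: space_restrict_space)
    have "(LINT w|M. (?e u w - ?e' u w)\<^sup>2) \<le> (LINT w|M. 2 * ((f u w - ?e u w)\<^sup>2 + (f u w - ?e' u w)\<^sup>2))"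
    proof (rule integral_mono)
      show "(?e u w - ?e' u w)\<^sup>2 \<le> 2 * ((f u w - ?e u w)\<^sup>2 + (f u w - ?e' u w)\<^sup>2)" for w
        using zero_le_power2[of "(f u w - ?e u w) + (f u w - ?e' u w)"] by (simp add: power2_eq_square algebra_simps)
    qed (use err_L2[OF f e u] err_L2[OF f e' u] L2_diff[OF el el'] in \<open>auto simp: L2_def\<close>)
    also have "\<dots> = 2 * (err f n \<tau> \<xi> u + err f n' \<tau>' \<xi>' u)"
      using err_L2[OF f e u] err_L2[OF f e' u] by (simp add: L2_def err_def)
    finally show "(LINT w|M. (?e u w - ?e' u w)\<^sup>2) \<le> 2 * (err f n \<tau> \<xi> u + err f n' \<tau>' \<xi>' u)" .
  qed (auto simp: err_nonneg)
  also have "\<dots> = 2 * \<bar>c\<bar> * ((LINT u|Leb t. err f n \<tau> \<xi> u) + (LINT u|Leb t. err f n' \<tau>' \<xi>' u))"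
    using err_integrable[OF f e, of t] err_integrable[OF f e', of t] by simp
  finally show ?thesis .
qed

text \<open>\<open>ito_integral\<close> is defined by choice, so it has its property only once some
  integral is shown to exist: the L2 limit of the grid sums.\<close>

theorem ito_integral_exists:
  assumes X: "incr X" and c: "cov_rate X X c" and f: "regular f" and t: "0 \<le> t"
  shows "has_ito_integral M F X f t (ito_integral M F X f t)"
proof -
  let ?\<tau> = "\<lambda>m k. t * real k / real (Suc m)" and ?\<xi> = "\<lambda>m k. f (t * real k / real (Suc m))"
  let ?J = "\<lambda>m. elementary_integral X (Suc m) (?\<tau> m) (?\<xi> m) t"
  let ?E = "\<lambda>m. LINT u|Leb t. err f (Suc m) (?\<tau> m) (?\<xi> m) u"
  note el = grid_elementary[OF f t]
  have E0: "0 \<le> ?E m" for m by (intro integral_nonneg_AE AE_I2 err_nonneg)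
  have "\<exists>I. L2 M I \<and> (\<lambda>m. LINT w|M. (I w - ?J m w)\<^sup>2) \<longlonglongrightarrow> 0"
  proof (rule L2_complete)
    show "L2 M (?J m)" for m by (rule elementary_integral_L2[OF X el t])
    fix e :: real assume e: "0 < e"
    define \<delta> where "\<delta> = e / (4 * \<bar>c\<bar> + 1)"
    have d: "0 < \<delta>" "4 * \<bar>c\<bar> * \<delta> < e" using e unfolding \<delta>_def by (auto simp: field_simps add_pos_nonneg)
    obtain K where K: "\<And>m. m \<ge> K \<Longrightarrow> ?E m < \<delta>"
      using order_tendstoD(2)[OF grid_err_tendsto[OF f t] d(1)] by (auto simp: eventually_sequentially)
    have "(LINT w|M. (?J m w - ?J l w)\<^sup>2) < e" if "m \<ge> K" "l \<ge> K" for m l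
    proof -
      have "(LINT w|M. (?J m w - ?J l w)\<^sup>2) \<le> 2 * \<bar>c\<bar> * (?E m + ?E l)"
        by (rule elementary_integral_diff[OF X c f t el el])
      also have "\<dots> \<le> 2 * \<bar>c\<bar> * (\<delta> + \<delta>)" using K[OF that(1)] K[OF that(2)] by (intro mult_left_mono) auto
      also have "\<dots> < e" using d by simp
      finally show ?thesis .
    qed
    then show "\<exists>K. \<forall>m\<ge>K. \<forall>l\<ge>K. (LINT w|M. (?J m w - ?J l w)\<^sup>2) < e" by blast
  qed
  then obtain I where I: "L2 M I" and l: "(\<lambda>m. LINT w|M. (I w - ?J m w)\<^sup>2) \<longlonglongrightarrow> 0" by blast
  have D: "L2 M (\<lambda>w. I w - ?J m w)" for m
    using I elementary_integral_L2[OF X el t] by (rule L2_diff)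
  then have eq: "(\<integral>\<^sup>+w. ennreal ((I w - ?J m w)\<^sup>2) \<partial>M) = ennreal (LINT w|M. (I w - ?J m w)\<^sup>2)" for m
    by (intro nn_integral_eq_integral) (auto simp: L2_def)
  have "has_ito_integral M F X f t I"
    unfolding has_ito_integral_def
  proof (intro conjI exI[of _ Suc] exI[of _ ?\<tau>] exI[of _ ?\<xi>] allI)
    show "I \<in> borel_measurable M" using I by (simp add: L2_def)
    show "elementary M F (Suc m) (?\<tau> m) (?\<xi> m)" for m by (rule el)
    show "(\<lambda>m. \<integral>\<^sup>+u\<in>{0..t}. (\<integral>\<^sup>+w. ennreal ((f u w - elementary_process (Suc m) (?\<tau> m) (?\<xi> m) u w)\<^sup>2) \<partial>M) \<partial>lborel) \<longlonglongrightarrow> 0"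
      unfolding err_nn_integral[OF f el] using tendsto_ennrealI[OF grid_err_tendsto[OF f t]] by simp
    show "(\<lambda>m. \<integral>\<^sup>+w. ennreal ((I w - ?J m w)\<^sup>2) \<partial>M) \<longlonglongrightarrow> 0"
      unfolding eq using tendsto_ennrealI[OF l] by simp
  qed
  then show ?thesis unfolding ito_integral_def by (rule someI[of "has_ito_integral M F X f t"])
qed

end

section \<open>Brownian motion\<close>

text \<open>\<open>sqrt\<close> of a negative real is minus the root of its absolute value, so
  \<open>centred_normal v\<close> with \<open>v < 0\<close> is the normal law of variance
  \<open>\<bar>v\<bar>\<close>. The absolute values in the next lemma come from here: they spare a
  sign check for variances given as quadratic forms of a kernel.\<close>

lemma normal_density_abs: "normal_density 0 (sqrt v) = normal_density 0 (sqrt \<bar>v\<bar>)"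
proof -
  have "(sqrt v)\<^sup>2 = \<bar>v\<bar>"
    by (metis abs_ge_zero power2_abs real_sqrt_abs2 real_sqrt_pow2 real_sqrt_mult_self power2_eq_square real_sqrt_mult)
  then show ?thesis by (auto simp: normal_density_def fun_eq_iff)
qed

context prob_space
begin

lemma centred_normal_law:
  assumes "has_law M X (centred_normal v)"
  shows "L2 M X" "expectation X = 0" "(LINT w|M. (X w)\<^sup>2) = \<bar>v\<bar>"
    "(LINT w|M. cos (c * X w)) = exp (- (c\<^sup>2 * \<bar>v\<bar> / 2))" "(LINT w|M. sin (c * X w)) = 0"
proof -
  have X[measurable]: "X \<in> borel_measurable M" and d: "distr M borel X = centred_normal v"
    using assms by (auto simp: has_law_def)
  have "L2 M X \<and> expectation X = 0 \<and> (LINT w|M. (X w)\<^sup>2) = \<bar>v\<bar> \<and>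
    (LINT w|M. cos (c * X w)) = exp (- (c\<^sup>2 * \<bar>v\<bar> / 2)) \<and> (LINT w|M. sin (c * X w)) = 0"
  proof (cases "v = 0")
    case True
    have "AE x in distr M borel X. x = 0"
      unfolding d centred_normal_def using True by (simp add: AE_return)
    then have z: "AE w in M. X w = 0" by (subst (asm) AE_distr_iff) auto
    have e: "(LINT w|M. g (X w)) = g 0" if "g \<in> borel_measurable borel" for g :: "real \<Rightarrow> real"
    proof -
      have "(LINT w|M. g (X w)) = (LINT w|M. g 0)"
        using z that by (intro integral_cong_AE) (auto elim: eventually_mono)
      then show ?thesis by (simp add: prob_space)
    qed
    have "integrable M (\<lambda>w. (X w)\<^sup>2)"
      using z by (subst integrable_cong_AE[where g="\<lambda>_. 0"]) (auto elim: eventually_mono)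
    then show ?thesis using e[of "\<lambda>x. x"] e[of "\<lambda>x. x\<^sup>2"] e[of "\<lambda>x. cos (c * x)"] e[of "\<lambda>x. sin (c * x)"] True
      by (simp add: L2_def)
  next
    case False
    define s where "s = sqrt \<bar>v\<bar>"
    have s: "0 < s" "s\<^sup>2 = \<bar>v\<bar>" using False by (auto simp: s_def)
    have D: "distributed M lborel X (normal_density 0 s)"
      unfolding distributed_def using d False normal_density_abs[of v] by (auto simp: centred_normal_def s_def cong: distr_cong)
    have var: "expectation X = 0" "variance X = \<bar>v\<bar>"
      using normal_distributed_expectation[OF s(1) D] normal_distributed_variance[OF s(1) D] s by auto
    have i: "integrable M (\<lambda>w. (X w)\<^sup>2)"
      using distributed_integrable[OF D, of "\<lambda>x. x\<^sup>2"] integrable_normal_moment[OF s(1), of 0 2] by simp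
    have Z: "distributed M lborel (\<lambda>w. (X w - 0) / s) std_normal_density"
      using D normal_standard_normal_convert[OF s(1), of X 0] by simp
    have dz: "distr M borel (\<lambda>w. X w / s) = std_normal_distribution"
      using Z unfolding distributed_def by (simp cong: distr_cong)
    interpret S: real_distribution std_normal_distribution by (rule real_dist_normal_dist)
    have ch: "(CLINT x|std_normal_distribution. iexp (c * s * x)) = complex_of_real (exp (- ((c * s)\<^sup>2 / 2)))"
      using fun_cong[OF char_std_normal_distribution, of "c * s"] by (simp add: char_def)
    have ii: "integrable std_normal_distribution (\<lambda>x. iexp (c * s * x))"
      by (rule S.integrable_iexp) auto
    have "(LINT w|M. cos (c * X w)) = (LINT w|M. cos (c * s * (X w / s)))" using s by simp
    also have "\<dots> = (LINT x|std_normal_distribution. cos (c * s * x))"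
      unfolding dz[symmetric] by (subst integral_distr) auto
    also have "\<dots> = Re (CLINT x|std_normal_distribution. iexp (c * s * x))"
      using integral_bounded_linear[OF bounded_linear_Re ii] by (simp add: cis_conv_exp[symmetric] cis.simps Re_exp)
    also have "\<dots> = exp (- (c\<^sup>2 * \<bar>v\<bar> / 2))" unfolding ch using s by (simp add: power_mult_distrib)
    finally have 1: "(LINT w|M. cos (c * X w)) = exp (- (c\<^sup>2 * \<bar>v\<bar> / 2))" .
    have "(LINT w|M. sin (c * X w)) = (LINT w|M. sin (c * s * (X w / s)))" using s by simp
    also have "\<dots> = (LINT x|std_normal_distribution. sin (c * s * x))"
      unfolding dz[symmetric] by (subst integral_distr) auto
    also have "\<dots> = Im (CLINT x|std_normal_distribution. iexp (c * s * x))"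
      using integral_bounded_linear[OF bounded_linear_Im ii] by (simp add: Im_exp)
    also have "\<dots> = 0" unfolding ch by simp
    finally show ?thesis using 1 var i by (simp add: L2_def)
  qed
  then show "L2 M X" "expectation X = 0" "(LINT w|M. (X w)\<^sup>2) = \<bar>v\<bar>"
    "(LINT w|M. cos (c * X w)) = exp (- (c\<^sup>2 * \<bar>v\<bar> / 2))" "(LINT w|M. sin (c * X w)) = 0" by auto
qed

end

context filtered
begin

lemma brownian_incr:
  assumes "brownian_motion M F B"
  shows "incr B"
proof -
  have "has_law M (\<lambda>w. B t w - B s w) (centred_normal (t - s))" if "0 \<le> s" "s < t" for s t
    using assms that by (auto simp: brownian_motion_def)
  from centred_normal_law(1,2)[OF this] assms show ?thesis
    unfolding incr_def brownian_motion_def by blast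
qed

text \<open>Suits the square of one Brownian increment, and products of one Q-Wiener increment at
  two points, because the whole spatial increment is independent of the past. Two different Brownian
  motions need another argument.\<close>

lemma cov_rate_if_indep:
  assumes X: "incr X" and Y: "incr Y"
    and ind: "\<And>s t. 0 \<le> s \<Longrightarrow> s < t \<Longrightarrow> indep_set (sets (F s))
      (sets (vimage_algebra (space M) (\<lambda>w. (X t w - X s w) * (Y t w - Y s w)) borel))"
    and c: "\<And>s t. 0 \<le> s \<Longrightarrow> s < t \<Longrightarrow> (LINT w|M. (X t w - X s w) * (Y t w - Y s w)) = c * (t - s)"
  shows "cov_rate X Y c"
  unfolding cov_rate_def
proof (intro allI impI)
  fix s t :: real and \<zeta> :: "'a \<Rightarrow> real" and b assume s: "0 \<le> s" "s < t" and z: "\<zeta> \<in> borel_measurable (F s)" "\<forall>w\<in>space M. \<bar>\<zeta> w\<bar> \<le> b"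
  let ?D = "\<lambda>w. (X t w - X s w) * (Y t w - Y s w)"
  have i: "integrable M ?D" using incr_L2[OF X] incr_L2[OF Y] s by (intro L2_mult) auto
  have "indep_var borel \<zeta> borel ?D"
    using i z by (intro indep_F[OF ind[OF s]]) auto
  moreover have "integrable M \<zeta>"
    using z measurable_F_M[OF z(1)] by (intro L2_integrable L2_bounded[of _ b]) auto
  ultimately show "(LINT w|M. \<zeta> w * ?D w) = c * (t - s) * (LINT w|M. \<zeta> w)"
    using indep_var_lebesgue_integral[of \<zeta> ?D] i c[OF s] by simp
qed

lemma indep_set_vimage_compose:
  assumes "indep_set A (sets (vimage_algebra (space M) D N))" "g \<in> measurable N N'" "D \<in> space M \<rightarrow> space N"
  shows "indep_set A (sets (vimage_algebra (space M) (\<lambda>w. g (D w)) N'))"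
proof -
  have "(\<lambda>w. g (D w)) \<in> measurable (vimage_algebra (space M) D N) N'"
    using assms(2,3) by (intro measurable_compose[OF measurable_vimage_algebra1]) auto
  then have "sets (vimage_algebra (space M) (\<lambda>w. g (D w)) N') \<subseteq> sets (vimage_algebra (space M) D N)"
    by (intro sets_image_in_sets) auto
  then show ?thesis using assms(1) unfolding indep_sets2_eq by blast
qed

lemma brownian_cov_rate:
  assumes B: "brownian_motion M F B"
  shows "cov_rate B B 1"
proof (rule cov_rate_if_indep[OF brownian_incr[OF B] brownian_incr[OF B]])
  fix s t :: real assume s: "0 \<le> s" "s < t"
  have "indep_set (sets (F s)) (sets (vimage_algebra (space M) (\<lambda>w. B t w - B s w) borel))"
    using B s by (auto simp: brownian_motion_def)
  from indep_set_vimage_compose[OF this, of "\<lambda>x. x * x" borel]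
  show "indep_set (sets (F s)) (sets (vimage_algebra (space M) (\<lambda>w. (B t w - B s w) * (B t w - B s w)) borel))" by auto
  have "has_law M (\<lambda>w. B t w - B s w) (centred_normal (t - s))"
    using B s by (auto simp: brownian_motion_def)
  from centred_normal_law(3)[OF this] s
  show "(LINT w|M. (B t w - B s w) * (B t w - B s w)) = 1 * (t - s)" by (simp add: power2_eq_square)
qed

end

section \<open>Independent Brownian motions have covariation 0\<close>

context filtered
begin

text \<open>Each increment is independent of \<open>F s\<close>, and the two paths are independent
  of each other, but joint independence of the pair from \<open>F s\<close> is not given. So
  \<open>[s, t]\<close> is cut into \<open>n\<close> pieces: off-diagonal products vanish by the
  martingale property, and the diagonal sum has second moment \<open>(t - s)^2 / n\<close> by
  independence of the paths. Cauchy-Schwarz against the bounded \<open>\<zeta>\<close> and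
  \<open>n \<rightarrow> \<infinity>\<close> finish.\<close>

lemma brownian_cross_cov_rate:
  assumes B: "brownian_motion M F B" and B': "brownian_motion M F B'"
    and ind: "indep_var (PiM {0..} (\<lambda>_. borel)) (\<lambda>w. \<lambda>t\<in>{0..}. B t w) (PiM {0..} (\<lambda>_. borel)) (\<lambda>w. \<lambda>t\<in>{0..}. B' t w)"
  shows "cov_rate B B' 0"
  unfolding cov_rate_def
proof (intro allI impI)
  fix s t :: real and \<zeta> :: "'a \<Rightarrow> real" and b
  assume st: "0 \<le> s" "s < t" and z: "\<zeta> \<in> borel_measurable (F s)" "\<forall>w\<in>space M. \<bar>\<zeta> w\<bar> \<le> b"
  note X = brownian_incr[OF B] and Y = brownian_incr[OF B']
  note zM = measurable_F_M[OF z(1)]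
  have zL: "L2 M \<zeta>" using zM z(2) by (intro L2_bounded) auto
  have b0: "0 \<le> b" using z(2) not_empty by (meson abs_ge_zero equals0I order_trans)
  let ?T = "LINT w|M. \<zeta> w * ((B t w - B s w) * (B' t w - B' s w))"
  have bound: "\<bar>?T\<bar> \<le> b * sqrt ((t - s)\<^sup>2 / n)" if n: "0 < n" for n :: nat
  proof -
    define h where "h = (t - s) / n"
    define r where "r k = s + real k * h" for k
    have h: "0 < h" using st n by (simp add: h_def)
    have r: "0 \<le> r k" "r k \<le> r (Suc k)" "r (Suc k) - r k = h" "r k < r (Suc k)" "s \<le> r k" for k
      using st h by (auto simp: r_def algebra_simps)
    have rmono: "r (Suc k) \<le> r l" if "k < l" for k l
      using that h by (auto simp: r_def intro!: mult_right_mono)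
    have r0: "r 0 = s" "r n = t" using n by (auto simp: r_def h_def)
    define d where "d k w = B (r (Suc k)) w - B (r k) w" for k w
    define e where "e k w = B' (r (Suc k)) w - B' (r k) w" for k w
    have dL: "L2 M (d k)" and eL: "L2 M (e k)" for k
      unfolding d_def e_def using incr_L2[OF X r(1,2)] incr_L2[OF Y r(1,2)] by auto
    have dF: "d k \<in> borel_measurable (F (r (Suc k)))" and eF: "e k \<in> borel_measurable (F (r (Suc k)))" for k
      unfolding d_def e_def using incr_F[OF X r(1,2)] incr_F[OF Y r(1,2)] by auto
    have sumd: "B t w - B s w = (\<Sum>k<n. d k w)" "B' t w - B' s w = (\<Sum>k<n. e k w)" for w
      unfolding d_def e_def r0[symmetric] using sum_lessThan_telescope[of "\<lambda>k. B (r k) w" n] sum_lessThan_telescope[of "\<lambda>k. B' (r k) w" n] by simp_all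
    have zdL: "L2 M (\<lambda>w. \<zeta> w * d k w)" "L2 M (\<lambda>w. \<zeta> w * e k w)" for k
      using L2_bounded_mult[OF dL zM] L2_bounded_mult[OF eL zM] z(2) by blast+
    have zdF: "(\<lambda>w. \<zeta> w * d k w) \<in> borel_measurable (F (r (Suc k)))" "(\<lambda>w. \<zeta> w * e k w) \<in> borel_measurable (F (r (Suc k)))" for k
      using measurable_F_mono[OF z(1) r(5)[of "Suc k"]] dF eF by auto
    have off: "(LINT w|M. \<zeta> w * (d k w * e l w)) = 0" if "k \<noteq> l" for k l
    proof (cases "k < l")
      case True
      have "(LINT w|M. (\<zeta> w * d k w) * e l w) = 0"
        unfolding e_def
        using zdF(1)[THEN measurable_F_mono, OF rmono[OF True]] by (intro incr_mean_zero[OF Y r(1,2) zdL(1)])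
      then show ?thesis by (simp add: mult.assoc)
    next
      case False
      then have "l < k" using that by simp
      have "(LINT w|M. (\<zeta> w * e l w) * d k w) = 0"
        unfolding d_def
        using zdF(2)[THEN measurable_F_mono, OF rmono[OF \<open>l < k\<close>]] by (intro incr_mean_zero[OF X r(1,2) zdL(2)])
      then show ?thesis by (simp add: mult_ac)
    qed
    \<comment> \<open>Independence of whole paths is needed here: it factorises
      \<open>E[d k * d l * e k * e l]\<close>, which the martingale property alone does not.\<close>
    have path: "indep_var borel (\<lambda>w. d k w * d l w) borel (\<lambda>w. e k w * e l w)" for k l
    proof -
      let ?g = "\<lambda>f. (f (r (Suc k)) - f (r k)) * (f (r (Suc l)) - f (r l) :: real)"
      have "indep_var borel (?g \<circ> (\<lambda>w. \<lambda>t\<in>{0..}. B t w)) borel (?g \<circ> (\<lambda>w. \<lambda>t\<in>{0..}. B' t w))"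
        using r(1) by (intro indep_var_compose[OF ind] borel_measurable_times borel_measurable_diff measurable_component_singleton) auto
      then show ?thesis using r(1) by (simp add: comp_def d_def e_def)
    qed
    have ii: "integrable M (\<lambda>w. (d k w * d l w) * (e k w * e l w))"
      and ee: "(LINT w|M. (d k w * d l w) * (e k w * e l w)) = (LINT w|M. d k w * d l w) * (LINT w|M. e k w * e l w)" for k l
      using indep_var_integrable[OF path L2_mult[OF dL dL] L2_mult[OF eL eL]]
        indep_var_lebesgue_integral[OF path L2_mult[OF dL dL] L2_mult[OF eL eL]] by auto
    have one: "(\<lambda>_. 1 :: real) \<in> borel_measurable (F q)" for q by simp
    have dd: "(LINT w|M. d k w * d l w) = (if k = l then h else 0)" for k l
    proof -
      have same: "(LINT w|M. d k w * d k w) = h"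
        using brownian_cov_rate[OF B, unfolded cov_rate_def, rule_format, OF r(1)[of k] r(4)[of k] one[of "r k"], of 1]
        unfolding d_def by (simp add: r(3) prob_space)
      have "(LINT w|M. d k w * d l w) = 0" if "k < l" for k l
        unfolding d_def[of l] using dF[THEN measurable_F_mono, OF rmono[OF that]] by (intro incr_mean_zero[OF X r(1,2) dL])
      note lt = this
      have "(LINT w|M. d k w * d l w) = 0" if "l < k"
        using lt[OF that] by (simp only: mult.commute)
      then show ?thesis using same lt[of k l] by (cases k l rule: linorder_cases) auto
    qed
    have eeq: "(LINT w|M. e k w * e k w) = h" for k
        using brownian_cov_rate[OF B', unfolded cov_rate_def, rule_format, OF r(1)[of k] r(4)[of k] one[of "r k"], of 1]
        unfolding e_def by (simp add: r(3) prob_space)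
    let ?S = "\<lambda>w. \<Sum>k<n. d k w * e k w"
    have "integrable M (\<lambda>w. (d k w * e k w)\<^sup>2)" for k
      using ii[of k k] by (simp add: power2_eq_square mult_ac)
    then have deL: "L2 M (\<lambda>w. d k w * e k w)" for k
      using dL[of k] eL[of k] by (auto simp: L2_def)
    then have SL: "L2 M ?S" by (intro L2_sum)
    have "(LINT w|M. (?S w)\<^sup>2) = (LINT w|M. (\<Sum>k<n. \<Sum>l<n. (d k w * d l w) * (e k w * e l w)))"
      by (intro Bochner_Integration.integral_cong refl) (simp add: power2_eq_square sum_product mult_ac)
    also have "\<dots> = (\<Sum>k<n. \<Sum>l<n. (LINT w|M. d k w * d l w) * (LINT w|M. e k w * e l w))"
      using ii ee by (subst integral_double_sum) auto
    also have "\<dots> = (\<Sum>k<n. \<Sum>l<n. if l = k then h * h else 0)"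
      unfolding dd using eeq by (intro sum.cong refl) auto
    also have "\<dots> = n * (h * h)" by simp
    also have "\<dots> = (t - s)\<^sup>2 / n" using n by (simp add: h_def power2_eq_square)
    finally have SS: "(LINT w|M. (?S w)\<^sup>2) = (t - s)\<^sup>2 / n" .
    have zde: "integrable M (\<lambda>w. \<zeta> w * (d k w * e l w))" for k l
      using L2_mult[OF zdL(1) eL] by (simp add: mult.assoc)
    have "?T = (LINT w|M. (\<Sum>k<n. \<Sum>l<n. \<zeta> w * (d k w * e l w)))"
      unfolding sumd sum_product by (simp only: sum_distrib_left)
    also have "\<dots> = (\<Sum>k<n. \<Sum>l<n. LINT w|M. \<zeta> w * (d k w * e l w))"
      using zde by (intro integral_double_sum) auto
    also have "\<dots> = (\<Sum>k<n. \<Sum>l<n. if l = k then (LINT w|M. \<zeta> w * (d k w * e k w)) else 0)"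
      using off by (intro sum.cong refl) auto
    also have "\<dots> = (\<Sum>k<n. LINT w|M. \<zeta> w * (d k w * e k w))" by simp
    also have "\<dots> = (LINT w|M. (\<Sum>k<n. \<zeta> w * (d k w * e k w)))"
      using zde by (intro Bochner_Integration.integral_sum[symmetric])
    also have "\<dots> = (LINT w|M. \<zeta> w * ?S w)" by (simp add: sum_distrib_left)
    finally have "\<bar>?T\<bar> \<le> sqrt (LINT w|M. (\<zeta> w)\<^sup>2) * sqrt (LINT w|M. (?S w)\<^sup>2)"
      using L2_bounded_CS[OF zL SL] by simp
    also have "\<dots> \<le> b * sqrt ((t - s)\<^sup>2 / n)"
    proof -
      have "(LINT w|M. (\<zeta> w)\<^sup>2) \<le> (LINT w|M. b\<^sup>2)"
        using zL z(2) b0 by (intro integral_mono) (auto simp: L2_def abs_le_square_iff[symmetric])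
      then have "sqrt (LINT w|M. (\<zeta> w)\<^sup>2) \<le> b"
        using b0 by (intro real_le_lsqrt) (auto simp: prob_space)
      then show ?thesis unfolding SS by (intro mult_right_mono) auto
    qed
    finally show ?thesis .
  qed
  have "(\<lambda>n. b * sqrt ((t - s)\<^sup>2 / real n)) \<longlonglongrightarrow> b * sqrt 0"
    by (intro tendsto_intros lim_const_over_n)
  then have "\<bar>?T\<bar> \<le> b * sqrt 0"
    using bound by (intro tendsto_lowerbound[where F=sequentially]) (auto simp: eventually_sequentially intro!: exI[of _ 1])
  then show "?T = 0 * (t - s) * (LINT w|M. \<zeta> w)" by simp
qed

end

context prob_space
begin

lemma centred_normal_char:
  assumes Y: "Y \<in> borel_measurable M"
    and c: "\<And>c. (LINT w|M. cos (c * Y w)) = exp (- (c\<^sup>2 * v / 2))" "\<And>c. (LINT w|M. sin (c * Y w)) = 0"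
  shows "char (distr M borel Y) = (\<lambda>c. complex_of_real (exp (- (c\<^sup>2 * v / 2))))"
proof
  fix c
  interpret D: prob_space "distr M borel Y" using Y by (rule prob_space_distr)
  have i: "integrable (distr M borel Y) (\<lambda>x. iexp (c * x))" by (rule D.integrable_iexp) auto
  have "Re (char (distr M borel Y) c) = (LINT x|distr M borel Y. cos (c * x))"
    unfolding char_def using integral_bounded_linear[OF bounded_linear_Re i] by (simp add: Re_exp)
  also have "\<dots> = exp (- (c\<^sup>2 * v / 2))" using Y c by (subst integral_distr) auto
  finally have 1: "Re (char (distr M borel Y) c) = exp (- (c\<^sup>2 * v / 2))" .
  have "Im (char (distr M borel Y) c) = (LINT x|distr M borel Y. sin (c * x))"
    unfolding char_def using integral_bounded_linear[OF bounded_linear_Im i] by (simp add: Im_exp)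
  also have "\<dots> = 0" using Y c by (subst integral_distr) auto
  finally show "char (distr M borel Y) c = complex_of_real (exp (- (c\<^sup>2 * v / 2)))"
    using 1 by (simp add: complex_eq_iff)
qed

text \<open>Characteristic functions converge by dominated convergence, and Levy's uniqueness
  theorem identifies the limit law. It carries normality from pairings with bumps to point
  values.\<close>

lemma centred_normal_limit:
  assumes X: "\<And>n::nat. has_law M (X n) (centred_normal (v n))" and v: "v \<longlonglongrightarrow> u" "0 \<le> u"
    and Y: "Y \<in> borel_measurable M" and lim: "AE w in M. (\<lambda>n. X n w) \<longlonglongrightarrow> Y w"
  shows "has_law M Y (centred_normal u)"
proof -
  have Xm: "X n \<in> borel_measurable M" for n using X by (simp add: has_law_def)
  have "(\<lambda>n. LINT w|M. cos (c * X n w)) \<longlonglongrightarrow> (LINT w|M. cos (c * Y w))" for c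
  proof (rule integral_dominated_convergence[where w="\<lambda>_. 1"])
    show "AE w in M. (\<lambda>n. cos (c * X n w)) \<longlonglongrightarrow> cos (c * Y w)"
      using lim by eventually_elim (intro tendsto_intros)
  qed (use Xm Y in auto)
  moreover have "(\<lambda>n. LINT w|M. cos (c * X n w)) \<longlonglongrightarrow> exp (- (c\<^sup>2 * \<bar>u\<bar> / 2))" for c
    unfolding centred_normal_law(4)[OF X] by (intro tendsto_intros v) simp
  ultimately have c: "(LINT w|M. cos (c * Y w)) = exp (- (c\<^sup>2 * u / 2))" for c
    using LIMSEQ_unique v(2) by (metis abs_of_nonneg)
  have "(\<lambda>n. LINT w|M. sin (c * X n w)) \<longlonglongrightarrow> (LINT w|M. sin (c * Y w))" for c
  proof (rule integral_dominated_convergence[where w="\<lambda>_. 1"])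
    show "AE w in M. (\<lambda>n. sin (c * X n w)) \<longlonglongrightarrow> sin (c * Y w)"
      using lim by eventually_elim (intro tendsto_intros)
  qed (use Xm Y in auto)
  then have s: "(LINT w|M. sin (c * Y w)) = 0" for c
    unfolding centred_normal_law(5)[OF X] by (simp add: LIMSEQ_const_iff)
  have cY: "char (distr M borel Y) = (\<lambda>c. complex_of_real (exp (- (c\<^sup>2 * u / 2))))"
    by (rule centred_normal_char[OF Y c s])
  interpret N: prob_space "centred_normal u"
    using v(2) prob_space_normal_density[of "sqrt u" 0] by (auto simp: centred_normal_def intro: prob_space_return)
  have sb: "sets (centred_normal u) = sets borel" by (simp add: centred_normal_def)
  have id: "(\<lambda>x. x) \<in> borel_measurable (centred_normal u)"
    using sb by (intro measurable_ident_sets)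
  have dN: "distr (centred_normal u) borel (\<lambda>x. x) = centred_normal u"
    using sb by (intro distr_id2) auto
  have l: "has_law (centred_normal u) (\<lambda>x. x) (centred_normal u)"
    using id dN by (simp add: has_law_def)
  have "char (distr (centred_normal u) borel (\<lambda>x. x)) = (\<lambda>c. complex_of_real (exp (- (c\<^sup>2 * u / 2))))"
    using N.centred_normal_law(4,5)[OF l] v(2) by (intro N.centred_normal_char[OF id]) auto
  then have "char (distr M borel Y) = char (centred_normal u)" using cY dN by simp
  moreover have "real_distribution (distr M borel Y)"
    using Y by (rule real_distribution_distr)
  moreover have "real_distribution (centred_normal u)"
    unfolding real_distribution_def real_distribution_axioms_def using sb sets_eq_imp_space_eq[OF sb] N.prob_space_axioms by auto
  ultimately have "distr M borel Y = centred_normal u" by (intro Levy_uniqueness)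
  then show ?thesis using Y by (simp add: has_law_def)
qed

end

section \<open>Q-Wiener processes\<close>

lemma lipschitz_continuous:
  fixes f :: "real \<Rightarrow> real"
  assumes "\<And>x y. \<bar>f x - f y\<bar> \<le> l * \<bar>x - y\<bar>"
  shows "continuous_on UNIV f" "f \<in> borel_measurable borel"
proof -
  have "0 \<le> l" using order_trans[OF abs_ge_zero assms[of 1 0]] by simp
  then have "l-lipschitz_on UNIV f" using assms by (intro lipschitz_onI) (auto simp: dist_real_def)
  then show "continuous_on UNIV f" by (rule lipschitz_on_continuous_on)
  then show "f \<in> borel_measurable borel" by (rule borel_measurable_continuous_onI)
qed

lemma wrap_shift: "wrap x = x - 2 * pi * of_int \<lfloor>(x + pi) / (2 * pi)\<rfloor>"
  by (simp add: wrap_def rmod_def)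

lemma wrap_range: "- pi \<le> wrap x" "wrap x < pi"
  using rmod_nonneg[of "2 * pi" "x + pi"] rmod_less[of "2 * pi" "x + pi"] by (auto simp: wrap_def)

lemma wrap_id: "- pi \<le> x \<Longrightarrow> x < pi \<Longrightarrow> wrap x = x"
  by (simp add: wrap_def)

lemma wrap_add: "wrap (x + 2 * pi) = wrap x"
proof -
  have "(x + 2 * pi + pi) / (2 * pi) = (x + pi) / (2 * pi) + 1" by (simp add: field_simps)
  then have "\<lfloor>(x + 2 * pi + pi) / (2 * pi)\<rfloor> = \<lfloor>(x + pi) / (2 * pi)\<rfloor> + 1" by linarith
  then show ?thesis unfolding wrap_shift by (simp add: algebra_simps)
qed

lemma wrap_measurable [measurable]: "wrap \<in> borel_measurable borel"
  unfolding wrap_shift[abs_def] by measurable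

lemma periodic_nat: "periodic f \<Longrightarrow> f (x + 2 * pi * of_nat n) = f x"
proof (induction n)
  case (Suc n)
  have "f (x + 2 * pi * of_nat (Suc n)) = f ((x + 2 * pi * of_nat n) + 2 * pi)" by (simp add: algebra_simps)
  then show ?case using Suc by (simp add: periodic_def)
qed simp

lemma periodic_int:
  assumes f: "periodic f"
  shows "f (x + 2 * pi * of_int k) = f x"
proof (cases "0 \<le> k")
  case True
  then show ?thesis using periodic_nat[OF f, of x "nat k"] by simp
next
  case False
  then show ?thesis using periodic_nat[OF f, of "x + 2 * pi * of_int k" "nat (- k)"] by simp
qed

lemma periodic_wrap: "periodic f \<Longrightarrow> f (wrap x) = f x"
  using periodic_int[of f x "- \<lfloor>(x + pi) / (2 * pi)\<rfloor>"] by (simp add: wrap_shift)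

lemma periodic_diff_wrap: "periodic f \<Longrightarrow> f (y - wrap x) = f (y - x)"
  using periodic_int[of f "y - x" "\<lfloor>(x + pi) / (2 * pi)\<rfloor>"] by (simp add: wrap_shift algebra_simps)

lemma periodic_wrap_diff: "periodic f \<Longrightarrow> f (wrap x - y) = f (x - y)"
  using periodic_int[of f "x - y" "- \<lfloor>(x + pi) / (2 * pi)\<rfloor>"] by (simp add: wrap_shift algebra_simps)

lemma periodic_reflect:
  assumes "periodic f"
  shows "periodic (\<lambda>y. f (x - y))"
proof -
  have "f (x - (y + 2 * pi)) = f (x - y)" for y
    using assms[unfolded periodic_def, rule_format, of "x - (y + 2 * pi)"] by (simp add: algebra_simps)
  then show ?thesis by (simp add: periodic_def)
qed

lemma space_torus [simp]: "space torus = {-pi..<pi}"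
  by (simp add: torus_def space_restrict_space)

lemma finite_measure_torus: "finite_measure torus"
proof
  show "emeasure torus (space torus) \<noteq> \<infinity>"
    by (simp add: torus_def space_restrict_space emeasure_restrict_space)
qed

lemma measure_torus: "measure torus {-pi..<pi} = 2 * pi"
  by (simp add: torus_def measure_restrict_space)

lemma measurable_torus: "f \<in> measurable borel N \<Longrightarrow> f \<in> measurable torus N"
  unfolding torus_def by (rule measurable_restrict_space1) simp

lemma integrable_torus:
  fixes g :: "real \<Rightarrow> real"
  assumes "g \<in> borel_measurable borel" "\<And>x. -pi \<le> x \<Longrightarrow> x < pi \<Longrightarrow> \<bar>g x\<bar> \<le> B"
  shows "integrable torus g"
proof -
  interpret T: finite_measure torus by (rule finite_measure_torus)
  show ?thesis using assms
    by (intro T.integrable_const_bound[where B=B]) (auto intro!: AE_I2 measurable_torus)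
qed

lemma torus_integral: "(LINT x|torus. g x) = (LINT x|lborel. indicator {-pi..<pi} x * g x)" for g :: "real \<Rightarrow> real"
  unfolding torus_def by (subst integral_restrict_space) auto

lemma continuous_periodic_bounded:
  assumes "continuous_on UNIV f" "periodic f"
  obtains B :: real where "0 < B" "\<And>x. \<bar>f x\<bar> \<le> B"
proof -
  have "compact (f ` {-pi..pi})" using continuous_on_subset[OF assms(1)] by (intro compact_continuous_image) auto
  then have "bounded (f ` {-pi..pi})" by (rule compact_imp_bounded)
  then obtain B where B: "\<forall>y\<in>f ` {-pi..pi}. norm y \<le> B" unfolding bounded_iff by blast
  have "\<bar>f x\<bar> \<le> max B 1" for x
  proof -
    have "wrap x \<in> {-pi..pi}" using wrap_range[of x] by auto
    then have "\<bar>f (wrap x)\<bar> \<le> B" using B by auto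
    then show ?thesis unfolding periodic_wrap[OF assms(2)] by linarith
  qed
  then show ?thesis using that[of "max B 1"] by auto
qed

text \<open>\<open>V\<close> is only controlled through \<open>L\<^sup>2\<close> pairings; pairing with a bump recovers its value at a point.\<close>

definition bump :: "real \<Rightarrow> real \<Rightarrow> real \<Rightarrow> real" where
  "bump z \<delta> y = (1 / \<delta>) * indicator {z..<z + \<delta>} (wrap y)"

lemma bump_measurable [measurable]: "bump z \<delta> \<in> borel_measurable borel"
  unfolding bump_def[abs_def] by measurable

lemma bump_periodic: "periodic (bump z \<delta>)"
  by (simp add: periodic_def bump_def wrap_add)

lemma bump_bound: "0 < \<delta> \<Longrightarrow> \<bar>bump z \<delta> y\<bar> \<le> 1 / \<delta>" "0 < \<delta> \<Longrightarrow> 0 \<le> bump z \<delta> y"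
  by (auto simp: bump_def indicator_def)

text \<open>As long as \<open>[z, z + \<delta>)\<close> stays inside the fundamental interval, the
  bump is a probability density on it, so pairing with it averages \<open>g\<close> there.\<close>

lemma bump_average:
  assumes z: "-pi \<le> z" "0 < \<delta>" "z + \<delta> \<le> pi" and g: "g \<in> borel_measurable borel"
    and a: "\<And>y. z \<le> y \<Longrightarrow> y < z + \<delta> \<Longrightarrow> \<bar>g y - a\<bar> \<le> e"
  shows "\<bar>(LINT y|torus. g y * bump z \<delta> y) - a\<bar> \<le> e" "integrable torus (\<lambda>y. g y * bump z \<delta> y)"
proof -
  have e0: "0 \<le> e" using a[of z] z by linarith
  have bz: "bump z \<delta> y = (1 / \<delta>) * indicator {z..<z + \<delta>} y" if "-pi \<le> y" "y < pi" for y
    using that by (simp add: bump_def wrap_id)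
  have pw: "\<bar>(g y - a) * bump z \<delta> y\<bar> \<le> e * bump z \<delta> y" if "-pi \<le> y" "y < pi" for y
    unfolding bz[OF that] using a[of y] z e0 by (auto simp: indicator_def abs_mult divide_right_mono)
  have i1: "integrable torus (\<lambda>y. (g y - a) * bump z \<delta> y)"
  proof (rule integrable_torus)
    show "\<bar>(g y - a) * bump z \<delta> y\<bar> \<le> e * (1 / \<delta>)" if "-pi \<le> y" "y < pi" for y
    proof -
      have "bump z \<delta> y \<le> 1 / \<delta>" using bump_bound(1)[OF z(2), of z y] by linarith
      then show ?thesis using pw[OF that] mult_left_mono[OF _ e0] by (meson order_trans)
    qed
  qed (use g in auto)
  have i2: "integrable torus (bump z \<delta>)"
    using bump_bound(1)[OF z(2)] by (intro integrable_torus[where B="1 / \<delta>"]) auto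
  have I: "(LINT y|torus. bump z \<delta> y) = 1"
  proof -
    have "(LINT y|torus. bump z \<delta> y) = (LINT y|lborel. (1 / \<delta>) * indicator {z..<z + \<delta>} y)"
      unfolding torus_integral
      by (intro Bochner_Integration.integral_cong refl) (use z in \<open>auto simp: indicator_def bump_def wrap_id\<close>)
    also have "\<dots> = 1" using z by simp
    finally show ?thesis .
  qed
  have "integrable torus (\<lambda>y. (g y - a) * bump z \<delta> y + a * bump z \<delta> y)" using i1 i2 by auto
  then show "integrable torus (\<lambda>y. g y * bump z \<delta> y)" by (simp add: algebra_simps)
  have "(LINT y|torus. g y * bump z \<delta> y) = (LINT y|torus. (g y - a) * bump z \<delta> y + a * bump z \<delta> y)"
    by (intro Bochner_Integration.integral_cong) (auto simp: algebra_simps)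
  also have "\<dots> = (LINT y|torus. (g y - a) * bump z \<delta> y) + a" using i1 i2 I by simp
  finally have "\<bar>(LINT y|torus. g y * bump z \<delta> y) - a\<bar> = \<bar>LINT y|torus. (g y - a) * bump z \<delta> y\<bar>" by simp
  also have "\<dots> \<le> (LINT y|torus. \<bar>(g y - a) * bump z \<delta> y\<bar>)" by (rule integral_abs_bound)
  also have "\<dots> \<le> (LINT y|torus. e * bump z \<delta> y)"
    using i1 i2 pw by (intro integral_mono) auto
  also have "\<dots> = e" using I by simp
  finally show "\<bar>(LINT y|torus. g y * bump z \<delta> y) - a\<bar> \<le> e" .
qed

lemma conv_measurable:
  assumes [measurable]: "w \<in> borel_measurable borel" "h \<in> borel_measurable borel"
  shows "conv w h \<in> borel_measurable borel"
proof -
  interpret T: sigma_finite_measure torus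
    using finite_measure_torus by (rule finite_measure.axioms)
  have t: "(\<lambda>y. y) \<in> borel_measurable torus" by (rule measurable_torus) simp
  have "(\<lambda>(x, y). w (x - y) * h y) \<in> borel_measurable (borel \<Otimes>\<^sub>M torus)"
    using t by measurable
  from T.borel_measurable_lebesgue_integral[OF this] show ?thesis
    by (simp add: conv_def[abs_def])
qed

lemma bump_pair:
  assumes z: "-pi \<le> z" "0 < \<delta>" "z + \<delta> \<le> pi" and z': "-pi \<le> z'" "z' + \<delta> \<le> pi"
    and w: "w \<in> borel_measurable borel" "\<And>a b. \<bar>a - b\<bar> \<le> \<delta> \<Longrightarrow> \<bar>w a - w b\<bar> \<le> e"
  shows "\<bar>L2_inner (conv w (bump z \<delta>)) (bump z' \<delta>) - w (z' - z)\<bar> \<le> 2 * e"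
  unfolding L2_inner_def
proof (rule bump_average(1)[OF z'(1) z(2) z'(2)])
  show "conv w (bump z \<delta>) \<in> borel_measurable borel" using w by (intro conv_measurable) auto
  fix y assume y: "z' \<le> y" "y < z' + \<delta>"
  have "\<bar>conv w (bump z \<delta>) y - w (y - z)\<bar> \<le> e"
    unfolding conv_def by (rule bump_average(1)[OF z]) (use w in auto)
  moreover have "\<bar>w (y - z) - w (z' - z)\<bar> \<le> e" using y by (intro w(2)) auto
  ultimately show "\<bar>conv w (bump z \<delta>) y - w (z' - z)\<bar> \<le> 2 * e" by linarith
qed

lemma bump_limit:
  assumes g: "continuous_on UNIV g" and d: "\<delta> \<longlonglongrightarrow> 0" "\<And>n::nat. 0 < \<delta> n"
    and z: "-pi \<le> z" "\<And>n. z + \<delta> n \<le> pi"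
  shows "(\<lambda>n. LINT y|torus. g y * bump z (\<delta> n) y) \<longlonglongrightarrow> g z"
proof (rule LIMSEQ_I)
  fix e :: real assume e: "0 < e"
  obtain r where r: "0 < r" "\<And>y. dist y z < r \<Longrightarrow> dist (g y) (g z) < e / 2"
    using g[unfolded continuous_on_iff, rule_format, of z "e / 2"] e by auto
  obtain N where N: "\<And>n. n \<ge> N \<Longrightarrow> \<delta> n < r"
    using order_tendstoD(2)[OF d(1) r(1)] by (auto simp: eventually_sequentially)
  have "norm ((LINT y|torus. g y * bump z (\<delta> n) y) - g z) < e" if "n \<ge> N" for n
  proof -
    have "\<bar>(LINT y|torus. g y * bump z (\<delta> n) y) - g z\<bar> \<le> e / 2"
    proof (rule bump_average(1)[OF z(1) d(2) z(2)])
      show "g \<in> borel_measurable borel" using g by (rule borel_measurable_continuous_onI)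
      show "\<bar>g y - g z\<bar> \<le> e / 2" if "z \<le> y" "y < z + \<delta> n" for y
        using r(2)[of y] N[OF \<open>n \<ge> N\<close>] that by (auto simp: dist_real_def)
    qed
    then show ?thesis using e by simp
  qed
  then show "\<exists>no. \<forall>n\<ge>no. norm ((LINT y|torus. g y * bump z (\<delta> n) y) - g z) < e" by blast
qed

section \<open>Point evaluations of a Q-Wiener process\<close>

locale kernel =
  fixes w :: "real \<Rightarrow> real" and L :: real
  assumes periodic: "periodic w" and even: "\<And>x. w (- x) = w x" and nonneg: "\<And>x. 0 \<le> w x"
    and lipschitz: "\<And>a b. \<bar>w a - w b\<bar> \<le> L * \<bar>a - b\<bar>"
begin

lemma L_nonneg: "0 \<le> L"
  using order_trans[OF abs_ge_zero lipschitz[of 1 0]] by simp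

lemma continuous: "continuous_on UNIV w" and measurable: "w \<in> borel_measurable borel"
  using lipschitz by (rule lipschitz_continuous)+

lemma bounded: obtains B where "0 < B" "\<And>x. \<bar>w x\<bar> \<le> B"
  using continuous_periodic_bounded[OF continuous periodic] by blast

text \<open>The quadratic form of \<open>Q\<close> at two bumps tends to the variance that
  \<open>V\<close> at \<open>z\<close> plus \<open>V\<close> at \<open>z'\<close> should have. Four
  bump pairs, each off by at most twice the oscillation \<open>L * \<delta>\<close>, give the factor
  8.\<close>

lemma bump_sum_form:
  assumes z: "-pi \<le> z" "z + \<delta> \<le> pi" "-pi \<le> z'" "z' + \<delta> \<le> pi" "0 < \<delta>"
  defines "h \<equiv> \<lambda>y. bump z \<delta> y + bump z' \<delta> y"
  shows "\<bar>L2_inner (conv w h) h - (2 * w 0 + 2 * w (z - z'))\<bar> \<le> 8 * (L * \<delta>)"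
proof -
  obtain B where B: "0 < B" "\<And>x. \<bar>w x\<bar> \<le> B" by (rule bounded) blast
  have lip: "\<bar>w a - w b\<bar> \<le> L * \<delta>" if "\<bar>a - b\<bar> \<le> \<delta>" for a b
    using lipschitz[of a b] mult_left_mono[OF that L_nonneg] by linarith
  have c1: "\<bar>conv w (bump x \<delta>) y - 0\<bar> \<le> B" "integrable torus (\<lambda>u. w (y - u) * bump x \<delta> u)"
    if "x \<in> {z, z'}" for x y
  proof -
    have x: "-pi \<le> x" "x + \<delta> \<le> pi" using that z by auto
    have m: "(\<lambda>u. w (y - u)) \<in> borel_measurable borel" using measurable by measurable
    show "\<bar>conv w (bump x \<delta>) y - 0\<bar> \<le> B" "integrable torus (\<lambda>u. w (y - u) * bump x \<delta> u)"
      unfolding conv_def using bump_average[OF x(1) z(5) x(2) m, of 0 B] B by auto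
  qed
  have c2: "integrable torus (\<lambda>y. conv w (bump x \<delta>) y * bump x' \<delta> y)" if "x \<in> {z, z'}" "x' \<in> {z, z'}" for x x'
    using that z c1(1)[OF that(1)] by (intro bump_average(2)[of x' \<delta> _ 0 B] conv_measurable measurable) auto
  have "conv w h y = conv w (bump z \<delta>) y + conv w (bump z' \<delta>) y" for y
    unfolding conv_def h_def using c1(2)[of z y] c1(2)[of z' y] by (simp add: distrib_left)
  then have "L2_inner (conv w h) h = L2_inner (conv w (bump z \<delta>)) (bump z \<delta>) + L2_inner (conv w (bump z \<delta>)) (bump z' \<delta>)
     + (L2_inner (conv w (bump z' \<delta>)) (bump z \<delta>) + L2_inner (conv w (bump z' \<delta>)) (bump z' \<delta>))"
    unfolding L2_inner_def h_def using c2[of z z] c2[of z z'] c2[of z' z] c2[of z' z'] by (simp add: algebra_simps)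
  moreover note bump_pair[OF z(1,5,2,1,2) measurable lip] bump_pair[OF z(1,5,2,3,4) measurable lip]
    bump_pair[OF z(3,5,4,1,2) measurable lip] bump_pair[OF z(3,5,4,3,4) measurable lip]
  moreover have "w (z' - z) = w (z - z')" using even[of "z - z'"] by simp
  ultimately show ?thesis by simp
qed

end

lemma H1_torusD: "g \<in> H1_torus \<Longrightarrow> continuous_on UNIV g \<and> periodic g"
  by (simp add: H1_torus_def L2_torus_def)

locale filtered_kernel = filtered + kernel +
  fixes V
  assumes Q: "Q_wiener_process M F (conv w) V"
begin

text \<open>The definition of \<open>V\<close> speaks of pairings with L2 functions. Pairings with
  shrinking bumps are normal, converge to point values because elements of \<open>H1_torus\<close>
  are continuous, and have convergent variances. Sums over two points are treated because they
  contain both the variance (\<open>x = y\<close>) and the covariance.\<close>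

lemma Q_wiener_law:
  assumes st: "0 \<le> s" "s < t"
  shows "has_law M (\<lambda>\<omega>. (V t \<omega> x - V s \<omega> x) + (V t \<omega> y - V s \<omega> y))
    (centred_normal ((t - s) * (2 * w 0 + 2 * w (x - y))))"
proof -
  define a b where "a = wrap x" and "b = wrap y"
  have ab: "-pi \<le> a" "a < pi" "-pi \<le> b" "b < pi" using wrap_range by (auto simp: a_def b_def)
  \<comment> \<open>\<open>wrap\<close> takes values strictly below \<open>pi\<close>, so this width
    is positive and both one-sided bumps end before \<open>pi\<close>, where they would wrap
    around.\<close>
  define \<delta> where "\<delta> n = (pi - max a b) / real (Suc n)" for n
  have d: "0 < \<delta> n" "\<delta> n \<le> pi - max a b" for n
    using ab unfolding \<delta>_def by (auto simp: divide_le_eq mult_le_cancel_left1)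
  have d': "a + \<delta> n \<le> pi" "b + \<delta> n \<le> pi" for n
    using d(2)[of n] by (auto simp: max_def split: if_splits)
  have d0: "\<delta> \<longlonglongrightarrow> 0"
    unfolding \<delta>_def using LIMSEQ_Suc[OF lim_const_over_n[of "pi - max a b"]] by simp
  define h where "h n y = bump a (\<delta> n) y + bump b (\<delta> n) y" for n y
  have hL: "h n \<in> L2_torus" for n
  proof -
    have "\<bar>h n u\<bar> \<le> 1 / \<delta> n + 1 / \<delta> n" for u
      unfolding h_def using bump_bound(1)[OF d(1)] by (intro order_trans[OF abs_triangle_ineq] add_mono) auto
    then have "(h n u)\<^sup>2 \<le> (1 / \<delta> n + 1 / \<delta> n)\<^sup>2" for u
      using d(1)[of n] by (intro abs_le_square_iff[THEN iffD1]) (auto simp: abs_of_nonneg)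
    moreover have [measurable]: "h n \<in> borel_measurable borel" unfolding h_def by measurable
    moreover have "periodic (h n)" using bump_periodic by (auto simp: periodic_def h_def)
    ultimately show ?thesis
      unfolding L2_torus_def by (auto intro!: integrable_torus[where B="(1 / \<delta> n + 1 / \<delta> n)\<^sup>2"])
  qed
  let ?v = "\<lambda>n. (t - s) * L2_inner (conv w (h n)) (h n)"
  have "\<forall>n. \<exists>X. (AE \<omega> in M. X \<omega> = L2_inner (\<lambda>x. V t \<omega> x - V s \<omega> x) (h n)) \<and> has_law M X (centred_normal (?v n))"
    using Q st hL unfolding Q_wiener_process_def by blast
  from choice[OF this] obtain X where X: "\<And>n. AE \<omega> in M. X n \<omega> = L2_inner (\<lambda>x. V t \<omega> x - V s \<omega> x) (h n)"
    and law: "\<And>n. has_law M (X n) (centred_normal (?v n))" by blast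
  have wab: "w (a - b) = w (x - y)"
    unfolding a_def b_def using periodic_wrap_diff[OF periodic] periodic_diff_wrap[OF periodic] by simp
  have vlim: "?v \<longlonglongrightarrow> (t - s) * (2 * w 0 + 2 * w (x - y))"
  proof (intro tendsto_mult_left)
    show "(\<lambda>n. L2_inner (conv w (h n)) (h n)) \<longlonglongrightarrow> 2 * w 0 + 2 * w (x - y)"
    proof (rule LIM_zero_cancel, rule Lim_null_comparison)
      show "\<forall>\<^sub>F n in sequentially. norm (L2_inner (conv w (h n)) (h n) - (2 * w 0 + 2 * w (x - y))) \<le> 8 * (L * \<delta> n)"
        unfolding wab[symmetric] h_def[abs_def] real_norm_def
        by (intro always_eventually allI bump_sum_form ab d d')
      show "(\<lambda>n. 8 * (L * \<delta> n)) \<longlonglongrightarrow> 0" using d0 by (auto intro!: tendsto_mult_right_zero)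
    qed
  qed
  have st': "(\<lambda>\<omega>. V t \<omega> z) \<in> borel_measurable M" "(\<lambda>\<omega>. V s \<omega> z) \<in> borel_measurable M" for z
  proof -
    have "adapted F (\<lambda>t \<omega>. V t \<omega> z)" using Q by (simp add: Q_wiener_process_def)
    then show "(\<lambda>\<omega>. V t \<omega> z) \<in> borel_measurable M" "(\<lambda>\<omega>. V s \<omega> z) \<in> borel_measurable M"
      using st measurable_F_M[of "\<lambda>\<omega>. V t \<omega> z" t] measurable_F_M[of "\<lambda>\<omega>. V s \<omega> z" s] unfolding adapted_def by auto
  qed
  have "AE \<omega> in M. \<forall>t\<ge>0. V t \<omega> \<in> H1_torus" using Q unfolding Q_wiener_process_def by (auto elim: eventually_mono)
  moreover have "AE \<omega> in M. \<forall>n. X n \<omega> = L2_inner (\<lambda>x. V t \<omega> x - V s \<omega> x) (h n)"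
    using X by (simp add: AE_all_countable)
  ultimately have lim: "AE \<omega> in M. (\<lambda>n. X n \<omega>) \<longlonglongrightarrow> (V t \<omega> x - V s \<omega> x) + (V t \<omega> y - V s \<omega> y)"
  proof eventually_elim
    case (elim \<omega>)
    let ?g = "\<lambda>x. V t \<omega> x - V s \<omega> x"
    have g: "continuous_on UNIV ?g" "periodic ?g"
      using H1_torusD[of "V t \<omega>"] H1_torusD[of "V s \<omega>"] elim(1) st by (auto simp: periodic_def intro!: continuous_intros)
    then obtain B where B: "0 < B" "\<And>x. \<bar>?g x\<bar> \<le> B" using continuous_periodic_bounded[of ?g] by blast
    have gm: "?g \<in> borel_measurable borel" using g(1) by (rule borel_measurable_continuous_onI)
    have "integrable torus (\<lambda>y. ?g y * bump z (\<delta> n) y)" if "z \<in> {a, b}" for z n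
      using that ab d d' B gm by (intro bump_average(2)[of z "\<delta> n" ?g 0 B]) auto
    then have "X n \<omega> = (LINT y|torus. ?g y * bump a (\<delta> n) y) + (LINT y|torus. ?g y * bump b (\<delta> n) y)" for n
      unfolding elim(2)[rule_format] L2_inner_def h_def by (simp add: distrib_left)
    moreover have "(\<lambda>n. (LINT y|torus. ?g y * bump a (\<delta> n) y) + (LINT y|torus. ?g y * bump b (\<delta> n) y)) \<longlonglongrightarrow> ?g a + ?g b"
      using g d0 d d' ab by (intro tendsto_add bump_limit) auto
    moreover have "?g a = ?g x" "?g b = ?g y" unfolding a_def b_def by (rule periodic_wrap[OF g(2)])+
    ultimately show ?case by simp
  qed
  show ?thesis
    using st nonneg[of 0] nonneg[of "x - y"] st'
    by (intro centred_normal_limit[OF law vlim _ _ lim]) auto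
qed

lemma Q_wiener_indep:
  assumes st: "0 \<le> s" "s < t" and g: "g \<in> borel_measurable (PiM UNIV (\<lambda>_. borel))"
  shows "indep_set (sets (F s)) (sets (vimage_algebra (space M) (\<lambda>\<omega>. g (\<lambda>x. V t \<omega> x - V s \<omega> x)) (borel :: real measure)))"
  using Q st unfolding Q_wiener_process_def
  by (intro indep_set_vimage_compose[OF _ g]) (auto simp: space_PiM)

lemma Q_wiener_incr: "incr (\<lambda>t \<omega>. V t \<omega> x)"
  unfolding incr_def
proof (intro conjI allI impI)
  show "adapted F (\<lambda>t \<omega>. V t \<omega> x)" using Q by (simp add: Q_wiener_process_def)
  fix s t :: real assume st: "0 \<le> s" "s < t"
  note l = centred_normal_law[OF Q_wiener_law[OF st, of x x]]
  show "L2 M (\<lambda>\<omega>. V t \<omega> x - V s \<omega> x)" using L2_cmult[OF l(1), of "1/2"] by (simp add: algebra_simps)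
  have "(LINT \<omega>|M. (V t \<omega> x - V s \<omega> x) + (V t \<omega> x - V s \<omega> x)) = 2 * (LINT \<omega>|M. V t \<omega> x - V s \<omega> x)"
    by (simp only: mult_2[symmetric] integral_mult_right_zero)
  then show "(LINT \<omega>|M. V t \<omega> x - V s \<omega> x) = 0" using l(2) by simp
  show "indep_set (sets (F s)) (sets (vimage_algebra (space M) (\<lambda>\<omega>. V t \<omega> x - V s \<omega> x) borel))"
    by (rule Q_wiener_indep[OF st, of "\<lambda>f. f x"]) (auto intro: measurable_component_singleton)
qed

text \<open>Polarisation: the variance of the sum at \<open>x\<close> and \<open>y\<close>, less the
  two variances, is twice the covariance, and so identifies the covariance kernel of
  \<open>V\<close> as \<open>w (x - y)\<close>.\<close>

lemma Q_wiener_cov_rate: "cov_rate (\<lambda>t \<omega>. V t \<omega> x) (\<lambda>t \<omega>. V t \<omega> y) (w (x - y))"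
proof (rule cov_rate_if_indep[OF Q_wiener_incr Q_wiener_incr])
  fix s t :: real assume st: "0 \<le> s" "s < t"
  have "(\<lambda>f. f z) \<in> borel_measurable (PiM UNIV (\<lambda>_. borel :: real measure))" for z :: real
    by (rule measurable_component_singleton) simp
  then show "indep_set (sets (F s)) (sets (vimage_algebra (space M) (\<lambda>\<omega>. (V t \<omega> x - V s \<omega> x) * (V t \<omega> y - V s \<omega> y)) borel))"
    by (intro Q_wiener_indep[OF st, of "\<lambda>f. f x * f y"] borel_measurable_times)
  let ?X = "\<lambda>\<omega>. V t \<omega> x - V s \<omega> x" and ?Y = "\<lambda>\<omega>. V t \<omega> y - V s \<omega> y"
  have L: "L2 M ?X" "L2 M ?Y" using Q_wiener_incr st by (auto simp: incr_def)
  have sq: "(LINT \<omega>|M. (V t \<omega> z - V s \<omega> z) * (V t \<omega> z - V s \<omega> z)) = (t - s) * w 0" for z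
  proof -
    let ?Z = "\<lambda>\<omega>. V t \<omega> z - V s \<omega> z"
    have "4 * (LINT \<omega>|M. ?Z \<omega> * ?Z \<omega>) = (LINT \<omega>|M. 4 * (?Z \<omega> * ?Z \<omega>))" by simp
    also have "\<dots> = (LINT \<omega>|M. (?Z \<omega> + ?Z \<omega>)\<^sup>2)"
      by (intro Bochner_Integration.integral_cong refl) (simp add: power2_eq_square algebra_simps)
    also have "\<dots> = 4 * ((t - s) * w 0)"
      using centred_normal_law(3)[OF Q_wiener_law[OF st, of z z]] st nonneg[of 0] by (simp add: abs_of_nonneg)
    finally show ?thesis by simp
  qed
  have "(LINT \<omega>|M. (?X \<omega> + ?Y \<omega>)\<^sup>2) = (LINT \<omega>|M. ?X \<omega> * ?X \<omega> + 2 * (?X \<omega> * ?Y \<omega>) + ?Y \<omega> * ?Y \<omega>)"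
    by (intro Bochner_Integration.integral_cong) (auto simp: power2_eq_square algebra_simps)
  also have "\<dots> = (LINT \<omega>|M. ?X \<omega> * ?X \<omega>) + 2 * (LINT \<omega>|M. ?X \<omega> * ?Y \<omega>) + (LINT \<omega>|M. ?Y \<omega> * ?Y \<omega>)"
    using L2_mult[OF L(1) L(1)] L2_mult[OF L] L2_mult[OF L(2) L(2)] by simp
  finally have "(LINT \<omega>|M. (?X \<omega> + ?Y \<omega>)\<^sup>2) = 2 * ((t - s) * w 0) + 2 * (LINT \<omega>|M. ?X \<omega> * ?Y \<omega>)"
    unfolding sq by simp
  moreover have "(LINT \<omega>|M. (?X \<omega> + ?Y \<omega>)\<^sup>2) = (t - s) * (2 * w 0 + 2 * w (x - y))"
    using centred_normal_law(3)[OF Q_wiener_law[OF st, of x y]] st nonneg[of 0] nonneg[of "x - y"] by (simp add: abs_of_nonneg)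
  ultimately show "(LINT \<omega>|M. ?X \<omega> * ?Y \<omega>) = w (x - y) * (t - s)" by (simp add: algebra_simps)
qed

end

section \<open>The von Mises kernel\<close>

lemma vm_unnorm_cos: "vm_unnorm \<epsilon> x = exp (- (1 / \<epsilon>\<^sup>2)) * exp (cos x / \<epsilon>\<^sup>2)"
proof -
  have "cos x = 1 - 2 * (sin (x / 2))\<^sup>2" using cos_double_sin[of "x / 2"] by simp
  then show ?thesis by (simp add: vm_unnorm_def exp_add[symmetric] diff_divide_distrib)
qed

lemma vm_unnorm_pos: "0 < vm_unnorm \<epsilon> x" and vm_unnorm_le_1: "vm_unnorm \<epsilon> x \<le> 1"
  by (auto simp: vm_unnorm_def)

lemma vm_unnorm_measurable [measurable]: "vm_unnorm \<epsilon> \<in> borel_measurable borel"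
  unfolding vm_unnorm_def[abs_def] by measurable

lemma vm_unnorm_integrable: "integrable torus (vm_unnorm \<epsilon>)"
  using vm_unnorm_pos vm_unnorm_le_1 by (intro integrable_torus[where B=1]) (auto simp: abs_of_pos)

definition vm_Z :: "real \<Rightarrow> real" where
  "vm_Z \<epsilon> = (LINT y|torus. vm_unnorm \<epsilon> y)"

lemma vm_alt: "vm \<epsilon> x = vm_unnorm \<epsilon> x / vm_Z \<epsilon>"
  by (simp add: vm_def vm_Z_def)

text \<open>On an interval of length \<open>2 * \<epsilon>\<close> around 0 the exponent is at least
  \<open>-1/2\<close>, and \<open>exp (-1/2) > 1/2\<close>. The bound
  \<open>\<epsilon> \<le> 2\<close> keeps the interval inside the torus and covers the width
  \<open>sqrt 2 * \<epsilon>\<close>.\<close>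

lemma vm_Z_ge:
  assumes "0 < \<epsilon>" "\<epsilon> \<le> 2"
  shows "\<epsilon> \<le> vm_Z \<epsilon>"
proof -
  have e: "\<epsilon> < pi" using assms pi_gt3 by linarith
  have "exp (1 :: real) < 4" using e_less_272 by simp
  then have "exp (1/2 :: real) < 2"
    using exp_double[of "1/2::real"] by (intro power2_less_imp_less[of _ 2]) (auto simp: power2_eq_square exp_add[symmetric])
  then have h: "1 / 2 < exp (- (1/2) :: real)" by (simp add: exp_minus field_simps)
  have pw: "(1/2) * indicator {-\<epsilon>..<\<epsilon>} y \<le> indicator {-pi..<pi} y * vm_unnorm \<epsilon> y" for y
  proof (cases "y \<in> {-\<epsilon>..<\<epsilon>}")
    case True
    then have y: "\<bar>y\<bar> \<le> \<epsilon>" by auto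
    have "\<bar>sin (y / 2)\<bar> \<le> \<epsilon> / 2" using abs_sin_x_le_abs_x[of "y / 2"] y by simp
    then have "(sin (y / 2))\<^sup>2 \<le> (\<epsilon> / 2)\<^sup>2" using assms by (intro abs_le_square_iff[THEN iffD1]) auto
    then have "(sin (y / 2))\<^sup>2 / (\<epsilon>\<^sup>2 / 2) \<le> 1 / 2" using assms by (simp add: field_simps power2_eq_square)
    then have "exp (- (1/2)) \<le> vm_unnorm \<epsilon> y" unfolding vm_unnorm_def by simp
    then show ?thesis using True h e by (auto simp: indicator_def)
  next
    case False
    then show ?thesis using vm_unnorm_pos[of \<epsilon> y] by (auto simp: indicator_def)
  qed
  have i: "integrable lborel (\<lambda>y. indicator {-pi..<pi} y * vm_unnorm \<epsilon> y)"
    using vm_unnorm_integrable[of \<epsilon>] unfolding torus_def by (subst (asm) integrable_restrict_space) auto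
  have "\<epsilon> = (LINT y|lborel. (1/2) * indicator {-\<epsilon>..<\<epsilon>} y)" using assms by simp
  also have "\<dots> \<le> vm_Z \<epsilon>"
    unfolding vm_Z_def torus_integral
  proof (rule integral_mono[OF _ i pw])
    have "emeasure lborel {-\<epsilon>..<\<epsilon>} < \<infinity>" using assms by simp
    then show "integrable lborel (\<lambda>y. (1/2) * indicator {-\<epsilon>..<\<epsilon>} y :: real)" by (intro integrable_mult_right integrable_real_indicator) auto
  qed
  finally show ?thesis .
qed

lemma vm_integral: "0 < \<epsilon> \<Longrightarrow> \<epsilon> \<le> 2 \<Longrightarrow> (LINT y|torus. vm \<epsilon> y) = 1"
  using vm_Z_ge[of \<epsilon>] unfolding vm_alt by (simp flip: vm_Z_def)

lemma vm_bounds: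
  assumes "0 < \<epsilon>" "\<epsilon> \<le> 2"
  shows "0 < vm \<epsilon> x" "vm \<epsilon> x \<le> 1 / \<epsilon>"
proof -
  have Z: "0 < vm_Z \<epsilon>" "\<epsilon> \<le> vm_Z \<epsilon>" using vm_Z_ge[OF assms] assms by auto
  show "0 < vm \<epsilon> x" unfolding vm_alt using Z vm_unnorm_pos by simp
  show "vm \<epsilon> x \<le> 1 / \<epsilon>" unfolding vm_alt using Z assms vm_unnorm_le_1[of \<epsilon> x] vm_unnorm_pos[of \<epsilon> x]
    by (intro frac_le) auto
qed

lemma vm_periodic: "periodic (vm \<epsilon>)"
proof -
  have "cos (x + 2 * pi) = cos x" for x :: real by (rule cos_periodic)
  then show ?thesis by (simp add: periodic_def vm_alt vm_unnorm_cos)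
qed

lemma vm_even: "vm \<epsilon> (- x) = vm \<epsilon> x"
  by (simp add: vm_alt vm_unnorm_cos)

lemma vm_measurable [measurable]: "vm \<epsilon> \<in> borel_measurable borel"
  unfolding vm_alt[abs_def] by measurable

text \<open>The derivative of the unnormalised kernel costs \<open>\<epsilon>^-2\<close> and the
  normaliser one more power. This crude cubic rate is the source of the threshold for
  \<open>\<theta>\<close>.\<close>

lemma vm_lipschitz:
  assumes "0 < \<epsilon>" "\<epsilon> \<le> 2"
  shows "\<bar>vm \<epsilon> a - vm \<epsilon> b\<bar> \<le> 2 / \<epsilon>^3 * \<bar>a - b\<bar>"
proof -
  have Z: "0 < vm_Z \<epsilon>" "\<epsilon> \<le> vm_Z \<epsilon>" using vm_Z_ge[OF assms] assms by auto
  have "norm (vm_unnorm \<epsilon> a - vm_unnorm \<epsilon> b) \<le> (2 / \<epsilon>\<^sup>2) * norm (a - b)"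
  proof (rule field_differentiable_bound[of UNIV _ "\<lambda>x. vm_unnorm \<epsilon> x * (- sin x / \<epsilon>\<^sup>2)"])
    have "((\<lambda>x. exp (- c) * exp (c * cos x)) has_field_derivative exp (- c) * exp (c * cos x) * (- sin x * c)) (at x)" for c x :: real
      by (auto intro!: derivative_eq_intros)
    from this[of "1 / \<epsilon>\<^sup>2"]
    show "(vm_unnorm \<epsilon> has_field_derivative vm_unnorm \<epsilon> x * (- sin x / \<epsilon>\<^sup>2)) (at x within UNIV)" for x
      by (simp add: vm_unnorm_cos[abs_def])
    show "norm (vm_unnorm \<epsilon> x * (- sin x / \<epsilon>\<^sup>2)) \<le> 2 / \<epsilon>\<^sup>2" for x
    proof -
      have "\<bar>vm_unnorm \<epsilon> x\<bar> * \<bar>- sin x / \<epsilon>\<^sup>2\<bar> \<le> 1 * (1 / \<epsilon>\<^sup>2)"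
        using vm_unnorm_pos[of \<epsilon> x] vm_unnorm_le_1[of \<epsilon> x] abs_sin_le_one[of x]
        by (intro mult_mono) (auto simp: divide_right_mono)
      also have "\<dots> \<le> 2 / \<epsilon>\<^sup>2" by (simp add: divide_right_mono)
      finally show ?thesis by (simp add: abs_mult)
    qed
  qed auto
  then have "\<bar>vm_unnorm \<epsilon> a - vm_unnorm \<epsilon> b\<bar> / vm_Z \<epsilon> \<le> (2 / \<epsilon>\<^sup>2 * \<bar>a - b\<bar>) / \<epsilon>"
    using Z assms by (intro frac_le) auto
  then show ?thesis unfolding vm_alt using Z assms
    by (simp add: diff_divide_distrib[symmetric] power3_eq_cube power2_eq_square)
qed

text \<open>Truncating the exponential series in \<open>exp (cos x / \<epsilon>\<^sup>2)\<close> approximates \<open>vm \<epsilon>\<close> by cosine polynomials, which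
  replaces its Fourier series.\<close>

definition cospoly :: "nat \<Rightarrow> (real \<Rightarrow> real) \<Rightarrow> bool" where
  "cospoly n f \<longleftrightarrow> (\<exists>a. \<forall>x. f x = (\<Sum>k\<le>n. a k * cos (real k * x)))"

lemma cospoly_add: "cospoly n f \<Longrightarrow> cospoly n g \<Longrightarrow> cospoly n (\<lambda>x. f x + g x)"
  unfolding cospoly_def
proof (elim exE)
  fix a b assume "\<forall>x. f x = (\<Sum>k\<le>n. a k * cos (real k * x))" "\<forall>x. g x = (\<Sum>k\<le>n. b k * cos (real k * x))"
  then show "\<exists>c. \<forall>x. f x + g x = (\<Sum>k\<le>n. c k * cos (real k * x))"
    by (intro exI[of _ "\<lambda>k. a k + b k"]) (simp add: distrib_right sum.distrib)
qed

lemma cospoly_cmult: "cospoly n f \<Longrightarrow> cospoly n (\<lambda>x. c * f x)"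
  unfolding cospoly_def
proof (elim exE)
  fix a assume "\<forall>x. f x = (\<Sum>k\<le>n. a k * cos (real k * x))"
  then show "\<exists>b. \<forall>x. c * f x = (\<Sum>k\<le>n. b k * cos (real k * x))"
    by (intro exI[of _ "\<lambda>k. c * a k"]) (simp add: sum_distrib_left mult.assoc)
qed

lemma cospoly_cos: "k \<le> n \<Longrightarrow> cospoly n (\<lambda>x. cos (real k * x))"
  unfolding cospoly_def
  by (intro exI[of _ "\<lambda>j. of_bool (j = k)"]) (simp add: of_bool_def if_distrib[of "\<lambda>z. z * _"] cong: if_cong)

lemma cospoly_sum: "(\<And>i. i \<in> I \<Longrightarrow> cospoly n (f i)) \<Longrightarrow> cospoly n (\<lambda>x. \<Sum>i\<in>I. f i x)"
proof (induction I rule: infinite_finite_induct)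
  case (insert i I)
  then show ?case using cospoly_add[of n "f i" "\<lambda>x. \<Sum>i\<in>I. f i x"] by simp
qed (auto simp: cospoly_def intro!: exI[of _ "\<lambda>_. 0"])

lemma cospoly_cos_mult:
  assumes "cospoly n f"
  shows "cospoly (Suc n) (\<lambda>x. cos x * f x)"
proof -
  obtain a where a: "\<forall>x. f x = (\<Sum>k\<le>n. a k * cos (real k * x))" using assms by (auto simp: cospoly_def)
  \<comment> \<open>Product-to-sum formula. At \<open>k = 0\<close> the second frequency is
    \<open>-1\<close>, equivalently 1; natural subtraction would give 0 instead.\<close>
  have "cospoly (Suc n) (\<lambda>x. \<Sum>k\<le>n. (a k / 2) * (cos (real (Suc k) * x) + cos (real (if k = 0 then 1 else k - 1) * x)))"
    by (intro cospoly_sum cospoly_cmult cospoly_add cospoly_cos) auto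
  moreover have "(\<Sum>k\<le>n. (a k / 2) * (cos (real (Suc k) * x) + cos (real (if k = 0 then 1 else k - 1) * x))) = cos x * f x" for x
    unfolding a[rule_format] sum_distrib_left
  proof (intro sum.cong refl)
    fix k
    have "cos (real (Suc k) * x) + cos (real (if k = 0 then 1 else k - 1) * x) = 2 * cos x * cos (real k * x)"
    proof (cases "k = 0")
      case False
      then have "cos (real (k - 1) * x) = cos (real k * x - x)" by (simp add: of_nat_diff algebra_simps)
      moreover have "cos (real (Suc k) * x) = cos (real k * x + x)" by (simp add: algebra_simps)
      ultimately show ?thesis using False by (simp add: cos_add cos_diff)
    qed simp
    then show "(a k / 2) * (cos (real (Suc k) * x) + cos (real (if k = 0 then 1 else k - 1) * x)) = cos x * (a k * cos (real k * x))" by simp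
  qed
  ultimately show ?thesis by simp
qed

lemma cospoly_cos_power: "j \<le> n \<Longrightarrow> cospoly n (\<lambda>x. cos x ^ j)"
proof (induction n arbitrary: j)
  case 0
  then show ?case using cospoly_cos[of 0 0] by simp
next
  case (Suc n)
  show ?case
  proof (cases j)
    case 0 then show ?thesis using cospoly_cos[of 0 "Suc n"] by simp
  next
    case (Suc i)
    then show ?thesis using cospoly_cos_mult[OF Suc.IH[of i]] Suc.prems by simp
  qed
qed

lemma torus_integral_Icc:
  fixes g :: "real \<Rightarrow> real"
  assumes "g \<in> borel_measurable borel"
  shows "(LINT x|torus. g x) = (LINT x|lborel. g x * indicator {-pi..pi} x)"
  unfolding torus_integral
proof (rule integral_cong_AE)
  show "AE x in lborel. indicator {-pi..<pi} x * g x = g x * indicator {-pi..pi} x"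
    using AE_lborel_singleton[of pi] by eventually_elim (auto simp: indicator_def)
qed (use assms in auto)

lemma torus_integral_cos:
  fixes m :: int
  assumes "m \<noteq> 0"
  shows "(LINT x|torus. cos (of_int m * x)) = 0"
proof -
  have "(LINT x|torus. cos (of_int m * x)) = (LINT x|lborel. cos (of_int m * x) * indicator {-pi..pi} x)"
    by (rule torus_integral_Icc) measurable
  also have "\<dots> = sin (of_int m * pi) / of_int m - sin (of_int m * (- pi)) / of_int m"
    using assms by (intro integral_FTC_Icc_real) (auto intro!: derivative_eq_intros continuous_intros)
  also have "\<dots> = 0" using sin_zero_iff_int2[of "of_int m * pi"] by auto
  finally show ?thesis .
qed

lemma cos_orthogonal:
  assumes "1 \<le> k"
  shows "(LINT x|torus. cos (real j * x) * cos (real k * x)) = (if j = k then pi else 0)"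
proof -
  have i: "integrable torus (\<lambda>x. cos (of_int m * x))" for m :: int
    by (rule integrable_torus[where B=1]) auto
  have e: "cos (real j * x) * cos (real k * x) = (cos (of_int (int j - int k) * x) + cos (of_int (int j + int k) * x)) / 2" for x
    by (simp add: cos_times_cos algebra_simps)
  have "(LINT x|torus. cos (real j * x) * cos (real k * x)) =
     ((LINT x|torus. cos (of_int (int j - int k) * x)) + (LINT x|torus. cos (of_int (int j + int k) * x))) / 2"
    unfolding e using i[of "int j - int k"] i[of "int j + int k"] by simp
  also have "(LINT x|torus. cos (of_int (int j + int k) * x)) = 0" using assms by (intro torus_integral_cos) auto
  also have "(LINT x|torus. cos (of_int (int j - int k) * x)) = (if j = k then 2 * pi else 0)"
    using torus_integral_cos[of "int j - int k"] measure_torus by auto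
  finally show ?thesis by (auto split: if_splits)
qed

text \<open>Testing against a cosine bounds the coefficient by the L1 norm of \<open>T\<close> over
  \<open>pi\<close>, and \<open>T\<close> is close to a probability density. The bound does not
  depend on how concentrated \<open>w\<close> is; this makes the Hoelder estimate uniform in
  \<open>\<epsilon>\<close>.\<close>

lemma cospoly_coeff_bound:
  assumes T: "\<And>x. T x = (\<Sum>j\<le>n. a j * cos (real j * x))" and k: "1 \<le> k" "k \<le> n"
    and w: "w \<in> borel_measurable borel" "\<And>x. 0 \<le> w x" "integrable torus w" "(LINT x|torus. w x) = 1"
    and r: "\<And>x. \<bar>T x - w x\<bar> \<le> r"
  shows "\<bar>a k\<bar> \<le> (1 + 2 * pi * r) / pi"
proof -
  have i: "integrable torus (\<lambda>x. cos (real j * x) * cos (real k * x))" for j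
    by (rule integrable_torus[where B=1]) (auto simp: abs_mult mult_le_one)
  have "(LINT x|torus. T x * cos (real k * x)) = (LINT x|torus. (\<Sum>j\<le>n. a j * (cos (real j * x) * cos (real k * x))))"
    unfolding T by (simp add: sum_distrib_right mult.assoc)
  also have "\<dots> = (\<Sum>j\<le>n. a j * (LINT x|torus. cos (real j * x) * cos (real k * x)))"
    using i by simp
  also have "\<dots> = a k * pi"
    unfolding cos_orthogonal[OF k(1)] using k by (simp add: if_distrib[of "\<lambda>z. _ * z"] cong: if_cong)
  finally have e: "a k * pi = (LINT x|torus. T x * cos (real k * x))" by simp
  have Tm: "T \<in> borel_measurable borel" unfolding T[abs_def] by measurable
  interpret t: finite_measure torus by (rule finite_measure_torus)
  have pw: "\<bar>T x * cos (real k * x)\<bar> \<le> w x + r" for x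
  proof -
    have "\<bar>T x * cos (real k * x)\<bar> \<le> \<bar>T x\<bar> * 1" unfolding abs_mult by (intro mult_left_mono) auto
    also have "\<dots> \<le> w x + r" using r[of x] w(2)[of x] by linarith
    finally show ?thesis .
  qed
  have "\<bar>a k\<bar> * pi = \<bar>LINT x|torus. T x * cos (real k * x)\<bar>" unfolding e[symmetric] by (simp add: abs_mult)
  also have "\<dots> \<le> (LINT x|torus. w x + r)"
  proof (rule integral_abs_bound_integral)
    show "integrable torus (\<lambda>x. T x * cos (real k * x))"
    proof (rule Bochner_Integration.integrable_bound)
      show "integrable torus (\<lambda>x. w x + r)" using w by auto
      show "(\<lambda>x. T x * cos (real k * x)) \<in> borel_measurable torus" using Tm by (intro measurable_torus) auto
      show "AE x in torus. norm (T x * cos (real k * x)) \<le> norm (w x + r)"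
        unfolding real_norm_def by (intro AE_I2 order_trans[OF pw abs_ge_self])
    qed
  qed (use w pw in auto)
  also have "\<dots> = 1 + 2 * pi * r" using w measure_torus by simp
  finally show ?thesis by (simp add: pos_le_divide_eq)
qed

text \<open>Interpolates between \<open>\<bar>sin y\<bar> \<le> 1\<close> and
  \<open>\<bar>sin y\<bar> \<le> \<bar>y\<bar>\<close>. The exponent \<open>1/20\<close> is half of
  what the decay \<open>k powr (-11/10)\<close> has to spare, so
  \<open>k powr (1/20 - 11/10) = k powr (-21/20)\<close> is still summable.\<close>

lemma abs_sin_le_powr: "\<bar>sin y\<bar> \<le> \<bar>y\<bar> powr (1/20)" for y :: real
proof (cases "\<bar>y\<bar> \<le> 1")
  case True
  show ?thesis
  proof (cases "y = 0")
    case False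
    have "\<bar>sin y\<bar> \<le> \<bar>y\<bar> powr 1" using abs_sin_x_le_abs_x[of y] False by simp
    also have "\<dots> \<le> \<bar>y\<bar> powr (1/20)" using True False by (intro powr_mono') auto
    finally show ?thesis .
  qed simp
next
  case False
  then have "1 \<le> \<bar>y\<bar> powr (1/20)" by (intro ge_one_powr_ge_zero) auto
  then show ?thesis using abs_sin_le_one[of y] by linarith
qed

definition exp_tail :: "real \<Rightarrow> nat \<Rightarrow> real" where
  "exp_tail K n = exp K - (\<Sum>j<n. K ^ j / fact j)"

lemma exp_tail_tendsto: "exp_tail K \<longlonglongrightarrow> 0"
proof -
  have "(\<lambda>n. \<Sum>j<n. K ^ j / fact j) \<longlonglongrightarrow> exp K"
    using exp_converges[of K] by (simp add: sums_def scaleR_conv_of_real divide_inverse mult.commute)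
  then have "(\<lambda>n. exp K - (\<Sum>j<n. K ^ j / fact j)) \<longlonglongrightarrow> exp K - exp K" by (intro tendsto_intros)
  then show ?thesis by (simp add: exp_tail_def[abs_def])
qed

lemma exp_partial_sum:
  fixes y K :: real
  assumes "\<bar>y\<bar> \<le> K"
  shows "\<bar>(\<Sum>j<n. y ^ j / fact j) - exp y\<bar> \<le> exp_tail K n"
proof -
  have s: "(\<lambda>j. z ^ j / fact j) sums exp z" for z :: real
    using exp_converges[of z] by (simp add: scaleR_conv_of_real divide_inverse mult.commute)
  have sm: "summable (\<lambda>j. z ^ (j + n) / fact (j + n))" for z :: real
    using s by (intro summable_ignore_initial_segment sums_summable)
  have e: "exp z - (\<Sum>j<n. z ^ j / fact j) = (\<Sum>j. z ^ (j + n) / fact (j + n))" for z :: real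
    using suminf_minus_initial_segment[OF sums_summable[OF s[of z]], of n] sums_unique[OF s[of z]] by simp
  have b: "\<bar>y ^ j / fact j\<bar> \<le> K ^ j / fact j" for j
    using assms by (simp add: abs_divide power_abs divide_right_mono power_mono)
  have sa: "summable (\<lambda>j. \<bar>y ^ (j + n) / fact (j + n)\<bar>)"
    using b by (intro summable_comparison_test'[OF sm[of K], of 0]) auto
  have "\<bar>exp y - (\<Sum>j<n. y ^ j / fact j)\<bar> \<le> (\<Sum>j. \<bar>y ^ (j + n) / fact (j + n)\<bar>)"
    unfolding e by (rule summable_rabs[OF sa])
  also have "\<dots> \<le> (\<Sum>j. K ^ (j + n) / fact (j + n))"
    using b sa sm by (intro suminf_le)
  finally show ?thesis unfolding exp_tail_def e[of K] by (subst abs_minus_commute)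
qed

definition holder_const :: real where
  "holder_const = (\<Sum>k. real k powr (- (21/20)))"

lemma holder_const_ge: "(\<Sum>k\<in>{1..n}. real k powr (- (21/20))) \<le> holder_const"
proof -
  have "summable (\<lambda>k. real k powr (- (21/20)))" by (subst summable_real_powr_iff) auto
  then show ?thesis unfolding holder_const_def by (intro sum_le_suminf) auto
qed

lemma holder_const_nonneg: "0 \<le> holder_const"
  using holder_const_ge[of 0] by simp

text \<open>For each cosine the difference between \<open>x\<close> and \<open>y\<close> is a small
  sine factor times a Fourier coefficient of the law of \<open>q\<close>. The kernel coefficients
  are bounded, so summability comes entirely from the decay of the law.\<close>

lemma (in prob_space) vm_holder:
  assumes q: "q \<in> borel_measurable M" and C: "0 \<le> C"
    and decay: "\<And>k \<phi>. 1 \<le> k \<Longrightarrow> \<bar>LINT w|M. cos (real k * q w + \<phi>)\<bar> \<le> C * real k powr (- (11/10))"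
    and e: "0 < \<epsilon>" "\<epsilon> \<le> 2"
  shows "\<bar>(LINT w|M. vm \<epsilon> (x - q w)) - (LINT w|M. vm \<epsilon> (y - q w))\<bar> \<le> C * holder_const * \<bar>x - y\<bar> powr (1/20)"
proof -
  define K where "K = 1 / \<epsilon>\<^sup>2"
  have K: "0 \<le> K" by (simp add: K_def)
  define A where "A = exp (- K) / vm_Z \<epsilon>"
  have Z: "0 < vm_Z \<epsilon>" using vm_Z_ge[OF e] e by linarith
  have A: "0 < A" using Z by (simp add: A_def)
  define T where "T n z = A * (\<Sum>j<n. (K * cos z) ^ j / fact j)" for n z
  have vA: "vm \<epsilon> z = A * exp (K * cos z)" for z
    by (simp add: vm_alt vm_unnorm_cos A_def K_def)
  have Tm[measurable]: "T n \<in> borel_measurable borel" for n unfolding T_def by measurable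
  have Tv: "\<bar>T n z - vm \<epsilon> z\<bar> \<le> A * exp_tail K n" for n z
  proof -
    have "\<bar>K * cos z\<bar> \<le> K" using K abs_cos_le_one[of z] by (simp add: abs_mult mult_left_le)
    from exp_partial_sum[OF this, of n] have "A * \<bar>(\<Sum>j<n. (K * cos z) ^ j / fact j) - exp (K * cos z)\<bar> \<le> A * exp_tail K n"
      using A by (intro mult_left_mono) auto
    moreover have "\<bar>T n z - vm \<epsilon> z\<bar> = A * \<bar>(\<Sum>j<n. (K * cos z) ^ j / fact j) - exp (K * cos z)\<bar>"
      unfolding T_def vA right_diff_distrib[symmetric] using A by (simp add: abs_mult)
    ultimately show ?thesis by simp
  qed
  have cp: "cospoly n (T n)" for n
  proof -
    have "cospoly n (\<lambda>z. \<Sum>j<n. (A * K ^ j / fact j) * cos z ^ j)"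
      by (intro cospoly_sum cospoly_cmult cospoly_cos_power) auto
    moreover have "T n = (\<lambda>z. \<Sum>j<n. (A * K ^ j / fact j) * cos z ^ j)"
      by (simp add: fun_eq_iff T_def sum_distrib_left power_mult_distrib mult.assoc)
    ultimately show ?thesis by simp
  qed
  have tail0: "0 \<le> exp_tail K n" for n using order_trans[OF abs_ge_zero Tv[of n 0]] A by (simp add: zero_le_mult_iff)
  have vi: "integrable torus (vm \<epsilon>)" using vm_bounds[OF e] by (intro integrable_torus[where B="1/\<epsilon>"]) (auto simp: abs_of_pos)
  have cosi: "integrable M (\<lambda>w. cos (c * (z - q w)))" "integrable M (\<lambda>w. sin (c * (z - q w)))" for c z
    using q by (auto intro!: integrable_const_bound[where B=1])
  have diffT: "\<bar>(LINT w|M. T n (x - q w)) - (LINT w|M. T n (y - q w))\<bar>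
     \<le> (1 + 2 * pi * (A * exp_tail K n)) / pi * (2 * C * holder_const * \<bar>x - y\<bar> powr (1/20))" for n
  proof -
    obtain a where a: "\<And>z. T n z = (\<Sum>k\<le>n. a k * cos (real k * z))" using cp[of n] by (auto simp: cospoly_def)
    let ?b = "(1 + 2 * pi * (A * exp_tail K n)) / pi"
    have ab: "\<bar>a k\<bar> \<le> ?b" if "1 \<le> k" "k \<le> n" for k
      using cospoly_coeff_bound[OF a that vm_measurable less_imp_le[OF vm_bounds(1)[OF e]] vi vm_integral[OF e] Tv] .
    let ?D = "\<lambda>k. (LINT w|M. cos (real k * (x - q w))) - (LINT w|M. cos (real k * (y - q w)))"
    have D: "\<bar>?D k\<bar> \<le> 2 * C * real k powr (- (21/20)) * \<bar>x - y\<bar> powr (1/20)" if k: "1 \<le> k" for k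
    proof -
      let ?m = "(x + y) / 2" and ?s = "sin (real k * (y - x) / 2)"
      have "?D k = (LINT w|M. cos (real k * (x - q w)) - cos (real k * (y - q w)))"
        using cosi by simp
      \<comment> \<open>After the sum-to-product formula the phase is deterministic; this is why the
        decay is required for every shift \<open>\<phi>\<close>.\<close>
      also have "\<dots> = (LINT w|M. 2 * ?s * cos (real k * q w + (pi / 2 - real k * ?m)))"
      proof (intro Bochner_Integration.integral_cong refl)
        fix w
        have "cos (real k * q w + (pi / 2 - real k * ?m)) = sin (real k * ?m - real k * q w)"
          by (simp add: cos_sin_eq algebra_simps)
        moreover have "cos (real k * (x - q w)) - cos (real k * (y - q w)) =
          2 * sin ((real k * (x - q w) + real k * (y - q w)) / 2) * sin ((real k * (y - q w) - real k * (x - q w)) / 2)"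
          by (rule cos_diff_cos)
        moreover have "(real k * (x - q w) + real k * (y - q w)) / 2 = real k * ?m - real k * q w"
          "(real k * (y - q w) - real k * (x - q w)) / 2 = real k * (y - x) / 2" by (simp_all add: field_simps)
        ultimately show "cos (real k * (x - q w)) - cos (real k * (y - q w)) = 2 * ?s * cos (real k * q w + (pi / 2 - real k * ?m))"
          by simp
      qed
      finally have "\<bar>?D k\<bar> = 2 * \<bar>?s\<bar> * \<bar>LINT w|M. cos (real k * q w + (pi / 2 - real k * ?m))\<bar>"
        by (simp add: abs_mult)
      also have "\<dots> \<le> 2 * (real k powr (1/20) * \<bar>x - y\<bar> powr (1/20)) * (C * real k powr (- (11/10)))"
      proof (intro mult_mono decay k mult_left_mono)
        have "\<bar>?s\<bar> \<le> \<bar>real k * (y - x) / 2\<bar> powr (1/20)" by (rule abs_sin_le_powr)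
        also have "\<dots> \<le> (real k * \<bar>x - y\<bar>) powr (1/20)" by (intro powr_mono2) (auto simp: abs_mult abs_minus_commute[of y x])
        also have "\<dots> = real k powr (1/20) * \<bar>x - y\<bar> powr (1/20)" by (simp add: powr_mult)
        finally show "\<bar>?s\<bar> \<le> real k powr (1/20) * \<bar>x - y\<bar> powr (1/20)" .
      qed auto
      also have "\<dots> = 2 * C * (real k powr (1/20) * real k powr (- (11/10))) * \<bar>x - y\<bar> powr (1/20)" by simp
      also have "real k powr (1/20) * real k powr (- (11/10)) = real k powr (- (21/20))" by (simp add: powr_add[symmetric])
      finally show ?thesis .
    qed
    have E: "(LINT w|M. T n (z - q w)) = (\<Sum>k\<le>n. a k * (LINT w|M. cos (real k * (z - q w))))" for z
      unfolding a using cosi by simp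
    have "(LINT w|M. T n (x - q w)) - (LINT w|M. T n (y - q w)) = (\<Sum>k\<le>n. a k * ?D k)"
      unfolding E by (simp add: sum_subtractf right_diff_distrib)
    also have "\<dots> = (\<Sum>k\<in>{1..n}. a k * ?D k)"
    proof (rule sum.mono_neutral_right)
      show "\<forall>i\<in>{..n} - {1..n}. a i * ?D i = 0"
      proof
        fix i assume "i \<in> {..n} - {1..n}"
        then have "i = 0" by auto
        then show "a i * ?D i = 0" by simp
      qed
    qed auto
    finally have "\<bar>(LINT w|M. T n (x - q w)) - (LINT w|M. T n (y - q w))\<bar> \<le> (\<Sum>k\<in>{1..n}. \<bar>a k\<bar> * \<bar>?D k\<bar>)"
      by (simp add: sum_abs abs_mult[symmetric])
    also have "\<dots> \<le> (\<Sum>k\<in>{1..n}. ?b * (2 * C * real k powr (- (21/20)) * \<bar>x - y\<bar> powr (1/20)))"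
      using ab D A tail0 by (intro sum_mono mult_mono) auto
    also have "\<dots> = ?b * (2 * C * (\<Sum>k\<in>{1..n}. real k powr (- (21/20))) * \<bar>x - y\<bar> powr (1/20))"
      by (simp add: sum_distrib_left sum_distrib_right mult.assoc)
    also have "\<dots> \<le> ?b * (2 * C * holder_const * \<bar>x - y\<bar> powr (1/20))"
      using C A tail0 holder_const_ge by (intro mult_left_mono mult_right_mono) auto
    finally show ?thesis .
  qed
  have lim: "(\<lambda>n. LINT w|M. T n (z - q w)) \<longlonglongrightarrow> (LINT w|M. vm \<epsilon> (z - q w))" for z
  proof (rule LIM_zero_cancel, rule Lim_null_comparison)
    show "(\<lambda>n. A * exp_tail K n) \<longlonglongrightarrow> 0" using exp_tail_tendsto by (rule tendsto_mult_right_zero)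
    have vi: "integrable M (\<lambda>w. vm \<epsilon> (z - q w))"
      using q vm_bounds[OF e] by (intro integrable_const_bound[where B="1/\<epsilon>"]) (auto simp: abs_of_pos)
    have di: "integrable M (\<lambda>w. T n (z - q w) - vm \<epsilon> (z - q w))" for n
      using q Tv[of n] by (intro integrable_const_bound[where B="A * exp_tail K n"]) auto
    have "norm ((LINT w|M. T n (z - q w)) - (LINT w|M. vm \<epsilon> (z - q w))) \<le> A * exp_tail K n" for n
    proof -
      have "integrable M (\<lambda>w. T n (z - q w))" using Bochner_Integration.integrable_add[OF di[of n] vi] by simp
      then have "(LINT w|M. T n (z - q w)) - (LINT w|M. vm \<epsilon> (z - q w)) = (LINT w|M. T n (z - q w) - vm \<epsilon> (z - q w))"
        using vi by simp
      also have "\<bar>\<dots>\<bar> \<le> (LINT w|M. A * exp_tail K n)"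
        by (rule order_trans[OF integral_abs_bound integral_mono]) (use di[of n] Tv[of n] in auto)
      finally show ?thesis by (simp add: prob_space)
    qed
    then show "\<forall>\<^sub>F n in sequentially. norm ((LINT w|M. T n (z - q w)) - (LINT w|M. vm \<epsilon> (z - q w))) \<le> A * exp_tail K n" by simp
  qed
  have "(\<lambda>n. \<bar>(LINT w|M. T n (x - q w)) - (LINT w|M. T n (y - q w))\<bar>) \<longlonglongrightarrow> \<bar>(LINT w|M. vm \<epsilon> (x - q w)) - (LINT w|M. vm \<epsilon> (y - q w))\<bar>"
    by (intro tendsto_intros lim)
  moreover have "(\<lambda>n. (1 + 2 * pi * (A * exp_tail K n)) / pi * (2 * C * holder_const * \<bar>x - y\<bar> powr (1/20)))
     \<longlonglongrightarrow> (1 + 2 * pi * (A * 0)) / pi * (2 * C * holder_const * \<bar>x - y\<bar> powr (1/20))"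
    by (intro tendsto_intros exp_tail_tendsto) auto
  \<comment> \<open>In the limit the truncation error disappears and the coefficient bound becomes
    \<open>1 / pi\<close>, whatever \<open>\<epsilon>\<close> is.\<close>
  ultimately have "\<bar>(LINT w|M. vm \<epsilon> (x - q w)) - (LINT w|M. vm \<epsilon> (y - q w))\<bar> \<le>
     (1 + 2 * pi * (A * 0)) / pi * (2 * C * holder_const * \<bar>x - y\<bar> powr (1/20))"
    using diffT by (intro LIMSEQ_le) auto
  also have "\<dots> = (2 / pi) * (C * holder_const * \<bar>x - y\<bar> powr (1/20))" by simp
  also have "\<dots> \<le> 1 * (C * holder_const * \<bar>x - y\<bar> powr (1/20))"
    using pi_gt3 C holder_const_nonneg by (intro mult_right_mono) auto
  finally show ?thesis by simp
qed

section \<open>Products of two kernels, near the diagonal and far from it\<close>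

lemma abs_exp_minus_one_le:
  fixes y v a :: real
  assumes "y \<le> 2 * a * v" "- b \<le> y" "0 \<le> a" "a \<le> 1/2" "0 \<le> v" "0 \<le> b"
  shows "exp (- (2 * v)) * \<bar>exp y - 1\<bar> \<le> 2 * a + b"
proof (cases "0 \<le> y")
  case True
  have "exp y - 1 \<le> y * exp y"
  proof -
    have "1 - y \<le> exp (- y)" using exp_ge_add_one_self[of "- y"] by simp
    then have "(1 - y) * exp y \<le> exp (- y) * exp y" by (intro mult_right_mono) auto
    then show ?thesis by (simp add: exp_minus algebra_simps)
  qed
  also have "\<dots> \<le> (2 * a * v) * exp v"
  proof (intro mult_mono)
    \<comment> \<open>A positive exponent \<open>y\<close> is at most \<open>v\<close>, so half of
      the weight \<open>exp (- (2 * v))\<close> absorbs \<open>exp y\<close>, and the other half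
      absorbs the factor \<open>v\<close>.\<close>
    have "2 * a * v \<le> 1 * v" using assms by (intro mult_right_mono) auto
    then show "exp y \<le> exp v" using assms by simp
  qed (use assms in auto)
  finally have "exp (- (2 * v)) * (exp y - 1) \<le> exp (- (2 * v)) * ((2 * a * v) * exp v)" by (intro mult_left_mono) auto
  also have "\<dots> = 2 * a * (v * exp (- v))"
  proof -
    have "exp (- (2 * v)) * exp v = exp (- v)" unfolding exp_add[symmetric] by simp
    then show ?thesis by (metis mult.assoc mult.commute)
  qed
  also have "\<dots> \<le> 2 * a * 1"
  proof (intro mult_left_mono)
    have "v \<le> exp v" using exp_ge_add_one_self[of v] by linarith
    then show "v * exp (- v) \<le> 1" by (simp add: exp_minus field_simps)
  qed (use assms in auto)
  finally show ?thesis using True assms by simp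
next
  case False
  have "1 - exp y \<le> b" using exp_ge_add_one_self[of y] assms(2) by linarith
  then have "exp (- (2 * v)) * (1 - exp y) \<le> 1 * b" using False assms by (intro mult_mono) auto
  then show ?thesis using False assms by (simp add: abs_if)
qed

text \<open>With \<open>K = 1 / \<epsilon>^2\<close>, \<open>c = cos ((x - y) / 2)\<close> and
  \<open>u = cos ((x + y) / 2 - q)\<close>, the product is exactly the two factors times
  \<open>exp z\<close>, where \<open>z = K (1 - c) (2 (1 - u) - (1 - c))\<close>. For Gaussians
  \<open>z\<close> would be 0. Here \<open>z\<close> may be large where \<open>u\<close> is far from
  1, but there the midpoint kernel compensates.\<close>

lemma vm_unnorm_product:
  assumes e: "0 < \<epsilon>" and c: "1 / 2 \<le> cos ((x - y) / 2)"
  shows "\<bar>vm_unnorm \<epsilon> (x - q) * vm_unnorm \<epsilon> (y - q)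
      - vm_unnorm (sqrt 2 * \<epsilon>) (x - y) * vm_unnorm (\<epsilon> / sqrt 2) ((x + y) / 2 - q)\<bar>
    \<le> vm_unnorm (sqrt 2 * \<epsilon>) (x - y) * (2 * (1 - cos ((x - y) / 2)) + (1 - cos ((x - y) / 2))\<^sup>2 / \<epsilon>\<^sup>2)"
proof -
  define c where "c = cos ((x - y) / 2)"
  define u where "u = cos ((x + y) / 2 - q)"
  define K where "K = 1 / \<epsilon>\<^sup>2"
  have K: "0 \<le> K" by (simp add: K_def)
  have cc: "1 / 2 \<le> c" "c \<le> 1" "u \<le> 1" using assms by (auto simp: c_def u_def)
  have eqs: "((x - q) + (y - q)) / 2 = (x + y) / 2 - q" "((x - q) - (y - q)) / 2 = (x - y) / 2"
    by (simp_all add: field_simps)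
  have s: "cos (x - q) + cos (y - q) = 2 * u * c" unfolding cos_plus_cos eqs u_def c_def ..
  have "2 * ((x - y) / 2) = x - y" by simp
  then have d: "cos (x - y) = 2 * c\<^sup>2 - 1" unfolding c_def by (metis cos_double_cos)
  define a where "a = 1 - c"
  define v where "v = K * (1 - u)"
  define z where "z = K * a * (2 * (1 - u) - a)"
  have U: "vm_unnorm (sqrt 2 * \<epsilon>) (x - y) = exp (- K * (1 - c\<^sup>2))"
    unfolding vm_unnorm_cos d exp_add[symmetric] using e by (simp add: K_def power_mult_distrib) (simp add: field_simps)
  have W: "vm_unnorm (\<epsilon> / sqrt 2) ((x + y) / 2 - q) = exp (- (2 * v))"
    unfolding vm_unnorm_cos u_def[symmetric] exp_add[symmetric] v_def K_def using e by (simp add: power_divide) (simp add: field_simps)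
  have "vm_unnorm \<epsilon> (x - q) * vm_unnorm \<epsilon> (y - q) = exp (- (2 * K) + K * (cos (x - q) + cos (y - q)))"
    unfolding vm_unnorm_cos exp_add[symmetric] K_def by (simp add: mult_exp_exp algebra_simps)
  also have "\<dots> = exp (- K * (1 - c\<^sup>2)) * exp (- (2 * v)) * exp z"
    unfolding s exp_add[symmetric] v_def z_def a_def by (simp add: algebra_simps power2_eq_square)
  finally have P: "vm_unnorm \<epsilon> (x - q) * vm_unnorm \<epsilon> (y - q) = exp (- K * (1 - c\<^sup>2)) * exp (- (2 * v)) * exp z" .
  have "exp (- (2 * v)) * \<bar>exp z - 1\<bar> \<le> 2 * a + K * a\<^sup>2"
  proof (rule abs_exp_minus_one_le)
    have "0 \<le> K * a\<^sup>2" "0 \<le> 2 * (K * (a * (1 - u)))" using K cc by (auto simp: a_def)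
    moreover have "2 * a * v - z = K * a\<^sup>2" "z + K * a\<^sup>2 = 2 * (K * (a * (1 - u)))"
      by (simp_all add: z_def v_def power2_eq_square algebra_simps)
    ultimately show "z \<le> 2 * a * v" "- (K * a\<^sup>2) \<le> z" by linarith+
  qed (use K cc in \<open>auto simp: a_def v_def\<close>)
  then have "exp (- K * (1 - c\<^sup>2)) * (exp (- (2 * v)) * \<bar>exp z - 1\<bar>) \<le> exp (- K * (1 - c\<^sup>2)) * (2 * a + K * a\<^sup>2)"
    by (intro mult_left_mono) auto
  moreover have "\<bar>exp (- K * (1 - c\<^sup>2)) * exp (- (2 * v)) * exp z - exp (- K * (1 - c\<^sup>2)) * exp (- (2 * v))\<bar>
     = exp (- K * (1 - c\<^sup>2)) * (exp (- (2 * v)) * \<bar>exp z - 1\<bar>)"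
  proof -
    have "exp (- K * (1 - c\<^sup>2)) * exp (- (2 * v)) * exp z - exp (- K * (1 - c\<^sup>2)) * exp (- (2 * v))
      = (exp (- K * (1 - c\<^sup>2)) * exp (- (2 * v))) * (exp z - 1)" by (simp add: algebra_simps)
    then show ?thesis by (simp only: abs_mult abs_exp_cancel mult.assoc)
  qed
  ultimately show ?thesis
    unfolding P U W c_def[symmetric] a_def K_def by simp
qed

lemma one_minus_cos_le: "1 - cos x \<le> x\<^sup>2 / 2" for x :: real
proof -
  have "cos x = 1 - 2 * (sin (x / 2))\<^sup>2" using cos_double_sin[of "x / 2"] by simp
  moreover have "(sin (x / 2))\<^sup>2 \<le> (x / 2)\<^sup>2"
    using abs_sin_x_le_abs_x[of "x / 2"] by (simp only: abs_le_square_iff)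
  ultimately show ?thesis by (simp add: power2_eq_square)
qed

text \<open>Jordan's inequality for the half angle: by concavity the sine lies above its chord on
  \<open>[0, pi / 2]\<close>.\<close>

lemma one_minus_cos_ge:
  fixes x :: real
  assumes "\<bar>x\<bar> \<le> pi"
  shows "2 * x\<^sup>2 / pi\<^sup>2 \<le> 1 - cos x"
proof -
  have c: "cos x = 1 - 2 * (sin (x / 2))\<^sup>2" using cos_double_sin[of "x / 2"] by simp
  have "\<bar>x\<bar> / pi \<le> \<bar>sin (x / 2)\<bar>"
  proof -
    have cv: "concave_on {0..pi} sin"
      unfolding concave_on_def
    proof (rule f''_ge0_imp_convex[where f'="\<lambda>x. - cos x" and f''="\<lambda>x. sin x"])
      show "((\<lambda>x. - sin x) has_real_derivative - cos x) (at x)" for x :: real by (auto intro!: derivative_eq_intros)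
      show "((\<lambda>x. - cos x) has_real_derivative sin x) (at x)" for x :: real by (auto intro!: derivative_eq_intros)
    qed (auto intro: sin_ge_zero)
    define s where "s = \<bar>x\<bar> / pi"
    have s: "0 \<le> s" "s \<le> 1" using assms by (auto simp: s_def)
    have "sin ((1 - s) *\<^sub>R 0 + s *\<^sub>R (pi / 2)) \<ge> (1 - s) * sin 0 + s * sin (pi / 2)"
      by (rule concave_onD[OF cv s]) auto
    then have "s \<le> sin (s * pi / 2)" by simp
    also have "s * pi / 2 = \<bar>x\<bar> / 2" by (simp add: s_def)
    also have "sin (\<bar>x\<bar> / 2) \<le> \<bar>sin (x / 2)\<bar>" by (simp add: abs_if)
    finally show ?thesis by (simp add: s_def)
  qed
  then have "(\<bar>x\<bar> / pi)\<^sup>2 \<le> (sin (x / 2))\<^sup>2"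
    by (intro abs_le_square_iff[THEN iffD1]) auto
  then show ?thesis unfolding c by (simp add: power_divide)
qed

text \<open>Gaussian normaliser over von Mises normaliser.\<close>

definition vm_ratio :: "real \<Rightarrow> real" where
  "vm_ratio \<epsilon> = \<epsilon> * sqrt (2 * pi) / vm_Z \<epsilon>"

text \<open>At the point 0 both densities are the reciprocals of their normalisers. Multiplying
  their difference by \<open>\<epsilon> * sqrt (2 * pi)\<close> turns
  \<open>\<epsilon> powr \<alpha>\<close> into
  \<open>\<epsilon> powr (1 + \<alpha>)\<close>.\<close>

lemma vm_ratio_eventually:
  assumes "vm_gauss_exponent \<alpha>"
  shows "\<exists>e0>0. e0 \<le> 1 \<and> (\<forall>\<epsilon>. 0 < \<epsilon> \<and> \<epsilon> \<le> e0 \<longrightarrow> \<bar>vm_ratio \<epsilon> - 1\<bar> \<le> 3 * \<epsilon> powr (1 + \<alpha>))"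
proof -
  obtain b where b: "0 < b" "\<And>\<epsilon> x. 0 < \<epsilon> \<Longrightarrow> \<epsilon> < b \<Longrightarrow> x \<in> {-pi<..<pi} \<Longrightarrow> \<bar>vm \<epsilon> x - normal_density 0 \<epsilon> x\<bar> \<le> \<epsilon> powr \<alpha>"
    using assms unfolding vm_gauss_exponent_def eventually_at_right_field by blast
  have sq: "sqrt (2 * pi) \<le> 3" using pi_less_4 by (intro real_le_lsqrt) auto
  have "\<bar>vm_ratio \<epsilon> - 1\<bar> \<le> 3 * \<epsilon> powr (1 + \<alpha>)" if e: "0 < \<epsilon>" "\<epsilon> \<le> min 1 (b / 2)" for \<epsilon>
  proof -
    have "\<bar>vm \<epsilon> 0 - normal_density 0 \<epsilon> 0\<bar> \<le> \<epsilon> powr \<alpha>" using b(2)[of \<epsilon> 0] e b(1) by auto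
    moreover have "vm \<epsilon> 0 = 1 / vm_Z \<epsilon>" by (simp add: vm_alt vm_unnorm_def)
    moreover have "normal_density 0 \<epsilon> 0 = 1 / (\<epsilon> * sqrt (2 * pi))"
      using e by (simp add: normal_density_def real_sqrt_mult)
    ultimately have h: "\<bar>1 / vm_Z \<epsilon> - 1 / (\<epsilon> * sqrt (2 * pi))\<bar> \<le> \<epsilon> powr \<alpha>" by simp
    have "vm_ratio \<epsilon> - 1 = (\<epsilon> * sqrt (2 * pi)) * (1 / vm_Z \<epsilon> - 1 / (\<epsilon> * sqrt (2 * pi)))"
      using e by (simp add: vm_ratio_def right_diff_distrib)
    then have "\<bar>vm_ratio \<epsilon> - 1\<bar> = (\<epsilon> * sqrt (2 * pi)) * \<bar>1 / vm_Z \<epsilon> - 1 / (\<epsilon> * sqrt (2 * pi))\<bar>"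
      using e by (simp add: abs_mult)
    also have "\<dots> \<le> (\<epsilon> * 3) * \<epsilon> powr \<alpha>" using h e sq by (intro mult_mono) auto
    also have "\<dots> = 3 * \<epsilon> powr (1 + \<alpha>)" using e by (simp add: powr_add)
    finally show ?thesis .
  qed
  then show ?thesis using b(1) by (intro exI[of _ "min 1 (b / 2)"]) auto
qed

lemma vm_ratio_unnorm:
  assumes "0 < \<epsilon>"
  shows "vm \<epsilon> x = vm_unnorm \<epsilon> x * vm_ratio \<epsilon> / (\<epsilon> * sqrt (2 * pi))"
  using assms by (simp add: vm_alt vm_ratio_def)

lemma sqrt2_bounds: "1 \<le> sqrt 2" "sqrt 2 \<le> 3 / 2"
proof -
  have "sqrt 2 \<le> sqrt ((3/2)\<^sup>2)" by (intro real_sqrt_le_mono) (simp add: power2_eq_square)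
  then show "sqrt 2 \<le> 3 / 2" by simp
qed simp

lemma ratio_product_close:
  fixes r s t h :: real
  assumes "\<bar>r - 1\<bar> \<le> h" "\<bar>s - 1\<bar> \<le> h" "\<bar>t - 1\<bar> \<le> h" "h \<le> 1 / 2"
  shows "\<bar>r\<^sup>2 - s * t\<bar> \<le> 5 * h" "r\<^sup>2 \<le> 3"
proof -
  have b: "\<bar>u * v - 1\<bar> \<le> (5/2) * h" if "\<bar>u - 1\<bar> \<le> h" "\<bar>v - 1\<bar> \<le> h" for u v :: real
  proof -
    have "u * v - 1 = (u - 1) * v + (v - 1)" by (simp add: algebra_simps)
    then have "\<bar>u * v - 1\<bar> \<le> \<bar>(u - 1) * v\<bar> + \<bar>v - 1\<bar>" by linarith
    also have "\<bar>(u - 1) * v\<bar> = \<bar>u - 1\<bar> * \<bar>v\<bar>" by (rule abs_mult)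
    finally have "\<bar>u * v - 1\<bar> \<le> \<bar>u - 1\<bar> * \<bar>v\<bar> + \<bar>v - 1\<bar>" .
    also have "\<dots> \<le> h * (3/2) + h" using that assms(4) by (intro add_mono mult_mono) auto
    finally show ?thesis by simp
  qed
  show "\<bar>r\<^sup>2 - s * t\<bar> \<le> 5 * h"
    using b[OF assms(1,1)] b[OF assms(2,3)] unfolding power2_eq_square by linarith
  show "r\<^sup>2 \<le> 3"
    using b[OF assms(1,1)] assms(4) unfolding power2_eq_square by linarith
qed

text \<open>Both products carry \<open>1 / \<epsilon>^2\<close> from their normalisers, but
  \<open>vm (sqrt 2 * \<epsilon>)\<close> has only one factor \<open>1 / \<epsilon>\<close>. A
  relative error of the unnormalised product thus loses one power of \<open>\<epsilon>\<close>:
  \<open>\<epsilon> powr (3/2)\<close> from the shape becomes \<open>\<epsilon> powr (1/2)\<close>,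
  and \<open>\<epsilon> powr (1 + \<alpha>)\<close> from the normalisers becomes
  \<open>\<epsilon> powr \<alpha>\<close>.\<close>

lemma kernel_compare:
  assumes \<alpha>: "vm_gauss_exponent \<alpha>"
  shows "\<exists>e0>0. e0 \<le> 1 \<and> (\<forall>\<epsilon> x y q. 0 < \<epsilon> \<and> \<epsilon> \<le> e0 \<and> \<bar>x - y\<bar> \<le> \<epsilon> powr (7/8) \<longrightarrow>
    \<bar>vm \<epsilon> (x - q) * vm \<epsilon> (y - q) - vm (sqrt 2 * \<epsilon>) (x - y) * vm (\<epsilon> / sqrt 2) ((x + y) / 2 - q)\<bar>
    \<le> vm (sqrt 2 * \<epsilon>) (x - y) * (90 * (\<epsilon> powr (1/2) + \<epsilon> powr \<alpha>)))"
proof -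
  have a01: "0 < \<alpha>" "\<alpha> < 1" using \<alpha> by (auto simp: vm_gauss_exponent_def)
  obtain b where b: "0 < b" "b \<le> 1" and r: "\<And>\<epsilon>. 0 < \<epsilon> \<Longrightarrow> \<epsilon> \<le> b \<Longrightarrow> \<bar>vm_ratio \<epsilon> - 1\<bar> \<le> 3 * \<epsilon> powr (1 + \<alpha>)"
    using vm_ratio_eventually[OF \<alpha>] by blast
  \<comment> \<open>Halving \<open>b\<close> makes room for the width
    \<open>sqrt 2 * \<epsilon> \<le> 2 * \<epsilon>\<close>; \<open>1 / 24\<close> gives
    \<open>h = 12 * \<epsilon> powr (1 + \<alpha>) \<le> 1 / 2\<close>, where
    \<open>12 = 3 * 2^2\<close> bounds \<open>3 * 2 powr (1 + \<alpha>)\<close>.\<close>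
  define e0 where "e0 = min (b / 2) (1 / 24)"
  note s2 = sqrt2_bounds
  have spi: "2 \<le> sqrt (2 * pi)" using pi_gt3 by (intro real_le_rsqrt) auto
  have "\<bar>vm \<epsilon> (x - q) * vm \<epsilon> (y - q) - vm (sqrt 2 * \<epsilon>) (x - y) * vm (\<epsilon> / sqrt 2) ((x + y) / 2 - q)\<bar>
    \<le> vm (sqrt 2 * \<epsilon>) (x - y) * (90 * (\<epsilon> powr (1/2) + \<epsilon> powr \<alpha>))"
    if e: "0 < \<epsilon>" "\<epsilon> \<le> e0" and d: "\<bar>x - y\<bar> \<le> \<epsilon> powr (7/8)" for \<epsilon> x y q
  proof -
    have e1: "\<epsilon> \<le> 1 / 24" "2 * \<epsilon> \<le> b" using e by (auto simp: e0_def)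
    define h where "h = 12 * \<epsilon> powr (1 + \<alpha>)"
    have h: "h \<le> 1 / 2"
    proof -
      have "\<epsilon> powr (1 + \<alpha>) \<le> \<epsilon> powr 1" using e e1 a01 by (intro powr_mono') auto
      then show ?thesis using e e1 by (simp add: h_def)
    qed
    have rr: "\<bar>vm_ratio z - 1\<bar> \<le> h" if z: "0 < z" "z \<le> 2 * \<epsilon>" for z
    proof -
      have "\<bar>vm_ratio z - 1\<bar> \<le> 3 * z powr (1 + \<alpha>)" using r z e1 by auto
      also have "\<dots> \<le> 3 * (2 * \<epsilon>) powr (1 + \<alpha>)" using z a01 by (intro mult_left_mono powr_mono2) auto
      also have "(2 * \<epsilon>) powr (1 + \<alpha>) = 2 powr (1 + \<alpha>) * \<epsilon> powr (1 + \<alpha>)" using e by (simp add: powr_mult)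
      also have "3 * (2 powr (1 + \<alpha>) * \<epsilon> powr (1 + \<alpha>)) \<le> 3 * (2 powr 2 * \<epsilon> powr (1 + \<alpha>))"
        using a01 by (intro mult_left_mono mult_right_mono powr_mono) auto
      finally show ?thesis by (simp add: h_def)
    qed
    define R R1 R2 where "R = vm_ratio \<epsilon>" and "R1 = vm_ratio (sqrt 2 * \<epsilon>)" and "R2 = vm_ratio (\<epsilon> / sqrt 2)"
    have "sqrt 2 * \<epsilon> \<le> 2 * \<epsilon>" using s2 e by (intro mult_right_mono) auto
    moreover have "\<epsilon> / sqrt 2 \<le> \<epsilon> / 1" using s2 e by (intro divide_left_mono) auto
    ultimately have Rs: "\<bar>R - 1\<bar> \<le> h" "\<bar>R1 - 1\<bar> \<le> h" "\<bar>R2 - 1\<bar> \<le> h"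
      unfolding R_def R1_def R2_def using e rr[of \<epsilon>] rr[of "sqrt 2 * \<epsilon>"] rr[of "\<epsilon> / sqrt 2"] by auto
    note rp = ratio_product_close[OF Rs h]
    have R1: "1 / 2 \<le> R1" using Rs(2) h by linarith
    define S where "S = sqrt (2 * pi)"
    have S: "2 \<le> S" using spi by (simp add: S_def)
    define u where "u = vm_unnorm \<epsilon> (x - q) * vm_unnorm \<epsilon> (y - q)"
    define U where "U = vm_unnorm (sqrt 2 * \<epsilon>) (x - y)"
    define U' where "U' = vm_unnorm (\<epsilon> / sqrt 2) ((x + y) / 2 - q)"
    have U0: "0 < U" "0 < U'" "U' \<le> 1" unfolding U_def U'_def using vm_unnorm_pos vm_unnorm_le_1 by auto
    define a where "a = 1 - cos ((x - y) / 2)"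
    have d2: "\<bar>x - y\<bar>\<^sup>2 \<le> (\<epsilon> powr (7/8))\<^sup>2" using d by (intro power_mono) auto
    have p74: "(\<epsilon> powr (7/8))\<^sup>2 = \<epsilon> powr (7/4)" by (simp add: power2_eq_square powr_add[symmetric])
    have a: "0 \<le> a" "a \<le> \<epsilon> powr (7/4) / 8"
      using one_minus_cos_le[of "(x - y) / 2"] d2 unfolding p74 a_def by (auto simp: power_divide)
    have le1: "\<epsilon> powr z \<le> 1" if "0 \<le> z" for z using powr_mono'[of 0 z \<epsilon>] that e e1 by auto
    have c: "1 / 2 \<le> cos ((x - y) / 2)" using a le1[of "7/4"] unfolding a_def by linarith
    have AA: "2 * a + a\<^sup>2 / \<epsilon>\<^sup>2 \<le> \<epsilon> powr (3/2)"
    proof -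
      have "a\<^sup>2 \<le> (\<epsilon> powr (7/4) / 8)\<^sup>2" using a by (intro power_mono) auto
      also have "\<dots> = \<epsilon> powr (7/2) / 64" by (simp add: power_divide power2_eq_square powr_add[symmetric])
      also have "\<epsilon> powr (7/2) = \<epsilon> powr (3/2) * \<epsilon>\<^sup>2"
        using e by (simp add: powr_add[symmetric] flip: powr_numeral)
      finally have "a\<^sup>2 / \<epsilon>\<^sup>2 \<le> \<epsilon> powr (3/2) / 64" using e by (simp add: field_simps)
      moreover have "\<epsilon> powr (7/4) \<le> \<epsilon> powr (3/2)" using e e1 by (intro powr_mono') auto
      moreover have "0 \<le> \<epsilon> powr (3/2)" by simp
      ultimately show ?thesis using a(2) by linarith
    qed
    have prod: "\<bar>u - U * U'\<bar> \<le> U * \<epsilon> powr (3/2)"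
    proof -
      have "\<bar>u - U * U'\<bar> \<le> U * (2 * a + a\<^sup>2 / \<epsilon>\<^sup>2)"
        unfolding u_def U_def U'_def a_def by (rule vm_unnorm_product[OF e(1) c])
      also have "\<dots> \<le> U * \<epsilon> powr (3/2)" using AA U0 by (intro mult_left_mono) auto
      finally show ?thesis .
    qed
    have W: "vm (sqrt 2 * \<epsilon>) (x - y) = U * R1 / (sqrt 2 * \<epsilon> * S)"
      using vm_ratio_unnorm[of "sqrt 2 * \<epsilon>" "x - y"] e by (simp add: U_def R1_def S_def)
    have w': "vm (\<epsilon> / sqrt 2) ((x + y) / 2 - q) = U' * R2 / (\<epsilon> / sqrt 2 * S)"
      using vm_ratio_unnorm[of "\<epsilon> / sqrt 2"] e by (simp add: U'_def R2_def S_def)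
    have ww: "vm \<epsilon> (x - q) * vm \<epsilon> (y - q) = u * R\<^sup>2 / (\<epsilon>\<^sup>2 * S\<^sup>2)"
      unfolding vm_ratio_unnorm[OF e(1)] u_def R_def S_def power2_eq_square times_divide_times_eq by (simp only: mult_ac)
    have "vm \<epsilon> (x - q) * vm \<epsilon> (y - q) - vm (sqrt 2 * \<epsilon>) (x - y) * vm (\<epsilon> / sqrt 2) ((x + y) / 2 - q)
      = ((u - U * U') * R\<^sup>2 + U * U' * (R\<^sup>2 - R1 * R2)) / (\<epsilon>\<^sup>2 * S\<^sup>2)"
    proof -
      have "(sqrt 2 * \<epsilon> * S) * (\<epsilon> / sqrt 2 * S) = \<epsilon>\<^sup>2 * S\<^sup>2" by (simp add: power2_eq_square)
      then have "vm (sqrt 2 * \<epsilon>) (x - y) * vm (\<epsilon> / sqrt 2) ((x + y) / 2 - q) = (U * R1 * (U' * R2)) / (\<epsilon>\<^sup>2 * S\<^sup>2)"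
        unfolding W w' times_divide_times_eq by (simp only:)
      then show ?thesis unfolding ww by (simp add: diff_divide_distrib[symmetric] algebra_simps)
    qed
    then have "\<bar>vm \<epsilon> (x - q) * vm \<epsilon> (y - q) - vm (sqrt 2 * \<epsilon>) (x - y) * vm (\<epsilon> / sqrt 2) ((x + y) / 2 - q)\<bar>
      = \<bar>(u - U * U') * R\<^sup>2 + U * U' * (R\<^sup>2 - R1 * R2)\<bar> / (\<epsilon>\<^sup>2 * S\<^sup>2)" by (simp add: abs_divide)
    also have "\<dots> \<le> (U * (3 * \<epsilon> powr (3/2) + 5 * h)) / (\<epsilon>\<^sup>2 * S\<^sup>2)"
    proof (intro divide_right_mono)
      have "\<bar>(u - U * U') * R\<^sup>2 + U * U' * (R\<^sup>2 - R1 * R2)\<bar> \<le> \<bar>u - U * U'\<bar> * R\<^sup>2 + U * U' * \<bar>R\<^sup>2 - R1 * R2\<bar>"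
        using U0 by (intro order_trans[OF abs_triangle_ineq]) (simp add: abs_mult)
      also have "\<dots> \<le> (U * \<epsilon> powr (3/2)) * 3 + U * 1 * (5 * h)"
        using prod rp U0 by (intro add_mono mult_mono) auto
      finally show "\<bar>(u - U * U') * R\<^sup>2 + U * U' * (R\<^sup>2 - R1 * R2)\<bar> \<le> U * (3 * \<epsilon> powr (3/2) + 5 * h)"
        by (simp add: algebra_simps)
    qed simp
    also have "\<dots> = (U / (\<epsilon>\<^sup>2 * S\<^sup>2)) * (3 * \<epsilon> powr (3/2) + 5 * h)" by simp
    also have "\<dots> \<le> (vm (sqrt 2 * \<epsilon>) (x - y) * (3 / 2) / \<epsilon>) * (3 * \<epsilon> powr (3/2) + 5 * h)"
    proof (intro mult_right_mono)
      have "sqrt 2 \<le> (3 / 2) * 1" using s2 by simp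
      also have "\<dots> \<le> (3 / 2) * (R1 * S)" using R1 S mult_mono[of "1/2" R1 2 S] by (intro mult_left_mono) auto
      finally have k: "sqrt 2 \<le> (3 / 2) * (R1 * S)" .
      have "U / (\<epsilon>\<^sup>2 * S\<^sup>2) = U * sqrt 2 / (sqrt 2 * \<epsilon>\<^sup>2 * S\<^sup>2)" by simp
      also have "\<dots> \<le> U * ((3 / 2) * (R1 * S)) / (sqrt 2 * \<epsilon>\<^sup>2 * S\<^sup>2)"
        using k U0 by (intro divide_right_mono mult_left_mono) auto
      also have "\<dots> = vm (sqrt 2 * \<epsilon>) (x - y) * (3 / 2) / \<epsilon>"
        unfolding W using e S by (simp add: power2_eq_square mult_ac)
      finally show "U / (\<epsilon>\<^sup>2 * S\<^sup>2) \<le> vm (sqrt 2 * \<epsilon>) (x - y) * (3 / 2) / \<epsilon>" .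
    qed (simp add: h_def)
    also have "\<dots> = vm (sqrt 2 * \<epsilon>) (x - y) * ((3 / 2) * (3 * \<epsilon> powr (1/2) + 60 * \<epsilon> powr \<alpha>))"
    proof -
      have "\<epsilon> powr (3/2) = \<epsilon> powr (1/2) * \<epsilon>" using e powr_add[of \<epsilon> "1/2" 1] by simp
      moreover have "\<epsilon> powr (1 + \<alpha>) = \<epsilon> powr \<alpha> * \<epsilon>" using e powr_add[of \<epsilon> 1 \<alpha>] by simp
      moreover have "(V * (3 / 2) / \<epsilon>) * (3 * (p * \<epsilon>) + 5 * (12 * (r * \<epsilon>))) = V * ((3 / 2) * (3 * p + 60 * r))" for V p r
        using e by (simp add: field_simps)
      ultimately show ?thesis unfolding h_def by simp
    qed
    also have "\<dots> \<le> vm (sqrt 2 * \<epsilon>) (x - y) * (90 * (\<epsilon> powr (1/2) + \<epsilon> powr \<alpha>))"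
    proof (intro mult_left_mono)
      show "0 \<le> vm (sqrt 2 * \<epsilon>) (x - y)" unfolding W using U0 R1 e S by (intro divide_nonneg_nonneg mult_nonneg_nonneg) auto
      have "(3 / 2) * (3 * p + 60 * r) \<le> 90 * (p + r)" if "0 \<le> p" for p r :: real using that by (simp add: algebra_simps)
      then show "(3 / 2) * (3 * \<epsilon> powr (1/2) + 60 * \<epsilon> powr \<alpha>) \<le> 90 * (\<epsilon> powr (1/2) + \<epsilon> powr \<alpha>)" by simp
    qed
    finally show ?thesis .
  qed
  moreover have "0 < e0" "e0 \<le> 1" using b by (auto simp: e0_def)
  ultimately show ?thesis by blast
qed

text \<open>\<open>exp t \<ge> (t / 16)^16\<close>, and the 16th power turns
  \<open>\<epsilon> powr (-1/4)\<close> into \<open>\<epsilon>^-4\<close>.\<close>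

lemma exp_neg_powr_le:
  fixes \<epsilon> t :: real
  assumes e: "0 < \<epsilon>" and t: "\<epsilon> powr (- (1/4)) / 16 \<le> t"
  shows "exp (- t) \<le> 256 ^ 16 * \<epsilon> ^ 4"
proof -
  have "0 < \<epsilon> powr (- (1/4)) / 16" using e by simp
  from less_le_trans[OF this t] have t0: "0 < t" .
  have "(t / 16) ^ 16 \<le> (1 + t / 16) ^ 16" using t0 by (intro power_mono) auto
  also have "\<dots> \<le> exp t" using exp_ge_one_plus_x_over_n_power_n[of 16 t] t0 by simp
  finally have "exp (- t) \<le> 1 / (t / 16) ^ 16" using t0 by (simp add: exp_minus field_simps)
  also have "\<dots> \<le> 1 / (\<epsilon> powr (- (1/4)) / 256) ^ 16"
    using t e by (intro divide_left_mono power_mono mult_pos_pos zero_less_power) (auto simp: t0)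
  also have "\<dots> = 256 ^ 16 * \<epsilon> ^ 4"
  proof -
    have "(\<epsilon> powr (- (1/4))) ^ 16 = \<epsilon> powr (- 4)" using e by (simp add: powr_power)
    also have "\<dots> = 1 / \<epsilon> ^ 4" using e by (simp add: powr_minus divide_inverse)
    finally show ?thesis by (simp add: power_divide)
  qed
  finally show ?thesis .
qed

lemma far_exponent:
  assumes e: "0 < \<epsilon>" and d: "\<epsilon> powr (7/8) \<le> \<bar>z\<bar>"
  shows "\<epsilon> powr (- (1/4)) / 16 \<le> z\<^sup>2 / pi\<^sup>2 / \<epsilon>\<^sup>2"
proof -
  have "(\<epsilon> powr (7/8))\<^sup>2 \<le> \<bar>z\<bar>\<^sup>2" using d by (intro power_mono) auto
  then have "\<epsilon> powr (7/4) \<le> z\<^sup>2" by (simp add: power2_eq_square powr_add[symmetric])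
  moreover have "\<epsilon> powr (7/4) = \<epsilon> powr (- (1/4)) * \<epsilon>\<^sup>2"
    using e by (simp add: powr_add[symmetric] flip: powr_numeral)
  ultimately have "\<epsilon> powr (- (1/4)) \<le> z\<^sup>2 / \<epsilon>\<^sup>2" using e by (simp add: pos_le_divide_eq)
  moreover have "pi\<^sup>2 \<le> 16" using pi_less_4 pi_gt_zero power_mono[of pi 4 2] by simp
  ultimately have "\<epsilon> powr (- (1/4)) / 16 \<le> (z\<^sup>2 / \<epsilon>\<^sup>2) / pi\<^sup>2" by (intro frac_le) auto
  then show ?thesis by (simp add: divide_divide_eq_left mult.commute)
qed

text \<open>Beyond the cutoff the exponents are at least of order
  \<open>\<epsilon> powr (-1/4)\<close>, so the unnormalised kernels are
  \<open>O(\<epsilon>^4)\<close>; at most two normalisers are lost. For the product,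
  \<open>cos (x - q) + cos (y - q) \<le> 2 * cos ((x - y) / 2)\<close> removes \<open>q\<close>. The
  distance must be at most \<open>pi\<close>, where the cosine is still comparable to a
  parabola.\<close>

lemma vm_far:
  assumes e: "0 < \<epsilon>" "\<epsilon> \<le> 1" and d: "\<epsilon> powr (7/8) \<le> \<bar>x - y\<bar>" "\<bar>x - y\<bar> \<le> pi"
  shows "vm (sqrt 2 * \<epsilon>) (x - y) \<le> 256 ^ 16 * \<epsilon>\<^sup>2" "vm \<epsilon> (x - q) * vm \<epsilon> (y - q) \<le> 256 ^ 16 * \<epsilon>\<^sup>2"
proof -
  let ?z = "x - y"
  note s2 = sqrt2_bounds
  have E: "\<epsilon> powr (- (1/4)) / 16 \<le> ?z\<^sup>2 / pi\<^sup>2 / \<epsilon>\<^sup>2" by (rule far_exponent[OF e(1) d(1)])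
  have Z: "\<epsilon> \<le> vm_Z \<epsilon>" using vm_Z_ge[of \<epsilon>] e by auto
  have "sqrt 2 * \<epsilon> \<le> vm_Z (sqrt 2 * \<epsilon>)" using e s2 mult_mono[of "sqrt 2" "3/2" \<epsilon> 1] by (intro vm_Z_ge) auto
  moreover have "1 * \<epsilon> \<le> sqrt 2 * \<epsilon>" using s2 e by (intro mult_right_mono) auto
  ultimately have Z2: "\<epsilon> \<le> vm_Z (sqrt 2 * \<epsilon>)" by linarith
  have "vm_unnorm (sqrt 2 * \<epsilon>) ?z = exp (- ((1 - cos ?z) / (2 * \<epsilon>\<^sup>2)))"
    unfolding vm_unnorm_cos exp_add[symmetric] by (simp add: power_mult_distrib diff_divide_distrib)
  also have "\<dots> \<le> 256 ^ 16 * \<epsilon> ^ 4"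
  proof (rule exp_neg_powr_le[OF e(1)], rule order_trans[OF E])
    have "(2 * ?z\<^sup>2 / pi\<^sup>2) / (2 * \<epsilon>\<^sup>2) \<le> (1 - cos ?z) / (2 * \<epsilon>\<^sup>2)"
      using one_minus_cos_ge[OF d(2)] by (intro divide_right_mono) auto
    then show "?z\<^sup>2 / pi\<^sup>2 / \<epsilon>\<^sup>2 \<le> (1 - cos ?z) / (2 * \<epsilon>\<^sup>2)" by simp
  qed
  finally have U: "vm_unnorm (sqrt 2 * \<epsilon>) ?z \<le> 256 ^ 16 * \<epsilon> ^ 4" .
  have "vm (sqrt 2 * \<epsilon>) ?z \<le> (256 ^ 16 * \<epsilon> ^ 4) / \<epsilon>"
    unfolding vm_alt using U Z2 e vm_unnorm_pos[of _ ?z] by (intro frac_le) (auto intro: less_imp_le)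
  also have "\<dots> = 256 ^ 16 * \<epsilon>\<^sup>2 * \<epsilon>" using e by (simp add: power2_eq_square power4_eq_xxxx)
  also have "\<dots> \<le> 256 ^ 16 * \<epsilon>\<^sup>2 * 1" using e by (intro mult_left_mono) auto
  finally show "vm (sqrt 2 * \<epsilon>) (x - y) \<le> 256 ^ 16 * \<epsilon>\<^sup>2" by simp
  have "cos (x - q) + cos (y - q) \<le> 2 * cos (?z / 2)"
  proof -
    have c0: "0 \<le> cos (?z / 2)" using d(2) by (intro cos_ge_zero) auto
    have "((x - q) - (y - q)) / 2 = ?z / 2" by simp
    then have "cos (x - q) + cos (y - q) = 2 * cos (((x - q) + (y - q)) / 2) * cos (?z / 2)" unfolding cos_plus_cos by metis
    also have "\<dots> \<le> 2 * 1 * cos (?z / 2)" using c0 by (intro mult_right_mono mult_left_mono) auto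
    finally show "cos (x - q) + cos (y - q) \<le> 2 * cos (?z / 2)" by simp
  qed
  have c: "?z\<^sup>2 / pi\<^sup>2 \<le> 2 - cos (x - q) - cos (y - q)"
  proof -
    have "2 * (?z / 2)\<^sup>2 / pi\<^sup>2 \<le> 1 - cos (?z / 2)" using d(2) by (intro one_minus_cos_ge) auto
    then have "2 * (2 * (?z / 2)\<^sup>2 / pi\<^sup>2) \<le> 2 - 2 * cos (?z / 2)" by linarith
    moreover have "2 * (2 * (?z / 2)\<^sup>2 / pi\<^sup>2) = ?z\<^sup>2 / pi\<^sup>2" by (simp add: power_divide)
    ultimately have "?z\<^sup>2 / pi\<^sup>2 \<le> 2 - 2 * cos (?z / 2)" by (simp only:)
    then show ?thesis by (rule order_trans) (use \<open>cos (x - q) + cos (y - q) \<le> 2 * cos (?z / 2)\<close> in linarith)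
  qed
  have "vm_unnorm \<epsilon> (x - q) * vm_unnorm \<epsilon> (y - q) = exp (- ((2 - cos (x - q) - cos (y - q)) / \<epsilon>\<^sup>2))"
    unfolding vm_unnorm_cos exp_add[symmetric] by (simp add: diff_divide_distrib mult_exp_exp)
  also have "\<dots> \<le> 256 ^ 16 * \<epsilon> ^ 4"
    using c by (intro exp_neg_powr_le[OF e(1)] order_trans[OF E] divide_right_mono) auto
  finally have u: "vm_unnorm \<epsilon> (x - q) * vm_unnorm \<epsilon> (y - q) \<le> 256 ^ 16 * \<epsilon> ^ 4" .
  have "vm \<epsilon> (x - q) * vm \<epsilon> (y - q) = (vm_unnorm \<epsilon> (x - q) * vm_unnorm \<epsilon> (y - q)) / (vm_Z \<epsilon> * vm_Z \<epsilon>)"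
    by (simp add: vm_alt)
  also have "\<dots> \<le> (256 ^ 16 * \<epsilon> ^ 4) / (\<epsilon> * \<epsilon>)"
    using u Z e by (intro frac_le mult_mono[of \<epsilon> _ \<epsilon>] mult_nonneg_nonneg less_imp_le[OF vm_unnorm_pos]) auto
  also have "\<dots> = 256 ^ 16 * \<epsilon>\<^sup>2" using e by (simp add: power2_eq_square power4_eq_xxxx)
  finally show "vm \<epsilon> (x - q) * vm \<epsilon> (y - q) \<le> 256 ^ 16 * \<epsilon>\<^sup>2" .
qed

section \<open>Regularity of the McKean-Vlasov law\<close>

lemma LBINT_eq_integral:
  fixes f :: "real \<Rightarrow> real"
  assumes "0 \<le> t" "continuous_on {0..} f"
  shows "(LBINT s=0..t. f s) = integral {0..t} f"
proof -
  have "continuous_on {0..t} f" using assms(2) by (rule continuous_on_subset) auto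
  then have "set_integrable lborel {0..t} f" by (rule borel_integrable_atLeastAtMost')
  then show ?thesis using interval_integral_eq_integral[of 0 t f] assms(1) by (simp add: zero_ereal_def)
qed

lemma integral_diff_eq:
  fixes f :: "real \<Rightarrow> real"
  assumes "0 \<le> a" "a \<le> b" "continuous_on {0..} f"
  shows "integral {0..b} f - integral {0..a} f = integral {a..b} f"
proof -
  have "f integrable_on {0..b}" using assms
    by (intro integrable_continuous_real continuous_on_subset[OF assms(3)]) auto
  from Henstock_Kurzweil_Integration.integral_combine[OF assms(1,2) this] show ?thesis by simp
qed

lemma integral_abs_le:
  fixes f :: "real \<Rightarrow> real"
  assumes "a \<le> b" "continuous_on {a..b} f" "\<And>x. a \<le> x \<Longrightarrow> x \<le> b \<Longrightarrow> \<bar>f x\<bar> \<le> C"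
  shows "\<bar>integral {a..b} f\<bar> \<le> C * (b - a)"
  using integral_bound[of a b f C] assms by auto

lemma left_riemann_sum_bound:
  fixes f :: "real \<Rightarrow> real"
  assumes \<delta>: "0 \<le> \<delta>" and c: "continuous_on {s..s + real n * \<delta>} f"
    and e: "\<And>x y. x \<in> {s..s + real n * \<delta>} \<Longrightarrow> y \<in> {s..s + real n * \<delta>} \<Longrightarrow> \<bar>x - y\<bar> \<le> \<delta> \<Longrightarrow> \<bar>f x - f y\<bar> \<le> e"
  shows "\<bar>integral {s..s + real n * \<delta>} f - \<delta> * (\<Sum>j<n. f (s + real j * \<delta>))\<bar> \<le> real n * (\<delta> * e)"
  using c e
proof (induction n)
  case (Suc n)
  define a b where "a = s + real n * \<delta>" and "b = s + real (Suc n) * \<delta>"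
  have ab: "a \<le> b" "s \<le> a" "b - a = \<delta>" "s \<le> b" using \<delta> by (auto simp: a_def b_def algebra_simps)
  note c = Suc.prems(1)[folded b_def] and e = Suc.prems(2)[folded b_def]
  have c': "continuous_on {s..a} f" "continuous_on {a..b} f"
    using ab by (auto intro!: continuous_on_subset[OF c])
  have IH: "\<bar>integral {s..a} f - \<delta> * (\<Sum>j<n. f (s + real j * \<delta>))\<bar> \<le> real n * (\<delta> * e)"
    using e ab by (intro Suc.IH[folded a_def] c') auto
  have "integral {a..b} (\<lambda>x. f x - f a) = integral {a..b} f - integral {a..b} (\<lambda>x. f a)"
    using c'(2) by (intro Henstock_Kurzweil_Integration.integral_diff integrable_continuous_real) auto
  then have 1: "integral {a..b} (\<lambda>x. f x - f a) = integral {a..b} f - \<delta> * f a" using ab by simp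
  have 2: "\<bar>integral {a..b} (\<lambda>x. f x - f a)\<bar> \<le> e * (b - a)"
    using ab by (intro integral_abs_le e continuous_intros c') auto
  have 3: "integral {s..a} f + integral {a..b} f = integral {s..b} f"
    using ab c by (intro Henstock_Kurzweil_Integration.integral_combine integrable_continuous_real) auto
  have 4: "\<delta> * (\<Sum>j<Suc n. f (s + real j * \<delta>)) = \<delta> * (\<Sum>j<n. f (s + real j * \<delta>)) + \<delta> * f a"
    by (simp add: a_def distrib_left)
  have 5: "real (Suc n) * (\<delta> * e) = real n * (\<delta> * e) + e * (b - a)" unfolding ab(3) by (simp add: algebra_simps)
  show ?case unfolding b_def[symmetric] 4 5 using IH 1 2 3 by linarith
qed simp

lemma left_riemann_sum_tendsto:
  fixes f :: "real \<Rightarrow> real"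
  assumes h: "0 \<le> h" and c: "continuous_on {s..s + h} f"
  shows "(\<lambda>n. h / real (Suc n) * (\<Sum>j<Suc n. f (s + real j * (h / real (Suc n))))) \<longlonglongrightarrow> integral {s..s + h} f"
proof (rule LIMSEQ_I)
  fix r :: real assume r: "0 < r"
  define e where "e = r / (2 * (h + 1))"
  have e: "0 < e" "h * e < r" using r h unfolding e_def by (auto simp: field_simps add_strict_increasing2)
  have "uniformly_continuous_on {s..s + h} f" using c by (intro compact_uniformly_continuous) auto
  then obtain d where d0: "0 < d" "\<forall>x\<in>{s..s + h}. \<forall>y\<in>{s..s + h}. dist y x < d \<longrightarrow> dist (f y) (f x) < e"
    using e(1) unfolding uniformly_continuous_on_def by blast
  have d: "0 < d" "\<bar>f x - f y\<bar> \<le> e" if "x \<in> {s..s + h}" "y \<in> {s..s + h}" "\<bar>x - y\<bar> < d" for x y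
    using d0 that by (auto simp: dist_real_def intro!: less_imp_le)
  have "(\<lambda>n. h / real (Suc n)) \<longlonglongrightarrow> 0" using LIMSEQ_Suc[OF lim_const_over_n[of h]] by simp
  from order_tendstoD(2)[OF this d0(1)] obtain N where N: "\<And>n. n \<ge> N \<Longrightarrow> h / real (Suc n) < d"
    by (auto simp: eventually_sequentially)
  have "norm (h / real (Suc n) * (\<Sum>j<Suc n. f (s + real j * (h / real (Suc n)))) - integral {s..s + h} f) < r" if "n \<ge> N" for n
  proof -
    let ?\<delta> = "h / real (Suc n)"
    have eq: "s + real (Suc n) * ?\<delta> = s + h" by simp
    have "\<bar>integral {s..s + real (Suc n) * ?\<delta>} f - ?\<delta> * (\<Sum>j<Suc n. f (s + real j * ?\<delta>))\<bar> \<le> real (Suc n) * (?\<delta> * e)"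
      unfolding eq
    proof (rule left_riemann_sum_bound[of ?\<delta> s "Suc n" f e, unfolded eq])
      show "\<bar>f x - f y\<bar> \<le> e" if "x \<in> {s..s + h}" "y \<in> {s..s + h}" "\<bar>x - y\<bar> \<le> ?\<delta>" for x y
        using d(2)[OF that(1,2)] that(3) N[OF \<open>n \<ge> N\<close>] by (meson le_less_trans)
    qed (use h c in auto)
    then show ?thesis using e(2) unfolding eq by (simp add: abs_minus_commute)
  qed
  then show "\<exists>no. \<forall>n\<ge>no. norm (h / real (Suc n) * (\<Sum>j<Suc n. f (s + real j * (h / real (Suc n)))) - integral {s..s + h} f) < r" by blast
qed

text \<open>The equation in increment form for \<open>q\<close> and \<open>p + \<gamma> * q\<close>.
  The second variable sees only the force and the noise, and since the noise is additive everything
  about a path is ordinary calculus.\<close>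

definition kinetic_path :: "real \<Rightarrow> real \<Rightarrow> (real \<Rightarrow> real) \<Rightarrow> (real \<Rightarrow> real) \<Rightarrow> (real \<Rightarrow> real) \<Rightarrow> (real \<Rightarrow> real) \<Rightarrow> bool" where
  "kinetic_path \<gamma> \<sigma> f \<beta> q p \<longleftrightarrow> continuous_on {0..} f \<and> continuous_on {0..} \<beta> \<and> continuous_on {0..} q \<and> continuous_on {0..} p \<and>
    (\<forall>a b. 0 \<le> a \<longrightarrow> a \<le> b \<longrightarrow> q b - q a = integral {a..b} p) \<and>
    (\<forall>a b. 0 \<le> a \<longrightarrow> a \<le> b \<longrightarrow> (p b + \<gamma> * q b) - (p a + \<gamma> * q a) = integral {a..b} f + \<sigma> * (\<beta> b - \<beta> a))"

lemma kinetic_pathI: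
  assumes c: "continuous_on {0..} f" "continuous_on {0..} \<beta>" "continuous_on {0..} q" "continuous_on {0..} p"
    and eq: "\<forall>t\<ge>0. q t = q 0 + (LBINT s=0..t. p s) \<and> p t = p 0 + (LBINT s=0..t. - \<gamma> * p s + f s) + \<sigma> * \<beta> t"
  shows "kinetic_path \<gamma> \<sigma> f \<beta> q p"
  unfolding kinetic_path_def
proof (intro conjI allI impI c)
  have eqs: "q t = q 0 + integral {0..t} p" "p t = p 0 + (- \<gamma> * integral {0..t} p + integral {0..t} f) + \<sigma> * \<beta> t" if "0 \<le> t" for t
  proof -
    show "q t = q 0 + integral {0..t} p" using eq[rule_format, OF that] unfolding LBINT_eq_integral[OF that c(4)] by blast
    have i: "p integrable_on {0..t}" "f integrable_on {0..t}"
      using continuous_on_subset[OF c(4), of "{0..t}"] continuous_on_subset[OF c(1), of "{0..t}"]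
      by (auto intro!: integrable_continuous_real)
    have "(LBINT s=0..t. - \<gamma> * p s + f s) = integral {0..t} (\<lambda>s. - \<gamma> * p s + f s)"
      by (intro LBINT_eq_integral that continuous_intros c)
    also have "\<dots> = integral {0..t} (\<lambda>s. - \<gamma> * p s) + integral {0..t} f"
      by (intro Henstock_Kurzweil_Integration.integral_add i integrable_continuous_real continuous_intros continuous_on_subset[OF c(4)]) auto
    also have "integral {0..t} (\<lambda>s. - \<gamma> * p s) = - \<gamma> * integral {0..t} p"
      by (rule Henstock_Kurzweil_Integration.integral_mult_right)
    finally show "p t = p 0 + (- \<gamma> * integral {0..t} p + integral {0..t} f) + \<sigma> * \<beta> t" using eq[rule_format, OF that] by linarith
  qed
  fix a b :: real assume ab: "0 \<le> a" "a \<le> b"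
  then have b: "0 \<le> b" by simp
  show 1: "q b - q a = integral {a..b} p"
    using eqs(1)[OF ab(1)] eqs(1)[OF b] integral_diff_eq[OF ab c(4)] by linarith
  have "p b - p a = - \<gamma> * integral {a..b} p + integral {a..b} f + \<sigma> * (\<beta> b - \<beta> a)"
    unfolding eqs(2)[OF ab(1)] eqs(2)[OF b] integral_diff_eq[OF ab c(4), symmetric] integral_diff_eq[OF ab c(1), symmetric]
    by (simp add: algebra_simps)
  then show "(p b + \<gamma> * q b) - (p a + \<gamma> * q a) = integral {a..b} f + \<sigma> * (\<beta> b - \<beta> a)"
    using 1 by (simp add: algebra_simps)
qed

text \<open>\<open>\<integral>\<close> of \<open>exp (- \<gamma> r)\<close> over
  \<open>[0, h]\<close>: the distance travelled in time \<open>h\<close> at unit initial speed under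
  friction alone.\<close>

definition damped :: "real \<Rightarrow> real \<Rightarrow> real" where
  "damped \<gamma> h = (1 - exp (- (\<gamma> * h))) / \<gamma>"

lemma damped_bounds:
  assumes "0 < \<gamma>" "0 \<le> h"
  shows "0 \<le> damped \<gamma> h" "damped \<gamma> h \<le> h"
proof -
  show "0 \<le> damped \<gamma> h" using assms by (simp add: damped_def)
  have "1 - exp (- (\<gamma> * h)) \<le> \<gamma> * h" using exp_ge_add_one_self[of "- (\<gamma> * h)"] by simp
  then show "damped \<gamma> h \<le> h" using assms by (simp add: damped_def divide_le_eq mult.commute)
qed

text \<open>Variation of constants for \<open>q' + \<gamma> (q - q s) = p s + \<integral> f +
  \<sigma> (\<beta> - \<beta> s)\<close>. In this form the noise enters as a Riemann integral of the
  Brownian path, not as a stochastic integral.\<close>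

lemma kinetic_path_solution:
  assumes k: "kinetic_path \<gamma> \<sigma> f \<beta> q p" and g: "0 < \<gamma>" and st: "0 \<le> s" "s \<le> t"
  shows "q t = q s + damped \<gamma> (t - s) * p s + integral {s..t} (\<lambda>r. exp (- (\<gamma> * (t - r))) * integral {s..r} f)
    + \<sigma> * integral {s..t} (\<lambda>r. exp (- (\<gamma> * (t - r))) * (\<beta> r - \<beta> s))"
proof -
  have c: "continuous_on {s..t} f" "continuous_on {s..t} \<beta>" "continuous_on {s..t} p"
    using k st unfolding kinetic_path_def by (auto elim!: continuous_on_subset)
  let ?E = "\<lambda>r. exp (- (\<gamma> * (t - r)))"
  let ?I = "\<lambda>r. integral {s..r} f"
  have cI: "continuous_on {s..t} ?I"
    using c(1) by (intro indefinite_integral_continuous_1 integrable_continuous_real)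
  have dq: "(q has_vector_derivative p r) (at r within {s..t})" if r: "r \<in> {s..t}" for r
  proof -
    have "((\<lambda>u. integral {s..u} p) has_vector_derivative p r) (at r within {s..t})"
      by (rule integral_has_vector_derivative[OF c(3) r])
    then have "((\<lambda>u. q s + integral {s..u} p) has_vector_derivative p r) (at r within {s..t})"
      by (auto intro!: derivative_eq_intros)
    then show ?thesis
    proof (rule has_vector_derivative_transform[OF r, rotated])
      fix x assume "x \<in> {s..t}"
      then have "q x - q s = integral {s..x} p" using k st unfolding kinetic_path_def by auto
      then show "q x = q s + integral {s..x} p" by simp
    qed
  qed
  have "((\<lambda>r. ?E r * (p s + ?I r + \<sigma> * (\<beta> r - \<beta> s))) has_integral ?E t * (q t - q s) - ?E s * (q s - q s)) {s..t}"
  proof (rule fundamental_theorem_of_calculus[OF st(2)])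
    fix r assume r: "r \<in> {s..t}"
    have dE: "(?E has_vector_derivative ?E r * \<gamma>) (at r within {s..t})"
      unfolding has_real_derivative_iff_has_vector_derivative[symmetric] by (auto intro!: derivative_eq_intros)
    have "p r + \<gamma> * q r = p s + \<gamma> * q s + ?I r + \<sigma> * (\<beta> r - \<beta> s)"
    proof -
      have "(p r + \<gamma> * q r) - (p s + \<gamma> * q s) = ?I r + \<sigma> * (\<beta> r - \<beta> s)"
        using k st r unfolding kinetic_path_def by auto
      then show ?thesis by simp
    qed
    then have "(p r + \<gamma> * q r) - \<gamma> * q s = p s + ?I r + \<sigma> * (\<beta> r - \<beta> s)" by simp
    moreover have "E * \<gamma> * (q r - q s) + E * p r = E * ((p r + \<gamma> * q r) - \<gamma> * q s)" for E
      by (simp add: algebra_simps)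
    ultimately have e: "?E r * \<gamma> * (q r - q s) + ?E r * p r = ?E r * (p s + ?I r + \<sigma> * (\<beta> r - \<beta> s))"
      by simp
    have "((\<lambda>r. ?E r * (q r - q s)) has_vector_derivative (?E r * p r + ?E r * \<gamma> * (q r - q s))) (at r within {s..t})"
      using has_vector_derivative_mult[OF dE has_vector_derivative_diff[OF dq[OF r] has_vector_derivative_const[of "q s"]]] by simp
    then show "((\<lambda>r. ?E r * (q r - q s)) has_vector_derivative ?E r * (p s + ?I r + \<sigma> * (\<beta> r - \<beta> s))) (at r within {s..t})"
      using e by (simp add: add.commute)
  qed
  then have "q t - q s = integral {s..t} (\<lambda>r. ?E r * (p s + ?I r + \<sigma> * (\<beta> r - \<beta> s)))"
    by (simp add: integral_unique)
  also have "\<dots> = integral {s..t} (\<lambda>r. ?E r * p s + ?E r * ?I r + \<sigma> * (?E r * (\<beta> r - \<beta> s)))"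
    by (simp add: algebra_simps)
  also have "\<dots> = integral {s..t} (\<lambda>r. ?E r * p s) + integral {s..t} (\<lambda>r. ?E r * ?I r) + integral {s..t} (\<lambda>r. \<sigma> * (?E r * (\<beta> r - \<beta> s)))"
    using c cI by (subst Henstock_Kurzweil_Integration.integral_add Henstock_Kurzweil_Integration.integral_add; (intro integrable_continuous_real continuous_intros)?; simp?)+
  also have "integral {s..t} (\<lambda>r. \<sigma> * (?E r * (\<beta> r - \<beta> s))) = \<sigma> * integral {s..t} (\<lambda>r. ?E r * (\<beta> r - \<beta> s))"
    by (rule Henstock_Kurzweil_Integration.integral_mult_right)
  also have "integral {s..t} (\<lambda>r. ?E r * p s) = damped \<gamma> (t - s) * p s"
  proof -
    have "(?E has_integral ?E t / \<gamma> - ?E s / \<gamma>) {s..t}"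
      using g unfolding has_real_derivative_iff_has_vector_derivative[symmetric]
      by (intro fundamental_theorem_of_calculus[OF st(2)]) (auto intro!: derivative_eq_intros simp flip: has_real_derivative_iff_has_vector_derivative)
    then have "integral {s..t} ?E = damped \<gamma> (t - s)"
      unfolding damped_def by (simp add: integral_unique diff_divide_distrib)
    then show ?thesis by simp
  qed
  finally show ?thesis by simp
qed

section \<open>The McKean-Vlasov process and its Brownian increments\<close>

locale force =
  fixes g :: "real \<Rightarrow> real" and B L :: real
  assumes g_periodic: "periodic g" and g_bound: "\<And>x. \<bar>g x\<bar> \<le> B"
    and g_lipschitz: "\<And>x y. \<bar>g x - g y\<bar> \<le> L * \<bar>x - y\<bar>"
begin

lemma B_nonneg: "0 \<le> B"
  using order_trans[OF abs_ge_zero g_bound[of 0]] .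

lemma L_nonneg: "0 \<le> L"
  using order_trans[OF abs_ge_zero g_lipschitz[of 1 0]] by simp

lemma g_continuous: "continuous_on UNIV g" and g_measurable [measurable]: "g \<in> borel_measurable borel"
  using g_lipschitz by (rule lipschitz_continuous)+

end

lemma C2_torus_force:
  assumes "C2_torus W"
  shows "\<exists>B L. force (deriv W) B L"
proof -
  have W: "periodic W" "\<And>x. W differentiable at x" "\<And>x. deriv W differentiable at x" "continuous_on UNIV (deriv (deriv W))"
    using assms by (auto simp: C2_torus_def differentiable_on_def)
  have D: "(W has_field_derivative deriv W x) (at x)" for x
    using W(2)[of x] by (auto simp: field_differentiable_derivI real_differentiable_def field_differentiable_def DERIV_imp_deriv)
  have D2: "(deriv W has_field_derivative deriv (deriv W) x) (at x)" for x
    using W(3)[of x] by (auto simp: field_differentiable_derivI real_differentiable_def field_differentiable_def DERIV_imp_deriv)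
  have shift: "periodic f \<Longrightarrow> (\<And>x. (f has_field_derivative f' x) (at x)) \<Longrightarrow> periodic f'" for f f' :: "real \<Rightarrow> real"
    unfolding periodic_def
  proof
    fix x assume p: "\<forall>x. f (x + 2 * pi) = f x" and d: "\<And>x. (f has_field_derivative f' x) (at x)"
    have "((\<lambda>x. f (x + 2 * pi)) has_field_derivative f' (x + 2 * pi)) (at x)"
      using d[of "x + 2 * pi"] by (simp add: DERIV_shift)
    then have "(f has_field_derivative f' (x + 2 * pi)) (at x)" using p by simp
    then show "f' (x + 2 * pi) = f' x" using d DERIV_unique by blast
  qed
  have p1: "periodic (deriv W)" and p2: "periodic (deriv (deriv W))"
    using shift[OF W(1) D] shift[OF shift[OF W(1) D] D2] by auto
  have c1: "continuous_on UNIV (deriv W)"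
    using W(3) by (auto intro!: differentiable_imp_continuous_within continuous_at_imp_continuous_on)
  obtain B where B: "\<And>x. \<bar>deriv W x\<bar> \<le> B" using continuous_periodic_bounded[OF c1 p1] by blast
  obtain L where L: "\<And>x. \<bar>deriv (deriv W) x\<bar> \<le> L" using continuous_periodic_bounded[OF W(4) p2] by blast
  have "norm (deriv W x - deriv W y) \<le> L * norm (x - y)" for x y
    by (rule field_differentiable_bound[of UNIV _ "deriv (deriv W)"]) (use D2 L in auto)
  then have "force (deriv W) B L" using p1 B by unfold_locales auto
  then show ?thesis by blast
qed

locale mckean = filtered M F + force g B L for M :: "'a measure" and F g B L +
  fixes \<gamma> \<sigma> :: real and \<beta> q p :: "real \<Rightarrow> 'a \<Rightarrow> real"
  assumes \<gamma>: "0 < \<gamma>" and \<sigma>: "0 < \<sigma>" and brownian: "brownian_motion M F \<beta>"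
    and sde: "kinetic_sde M F \<gamma> \<sigma> (\<lambda>t w. - (LINT y|torus_law M (q t). g (q t w - y))) \<beta> q p"
begin

definition drift :: "real \<Rightarrow> real \<Rightarrow> real" where
  "drift t x = - (LINT w|M. g (x - q t w))"

lemma q_F: "0 \<le> t \<Longrightarrow> q t \<in> borel_measurable (F t)" and p_F: "0 \<le> t \<Longrightarrow> p t \<in> borel_measurable (F t)"
  using sde by (auto simp: kinetic_sde_def adapted_def)

lemma q_M: "0 \<le> t \<Longrightarrow> q t \<in> borel_measurable M"
  using measurable_F_M[OF q_F] .

lemma integrable_g: "0 \<le> t \<Longrightarrow> integrable M (\<lambda>w. g (x - q t w))"
  using q_M[of t] g_bound by (intro integrable_const_bound[where B=B]) auto

lemma drift_eq: "0 \<le> t \<Longrightarrow> - (LINT y|torus_law M (q t). g (x - y)) = drift t x"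
  unfolding drift_def torus_law_def using q_M[of t]
  by (subst integral_distr) (auto simp: periodic_diff_wrap[OF g_periodic])

lemma drift_bound: "0 \<le> t \<Longrightarrow> \<bar>drift t x\<bar> \<le> B"
proof -
  assume t: "0 \<le> t"
  have "\<bar>LINT w|M. g (x - q t w)\<bar> \<le> (LINT w|M. B)"
    by (rule order_trans[OF integral_abs_bound integral_mono]) (use integrable_g[OF t] g_bound in auto)
  then show ?thesis by (simp add: drift_def prob_space)
qed

lemma drift_lipschitz: "0 \<le> t \<Longrightarrow> \<bar>drift t x - drift t y\<bar> \<le> L * \<bar>x - y\<bar>"
proof -
  assume t: "0 \<le> t"
  have "drift t x - drift t y = (LINT w|M. g (y - q t w) - g (x - q t w))"
    using integrable_g[OF t] by (simp add: drift_def)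
  also have "\<bar>\<dots>\<bar> \<le> (LINT w|M. L * \<bar>x - y\<bar>)"
  proof (rule order_trans[OF integral_abs_bound integral_mono])
    show "\<bar>g (y - q t w) - g (x - q t w)\<bar> \<le> L * \<bar>x - y\<bar>" for w
      using g_lipschitz[of "y - q t w" "x - q t w"] by (simp add: abs_minus_commute)
  qed (use integrable_g[OF t] in auto)
  finally show ?thesis by (simp add: prob_space)
qed

lemma q_continuous_AE: "AE w in M. continuous_on {0..} (\<lambda>t. q t w)"
  using sde by (auto simp: kinetic_sde_def elim: eventually_mono)

lemma continuous_drift:
  assumes "continuous_on {0..} y"
  shows "continuous_on {0..} (\<lambda>r. drift r (y r))"
  unfolding drift_def
proof (intro continuous_on_minus continuous_on_expectation[where B=B])
  show "AE w in M. continuous_on {0..} (\<lambda>u. g (y u - q u w))"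
    using q_continuous_AE
    by eventually_elim (intro continuous_on_compose2[OF g_continuous] continuous_on_diff assms; simp)
qed (use q_M g_bound in auto)

lemma path_AE: "AE w in M. kinetic_path \<gamma> \<sigma> (\<lambda>r. drift r (q r w)) (\<lambda>r. \<beta> r w) (\<lambda>r. q r w) (\<lambda>r. p r w)"
proof -
  have "AE w in M. continuous_on {0..} (\<lambda>t. q t w) \<and> continuous_on {0..} (\<lambda>t. p t w) \<and>
        (\<forall>t\<ge>0. q t w = q 0 w + (LBINT s=0..t. p s w) \<and>
                p t w = p 0 w + (LBINT s=0..t. - \<gamma> * p s w + - (LINT y|torus_law M (q s). g (q s w - y))) + \<sigma> * \<beta> t w)"
    using sde by (simp add: kinetic_sde_def)
  moreover have "AE w in M. continuous_on {0..} (\<lambda>t. \<beta> t w)"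
    using brownian by (auto simp: brownian_motion_def elim: eventually_mono)
  ultimately show ?thesis
  proof eventually_elim
    case (elim w)
    have e: "(LBINT s=0..t. - \<gamma> * p s w + - (LINT y|torus_law M (q s). g (q s w - y))) = (LBINT s=0..t. - \<gamma> * p s w + drift s (q s w))"
      if "0 \<le> t" for t :: real
      by (rule interval_integral_cong) (use that in \<open>auto simp: einterval_def drift_eq less_imp_le zero_ereal_def\<close>)
    have c: "continuous_on {0..} (\<lambda>t. q t w)" "continuous_on {0..} (\<lambda>t. p t w)" using elim(1) by blast+
    have eq: "q t w = q 0 w + (LBINT s=0..t. p s w)"
      "p t w = p 0 w + (LBINT s=0..t. - \<gamma> * p s w + drift s (q s w)) + \<sigma> * \<beta> t w" if "0 \<le> t" for t
      unfolding e[OF that, symmetric] using elim(1) that by blast+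
    show ?case by (intro kinetic_pathI continuous_drift c elim(2) allI impI conjI eq)
  qed
qed

definition increments :: "real \<Rightarrow> real \<Rightarrow> nat \<Rightarrow> 'a \<Rightarrow> real" where
  "increments s \<delta> l w = \<beta> (s + real (Suc l) * \<delta>) w - \<beta> (s + real l * \<delta>) w"

lemma increments_law:
  assumes "0 \<le> s" "0 < \<delta>"
  shows "has_law M (increments s \<delta> l) (centred_normal \<delta>)"
    "indep_set (sets (F (s + real l * \<delta>))) (sets (vimage_algebra (space M) (increments s \<delta> l) borel))"
    "increments s \<delta> l \<in> borel_measurable (F (s + real (Suc l) * \<delta>))"
proof -
  have *: "0 \<le> s + real l * \<delta>" "s + real l * \<delta> < s + real (Suc l) * \<delta>" using assms by auto
  have d: "(s + real (Suc l) * \<delta>) - (s + real l * \<delta>) = \<delta>" by (simp add: algebra_simps)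
  have "\<forall>s\<ge>0. \<forall>t>s. has_law M (\<lambda>w. \<beta> t w - \<beta> s w) (centred_normal (t - s)) \<and>
     indep_set (sets (F s)) (sets (vimage_algebra (space M) (\<lambda>w. \<beta> t w - \<beta> s w) borel))"
    using brownian by (simp add: brownian_motion_def)
  from this[rule_format, OF *]
  show "has_law M (increments s \<delta> l) (centred_normal \<delta>)"
    "indep_set (sets (F (s + real l * \<delta>))) (sets (vimage_algebra (space M) (increments s \<delta> l) borel))"
    unfolding increments_def[abs_def] d by auto
  show "increments s \<delta> l \<in> borel_measurable (F (s + real (Suc l) * \<delta>))"
    unfolding increments_def[abs_def] using incr_F[OF brownian_incr[OF brownian] *(1) less_imp_le[OF *(2)]] .
qed

text \<open>Each increment is independent of everything before it and symmetric, so adding it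
  multiplies the mean cosine by its Gaussian characteristic function and the sine part vanishes.
  \<open>Y\<close> is the information at time \<open>s\<close>; its law does not matter.\<close>

lemma cos_shifted_by_increments:
  assumes s: "0 \<le> s" "0 < \<delta>" and Y: "Y \<in> borel_measurable (F s)"
  shows "\<bar>LINT w|M. cos (Y w + (\<Sum>l<n. c l * increments s \<delta> l w))\<bar> \<le> exp (- (\<delta> / 2 * (\<Sum>l<n. (c l)\<^sup>2)))"
proof -
  let ?S = "\<lambda>n w. Y w + (\<Sum>l<n. c l * increments s \<delta> l w)"
  have SF: "?S n \<in> borel_measurable (F (s + real n * \<delta>))" for n
  proof (induction n)
    case 0 then show ?case using Y by simp
  next
    case (Suc n)
    have "?S n \<in> borel_measurable (F (s + real (Suc n) * \<delta>))"
      using measurable_F_mono[OF Suc] s by (simp add: mult_right_mono)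
    then have "(\<lambda>w. ?S n w + c n * increments s \<delta> n w) \<in> borel_measurable (F (s + real (Suc n) * \<delta>))"
      by (rule borel_measurable_add[OF _ borel_measurable_times[OF borel_measurable_const increments_law(3)[OF s]]])
    then show ?case by (simp add: add.assoc)
  qed
  have "(LINT w|M. cos (?S n w)) = exp (- (\<delta> / 2 * (\<Sum>l<n. (c l)\<^sup>2))) * (LINT w|M. cos (Y w))"
  proof (induction n)
    case (Suc n)
    let ?D = "increments s \<delta> n"
    note law = increments_law[OF s, of n]
    have Dm: "?D \<in> borel_measurable M" using law(1) by (simp add: has_law_def)
    have Sm: "?S n \<in> borel_measurable M" using measurable_F_M[OF SF] .
    have ind: "indep_var borel (?S n) borel ?D" by (rule indep_F[OF law(2) SF Dm])
    have i1: "indep_var borel (\<lambda>w. cos (?S n w)) borel (\<lambda>w. cos (c n * ?D w))"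
      using indep_var_compose[OF ind, of cos borel "\<lambda>x. cos (c n * x)" borel] by (simp add: comp_def)
    have i2: "indep_var borel (\<lambda>w. sin (?S n w)) borel (\<lambda>w. sin (c n * ?D w))"
      using indep_var_compose[OF ind, of sin borel "\<lambda>x. sin (c n * x)" borel] by (simp add: comp_def)
    have int: "integrable M (\<lambda>w. cos (?S n w))" "integrable M (\<lambda>w. sin (?S n w))"
      "integrable M (\<lambda>w. cos (c n * ?D w))" "integrable M (\<lambda>w. sin (c n * ?D w))"
      using Sm Dm by (auto intro!: integrable_const_bound[where B=1])
    have "(LINT w|M. cos (?S (Suc n) w)) = (LINT w|M. cos (?S n w) * cos (c n * ?D w) - sin (?S n w) * sin (c n * ?D w))"
      by (simp add: add.assoc[symmetric] cos_add)
    also have "\<dots> = (LINT w|M. cos (?S n w)) * (LINT w|M. cos (c n * ?D w)) - (LINT w|M. sin (?S n w)) * (LINT w|M. sin (c n * ?D w))"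
      using indep_var_integrable[OF i1 int(1,3)] indep_var_integrable[OF i2 int(2,4)]
        indep_var_lebesgue_integral[OF i1 int(1,3)] indep_var_lebesgue_integral[OF i2 int(2,4)] by simp
    also have "\<dots> = exp (- (\<delta> / 2 * (\<Sum>l<n. (c l)\<^sup>2))) * exp (- ((c n)\<^sup>2 * \<delta> / 2)) * (LINT w|M. cos (Y w))"
      using centred_normal_law(4,5)[OF law(1), of "c n"] s Suc by simp
    also have "exp (- (\<delta> / 2 * (\<Sum>l<n. (c l)\<^sup>2))) * exp (- ((c n)\<^sup>2 * \<delta> / 2)) = exp (- (\<delta> / 2 * (\<Sum>l<Suc n. (c l)\<^sup>2)))"
      unfolding exp_add[symmetric] by (simp add: algebra_simps)
    finally show ?case .
  qed simp
  moreover have "\<bar>LINT w|M. cos (Y w)\<bar> \<le> 1"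
  proof -
    have "\<bar>LINT w|M. cos (Y w)\<bar> \<le> (LINT w|M. 1)"
      by (rule order_trans[OF integral_abs_bound integral_mono])
        (use measurable_F_M[OF Y] in \<open>auto intro!: integrable_const_bound[where B=1]\<close>)
    then show ?thesis by (simp add: prob_space)
  qed
  ultimately show ?thesis by (simp add: abs_mult mult_left_le)
qed

end

section \<open>One step of the process with the force evaluated along the free flight\<close>

context mckean
begin

text \<open>The solution formula with the noise left out and the force evaluated along the free
  flight \<open>x + damped \<gamma> (z - s) * y\<close>. It is a function of the state at time
  \<open>s\<close> only.\<close>

definition frozen :: "real \<Rightarrow> real \<Rightarrow> real \<Rightarrow> real \<Rightarrow> real" where
  "frozen s h x y = x + damped \<gamma> h * y + integral {s..s + h} (\<lambda>r. exp (- (\<gamma> * (s + h - r))) *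
     integral {s..r} (\<lambda>z. drift z (x + damped \<gamma> (z - s) * y)))"

lemma damped_continuous: "continuous_on A (\<lambda>z. damped \<gamma> (z - s))"
  unfolding damped_def using \<gamma> by (intro continuous_intros) auto

lemma frozen_drift_continuous: "continuous_on {0..} (\<lambda>z. drift z (x + damped \<gamma> (z - s) * y))"
  by (intro continuous_drift continuous_intros damped_continuous)

lemma double_integral_diff:
  assumes s: "0 \<le> s" "0 \<le> h" and f: "continuous_on {0..} f" and f': "continuous_on {0..} f'"
    and C: "\<And>z. s \<le> z \<Longrightarrow> z \<le> s + h \<Longrightarrow> \<bar>f z - f' z\<bar> \<le> C"
  shows "\<bar>integral {s..s + h} (\<lambda>r. exp (- (\<gamma> * (s + h - r))) * integral {s..r} f)
      - integral {s..s + h} (\<lambda>r. exp (- (\<gamma> * (s + h - r))) * integral {s..r} f')\<bar> \<le> C * h\<^sup>2"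
proof -
  let ?E = "\<lambda>r. exp (- (\<gamma> * (s + h - r)))"
  have C0: "0 \<le> C" using order_trans[OF abs_ge_zero C[of s]] s by simp
  have cf: "continuous_on {s..a} f" "continuous_on {s..a} f'" for a
    using s by (auto intro: continuous_on_subset[OF f] continuous_on_subset[OF f'])
  have cI: "continuous_on {s..s+h} (\<lambda>r. integral {s..r} f)" "continuous_on {s..s+h} (\<lambda>r. integral {s..r} f')"
    by (intro indefinite_integral_continuous_1 integrable_continuous_real cf)+
  have i: "(\<lambda>r. ?E r * integral {s..r} f) integrable_on {s..s+h}" "(\<lambda>r. ?E r * integral {s..r} f') integrable_on {s..s+h}"
    by (intro integrable_continuous_real continuous_intros cI)+
  have "\<bar>integral {s..s+h} (\<lambda>r. ?E r * integral {s..r} f - ?E r * integral {s..r} f')\<bar> \<le> (C * h) * (s + h - s)"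
  proof (rule integral_abs_le)
    show "continuous_on {s..s+h} (\<lambda>r. ?E r * integral {s..r} f - ?E r * integral {s..r} f')"
      by (intro continuous_intros cI)
    fix r assume r: "s \<le> r" "r \<le> s + h"
    have "integral {s..r} f - integral {s..r} f' = integral {s..r} (\<lambda>z. f z - f' z)"
      by (intro Henstock_Kurzweil_Integration.integral_diff[symmetric] integrable_continuous_real cf)
    moreover have "\<bar>integral {s..r} (\<lambda>z. f z - f' z)\<bar> \<le> C * (r - s)"
      using r C by (intro integral_abs_le continuous_intros cf) auto
    moreover have "C * (r - s) \<le> C * h" using r C0 by (intro mult_left_mono) auto
    ultimately have I: "\<bar>integral {s..r} f - integral {s..r} f'\<bar> \<le> C * h" by linarith
    have "\<bar>?E r * integral {s..r} f - ?E r * integral {s..r} f'\<bar> = ?E r * \<bar>integral {s..r} f - integral {s..r} f'\<bar>"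
      unfolding right_diff_distrib[symmetric] by (simp add: abs_mult)
    also have "\<dots> \<le> 1 * (C * h)" using I r \<gamma> by (intro mult_mono) auto
    finally show "\<bar>?E r * integral {s..r} f - ?E r * integral {s..r} f'\<bar> \<le> C * h" by simp
  qed (use s in auto)
  also have "(C * h) * (s + h - s) = C * h\<^sup>2" by (simp add: power2_eq_square)
  also have "integral {s..s+h} (\<lambda>r. ?E r * integral {s..r} f - ?E r * integral {s..r} f')
    = integral {s..s+h} (\<lambda>r. ?E r * integral {s..r} f) - integral {s..s+h} (\<lambda>r. ?E r * integral {s..r} f')"
    by (rule Henstock_Kurzweil_Integration.integral_diff[OF i])
  finally show ?thesis .
qed

text \<open>Supplies continuity, hence measurability of \<open>frozen\<close> at the random state;
  the constant does not enter the estimates.\<close>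

lemma frozen_lipschitz:
  assumes s: "0 \<le> s" "0 \<le> h" "h \<le> 1"
  shows "\<bar>frozen s h x y - frozen s h x' y'\<bar> \<le> (1 + L) * (\<bar>x - x'\<bar> + \<bar>y - y'\<bar>)"
proof -
  let ?D = "\<bar>x - x'\<bar> + \<bar>y - y'\<bar>"
  have d: "\<bar>(x + damped \<gamma> a * y) - (x' + damped \<gamma> a * y')\<bar> \<le> ?D" if "0 \<le> a" "a \<le> 1" for a
  proof -
    have "(x + damped \<gamma> a * y) - (x' + damped \<gamma> a * y') = (x - x') + damped \<gamma> a * (y - y')" by (simp add: algebra_simps)
    then have "\<bar>(x + damped \<gamma> a * y) - (x' + damped \<gamma> a * y')\<bar> \<le> \<bar>x - x'\<bar> + \<bar>damped \<gamma> a * (y - y')\<bar>" by linarith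
    also have "\<bar>damped \<gamma> a * (y - y')\<bar> \<le> 1 * \<bar>y - y'\<bar>"
      unfolding abs_mult using damped_bounds[OF \<gamma> that(1)] that(2) by (intro mult_right_mono) auto
    finally show ?thesis by simp
  qed
  have "\<bar>integral {s..s + h} (\<lambda>r. exp (- (\<gamma> * (s + h - r))) * integral {s..r} (\<lambda>z. drift z (x + damped \<gamma> (z - s) * y)))
      - integral {s..s + h} (\<lambda>r. exp (- (\<gamma> * (s + h - r))) * integral {s..r} (\<lambda>z. drift z (x' + damped \<gamma> (z - s) * y')))\<bar> \<le> (L * ?D) * h\<^sup>2"
  proof (rule double_integral_diff[OF s(1,2) frozen_drift_continuous frozen_drift_continuous])
    fix z assume z: "s \<le> z" "z \<le> s + h"
    have "\<bar>drift z (x + damped \<gamma> (z - s) * y) - drift z (x' + damped \<gamma> (z - s) * y')\<bar> \<le> L * \<bar>(x + damped \<gamma> (z - s) * y) - (x' + damped \<gamma> (z - s) * y')\<bar>"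
      using s z by (intro drift_lipschitz) auto
    also have "\<dots> \<le> L * ?D" using s z L_nonneg by (intro mult_left_mono d) auto
    finally show "\<bar>drift z (x + damped \<gamma> (z - s) * y) - drift z (x' + damped \<gamma> (z - s) * y')\<bar> \<le> L * ?D" .
  qed
  moreover have "(L * ?D) * h\<^sup>2 \<le> (L * ?D) * 1"
    using s L_nonneg by (intro mult_left_mono mult_nonneg_nonneg) (auto simp: power_le_one)
  moreover have "(1 + L) * ?D = ?D + L * ?D" by (simp add: algebra_simps)
  ultimately show ?thesis using d[OF s(2,3)] unfolding frozen_def by linarith
qed

lemma frozen_measurable:
  assumes s: "0 \<le> s" "0 \<le> h" "h \<le> 1"
  shows "(\<lambda>w. frozen s h (q s w) (p s w)) \<in> borel_measurable (F s)"
proof -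
  have "(2 * (1 + L))-lipschitz_on UNIV (\<lambda>z. frozen s h (fst z) (snd z))"
  proof (rule lipschitz_onI)
    fix z z' :: "real \<times> real"
    have "\<bar>fst z - fst z'\<bar> + \<bar>snd z - snd z'\<bar> \<le> 2 * dist z z'"
      using dist_fst_le[of z z'] dist_snd_le[of z z'] by (simp add: dist_real_def)
    then have "(1 + L) * (\<bar>fst z - fst z'\<bar> + \<bar>snd z - snd z'\<bar>) \<le> (1 + L) * (2 * dist z z')"
      using L_nonneg by (intro mult_left_mono) auto
    also have "(1 + L) * (2 * dist z z') = 2 * (1 + L) * dist z z'" by simp
    finally show "dist (frozen s h (fst z) (snd z)) (frozen s h (fst z') (snd z')) \<le> 2 * (1 + L) * dist z z'"
      unfolding dist_real_def by (rule order_trans[OF frozen_lipschitz[OF s, of "fst z" "snd z" "fst z'" "snd z'"]])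
  qed (use L_nonneg in auto)
  then have 1: "(\<lambda>z. frozen s h (fst z) (snd z)) \<in> borel_measurable borel"
    by (intro borel_measurable_continuous_onI lipschitz_on_continuous_on)
  have 2: "(\<lambda>w. (q s w, p s w)) \<in> borel_measurable (F s)"
    using q_F[OF s(1)] p_F[OF s(1)] by (rule borel_measurable_Pair)
  show ?thesis using measurable_compose[OF 2 1] by simp
qed

text \<open>The true path leaves the free flight by at most \<open>B * h^2\<close> from the force
  plus the integrated size of the noise. Feeding this into the Lipschitz drift and integrating twice
  in time gains another \<open>h^2\<close>.\<close>

lemma frozen_error:
  assumes k: "kinetic_path \<gamma> \<sigma> (\<lambda>r. drift r (q r w)) (\<lambda>r. \<beta> r w) (\<lambda>r. q r w) (\<lambda>r. p r w)"
    and s: "0 \<le> s" "0 \<le> h"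
  shows "\<bar>q (s + h) w - (frozen s h (q s w) (p s w)
      + \<sigma> * integral {s..s + h} (\<lambda>r. exp (- (\<gamma> * (s + h - r))) * (\<beta> r w - \<beta> s w)))\<bar>
    \<le> L * (B * h\<^sup>2 + \<sigma> * integral {s..s + h} (\<lambda>r. \<bar>\<beta> r w - \<beta> s w\<bar>)) * h\<^sup>2"
proof -
  let ?f = "\<lambda>r. drift r (q r w)" and ?f' = "\<lambda>z. drift z (q s w + damped \<gamma> (z - s) * p s w)"
  let ?N = "integral {s..s + h} (\<lambda>r. \<bar>\<beta> r w - \<beta> s w\<bar>)"
  have c: "continuous_on {0..} ?f" "continuous_on {0..} (\<lambda>r. \<beta> r w)" using k by (auto simp: kinetic_path_def)
  have cb: "continuous_on {s..a} (\<lambda>r. \<beta> r w)" for a using s by (auto intro: continuous_on_subset[OF c(2)])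
  have close: "\<bar>q z w - (q s w + damped \<gamma> (z - s) * p s w)\<bar> \<le> B * h\<^sup>2 + \<sigma> * ?N" if z: "s \<le> z" "z \<le> s + h" for z
  proof -
    let ?E = "\<lambda>r. exp (- (\<gamma> * (z - r)))"
    have e: "q z w - (q s w + damped \<gamma> (z - s) * p s w) = integral {s..z} (\<lambda>r. ?E r * integral {s..r} ?f)
       + \<sigma> * integral {s..z} (\<lambda>r. ?E r * (\<beta> r w - \<beta> s w))"
      using kinetic_path_solution[OF k \<gamma> s(1) z(1)] by simp
    have "\<bar>integral {s..z} (\<lambda>r. ?E r * integral {s..r} ?f)\<bar> \<le> B * (z - s)\<^sup>2"
      using double_integral_diff[OF s(1), of "z - s" ?f "\<lambda>_. 0" B] z s c drift_bound by simp
    also have "\<dots> \<le> B * h\<^sup>2" using z B_nonneg by (intro mult_left_mono power_mono) auto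
    finally have 1: "\<bar>integral {s..z} (\<lambda>r. ?E r * integral {s..r} ?f)\<bar> \<le> B * h\<^sup>2" .
    have ii: "(\<lambda>r. \<bar>\<beta> r w - \<beta> s w\<bar>) integrable_on {s..a}" for a
      by (intro integrable_continuous_real continuous_intros cb)
    have "\<bar>integral {s..z} (\<lambda>r. ?E r * (\<beta> r w - \<beta> s w))\<bar> \<le> integral {s..z} (\<lambda>r. \<bar>\<beta> r w - \<beta> s w\<bar>)"
    proof (rule integral_norm_bound_integral[of "\<lambda>r. ?E r * (\<beta> r w - \<beta> s w)" "{s..z}" "\<lambda>r. \<bar>\<beta> r w - \<beta> s w\<bar>", unfolded real_norm_def])
      show "(\<lambda>r. ?E r * (\<beta> r w - \<beta> s w)) integrable_on {s..z}"
        by (intro integrable_continuous_real continuous_intros cb)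
      show "\<bar>?E r * (\<beta> r w - \<beta> s w)\<bar> \<le> \<bar>\<beta> r w - \<beta> s w\<bar>" if "r \<in> {s..z}" for r
        using that \<gamma> by (auto simp: abs_mult intro!: mult_left_le_one_le)
    qed (rule ii)
    also have "\<dots> \<le> ?N" using z ii by (intro integral_subset_le) auto
    finally have "\<sigma> * \<bar>integral {s..z} (\<lambda>r. ?E r * (\<beta> r w - \<beta> s w))\<bar> \<le> \<sigma> * ?N"
      using \<sigma> by (intro mult_left_mono) auto
    moreover have "\<bar>\<sigma> * integral {s..z} (\<lambda>r. ?E r * (\<beta> r w - \<beta> s w))\<bar> = \<sigma> * \<bar>integral {s..z} (\<lambda>r. ?E r * (\<beta> r w - \<beta> s w))\<bar>"
      using \<sigma> by (simp add: abs_mult)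
    ultimately show ?thesis using 1 unfolding e by linarith
  qed
  have "\<bar>integral {s..s + h} (\<lambda>r. exp (- (\<gamma> * (s + h - r))) * integral {s..r} ?f)
      - integral {s..s + h} (\<lambda>r. exp (- (\<gamma> * (s + h - r))) * integral {s..r} ?f')\<bar> \<le> L * (B * h\<^sup>2 + \<sigma> * ?N) * h\<^sup>2"
  proof (rule double_integral_diff[OF s c(1) frozen_drift_continuous])
    fix z assume z: "s \<le> z" "z \<le> s + h"
    have "\<bar>?f z - ?f' z\<bar> \<le> L * \<bar>q z w - (q s w + damped \<gamma> (z - s) * p s w)\<bar>" using s z by (intro drift_lipschitz) auto
    also have "\<dots> \<le> L * (B * h\<^sup>2 + \<sigma> * ?N)" using close[OF z] L_nonneg by (intro mult_left_mono)
    finally show "\<bar>?f z - ?f' z\<bar> \<le> L * (B * h\<^sup>2 + \<sigma> * ?N)" .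
  qed
  moreover have "s \<le> s + h" using s by simp
  note kinetic_path_solution[OF k \<gamma> s(1) this]
  ultimately show ?thesis unfolding frozen_def by simp
qed

end

lemma abs_cos_diff_le: "\<bar>cos x - cos y\<bar> \<le> \<bar>x - y\<bar>" for x y :: real
proof -
  have "norm (cos x - cos y) \<le> 1 * norm (x - y)"
    by (rule field_differentiable_bound[of UNIV _ "\<lambda>x. - sin x"]) (auto intro!: derivative_eq_intros)
  then show ?thesis by simp
qed

lemma sum_by_parts_swap:
  fixes w d :: "nat \<Rightarrow> real"
  shows "(\<Sum>j<n. w j * (\<Sum>l<j. d l)) = (\<Sum>l<n. (\<Sum>j\<in>{Suc l..<n}. w j) * d l)"
proof (induction n)
  case (Suc n)
  have "(\<Sum>l<Suc n. (\<Sum>j\<in>{Suc l..<Suc n}. w j) * d l) = (\<Sum>l<n. ((\<Sum>j\<in>{Suc l..<n}. w j) + w n) * d l)"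
    by (auto intro!: sum.cong simp: sum.atLeastLessThan_Suc)
  also have "\<dots> = (\<Sum>l<n. (\<Sum>j\<in>{Suc l..<n}. w j) * d l) + w n * (\<Sum>l<n. d l)"
    by (simp add: distrib_right sum.distrib sum_distrib_left)
  finally show ?case using Suc by simp
qed simp

text \<open>The discrete form of the \<open>h^3\<close> law for the variance of an integrated
  Brownian motion.\<close>

lemma sum_squares_ge:
  assumes "2 \<le> n"
  shows "real n ^ 3 / 8 \<le> (\<Sum>l<n. (real (n - Suc l))\<^sup>2)"
proof -
  have sq: "(\<Sum>i<n. (real i)\<^sup>2) = real n * ((real n - 1) * (2 * real n - 1)) / 6" for n
    by (induction n) (auto simp: field_simps power2_eq_square)
  have "(real n / 2) * (3 * real n / 2) \<le> (real n - 1) * (2 * real n - 1)"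
    using assms by (intro mult_mono) auto
  then have "real n * ((real n / 2) * (3 * real n / 2)) / 6 \<le> real n * ((real n - 1) * (2 * real n - 1)) / 6"
    by (intro divide_right_mono mult_left_mono) auto
  also have "\<dots> = (\<Sum>l<n. (real (n - Suc l))\<^sup>2)"
    unfolding sq[symmetric] by (rule sum.nat_diff_reindex[symmetric])
  finally show ?thesis by (simp add: power3_eq_cube)
qed

section \<open>Decay of the Fourier coefficients of the law\<close>

context mckean
begin

text \<open>Riemann sum of the noise integral in \<open>kinetic_path_solution\<close>. Unlike the
  integral it is a finite combination of increments, whose characteristic function is
  explicit.\<close>

definition noise_sum :: "real \<Rightarrow> real \<Rightarrow> nat \<Rightarrow> 'a \<Rightarrow> real" where
  "noise_sum s h m \<omega> = h / real (Suc m) * (\<Sum>j<Suc m. exp (- (\<gamma> * (s + h - (s + real j * (h / real (Suc m)))))) *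
      (\<beta> (s + real j * (h / real (Suc m))) \<omega> - \<beta> s \<omega>))"

definition noise_abs :: "real \<Rightarrow> real \<Rightarrow> nat \<Rightarrow> 'a \<Rightarrow> real" where
  "noise_abs s h m \<omega> = h / real (Suc m) * (\<Sum>j<Suc m. \<bar>\<beta> (s + real j * (h / real (Suc m))) \<omega> - \<beta> s \<omega>\<bar>)"

lemma noise_incr_M:
  assumes "0 \<le> s" "0 \<le> h"
  shows "(\<lambda>\<omega>. \<beta> (s + real j * (h / real (Suc m))) \<omega> - \<beta> s \<omega>) \<in> borel_measurable M"
  using incr_F[OF brownian_incr[OF brownian], of s "s + real j * (h / real (Suc m))"] assms measurable_F_M by auto

text \<open>Summation by parts gives the increment number \<open>l\<close> the total weight of the
  grid points after it, at least \<open>u * (n - 1 - l)\<close>. The sum of squares is then of order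
  \<open>n^3\<close>, which with step \<open>h / n\<close> yields variance of order
  \<open>h^3\<close>, uniformly in the mesh.\<close>

lemma noise_sum_cos:
  assumes s: "0 \<le> s" "0 < h" "h \<le> 1" and m: "1 \<le> m" and \<kappa>: "0 \<le> \<kappa>" and A: "A \<in> borel_measurable (F s)"
  shows "\<bar>LINT \<omega>|M. cos (A \<omega> + \<kappa> * \<sigma> * noise_sum s h m \<omega>)\<bar> \<le> exp (- ((\<kappa> * \<sigma> * exp (- \<gamma>))\<^sup>2 * h ^ 3 / 16))"
proof -
  define n where "n = Suc m"
  define \<delta> where "\<delta> = h / real n"
  have n: "2 \<le> n" using m by (simp add: n_def)
  have d: "0 < \<delta>" "\<delta> * real n = h" using s n by (auto simp: \<delta>_def)
  define w where "w j = \<kappa> * \<sigma> * \<delta> * exp (- (\<gamma> * (s + h - (s + real j * \<delta>))))" for j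
  define c where "c l = (\<Sum>j\<in>{Suc l..<n}. w j)" for l
  have tel: "\<beta> (s + real j * \<delta>) \<omega> - \<beta> s \<omega> = (\<Sum>l<j. increments s \<delta> l \<omega>)" for j \<omega>
    unfolding increments_def using sum_lessThan_telescope[of "\<lambda>l. \<beta> (s + real l * \<delta>) \<omega>" j] by simp
  have "\<kappa> * \<sigma> * noise_sum s h m \<omega> = (\<Sum>l<n. c l * increments s \<delta> l \<omega>)" for \<omega>
  proof -
    have "\<kappa> * \<sigma> * noise_sum s h m \<omega> = (\<Sum>j<n. w j * (\<beta> (s + real j * \<delta>) \<omega> - \<beta> s \<omega>))"
      unfolding noise_sum_def n_def[symmetric] \<delta>_def[symmetric] w_def by (simp add: sum_distrib_left mult.assoc)
    also have "\<dots> = (\<Sum>l<n. c l * increments s \<delta> l \<omega>)" unfolding tel c_def by (rule sum_by_parts_swap)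
    finally show ?thesis .
  qed
  then have "\<bar>LINT \<omega>|M. cos (A \<omega> + \<kappa> * \<sigma> * noise_sum s h m \<omega>)\<bar> \<le> exp (- (\<delta> / 2 * (\<Sum>l<n. (c l)\<^sup>2)))"
    using cos_shifted_by_increments[OF s(1) d(1) A, where n=n and c=c] by simp
  also have "\<dots> \<le> exp (- ((\<kappa> * \<sigma> * exp (- \<gamma>))\<^sup>2 * h ^ 3 / 16))"
  proof -
    define u where "u = \<kappa> * \<sigma> * \<delta> * exp (- \<gamma>)"
    have u0: "0 \<le> u" using \<kappa> \<sigma> d by (simp add: u_def)
    have w: "u \<le> w j" if "j < n" for j
    proof -
      have "h - real j * \<delta> \<le> 1" using s d by (smt (verit) mult_nonneg_nonneg of_nat_0_le_iff)
      then have "\<gamma> * (s + h - (s + real j * \<delta>)) \<le> \<gamma> * 1" using \<gamma> by (intro mult_left_mono) auto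
      then show ?thesis unfolding u_def w_def using \<kappa> \<sigma> d by (intro mult_left_mono) auto
    qed
    have cl: "(u * real (n - Suc l))\<^sup>2 \<le> (c l)\<^sup>2" for l
    proof -
      have "(\<Sum>j\<in>{Suc l..<n}. u) \<le> c l" unfolding c_def using w by (intro sum_mono) auto
      then show ?thesis using u0 by (intro power_mono) (auto simp: mult.commute)
    qed
    have "u\<^sup>2 * (real n ^ 3 / 8) \<le> u\<^sup>2 * (\<Sum>l<n. (real (n - Suc l))\<^sup>2)" using sum_squares_ge[OF n] by (intro mult_left_mono) auto
    also have "\<dots> \<le> (\<Sum>l<n. (c l)\<^sup>2)"
      unfolding sum_distrib_left using cl by (intro sum_mono) (simp only: power_mult_distrib)
    finally have "\<delta> / 2 * (u\<^sup>2 * (real n ^ 3 / 8)) \<le> \<delta> / 2 * (\<Sum>l<n. (c l)\<^sup>2)" using d by (intro mult_left_mono) auto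
    moreover have "\<delta> / 2 * (u\<^sup>2 * (real n ^ 3 / 8)) = (\<kappa> * \<sigma> * exp (- \<gamma>))\<^sup>2 * h ^ 3 / 16"
      unfolding u_def d(2)[symmetric] by (simp add: power_mult_distrib power2_eq_square power3_eq_cube)
    ultimately show ?thesis by (simp only: exp_le_cancel_iff neg_le_iff_le)
  qed
  finally show ?thesis .
qed

lemma noise_abs_expectation:
  assumes s: "0 \<le> s" "0 < h"
  shows "integrable M (noise_abs s h m)" "(LINT \<omega>|M. noise_abs s h m \<omega>) \<le> h * sqrt h" "0 \<le> noise_abs s h m \<omega>"
proof -
  define \<delta> where "\<delta> = h / real (Suc m)"
  have d: "0 < \<delta>" "\<delta> * real (Suc m) = h" using s by (auto simp: \<delta>_def)
  have L: "L2 M (\<lambda>\<omega>. \<beta> (s + real j * \<delta>) \<omega> - \<beta> s \<omega>)" for j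
    using incr_L2[OF brownian_incr[OF brownian], of s "s + real j * \<delta>"] s d by auto
  have i: "integrable M (\<lambda>\<omega>. \<bar>\<beta> (s + real j * \<delta>) \<omega> - \<beta> s \<omega>\<bar>)" for j
    using L2_integrable[OF L] by (rule integrable_abs)
  have E: "(LINT \<omega>|M. \<bar>\<beta> (s + real j * \<delta>) \<omega> - \<beta> s \<omega>\<bar>) \<le> sqrt h" if "j < Suc m" for j
  proof -
    have jd: "real j * \<delta> \<le> h" using that d mult_right_mono[of "real j" "real (Suc m)" \<delta>] by (simp add: mult.commute)
    have "(LINT \<omega>|M. (\<beta> (s + real j * \<delta>) \<omega> - \<beta> s \<omega>)\<^sup>2) = real j * \<delta>"
    proof (cases "j = 0")
      case False
      then have "s < s + real j * \<delta>" using d by simp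
      then have "has_law M (\<lambda>\<omega>. \<beta> (s + real j * \<delta>) \<omega> - \<beta> s \<omega>) (centred_normal (s + real j * \<delta> - s))"
        using brownian s unfolding brownian_motion_def by blast
      from centred_normal_law(3)[OF this] show ?thesis using d by simp
    qed simp
    then have "(LINT \<omega>|M. \<bar>\<beta> (s + real j * \<delta>) \<omega> - \<beta> s \<omega>\<bar>) \<le> sqrt (real j * \<delta>)" using L1_le_L2[OF L, of j] by simp
    also have "\<dots> \<le> sqrt h" using jd by simp
    finally show ?thesis .
  qed
  have e: "noise_abs s h m = (\<lambda>\<omega>. \<delta> * (\<Sum>j<Suc m. \<bar>\<beta> (s + real j * \<delta>) \<omega> - \<beta> s \<omega>\<bar>))"
    by (simp only: fun_eq_iff noise_abs_def \<delta>_def simp_thms)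
  show "integrable M (noise_abs s h m)" unfolding e using i by (intro integrable_mult_right Bochner_Integration.integrable_sum)
  have "(LINT \<omega>|M. noise_abs s h m \<omega>) = \<delta> * (\<Sum>j<Suc m. LINT \<omega>|M. \<bar>\<beta> (s + real j * \<delta>) \<omega> - \<beta> s \<omega>\<bar>)"
    unfolding e using i by (subst integral_mult_right_zero, subst Bochner_Integration.integral_sum) auto
  also have "\<dots> \<le> \<delta> * (\<Sum>j<Suc m. sqrt h)" using E d by (intro mult_left_mono sum_mono) auto
  also have "\<dots> = h * sqrt h" using d(2) by (simp only: sum_constant card_lessThan mult.assoc[symmetric])
  finally show "(LINT \<omega>|M. noise_abs s h m \<omega>) \<le> h * sqrt h" .
  show "0 \<le> noise_abs s h m \<omega>" unfolding noise_abs_def using s by (intro mult_nonneg_nonneg sum_nonneg) auto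
qed

text \<open>Of the process on \<open>[s, s + h]\<close> the part \<open>frozen\<close> is known at time \<open>s\<close>, the noise has variance of order
  \<open>h\<^sup>3\<close>, and the remaining error is of order \<open>h\<^bsup>7/2\<^esup>\<close>. Taking \<open>h\<close> of order \<open>k\<^bsup>-3/5\<^esup>\<close> makes the
  \<open>k\<close>-th Fourier coefficient of the law summable.\<close>

lemma char_bound:
  assumes s: "0 \<le> s" "0 < h" "h \<le> 1" and \<kappa>: "0 \<le> \<kappa>"
  shows "\<bar>LINT \<omega>|M. cos (\<kappa> * q (s + h) \<omega> + \<phi>)\<bar> \<le>
    exp (- ((\<kappa> * \<sigma> * exp (- \<gamma>))\<^sup>2 * h ^ 3 / 16)) + \<kappa> * L * (B + \<sigma>) * h ^ 3 * sqrt h"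
proof -
  define A where "A \<omega> = \<kappa> * frozen s h (q s \<omega>) (p s \<omega>) + \<phi>" for \<omega>
  have AF: "A \<in> borel_measurable (F s)"
    unfolding A_def[abs_def] using frozen_measurable[of s h] s by (intro borel_measurable_add borel_measurable_times) auto
  define K where "K = \<kappa> * L * h\<^sup>2"
  have K: "0 \<le> K" using \<kappa> L_nonneg by (simp add: K_def)
  let ?C = "\<lambda>\<omega>. cos (\<kappa> * q (s + h) \<omega> + \<phi>)"
  let ?D = "\<lambda>m \<omega>. cos (A \<omega> + \<kappa> * \<sigma> * noise_sum s h m \<omega>)"
  \<comment> \<open>The excess over the expected error bound, cut at 0. It is bounded by 2 and
    vanishes almost surely as the mesh is refined, so dominated convergence applies to it, while
    \<open>noise_abs\<close> itself need only have a bounded mean.\<close>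
  define Y where "Y m \<omega> = max 0 (\<bar>?C \<omega> - ?D m \<omega>\<bar> - K * (B * h\<^sup>2 + \<sigma> * noise_abs s h m \<omega>))" for m \<omega>
  have qm[measurable]: "q (s + h) \<in> borel_measurable M" using q_M s by simp
  have Am[measurable]: "A \<in> borel_measurable M" using measurable_F_M[OF AF] .
  have nm[measurable]: "noise_sum s h m \<in> borel_measurable M" for m
    unfolding noise_sum_def[abs_def] using s by (intro borel_measurable_times borel_measurable_sum noise_incr_M) auto
  have nam[measurable]: "noise_abs s h m \<in> borel_measurable M" for m
    using noise_abs_expectation(1)[OF s(1,2)] by auto
  have Ym[measurable]: "Y m \<in> borel_measurable M" for m unfolding Y_def by measurable
  have Y2: "\<bar>Y m \<omega>\<bar> \<le> 2" for m \<omega>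
  proof -
    have "0 \<le> K * (B * h\<^sup>2 + \<sigma> * noise_abs s h m \<omega>)"
      using K B_nonneg \<sigma> noise_abs_expectation(3)[OF s(1,2)] by (intro mult_nonneg_nonneg add_nonneg_nonneg) auto
    moreover have "\<bar>?C \<omega> - ?D m \<omega>\<bar> \<le> 2" using abs_cos_le_one[of "\<kappa> * q (s + h) \<omega> + \<phi>"] abs_cos_le_one[of "A \<omega> + \<kappa> * \<sigma> * noise_sum s h m \<omega>"] by linarith
    ultimately show ?thesis by (auto simp: Y_def)
  qed
  have Yi: "integrable M (Y m)" for m using Y2 by (intro integrable_const_bound[where B=2]) auto
  have "AE \<omega> in M. (\<lambda>m. Y m \<omega>) \<longlonglongrightarrow> 0"
    using path_AE
  proof eventually_elim
    case (elim \<omega>)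
    let ?E = "\<lambda>r. exp (- (\<gamma> * (s + h - r))) * (\<beta> r \<omega> - \<beta> s \<omega>)"
    let ?\<eta> = "integral {s..s + h} ?E" and ?N = "integral {s..s + h} (\<lambda>r. \<bar>\<beta> r \<omega> - \<beta> s \<omega>\<bar>)"
    have cb: "continuous_on {s..s + h} (\<lambda>r. \<beta> r \<omega>)"
      using elim s by (auto simp: kinetic_path_def elim!: continuous_on_subset)
    have l1: "(\<lambda>m. noise_sum s h m \<omega>) \<longlonglongrightarrow> ?\<eta>"
      unfolding noise_sum_def using s by (intro left_riemann_sum_tendsto[of h s ?E] continuous_intros cb) auto
    have l2: "(\<lambda>m. noise_abs s h m \<omega>) \<longlonglongrightarrow> ?N"
      unfolding noise_abs_def using s by (intro left_riemann_sum_tendsto[of h s "\<lambda>r. \<bar>\<beta> r \<omega> - \<beta> s \<omega>\<bar>"] continuous_intros cb) auto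
    have b: "Y m \<omega> \<le> \<kappa> * \<sigma> * \<bar>?\<eta> - noise_sum s h m \<omega>\<bar> + K * \<sigma> * \<bar>?N - noise_abs s h m \<omega>\<bar>" for m
    proof -
      have "\<bar>?C \<omega> - ?D m \<omega>\<bar> \<le> \<bar>(\<kappa> * q (s + h) \<omega> + \<phi>) - (A \<omega> + \<kappa> * \<sigma> * noise_sum s h m \<omega>)\<bar>" by (rule abs_cos_diff_le)
      also have "(\<kappa> * q (s + h) \<omega> + \<phi>) - (A \<omega> + \<kappa> * \<sigma> * noise_sum s h m \<omega>) =
         \<kappa> * (q (s + h) \<omega> - (frozen s h (q s \<omega>) (p s \<omega>) + \<sigma> * ?\<eta>)) + \<kappa> * \<sigma> * (?\<eta> - noise_sum s h m \<omega>)"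
        by (simp add: A_def algebra_simps)
      also have "\<bar>\<dots>\<bar> \<le> \<kappa> * \<bar>q (s + h) \<omega> - (frozen s h (q s \<omega>) (p s \<omega>) + \<sigma> * ?\<eta>)\<bar> + \<kappa> * \<sigma> * \<bar>?\<eta> - noise_sum s h m \<omega>\<bar>"
        using \<kappa> \<sigma> by (intro order_trans[OF abs_triangle_ineq]) (simp add: abs_mult)
      also have "\<kappa> * \<bar>q (s + h) \<omega> - (frozen s h (q s \<omega>) (p s \<omega>) + \<sigma> * ?\<eta>)\<bar> \<le> \<kappa> * (L * (B * h\<^sup>2 + \<sigma> * ?N) * h\<^sup>2)"
        using frozen_error[OF elim, of s h] s \<kappa> by (intro mult_left_mono) auto
      also have "\<kappa> * (L * (B * h\<^sup>2 + \<sigma> * ?N) * h\<^sup>2) = K * (B * h\<^sup>2 + \<sigma> * noise_abs s h m \<omega>) + K * \<sigma> * (?N - noise_abs s h m \<omega>)"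
        by (simp add: K_def algebra_simps)
      also have "K * \<sigma> * (?N - noise_abs s h m \<omega>) \<le> K * \<sigma> * \<bar>?N - noise_abs s h m \<omega>\<bar>"
        using K \<sigma> by (intro mult_left_mono) auto
      finally have "\<bar>?C \<omega> - ?D m \<omega>\<bar> - K * (B * h\<^sup>2 + \<sigma> * noise_abs s h m \<omega>) \<le> \<kappa> * \<sigma> * \<bar>?\<eta> - noise_sum s h m \<omega>\<bar> + K * \<sigma> * \<bar>?N - noise_abs s h m \<omega>\<bar>"
        by simp
      moreover have "0 \<le> \<kappa> * \<sigma> * \<bar>?\<eta> - noise_sum s h m \<omega>\<bar> + K * \<sigma> * \<bar>?N - noise_abs s h m \<omega>\<bar>"
        using K \<kappa> \<sigma> by auto
      ultimately show ?thesis by (simp add: Y_def)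
    qed
    have "(\<lambda>m. \<kappa> * \<sigma> * \<bar>?\<eta> - noise_sum s h m \<omega>\<bar> + K * \<sigma> * \<bar>?N - noise_abs s h m \<omega>\<bar>) \<longlonglongrightarrow> \<kappa> * \<sigma> * \<bar>?\<eta> - ?\<eta>\<bar> + K * \<sigma> * \<bar>?N - ?N\<bar>"
      by (intro tendsto_intros l1 l2)
    then have "(\<lambda>m. \<kappa> * \<sigma> * \<bar>?\<eta> - noise_sum s h m \<omega>\<bar> + K * \<sigma> * \<bar>?N - noise_abs s h m \<omega>\<bar>) \<longlonglongrightarrow> 0" by simp
    then show ?case
      by (rule Lim_null_comparison[rotated]) (use b in \<open>auto simp: Y_def intro!: always_eventually\<close>)
  qed
  then have Ylim: "(\<lambda>m. LINT \<omega>|M. Y m \<omega>) \<longlonglongrightarrow> (LINT \<omega>|M. 0)"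
    using Y2 by (intro integral_dominated_convergence[where w="\<lambda>_. 2"]) auto
  let ?R = "exp (- ((\<kappa> * \<sigma> * exp (- \<gamma>))\<^sup>2 * h ^ 3 / 16)) + K * (B * h\<^sup>2 + \<sigma> * (h * sqrt h))"
  have main: "\<bar>LINT \<omega>|M. ?C \<omega>\<bar> \<le> ?R + (LINT \<omega>|M. Y m \<omega>)" if m: "1 \<le> m" for m
  proof -
    have Ci: "integrable M ?C" and Di: "integrable M (?D m)" by (auto intro!: integrable_const_bound[where B=1])
    note ni = noise_abs_expectation(1)[OF s(1,2), of m]
    have "\<bar>(LINT \<omega>|M. ?C \<omega>) - (LINT \<omega>|M. ?D m \<omega>)\<bar> = \<bar>LINT \<omega>|M. ?C \<omega> - ?D m \<omega>\<bar>" using Ci Di by simp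
    also have "\<dots> \<le> (LINT \<omega>|M. \<bar>?C \<omega> - ?D m \<omega>\<bar>)" by (rule integral_abs_bound)
    also have "\<dots> \<le> (LINT \<omega>|M. K * (B * h\<^sup>2 + \<sigma> * noise_abs s h m \<omega>) + Y m \<omega>)"
    proof (rule integral_mono)
      show "integrable M (\<lambda>\<omega>. K * (B * h\<^sup>2 + \<sigma> * noise_abs s h m \<omega>) + Y m \<omega>)"
        using ni Yi by (intro Bochner_Integration.integrable_add integrable_mult_right) auto
      show "\<bar>?C \<omega> - ?D m \<omega>\<bar> \<le> K * (B * h\<^sup>2 + \<sigma> * noise_abs s h m \<omega>) + Y m \<omega>" for \<omega>
        unfolding Y_def by linarith
    qed (use Ci Di in auto)
    also have "\<dots> = K * (B * h\<^sup>2 + \<sigma> * (LINT \<omega>|M. noise_abs s h m \<omega>)) + (LINT \<omega>|M. Y m \<omega>)"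
      using ni Yi by (simp add: prob_space)
    also have "\<dots> \<le> K * (B * h\<^sup>2 + \<sigma> * (h * sqrt h)) + (LINT \<omega>|M. Y m \<omega>)"
      using noise_abs_expectation(2)[OF s(1,2), of m] K \<sigma> by (intro add_right_mono mult_left_mono add_left_mono) auto
    finally show ?thesis using noise_sum_cos[OF s m \<kappa> AF] by linarith
  qed
  have "(\<lambda>m. ?R + (LINT \<omega>|M. Y m \<omega>)) \<longlonglongrightarrow> ?R + (LINT \<omega>|M. 0)" by (intro tendsto_intros Ylim)
  then have "\<bar>LINT \<omega>|M. ?C \<omega>\<bar> \<le> ?R"
    using main by (intro tendsto_lowerbound[where F=sequentially and a="\<bar>LINT \<omega>|M. ?C \<omega>\<bar>"]) (auto simp: eventually_sequentially intro!: exI[of _ 1])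
  moreover have "K * (B * h\<^sup>2 + \<sigma> * (h * sqrt h)) \<le> \<kappa> * L * (B + \<sigma>) * h ^ 3 * sqrt h"
  proof -
    have "h * h \<le> h * sqrt h" using s by (intro mult_left_mono real_le_rsqrt) (auto simp: power2_eq_square mult_left_le)
    then have "B * h\<^sup>2 + \<sigma> * (h * sqrt h) \<le> B * (h * sqrt h) + \<sigma> * (h * sqrt h)"
      using B_nonneg by (intro add_right_mono mult_left_mono) (auto simp: power2_eq_square)
    then have "K * (B * h\<^sup>2 + \<sigma> * (h * sqrt h)) \<le> K * (B * (h * sqrt h) + \<sigma> * (h * sqrt h))" using K by (intro mult_left_mono)
    also have "\<dots> = \<kappa> * L * (B + \<sigma>) * h ^ 3 * sqrt h" by (simp add: K_def power2_eq_square power3_eq_cube algebra_simps)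
    finally show ?thesis .
  qed
  ultimately show ?thesis by linarith
qed

end

context mckean
begin

text \<open>Stepping back by \<open>h\<close> from time \<open>t\<close>, the noise term is
  \<open>exp (- a K^2 h^3)\<close> and the remainder \<open>K h^(7/2)\<close>, up to constants. Only
  times at least \<open>t0 > 0\<close> leave room for the step.\<close>

lemma char_decay:
  assumes t0: "0 < t0"
  shows "\<exists>C\<ge>0. \<forall>t\<ge>t0. \<forall>k\<ge>1. \<forall>\<phi>. \<bar>LINT w|M. cos (real k * q t w + \<phi>)\<bar> \<le> C * real k powr (- (11/10))"
proof -
  define h0 where "h0 = min t0 1"
  have h0: "0 < h0" "h0 \<le> 1" "h0 \<le> t0" using t0 by (auto simp: h0_def)
  define a where "a = (\<sigma> * exp (- \<gamma>))\<^sup>2 * h0 ^ 3 / 16"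
  have a: "0 < a" using h0 \<sigma> by (simp add: a_def)
  define b where "b = L * (B + \<sigma>) * h0 ^ 3 * sqrt h0"
  have b: "0 \<le> b" using L_nonneg B_nonneg \<sigma> h0 by (simp add: b_def)
  have "\<bar>LINT w|M. cos (real k * q t w + \<phi>)\<bar> \<le> ((6 / a) ^ 6 + b) * real k powr (- (11/10))"
    if t: "t0 \<le> t" and k: "1 \<le> k" for t k \<phi>
  proof -
    define K where "K = real k"
    have K: "1 \<le> K" using k by (simp add: K_def)
    \<comment> \<open>With \<open>h\<close> of order \<open>K powr (-r)\<close> the exponential
      decays if \<open>r < 2/3\<close>, and the remainder is summable if \<open>r > 4/7\<close>. The
      value \<open>3/5\<close> lies between and gives \<open>K powr (1/5)\<close> in the exponent
      and \<open>K powr (-11/10)\<close> for the remainder.\<close>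
    define h where "h = h0 * K powr (- (3/5))"
    have "K powr (- (3/5)) \<le> K powr 0" using K by (intro powr_mono) auto
    then have h: "0 < h" "h \<le> h0" using h0 K by (auto simp: h_def mult_left_le)
    have s: "0 \<le> t - h" "h \<le> 1" using h h0 t by auto
    have e1: "(K * \<sigma> * exp (- \<gamma>))\<^sup>2 * h ^ 3 / 16 = a * K powr (1/5)"
    proof -
      have "K\<^sup>2 * (K powr (- (3/5))) ^ 3 = K powr (1/5)"
      proof -
        have "K\<^sup>2 * (K powr (- (3/5))) ^ 3 = K powr 2 * K powr (- (9/5))"
          using K by (simp add: powr_power)
        also have "\<dots> = K powr (1/5)" unfolding powr_add[symmetric] by simp
        finally show ?thesis .
      qed
      moreover have "(K * \<sigma> * exp (- \<gamma>))\<^sup>2 * h ^ 3 / 16 = a * (K\<^sup>2 * (K powr (- (3/5))) ^ 3)"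
        by (simp add: h_def a_def power_mult_distrib)
      ultimately show ?thesis by simp
    qed
    have e2: "K * L * (B + \<sigma>) * h ^ 3 * sqrt h = b * K powr (- (11/10))"
    proof -
      have "sqrt (K powr (- (3/5))) = K powr (- (3/10))"
        using K by (simp add: powr_half_sqrt[symmetric] powr_powr)
      moreover have "K * (K powr (- (3/5))) ^ 3 * K powr (- (3/10)) = K powr (- (11/10))"
      proof -
        have "K * (K powr (- (3/5))) ^ 3 * K powr (- (3/10)) = K powr 1 * K powr (- (9/5)) * K powr (- (3/10))"
          using K by (simp add: powr_power)
        also have "\<dots> = K powr (- (11/10))" unfolding powr_add[symmetric] by simp
        finally show ?thesis .
      qed
      moreover have "K * L * (B + \<sigma>) * h ^ 3 * sqrt h = b * (K * (K powr (- (3/5))) ^ 3 * sqrt (K powr (- (3/5))))"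
        by (simp add: h_def b_def power_mult_distrib real_sqrt_mult)
      ultimately show ?thesis by simp
    qed
    have z: "0 < a * K powr (1/5)" using a K by simp
    have "exp (- (a * K powr (1/5))) \<le> (6 / a) ^ 6 * K powr (- (11/10))"
    proof -
      \<comment> \<open>The sixth power gives decay \<open>K powr (-6/5)\<close>, enough for the
        rate \<open>-11/10\<close> of the other term.\<close>
      have "(a * K powr (1/5) / 6) ^ 6 \<le> (1 + a * K powr (1/5) / 6) ^ 6" using z by (intro power_mono) auto
      also have "\<dots> \<le> exp (a * K powr (1/5))" using exp_ge_one_plus_x_over_n_power_n[of 6 "a * K powr (1/5)"] z by simp
      finally have "(a * K powr (1/5) / 6) ^ 6 \<le> exp (a * K powr (1/5))" .
      moreover have "0 < (a * K powr (1/5) / 6) ^ 6" using z by (intro zero_less_power) simp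
      ultimately have "exp (- (a * K powr (1/5))) \<le> 1 / (a * K powr (1/5) / 6) ^ 6"
        unfolding exp_minus inverse_eq_divide by (intro divide_left_mono mult_pos_pos) auto
      also have "\<dots> = (6 / a) ^ 6 * K powr (- (6/5))"
      proof -
        have "(K powr (1/5)) ^ 6 = K powr (6/5)" using K by (simp add: powr_power)
        then show ?thesis by (simp add: power_mult_distrib power_divide powr_minus field_simps)
      qed
      also have "\<dots> \<le> (6 / a) ^ 6 * K powr (- (11/10))" using K a by (intro mult_left_mono powr_mono) auto
      finally show ?thesis .
    qed
    then show ?thesis
      using char_bound[OF s(1) h(1) s(2), of K \<phi>] K unfolding e1 e2 by (simp add: K_def distrib_right)
  qed
  moreover have "0 \<le> (6 / a) ^ 6 + b" using a b by simp
  ultimately show ?thesis by blast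
qed

lemma law_holder:
  assumes "0 < t0"
  shows "\<exists>C\<ge>0. \<forall>t\<ge>t0. \<forall>\<epsilon> x y. 0 < \<epsilon> \<and> \<epsilon> \<le> 2 \<longrightarrow>
    \<bar>(LINT w|M. vm \<epsilon> (x - q t w)) - (LINT w|M. vm \<epsilon> (y - q t w))\<bar> \<le> C * \<bar>x - y\<bar> powr (1/20)"
proof -
  obtain C where C: "0 \<le> C" "\<And>t k \<phi>. t0 \<le> t \<Longrightarrow> 1 \<le> k \<Longrightarrow> \<bar>LINT w|M. cos (real k * q t w + \<phi>)\<bar> \<le> C * real k powr (- (11/10))"
    using char_decay[OF assms] by blast
  have "\<bar>(LINT w|M. vm \<epsilon> (x - q t w)) - (LINT w|M. vm \<epsilon> (y - q t w))\<bar> \<le> C * holder_const * \<bar>x - y\<bar> powr (1/20)"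
    if "t0 \<le> t" "0 < \<epsilon>" "\<epsilon> \<le> 2" for t \<epsilon> x y
    using that assms by (intro vm_holder q_M C) auto
  moreover have "0 \<le> C * holder_const" using C holder_const_nonneg by simp
  ultimately show ?thesis by blast
qed

end

section \<open>Euler chains\<close>

lemma discrete_gronwall:
  fixes E c :: "nat \<Rightarrow> real"
  assumes E0: "E 0 \<le> 0" and step: "\<And>k. k < m \<Longrightarrow> E (Suc k) \<le> (1 + \<eta> * K) * E k + \<eta> * c k"
    and c: "\<And>k. 0 \<le> c k" and n: "0 \<le> \<eta>" "0 \<le> K" and k: "k \<le> m"
  shows "E k \<le> exp (K * (real m * \<eta>)) * (\<eta> * (\<Sum>j<m. c j))"
proof -
  have "E k \<le> exp (K * (real k * \<eta>)) * (\<eta> * (\<Sum>j<k. c j))" using k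
  proof (induction k)
    case 0 then show ?case using E0 by simp
  next
    case (Suc k)
    let ?S = "\<eta> * (\<Sum>j<k. c j)"
    have S: "0 \<le> ?S" using n c by (intro mult_nonneg_nonneg sum_nonneg) auto
    have le: "1 + \<eta> * K \<le> exp (\<eta> * K)" by (rule exp_ge_add_one_self)
    have ex: "exp (K * (real (Suc k) * \<eta>)) = exp (\<eta> * K) * exp (K * (real k * \<eta>))"
      unfolding exp_add[symmetric] by (simp add: algebra_simps)
    have "E (Suc k) \<le> (1 + \<eta> * K) * E k + \<eta> * c k" using step Suc.prems by simp
    also have "(1 + \<eta> * K) * E k \<le> (1 + \<eta> * K) * (exp (K * (real k * \<eta>)) * ?S)"
      using Suc n by (intro mult_left_mono) auto
    also have "\<dots> \<le> exp (\<eta> * K) * (exp (K * (real k * \<eta>)) * ?S)" using le S by (intro mult_right_mono) auto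
    also have "\<dots> = exp (K * (real (Suc k) * \<eta>)) * ?S" unfolding ex by simp
    also have "\<eta> * c k \<le> exp (K * (real (Suc k) * \<eta>)) * (\<eta> * c k)"
      using n c[of k] mult_right_mono[of 1 "exp (K * (real (Suc k) * \<eta>))" "\<eta> * c k"] by simp
    finally show ?case by (simp add: distrib_left)
  qed
  also have "\<dots> \<le> exp (K * (real m * \<eta>)) * (\<eta> * (\<Sum>j<m. c j))"
    using k n c by (intro mult_mono mult_left_mono mult_right_mono sum_mono2 mult_nonneg_nonneg sum_nonneg) (auto intro!: mult_left_mono mult_right_mono)
  finally show ?thesis .
qed

definition euler_step :: "real \<Rightarrow> real \<Rightarrow> real \<Rightarrow> (real \<Rightarrow> real) \<Rightarrow> real \<times> real \<Rightarrow> real \<Rightarrow> real \<times> real" where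
  "euler_step \<gamma> \<sigma> \<eta> G z d = (fst z + \<eta> * (snd z - \<gamma> * fst z), snd z + \<eta> * G (fst z) + \<sigma> * d)"

text \<open>The chain carries the position and \<open>p + \<gamma> q\<close>, on which friction does not act. It starts from the
  representative in \<open>[-\<pi>, \<pi>)\<close>, so that its law depends on the initial data only through the phase law.\<close>

primrec euler :: "real \<Rightarrow> real \<Rightarrow> (nat \<Rightarrow> real \<Rightarrow> real) \<Rightarrow> real \<Rightarrow> real \<Rightarrow> (real \<Rightarrow> real) \<Rightarrow> real \<times> real \<Rightarrow> nat \<Rightarrow> real \<times> real" where
  "euler \<gamma> \<sigma> G s \<eta> \<beta> z 0 = (wrap (fst z), snd z + \<gamma> * wrap (fst z))"
| "euler \<gamma> \<sigma> G s \<eta> \<beta> z (Suc k) = euler_step \<gamma> \<sigma> \<eta> (G k) (euler \<gamma> \<sigma> G s \<eta> \<beta> z k) (\<beta> (s + real (Suc k) * \<eta>) - \<beta> (s + real k * \<eta>))"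

text \<open>Positions are compared after the lattice shift \<open>c\<close>, since the chain starts
  from the wrapped representative. The growth rate \<open>1 + \<gamma>\<close> comes from the linear
  part, \<open>w\<close> is the oscillation of the path over one step, and the force mismatch is
  kept explicit for a later Gronwall argument.\<close>

lemma euler_error_step:
  fixes G :: "nat \<Rightarrow> real \<Rightarrow> real" and k :: nat
  assumes k: "kinetic_path \<gamma> \<sigma> f \<beta> q p" and g: "0 \<le> \<gamma>" and s: "0 \<le> s" "0 \<le> \<eta>"
  defines "T \<equiv> \<lambda>k. s + real k * \<eta>"
  defines "X \<equiv> \<lambda>k. euler \<gamma> \<sigma> G s \<eta> \<beta> (q s, p s) k"
  defines "c \<equiv> q s - wrap (q s)"
  defines "E \<equiv> \<lambda>k. \<bar>(q (T k) - c) - fst (X k)\<bar> + \<bar>(p (T k) + \<gamma> * (q (T k) - c)) - snd (X k)\<bar>"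
  assumes w: "\<And>r. T k \<le> r \<Longrightarrow> r \<le> T (Suc k) \<Longrightarrow> \<bar>p r - p (T k)\<bar> \<le> w \<and> \<bar>f r - f (T k)\<bar> \<le> w"
  shows "E 0 = 0" "E (Suc k) \<le> (1 + \<eta> * (1 + \<gamma>)) * E k + \<eta> * (2 * w + \<bar>f (T k) - G k (fst (X k))\<bar>)"
proof -
  show "E 0 = 0" by (simp add: E_def X_def T_def c_def)
  have T: "0 \<le> T k" "T k \<le> T (Suc k)" "T (Suc k) - T k = \<eta>" using s by (auto simp: T_def algebra_simps)
  have cf: "continuous_on {T k..T (Suc k)} p" "continuous_on {T k..T (Suc k)} f"
    using \<open>kinetic_path \<gamma> \<sigma> f \<beta> q p\<close> T(1) unfolding kinetic_path_def by (auto elim!: continuous_on_subset)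
  have split: "\<bar>integral {T k..T (Suc k)} h - \<eta> * a\<bar> \<le> \<eta> * b"
    if h: "continuous_on {T k..T (Suc k)} h" and b: "\<And>r. T k \<le> r \<Longrightarrow> r \<le> T (Suc k) \<Longrightarrow> \<bar>h r - a\<bar> \<le> b" for h :: "real \<Rightarrow> real" and a b
  proof -
    have "integral {T k..T (Suc k)} (\<lambda>r. h r - a) = integral {T k..T (Suc k)} h - integral {T k..T (Suc k)} (\<lambda>_. a)"
      using h by (intro Henstock_Kurzweil_Integration.integral_diff integrable_continuous_real) auto
    then have "integral {T k..T (Suc k)} h - \<eta> * a = integral {T k..T (Suc k)} (\<lambda>r. h r - a)"
      using T by (simp add: mult.commute)
    moreover have "\<bar>integral {T k..T (Suc k)} (\<lambda>r. h r - a)\<bar> \<le> b * (T (Suc k) - T k)"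
      using T b h by (intro integral_abs_le continuous_intros) auto
    ultimately show ?thesis unfolding T(3) by (simp add: mult.commute)
  qed
  let ?eq = "\<lambda>k. (q (T k) - c) - fst (X k)" and ?ev = "\<lambda>k. (p (T k) + \<gamma> * (q (T k) - c)) - snd (X k)"
  have dq: "q (T (Suc k)) - q (T k) = integral {T k..T (Suc k)} p"
    and dv: "(p (T (Suc k)) + \<gamma> * q (T (Suc k))) - (p (T k) + \<gamma> * q (T k)) = integral {T k..T (Suc k)} f + \<sigma> * (\<beta> (T (Suc k)) - \<beta> (T k))"
    using \<open>kinetic_path \<gamma> \<sigma> f \<beta> q p\<close> T(1,2) unfolding kinetic_path_def by auto
  have X: "fst (X (Suc k)) = fst (X k) + \<eta> * (snd (X k) - \<gamma> * fst (X k))"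
    "snd (X (Suc k)) = snd (X k) + \<eta> * G k (fst (X k)) + \<sigma> * (\<beta> (T (Suc k)) - \<beta> (T k))"
    unfolding X_def T_def by (simp_all add: euler_step_def)
  let ?g = "G k (fst (X k))"
  have "?eq (Suc k) = ?eq k + \<eta> * ?ev k - \<eta> * (\<gamma> * ?eq k) + (integral {T k..T (Suc k)} p - \<eta> * p (T k))"
    using dq unfolding X by (simp add: algebra_simps)
  moreover have "\<bar>integral {T k..T (Suc k)} p - \<eta> * p (T k)\<bar> \<le> \<eta> * w" using w by (intro split cf) auto
  moreover have "\<bar>\<eta> * (\<gamma> * ?eq k)\<bar> = \<eta> * (\<gamma> * \<bar>?eq k\<bar>)" "\<bar>\<eta> * ?ev k\<bar> = \<eta> * \<bar>?ev k\<bar>" using g s by (simp_all add: abs_mult)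
  ultimately have 1: "\<bar>?eq (Suc k)\<bar> \<le> \<bar>?eq k\<bar> + \<eta> * \<bar>?ev k\<bar> + \<eta> * (\<gamma> * \<bar>?eq k\<bar>) + \<eta> * w" by linarith
  have "?ev (Suc k) = ?ev k + (integral {T k..T (Suc k)} f - \<eta> * f (T k)) + \<eta> * (f (T k) - ?g)"
    using dv unfolding X by (simp add: algebra_simps)
  moreover have "\<bar>integral {T k..T (Suc k)} f - \<eta> * f (T k)\<bar> \<le> \<eta> * w" using w by (intro split cf) auto
  moreover have "\<bar>\<eta> * (f (T k) - ?g)\<bar> = \<eta> * \<bar>f (T k) - ?g\<bar>" using s by (simp add: abs_mult)
  ultimately have 2: "\<bar>?ev (Suc k)\<bar> \<le> \<bar>?ev k\<bar> + \<eta> * w + \<eta> * \<bar>f (T k) - ?g\<bar>" by linarith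
  have "\<eta> * (\<gamma> * \<bar>?ev k\<bar>) \<ge> 0" "\<eta> * \<bar>?eq k\<bar> \<ge> 0" using g s by auto
  then show "E (Suc k) \<le> (1 + \<eta> * (1 + \<gamma>)) * E k + \<eta> * (2 * w + \<bar>f (T k) - ?g\<bar>)"
    using 1 2 unfolding E_def by (simp add: algebra_simps)
qed

lemma modulus_small:
  fixes h :: "real \<Rightarrow> real"
  assumes h: "continuous_on {0..} h" and e: "0 < e" and s: "0 \<le> s" "0 \<le> u"
  shows "\<exists>m0. \<forall>m\<ge>m0. \<forall>k\<le>m. \<forall>r. s + real k * (u / real (Suc m)) \<le> r \<longrightarrow> r \<le> s + real (Suc k) * (u / real (Suc m)) \<longrightarrow>
    \<bar>h r - h (s + real k * (u / real (Suc m)))\<bar> \<le> e"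
proof -
  have "continuous_on {s..s + u} h" using s by (intro continuous_on_subset[OF h]) auto
  then have "uniformly_continuous_on {s..s + u} h" by (intro compact_uniformly_continuous) auto
  then obtain d where d: "0 < d" "\<forall>x\<in>{s..s + u}. \<forall>y\<in>{s..s + u}. dist y x < d \<longrightarrow> dist (h y) (h x) < e"
    using e unfolding uniformly_continuous_on_def by blast
  have "(\<lambda>n. u / real (Suc n)) \<longlonglongrightarrow> 0" using LIMSEQ_Suc[OF lim_const_over_n[of u]] by simp
  from order_tendstoD(2)[OF this d(1)] obtain N where N: "\<And>n. n \<ge> N \<Longrightarrow> u / real (Suc n) < d"
    by (auto simp: eventually_sequentially)
  show ?thesis
  proof (intro exI[of _ N] allI impI)
    fix m k r assume m: "N \<le> m" and k: "k \<le> m"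
    let ?\<eta> = "u / real (Suc m)"
    assume r: "s + real k * ?\<eta> \<le> r" "r \<le> s + real (Suc k) * ?\<eta>"
    have n0: "0 \<le> ?\<eta>" using s by simp
    have "real (Suc k) * ?\<eta> \<le> real (Suc m) * ?\<eta>" using k n0 by (intro mult_right_mono) auto
    then have top: "s + real (Suc k) * ?\<eta> \<le> s + u" by simp
    have k0: "0 \<le> real k * ?\<eta>" using n0 by (intro mult_nonneg_nonneg) auto
    have sk: "real (Suc k) * ?\<eta> = real k * ?\<eta> + ?\<eta>" by (simp add: distrib_right add_divide_distrib)
    have "dist r (s + real k * ?\<eta>) < d" using r N[OF m] unfolding dist_real_def sk by linarith
    moreover have "r \<in> {s..s + u}" "s + real k * ?\<eta> \<in> {s..s + u}" using r top k0 by auto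
    ultimately have "dist (h r) (h (s + real k * ?\<eta>)) < e" using d(2) by blast
    then show "\<bar>h r - h (s + real k * ?\<eta>)\<bar> \<le> e" by (simp add: dist_real_def)
  qed
qed

section \<open>The law of an Euler chain\<close>

context filtered
begin

lemma indep_pair_distr:
  assumes ind: "indep_set (sets (F s)) (sets (vimage_algebra (space M) D N))"
    and X: "X \<in> measurable (F s) N'" and D: "D \<in> measurable M N"
  shows "distr M (N' \<Otimes>\<^sub>M N) (\<lambda>w. (X w, D w)) = distr M N' X \<Otimes>\<^sub>M distr M N D"
proof (rule sym, rule pair_measure_eqI)
  have XM: "X \<in> measurable M N'" using X by (rule measurable_F_M)
  interpret DX: prob_space "distr M N' X" using XM by (rule prob_space_distr)
  interpret DD: prob_space "distr M N D" using D by (rule prob_space_distr)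
  show "sigma_finite_measure (distr M N' X)" "sigma_finite_measure (distr M N D)" by unfold_locales
  show "sets (distr M N' X \<Otimes>\<^sub>M distr M N D) = sets (distr M (N' \<Otimes>\<^sub>M N) (\<lambda>w. (X w, D w)))"
    by (simp cong: sets_pair_measure_cong)
  fix A B assume "A \<in> sets (distr M N' X)" "B \<in> sets (distr M N D)"
  then have AB: "A \<in> sets N'" "B \<in> sets N" by auto
  have XA: "X -` A \<inter> space M \<in> sets (F s)" using measurable_sets[OF X AB(1)] by simp
  have DB: "D -` B \<inter> space M \<in> sets (vimage_algebra (space M) D N)" using AB(2) by (rule in_vimage_algebra)
  have "emeasure (distr M (N' \<Otimes>\<^sub>M N) (\<lambda>w. (X w, D w))) (A \<times> B) = emeasure M ((X -` A \<inter> space M) \<inter> (D -` B \<inter> space M))"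
    using XM D AB by (subst emeasure_distr) (auto intro!: arg_cong[where f="emeasure M"])
  also have "\<dots> = emeasure M (X -` A \<inter> space M) * emeasure M (D -` B \<inter> space M)"
    using indep_setD[OF ind XA DB] by (simp add: emeasure_eq_measure ennreal_mult)
  finally show "emeasure (distr M N' X) A * emeasure (distr M N D) B = emeasure (distr M (N' \<Otimes>\<^sub>M N) (\<lambda>w. (X w, D w))) (A \<times> B)"
    using XM D AB by (simp add: emeasure_distr)
qed

end

lemma euler_step_measurable:
  assumes "G \<in> borel_measurable borel"
  shows "(\<lambda>(z, d). euler_step \<gamma> \<sigma> \<eta> G z d) \<in> measurable (borel \<Otimes>\<^sub>M borel) (borel :: (real \<times> real) measure)"
proof -
  have m: "(\<lambda>x. fst (fst x)) \<in> borel_measurable ((borel :: (real \<times> real) measure) \<Otimes>\<^sub>M (borel :: real measure))"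
    "(\<lambda>x. snd (fst x)) \<in> borel_measurable ((borel :: (real \<times> real) measure) \<Otimes>\<^sub>M (borel :: real measure))"
    unfolding borel_prod[symmetric] by measurable
  have "(\<lambda>x. G (fst (fst x))) \<in> borel_measurable ((borel :: (real \<times> real) measure) \<Otimes>\<^sub>M (borel :: real measure))"
    using measurable_compose[OF m(1) assms] .
  then show ?thesis
    unfolding euler_step_def split_beta using m
    by (intro borel_measurable_Pair borel_measurable_add borel_measurable_times borel_measurable_diff borel_measurable_const) auto
qed

text \<open>The Markov recursion for the law of the chain. It mentions no probability space, so it
  can identify chains that live on different ones.\<close>

primrec euler_law :: "real \<Rightarrow> real \<Rightarrow> (nat \<Rightarrow> real \<Rightarrow> real) \<Rightarrow> real \<Rightarrow> (real \<times> real) measure \<Rightarrow> nat \<Rightarrow> (real \<times> real) measure" where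
  "euler_law \<gamma> \<sigma> G \<eta> \<mu> 0 = distr \<mu> borel (\<lambda>z. (fst z, snd z + \<gamma> * fst z))"
| "euler_law \<gamma> \<sigma> G \<eta> \<mu> (Suc k) = distr (euler_law \<gamma> \<sigma> G \<eta> \<mu> k \<Otimes>\<^sub>M centred_normal \<eta>) borel (\<lambda>(z, d). euler_step \<gamma> \<sigma> \<eta> (G k) z d)"

lemma fst_snd_borel [measurable]: "fst \<in> borel_measurable (borel :: (real \<times> real) measure)" "snd \<in> borel_measurable (borel :: (real \<times> real) measure)"
  unfolding borel_prod[symmetric] by measurable

context filtered
begin

lemma euler_F:
  assumes B: "brownian_motion M F \<beta>" and s: "0 \<le> s" "0 < \<eta>"
    and z: "Q \<in> borel_measurable (F s)" "P \<in> borel_measurable (F s)" and G: "\<And>k. G k \<in> borel_measurable borel"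
  shows "(\<lambda>w. euler \<gamma> \<sigma> G s \<eta> (\<lambda>r. \<beta> r w) (Q w, P w) k) \<in> borel_measurable (F (s + real k * \<eta>))"
proof (induction k)
  case 0
  have "(\<lambda>w. wrap (Q w)) \<in> borel_measurable (F s)" using z(1) by measurable
  then show ?case using z by (auto intro!: borel_measurable_Pair)
next
  case (Suc k)
  let ?T = "\<lambda>k. s + real k * \<eta>"
  have T: "0 \<le> ?T k" "?T k \<le> ?T (Suc k)" using s by (auto simp: mult_right_mono)
  have 1: "(\<lambda>w. euler \<gamma> \<sigma> G s \<eta> (\<lambda>r. \<beta> r w) (Q w, P w) k) \<in> borel_measurable (F (?T (Suc k)))"
    using measurable_F_mono[OF Suc T(2)] .
  have 2: "(\<lambda>w. \<beta> (?T (Suc k)) w - \<beta> (?T k) w) \<in> borel_measurable (F (?T (Suc k)))"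
    by (rule incr_F[OF brownian_incr[OF B] T])
  show ?case
    using measurable_compose[OF measurable_Pair[OF 1 2] euler_step_measurable[OF G[of k], of \<gamma> \<sigma> \<eta>]] by simp
qed

text \<open>The chain after \<open>k\<close> steps is known at time \<open>s + k * \<eta>\<close>,
  and the next Brownian increment is independent of that past. The starting time disappears from the
  right-hand side.\<close>

lemma euler_distr:
  assumes B: "brownian_motion M F \<beta>" and s: "0 \<le> s" "0 < \<eta>"
    and z: "Q \<in> borel_measurable (F s)" "P \<in> borel_measurable (F s)" and G: "\<And>k. G k \<in> borel_measurable borel"
  shows "distr M borel (\<lambda>w. euler \<gamma> \<sigma> G s \<eta> (\<lambda>r. \<beta> r w) (Q w, P w) k) = euler_law \<gamma> \<sigma> G \<eta> (phase_law M Q P) k"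
proof (induction k)
  case 0
  have "Q \<in> borel_measurable M" "P \<in> borel_measurable M" using z measurable_F_M by auto
  then have "(\<lambda>w. (wrap (Q w), P w)) \<in> borel_measurable M" by (intro borel_measurable_Pair) auto
  then show ?case unfolding phase_law_def euler_law.simps
    by (subst distr_distr) (auto simp: comp_def intro!: borel_measurable_Pair)
next
  case (Suc k)
  let ?T = "\<lambda>k. s + real k * \<eta>"
  let ?X = "\<lambda>w. euler \<gamma> \<sigma> G s \<eta> (\<lambda>r. \<beta> r w) (Q w, P w) k"
  let ?D = "\<lambda>w. \<beta> (?T (Suc k)) w - \<beta> (?T k) w"
  have T: "0 \<le> ?T k" "?T k < ?T (Suc k)" using s by auto
  have d: "?T (Suc k) - ?T k = \<eta>" by (simp add: algebra_simps)
  have X: "?X \<in> borel_measurable (F (?T k))" by (rule euler_F[OF B s z G])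
  have "\<forall>s\<ge>0. \<forall>t>s. has_law M (\<lambda>w. \<beta> t w - \<beta> s w) (centred_normal (t - s)) \<and>
     indep_set (sets (F s)) (sets (vimage_algebra (space M) (\<lambda>w. \<beta> t w - \<beta> s w) borel))"
    using B by (simp add: brownian_motion_def)
  from this[rule_format, OF T] have law: "has_law M ?D (centred_normal \<eta>)"
    and ind: "indep_set (sets (F (?T k))) (sets (vimage_algebra (space M) ?D borel))" unfolding d by auto
  have D: "?D \<in> borel_measurable M" "distr M borel ?D = centred_normal \<eta>" using law by (auto simp: has_law_def)
  have XD: "(\<lambda>w. (?X w, ?D w)) \<in> measurable M (borel \<Otimes>\<^sub>M borel)"
    using measurable_F_M[OF X] D(1) by (rule measurable_Pair)
  have "distr M borel (\<lambda>w. euler \<gamma> \<sigma> G s \<eta> (\<lambda>r. \<beta> r w) (Q w, P w) (Suc k))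
    = distr (distr M (borel \<Otimes>\<^sub>M borel) (\<lambda>w. (?X w, ?D w))) borel (\<lambda>(z, d). euler_step \<gamma> \<sigma> \<eta> (G k) z d)"
    by (subst distr_distr[OF euler_step_measurable[OF G] XD]) (simp add: comp_def)
  also have "\<dots> = euler_law \<gamma> \<sigma> G \<eta> (phase_law M Q P) (Suc k)"
    unfolding indep_pair_distr[OF ind X D(1)] Suc D(2) by simp
  finally show ?case .
qed

end

section \<open>Independence of functions of independent pairs\<close>

context prob_space
begin

text \<open>Rectangles \<open>{z i \<in> A} \<inter> {b i \<in> C}\<close> form a pi-system whose
  probabilities factorise: first data against noise, then over the indices within each family.
  Stating measurability of \<open>X i\<close> over every \<open>G\<close> that makes
  \<open>z i\<close> and \<open>b i\<close> measurable expresses that it is a function of these two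
  alone.\<close>

lemma indep_vars_from_pairs:
  assumes I: "finite I"
    and z: "indep_vars (\<lambda>_. S) z I" and b: "indep_vars (\<lambda>_. T) b I"
    and zV: "\<And>i. i \<in> I \<Longrightarrow> z i \<in> measurable Vz S" and bV: "\<And>i. i \<in> I \<Longrightarrow> b i \<in> measurable Vb T"
    and sp: "space Vz = space M" "space Vb = space M" and ind: "indep_set (sets Vz) (sets Vb)"
    and X: "\<And>i G. i \<in> I \<Longrightarrow> z i \<in> measurable G S \<Longrightarrow> b i \<in> measurable G T \<Longrightarrow> X i \<in> measurable G N"
  shows "indep_vars (\<lambda>_. N) X I"
proof -
  define R where "R i = {(z i -` A \<inter> space M) \<inter> (b i -` C \<inter> space M) | A C. A \<in> sets S \<and> C \<in> sets T}" for i
  have zM: "z i \<in> measurable M S" and bM: "b i \<in> measurable M T" if "i \<in> I" for i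
    using z b that by (auto simp: indep_vars_def)
  have Rev: "R i \<subseteq> events" if "i \<in> I" for i
  proof
    fix x assume "x \<in> R i"
    then obtain A C where *: "x = (z i -` A \<inter> space M) \<inter> (b i -` C \<inter> space M)" "A \<in> sets S" "C \<in> sets T"
      unfolding R_def by blast
    show "x \<in> events" unfolding *(1) by (intro sets.Int measurable_sets[OF zM[OF that] *(2)] measurable_sets[OF bM[OF that] *(3)])
  qed
  have key: "prob (\<Inter>i\<in>J. (z i -` A i \<inter> space M) \<inter> (b i -` C i \<inter> space M)) = (\<Prod>i\<in>J. prob (z i -` A i \<inter> space M) * prob (b i -` C i \<inter> space M))"
    if J: "J \<noteq> {}" "J \<subseteq> I" and AC: "\<And>i. i \<in> J \<Longrightarrow> A i \<in> sets S" "\<And>i. i \<in> J \<Longrightarrow> C i \<in> sets T" for J A C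
  proof -
    have fJ: "finite J" using J I finite_subset by blast
    have "(\<Inter>i\<in>J. z i -` A i \<inter> space M) \<in> sets Vz"
    proof (intro sets.finite_INT fJ J(1))
      fix i assume "i \<in> J"
      then show "z i -` A i \<inter> space M \<in> sets Vz" using measurable_sets[OF zV AC(1), of i i] J sp by auto
    qed
    moreover have "(\<Inter>i\<in>J. b i -` C i \<inter> space M) \<in> sets Vb"
    proof (intro sets.finite_INT fJ J(1))
      fix i assume "i \<in> J"
      then show "b i -` C i \<inter> space M \<in> sets Vb" using measurable_sets[OF bV AC(2), of i i] J sp by auto
    qed
    ultimately have "prob ((\<Inter>i\<in>J. z i -` A i \<inter> space M) \<inter> (\<Inter>i\<in>J. b i -` C i \<inter> space M)) =
       prob (\<Inter>i\<in>J. z i -` A i \<inter> space M) * prob (\<Inter>i\<in>J. b i -` C i \<inter> space M)"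
      by (rule indep_setD[OF ind])
    moreover have "(\<Inter>i\<in>J. (z i -` A i \<inter> space M) \<inter> (b i -` C i \<inter> space M)) = (\<Inter>i\<in>J. z i -` A i \<inter> space M) \<inter> (\<Inter>i\<in>J. b i -` C i \<inter> space M)"
      by (rule INT_Int_distrib)
    moreover have "prob (\<Inter>i\<in>J. z i -` A i \<inter> space M) = (\<Prod>i\<in>J. prob (z i -` A i \<inter> space M))"
      using AC by (intro indep_varsD[OF z J(1) fJ J(2)]) auto
    moreover have "prob (\<Inter>i\<in>J. b i -` C i \<inter> space M) = (\<Prod>i\<in>J. prob (b i -` C i \<inter> space M))"
      using AC by (intro indep_varsD[OF b J(1) fJ J(2)]) auto
    ultimately show ?thesis by (simp add: prod.distrib)
  qed
  have iR: "indep_sets R I"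
  proof (rule indep_setsI)
    show "R i \<subseteq> events" if "i \<in> I" for i by (rule Rev[OF that])
    fix E J assume J: "J \<noteq> {}" "J \<subseteq> I" "finite J" and E: "\<forall>j\<in>J. E j \<in> R j"
    have "\<forall>j\<in>J. \<exists>AC. fst AC \<in> sets S \<and> snd AC \<in> sets T \<and> E j = (z j -` fst AC \<inter> space M) \<inter> (b j -` snd AC \<inter> space M)"
    proof
      fix j assume "j \<in> J"
      then have "E j \<in> R j" using E by (rule bspec[rotated])
      then obtain A C where "E j = (z j -` A \<inter> space M) \<inter> (b j -` C \<inter> space M)" "A \<in> sets S" "C \<in> sets T"
        unfolding R_def by blast
      then show "\<exists>AC. fst AC \<in> sets S \<and> snd AC \<in> sets T \<and> E j = (z j -` fst AC \<inter> space M) \<inter> (b j -` snd AC \<inter> space M)"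
        by (intro exI[of _ "(A, C)"]) (simp only: fst_conv snd_conv simp_thms)
    qed
    from bchoice[OF this] obtain AC where AC: "\<And>j. j \<in> J \<Longrightarrow> fst (AC j) \<in> sets S" "\<And>j. j \<in> J \<Longrightarrow> snd (AC j) \<in> sets T"
      "\<And>j. j \<in> J \<Longrightarrow> E j = (z j -` fst (AC j) \<inter> space M) \<inter> (b j -` snd (AC j) \<inter> space M)" by blast
    have "prob (\<Inter>j\<in>J. E j) = prob (\<Inter>j\<in>J. (z j -` fst (AC j) \<inter> space M) \<inter> (b j -` snd (AC j) \<inter> space M))"
      using AC(3) by simp
    also have "\<dots> = (\<Prod>j\<in>J. prob (z j -` fst (AC j) \<inter> space M) * prob (b j -` snd (AC j) \<inter> space M))"
      by (rule key[OF J(1,2) AC(1,2)])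
    also have "\<dots> = (\<Prod>j\<in>J. prob (E j))"
    proof (intro prod.cong refl)
      fix j assume j: "j \<in> J"
      have "prob (\<Inter>i\<in>{j}. (z i -` fst (AC i) \<inter> space M) \<inter> (b i -` snd (AC i) \<inter> space M)) = (\<Prod>i\<in>{j}. prob (z i -` fst (AC i) \<inter> space M) * prob (b i -` snd (AC i) \<inter> space M))"
        using j J(2) AC by (intro key) auto
      then show "prob (z j -` fst (AC j) \<inter> space M) * prob (b j -` snd (AC j) \<inter> space M) = prob (E j)"
        using AC(3)[OF j] by simp
    qed
    finally show "prob (\<Inter>j\<in>J. E j) = (\<Prod>j\<in>J. prob (E j))" .
  qed
  have stable: "Int_stable (R i)" for i
    unfolding Int_stable_def
  proof (intro ballI)
    fix a a' assume "a \<in> R i" "a' \<in> R i"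
    then obtain A C A' C' where *: "A \<in> sets S" "C \<in> sets T" "A' \<in> sets S" "C' \<in> sets T"
      "a = (z i -` A \<inter> space M) \<inter> (b i -` C \<inter> space M)" "a' = (z i -` A' \<inter> space M) \<inter> (b i -` C' \<inter> space M)"
      by (auto simp: R_def)
    then have "a \<inter> a' = (z i -` (A \<inter> A') \<inter> space M) \<inter> (b i -` (C \<inter> C') \<inter> space M)" by auto
    then show "a \<inter> a' \<in> R i" unfolding R_def using * by blast
  qed
  have ss: "indep_sets (\<lambda>i. sigma_sets (space M) (R i)) I" by (rule indep_sets_sigma[OF iR]) (rule stable)
  have XG: "X i \<in> measurable (sigma (space M) (R i)) N" if i: "i \<in> I" for i
  proof (rule X[OF i])
    have Rs: "R i \<subseteq> Pow (space M)" by (auto simp: R_def)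
    have bT: "b i -` space T \<inter> space M = space M" "z i -` space S \<inter> space M = space M"
      using measurable_space[OF bM[OF i]] measurable_space[OF zM[OF i]] by auto
    show "z i \<in> measurable (sigma (space M) (R i)) S"
    proof (rule measurableI)
      show "z i x \<in> space S" if "x \<in> space (sigma (space M) (R i))" for x using measurable_space[OF zM[OF i]] that unfolding space_measure_of[OF Rs] by blast
      fix A assume A: "A \<in> sets S"
      have "(z i -` A \<inter> space M) \<inter> (b i -` space T \<inter> space M) \<in> R i" unfolding R_def using A by blast
      moreover have "(z i -` A \<inter> space M) \<inter> (b i -` space T \<inter> space M) = z i -` A \<inter> space M" unfolding bT by blast
      ultimately show "z i -` A \<inter> space (sigma (space M) (R i)) \<in> sets (sigma (space M) (R i))"
        unfolding sets_measure_of[OF Rs] space_measure_of[OF Rs] by (simp only: sigma_sets.Basic)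
    qed
    show "b i \<in> measurable (sigma (space M) (R i)) T"
    proof (rule measurableI)
      show "b i x \<in> space T" if "x \<in> space (sigma (space M) (R i))" for x using measurable_space[OF bM[OF i]] that unfolding space_measure_of[OF Rs] by blast
      fix C assume C: "C \<in> sets T"
      have "(z i -` space S \<inter> space M) \<inter> (b i -` C \<inter> space M) \<in> R i" unfolding R_def using C by blast
      moreover have "(z i -` space S \<inter> space M) \<inter> (b i -` C \<inter> space M) = b i -` C \<inter> space M" unfolding bT by blast
      ultimately show "b i -` C \<inter> space (sigma (space M) (R i)) \<in> sets (sigma (space M) (R i))"
        unfolding sets_measure_of[OF Rs] space_measure_of[OF Rs] by (simp only: sigma_sets.Basic)
    qed
  qed
  have sub: "sigma_sets (space M) (R i) \<subseteq> events" if "i \<in> I" for i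
    using Rev[OF that] by (rule sets.sigma_sets_subset)
  show ?thesis
    unfolding indep_vars_def2
  proof (intro conjI ballI)
    fix i assume i: "i \<in> I"
    have Rs: "R i \<subseteq> Pow (space M)" by (auto simp: R_def)
    show "random_variable N (X i)"
      using XG[OF i] sub[OF i] unfolding measurable_def sets_measure_of[OF Rs] space_measure_of[OF Rs] by blast
  next
    show "indep_sets (\<lambda>i. {X i -` A \<inter> space M |A. A \<in> sets N}) I"
    proof (rule indep_sets_mono_sets[OF ss])
      fix i assume i: "i \<in> I"
      have Rs: "R i \<subseteq> Pow (space M)" by (auto simp: R_def)
      show "{X i -` A \<inter> space M |A. A \<in> sets N} \<subseteq> sigma_sets (space M) (R i)"
        using measurable_sets[OF XG[OF i]] unfolding sets_measure_of[OF Rs] space_measure_of[OF Rs] by blast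
    qed
  qed
qed

end

section \<open>Laws of large numbers in mean\<close>

context prob_space
begin

text \<open>Only the diagonal of the second moment survives. The index set may have fewer than
  \<open>N\<close> elements because the self-interaction is removed before use.\<close>

lemma uncorrelated_mean:
  fixes N :: nat
  assumes J: "finite J" "card J \<le> N" and Y: "\<And>j. j \<in> J \<Longrightarrow> Y j \<in> borel_measurable M"
    and b: "\<And>j w. j \<in> J \<Longrightarrow> \<bar>Y j w\<bar> \<le> b" "0 \<le> b" and u: "\<And>i j. i \<in> J \<Longrightarrow> j \<in> J \<Longrightarrow> i \<noteq> j \<Longrightarrow> (LINT w|M. Y i w * Y j w) = 0"
  shows "(LINT w|M. \<bar>(1 / real N) * (\<Sum>j\<in>J. Y j w)\<bar>) \<le> b / sqrt (real N)"
proof (cases "N = 0")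
  case False
  let ?S = "\<lambda>w. (1 / real N) * (\<Sum>j\<in>J. Y j w)"
  have iY: "integrable M (\<lambda>w. Y i w * Y j w)" if "i \<in> J" "j \<in> J" for i j
  proof (rule integrable_const_bound[where B="b * b"])
    show "AE w in M. norm (Y i w * Y j w) \<le> b * b"
      using b that by (auto simp: abs_mult intro!: mult_mono)
  qed (use Y that in auto)
  have Sb: "\<bar>?S w\<bar> \<le> (1 / real N) * (\<Sum>j\<in>J. b)" for w
    unfolding abs_mult by (intro mult_mono order_trans[OF sum_abs] sum_mono b) auto
  have "L2 M ?S" by (rule L2_bounded[OF _ Sb]) (use Y in auto)
  then have "(LINT w|M. \<bar>?S w\<bar>) \<le> sqrt (LINT w|M. (?S w)\<^sup>2)" by (rule L1_le_L2)
  also have "(LINT w|M. (?S w)\<^sup>2) = (1 / real N)\<^sup>2 * (LINT w|M. (\<Sum>i\<in>J. \<Sum>j\<in>J. Y i w * Y j w))"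
    unfolding power_mult_distrib power2_eq_square[of "sum _ _"] sum_product by simp
  also have "(LINT w|M. (\<Sum>i\<in>J. \<Sum>j\<in>J. Y i w * Y j w)) = (\<Sum>i\<in>J. \<Sum>j\<in>J. LINT w|M. Y i w * Y j w)"
    using iY by (simp add: Bochner_Integration.integral_sum)
  also have "\<dots> = (\<Sum>i\<in>J. LINT w|M. Y i w * Y i w)"
  proof (intro sum.cong refl)
    fix i assume i: "i \<in> J"
    have "(\<Sum>j\<in>J. LINT w|M. Y i w * Y j w) = (\<Sum>j\<in>J. if j = i then LINT w|M. Y i w * Y i w else 0)"
      using i u by (intro sum.cong refl) auto
    then show "(\<Sum>j\<in>J. LINT w|M. Y i w * Y j w) = (LINT w|M. Y i w * Y i w)" using J i by simp
  qed
  also have "sqrt ((1 / real N)\<^sup>2 * \<dots>) \<le> sqrt ((1 / real N)\<^sup>2 * (real N * b\<^sup>2))"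
  proof (intro real_sqrt_le_mono mult_left_mono)
    have "(LINT w|M. Y i w * Y i w) \<le> b\<^sup>2" if "i \<in> J" for i
    proof -
      have "(LINT w|M. Y i w * Y i w) \<le> (LINT w|M. b\<^sup>2)"
      proof (intro integral_mono iY that)
        show "Y i w * Y i w \<le> b\<^sup>2" for w
          using power_mono[OF b(1)[OF that, of w] abs_ge_zero, of 2] by (simp add: power2_eq_square)
      qed simp
      then show ?thesis by (simp add: prob_space)
    qed
    then have "(\<Sum>i\<in>J. LINT w|M. Y i w * Y i w) \<le> (\<Sum>i\<in>J. b\<^sup>2)" by (rule sum_mono)
    also have "\<dots> \<le> real N * b\<^sup>2" using J(2) by (simp add: mult_right_mono)
    finally show "(\<Sum>i\<in>J. LINT w|M. Y i w * Y i w) \<le> real N * b\<^sup>2" .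
  qed simp
  also have "(1 / real N)\<^sup>2 * (real N * b\<^sup>2) = b\<^sup>2 / real N" using False by (simp add: power2_eq_square)
  also have "sqrt (b\<^sup>2 / real N) = b / sqrt (real N)" using b(2) by (simp add: real_sqrt_divide)
  finally show ?thesis .
qed simp

lemma indep_vars_pair:
  assumes X: "indep_vars (\<lambda>_. N) X I" and ij: "i \<in> I" "j \<in> I" "i \<noteq> j"
  shows "indep_var N (X i) N (X j)"
proof -
  have "indep_var (PiM {i} (\<lambda>_. N)) (\<lambda>w. restrict (\<lambda>n. X n w) {i}) (PiM {j} (\<lambda>_. N)) (\<lambda>w. restrict (\<lambda>n. X n w) {j})"
    using ij by (intro indep_var_restrict[OF X]) auto
  from indep_var_compose[OF this, of "\<lambda>f. f i" N "\<lambda>f. f j" N]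
  show ?thesis by (simp add: comp_def)
qed

lemma independent_mean:
  fixes X :: "nat \<Rightarrow> 'a \<Rightarrow> real" and N :: nat
  assumes X: "indep_vars (\<lambda>_. borel) X {..<N}" and \<phi>: "\<phi> \<in> borel_measurable borel" "\<And>x. \<bar>\<phi> x\<bar> \<le> b"
    and m: "\<And>j. j < N \<Longrightarrow> (LINT w|M. \<phi> (X j w)) = c"
  shows "0 < N \<Longrightarrow> (LINT w|M. \<bar>(1 / real N) * (\<Sum>j<N. \<phi> (X j w)) - c\<bar>) \<le> 2 * b / sqrt (real N)"
proof -
  assume N: "0 < N"
  have Xm: "X j \<in> borel_measurable M" if "j < N" for j using X that by (auto simp: indep_vars_def)
  have b0: "0 \<le> b" using order_trans[OF abs_ge_zero \<phi>(2)[of 0]] .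
  have int: "integrable M (\<lambda>w. \<phi> (X j w))" if "j < N" for j
    using Xm[OF that] \<phi> by (intro integrable_const_bound[where B=b]) auto
  have "\<bar>LINT w|M. \<phi> (X 0 w)\<bar> \<le> (LINT w|M. b)"
    by (rule order_trans[OF integral_abs_bound integral_mono]) (use int[OF N] \<phi> in auto)
  then have c: "\<bar>c\<bar> \<le> b" using m[OF N] by (simp add: prob_space)
  have "(LINT w|M. \<bar>(1 / real N) * (\<Sum>j<N. \<phi> (X j w) - c)\<bar>) \<le> 2 * b / sqrt (real N)"
  proof (rule uncorrelated_mean)
    show "\<bar>\<phi> (X j w) - c\<bar> \<le> 2 * b" for j w using c \<phi>(2)[of "X j w"] by linarith
    fix i j assume ij: "i \<in> {..<N}" "j \<in> {..<N}" "i \<noteq> j"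
    have "indep_var borel (X i) borel (X j)" using X ij by (intro indep_vars_pair) auto
    from indep_var_compose[OF this, of "\<lambda>x. \<phi> x - c" borel "\<lambda>x. \<phi> x - c" borel]
    have "indep_var borel (\<lambda>w. \<phi> (X i w) - c) borel (\<lambda>w. \<phi> (X j w) - c)" using \<phi>(1) by (simp add: comp_def)
    from indep_var_lebesgue_integral[OF this]
    have "(LINT w|M. (\<phi> (X i w) - c) * (\<phi> (X j w) - c)) = (LINT w|M. \<phi> (X i w) - c) * (LINT w|M. \<phi> (X j w) - c)"
      using int ij by auto
    also have "(LINT w|M. \<phi> (X i w) - c) = 0" using int[of i] ij m[of i] by (simp add: prob_space)
    finally show "(LINT w|M. (\<phi> (X i w) - c) * (\<phi> (X j w) - c)) = 0" by simp
  qed (use Xm \<phi> b0 in auto)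
  then show ?thesis using N by (simp add: sum_subtractf right_diff_distrib)
qed

text \<open>Fubini on the product law: freeze the first variable and average over the
  second.\<close>

lemma indep_var_integral_zero:
  fixes \<Phi> :: "'b \<times> 'b \<Rightarrow> real"
  assumes ind: "indep_var S U T V" and \<Phi>: "\<Phi> \<in> borel_measurable (S \<Otimes>\<^sub>M T)" "\<And>z. \<bar>\<Phi> z\<bar> \<le> C"
    and z: "\<And>u. u \<in> space S \<Longrightarrow> (LINT w|M. \<Phi> (u, V w)) = 0"
  shows "(LINT w|M. \<Phi> (U w, V w)) = 0"
proof -
  have rv: "U \<in> measurable M S" "V \<in> measurable M T" using ind indep_var_rv1 indep_var_rv2 by blast+
  interpret DU: prob_space "distr M S U" using rv(1) by (rule prob_space_distr)
  interpret DV: prob_space "distr M T V" using rv(2) by (rule prob_space_distr)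
  interpret P: pair_prob_space "distr M S U" "distr M T V" ..
  have "(LINT w|M. \<Phi> (U w, V w)) = (LINT z|distr M (S \<Otimes>\<^sub>M T) (\<lambda>w. (U w, V w)). \<Phi> z)"
    using rv \<Phi> by (subst integral_distr) auto
  also have "\<dots> = (LINT z|(distr M S U \<Otimes>\<^sub>M distr M T V). \<Phi> z)"
    using ind by (simp add: indep_var_distribution_eq)
  also have "\<dots> = (LINT u|distr M S U. LINT v|distr M T V. \<Phi> (u, v))"
    using \<Phi> by (intro P.integral_fst'[symmetric] P.integrable_const_bound[where B=C]) auto
  also have "\<dots> = (LINT u|distr M S U. 0)"
  proof (rule Bochner_Integration.integral_cong[OF refl])
    fix u assume "u \<in> space (distr M S U)"
    then have u: "u \<in> space S" by simp
    show "(LINT v|distr M T V. \<Phi> (u, v)) = 0"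
      using rv(2) measurable_compose[OF measurable_Pair1'[OF u] \<Phi>(1)] z[OF u] by (subst integral_distr) auto
  qed
  finally show ?thesis by simp
qed

text \<open>Terms with \<open>j \<noteq> i\<close> are centred given \<open>X i\<close>, and
  uncorrelated: freezing \<open>X i\<close> and \<open>X j\<close> leaves the term with
  \<open>l\<close> of mean 0. The self-interaction \<open>j = i\<close> is not centred; it is split
  off and costs \<open>2 * b / N\<close>.\<close>

lemma interaction_mean:
  fixes X :: "nat \<Rightarrow> 'a \<Rightarrow> real" and N :: nat
  assumes X: "indep_vars (\<lambda>_. borel) X {..<N}" and g: "g \<in> borel_measurable borel" "\<And>x. \<bar>g x\<bar> \<le> b"
    and h: "h \<in> borel_measurable borel" "\<And>x. \<bar>h x\<bar> \<le> b" "\<And>j x. j < N \<Longrightarrow> (LINT w|M. g (x - X j w)) = h x"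
    and i: "i < N"
  shows "(LINT w|M. \<bar>(1 / real N) * (\<Sum>j<N. g (X i w - X j w)) - h (X i w)\<bar>) \<le> 4 * b / sqrt (real N)"
proof -
  have Xm: "X j \<in> borel_measurable M" if "j < N" for j using X that by (auto simp: indep_vars_def)
  have b0: "0 \<le> b" using order_trans[OF abs_ge_zero g(2)[of 0]] .
  let ?Y = "\<lambda>j w. g (X i w - X j w) - h (X i w)"
  let ?J = "{..<N} - {i}"
  have Yb: "\<bar>?Y j w\<bar> \<le> 2 * b" for j w using g(2)[of "X i w - X j w"] h(2)[of "X i w"] by linarith
  have Ym: "?Y j \<in> borel_measurable M" if "j < N" for j
    using measurable_compose[OF borel_measurable_diff[OF Xm[OF i] Xm[OF that]] g(1)] measurable_compose[OF Xm[OF i] h(1)] by simp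
  have 1: "(LINT w|M. \<bar>(1 / real N) * (\<Sum>j\<in>?J. ?Y j w)\<bar>) \<le> 2 * b / sqrt (real N)"
  proof (rule uncorrelated_mean)
    fix j l assume jl: "j \<in> ?J" "l \<in> ?J" "j \<noteq> l"
    have "indep_var (PiM {i, j} (\<lambda>_. borel)) (\<lambda>w. restrict (\<lambda>n. X n w) {i, j}) (PiM {l} (\<lambda>_. borel)) (\<lambda>w. restrict (\<lambda>n. X n w) {l})"
      using jl i by (intro indep_var_restrict[OF X]) auto
    then have "(LINT w|M. (\<lambda>z. (g (fst z i - fst z j) - h (fst z i)) * (g (fst z i - snd z l) - h (fst z i)))
        (restrict (\<lambda>n. X n w) {i, j}, restrict (\<lambda>n. X n w) {l})) = 0"
    proof (rule indep_var_integral_zero[where C="2 * b * (2 * b)"])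
      let ?P = "PiM {i, j} (\<lambda>_. borel :: real measure) \<Otimes>\<^sub>M PiM {l} (\<lambda>_. borel :: real measure)"
      have m: "(\<lambda>z. fst z i) \<in> borel_measurable ?P" "(\<lambda>z. fst z j) \<in> borel_measurable ?P" "(\<lambda>z. snd z l) \<in> borel_measurable ?P"
        by measurable
      show "(\<lambda>z. (g (fst z i - fst z j) - h (fst z i)) * (g (fst z i - snd z l) - h (fst z i))) \<in> borel_measurable ?P"
        by (intro borel_measurable_times borel_measurable_diff measurable_compose[OF _ g(1)] measurable_compose[OF _ h(1)] m)
      have d: "\<bar>g x - h y\<bar> \<le> 2 * b" for x y using g(2)[of x] h(2)[of y] by linarith
      show "\<bar>(g (fst z i - fst z j) - h (fst z i)) * (g (fst z i - snd z l) - h (fst z i))\<bar> \<le> 2 * b * (2 * b)" for z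
        unfolding abs_mult using b0 by (intro mult_mono d) auto
      have int: "integrable M (\<lambda>w. g (x - X l w))" for x
        using Xm[of l] jl g by (intro integrable_const_bound[where B=b]) auto
      have "(LINT w|M. g (x - X l w) - h x) = 0" for x
        using int[of x] h(3)[of l x] jl by (simp add: prob_space)
      then show "(LINT w|M. (g (fst (u, restrict (\<lambda>n. X n w) {l}) i - fst (u, restrict (\<lambda>n. X n w) {l}) j) - h (fst (u, restrict (\<lambda>n. X n w) {l}) i)) *
           (g (fst (u, restrict (\<lambda>n. X n w) {l}) i - snd (u, restrict (\<lambda>n. X n w) {l}) l) - h (fst (u, restrict (\<lambda>n. X n w) {l}) i))) = 0" for u
        by simp
    qed
    then show "(LINT w|M. ?Y j w * ?Y l w) = 0" by simp
  next
    show "card ?J \<le> N" by (rule order_trans[OF card_Diff1_le]) simp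
  qed (use Ym Yb b0 in auto)
  have "real N * 1 \<le> real N * real N" using i by (intro mult_left_mono) auto
  then have "sqrt (real N) \<le> real N" using i by (intro real_le_lsqrt) (auto simp: power2_eq_square)
  then have 2: "2 * b / real N \<le> 2 * b / sqrt (real N)" using i b0 by (intro divide_left_mono) auto
  have "(LINT w|M. \<bar>(1 / real N) * (\<Sum>j<N. g (X i w - X j w)) - h (X i w)\<bar>)
    \<le> (LINT w|M. 2 * b / real N + \<bar>(1 / real N) * (\<Sum>j\<in>?J. ?Y j w)\<bar>)"
  proof (rule integral_mono)
    fix w
    have "(1 / real N) * (\<Sum>j<N. g (X i w - X j w)) - h (X i w) = (1 / real N) * (\<Sum>j<N. ?Y j w)"
      using i by (simp add: sum_subtractf right_diff_distrib)
    also have "(\<Sum>j<N. ?Y j w) = ?Y i w + (\<Sum>j\<in>?J. ?Y j w)" using i by (intro sum.remove) auto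
    finally have e: "(1 / real N) * (\<Sum>j<N. g (X i w - X j w)) - h (X i w) = ?Y i w / real N + (1 / real N) * (\<Sum>j\<in>?J. ?Y j w)"
      by (simp add: add_divide_distrib)
    have "\<bar>?Y i w / real N\<bar> \<le> 2 * b / real N" unfolding abs_divide abs_of_nat by (intro divide_right_mono Yb) simp
    then show "\<bar>(1 / real N) * (\<Sum>j<N. g (X i w - X j w)) - h (X i w)\<bar> \<le> 2 * b / real N + \<bar>(1 / real N) * (\<Sum>j\<in>?J. ?Y j w)\<bar>"
      unfolding e using abs_triangle_ineq[of "?Y i w / real N" "(1 / real N) * (\<Sum>j\<in>?J. ?Y j w)"] by linarith
  next
    have iY: "integrable M (?Y j)" if "j < N" for j
      using Ym[OF that] Yb by (intro integrable_const_bound[where B="2 * b"]) auto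
    then show "integrable M (\<lambda>w. 2 * b / real N + \<bar>(1 / real N) * (\<Sum>j\<in>?J. ?Y j w)\<bar>)"
      by (intro Bochner_Integration.integrable_add integrable_const integrable_abs integrable_mult_right Bochner_Integration.integrable_sum) auto
    have "integrable M (\<lambda>w. \<bar>(1 / real N) * (\<Sum>j<N. ?Y j w)\<bar>)" using iY by (intro integrable_abs integrable_mult_right Bochner_Integration.integrable_sum) auto
    moreover have "(1 / real N) * (\<Sum>j<N. ?Y j w) = (1 / real N) * (\<Sum>j<N. g (X i w - X j w)) - h (X i w)" for w
      using i by (simp add: sum_subtractf right_diff_distrib)
    ultimately show "integrable M (\<lambda>w. \<bar>(1 / real N) * (\<Sum>j<N. g (X i w - X j w)) - h (X i w)\<bar>)" by (simp only:)
  qed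
  also have "\<dots> = 2 * b / real N + (LINT w|M. \<bar>(1 / real N) * (\<Sum>j\<in>?J. ?Y j w)\<bar>)"
  proof -
    have "integrable M (?Y j)" if "j < N" for j
      using Ym[OF that] Yb by (intro integrable_const_bound[where B="2 * b"]) auto
    then have "integrable M (\<lambda>w. \<bar>(1 / real N) * (\<Sum>j\<in>?J. ?Y j w)\<bar>)" by (intro integrable_abs integrable_mult_right Bochner_Integration.integrable_sum) auto
    then show ?thesis by (subst Bochner_Integration.integral_add) (auto simp: prob_space)
  qed
  also have "\<dots> \<le> 2 * b / sqrt (real N) + 2 * b / sqrt (real N)" using 1 2 by (rule add_mono[rotated])
  finally show ?thesis by simp
qed

lemma expectation_tendsto_zero:
  fixes Y :: "nat \<Rightarrow> 'a \<Rightarrow> real"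
  assumes "\<And>m. Y m \<in> borel_measurable M" "\<And>m w. w \<in> space M \<Longrightarrow> \<bar>Y m w\<bar> \<le> C" "AE w in M. (\<lambda>m. Y m w) \<longlonglongrightarrow> 0"
  shows "(\<lambda>m. LINT w|M. Y m w) \<longlonglongrightarrow> 0"
proof -
  have "(\<lambda>m. LINT w|M. Y m w) \<longlonglongrightarrow> (LINT w|M. 0)"
    by (rule integral_dominated_convergence[where w="\<lambda>_. C"]) (use assms in auto)
  then show ?thesis by simp
qed

end

text \<open>One deterministic statement for two uses: a single path with the true drift, and all
  particles summed, where the force mismatch is controlled only by the total error plus
  \<open>c\<close>. Paths are merely continuous, so the threshold depends on the path and there is
  no rate in the mesh.\<close>

lemma euler_average_error:
  fixes \<gamma> \<sigma> s u :: real and q p f \<beta> :: "nat \<Rightarrow> real \<Rightarrow> real" and G :: "nat \<Rightarrow> nat \<Rightarrow> real \<Rightarrow> real" and c :: "nat \<Rightarrow> nat \<Rightarrow> real"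
  defines "T \<equiv> \<lambda>m k. s + real k * (u / real (Suc m))"
  defines "X \<equiv> \<lambda>m i k. euler \<gamma> \<sigma> (G m) s (u / real (Suc m)) (\<beta> i) (q i s, p i s) k"
  defines "e \<equiv> \<lambda>m i k. \<bar>(q i (T m k) - (q i s - wrap (q i s))) - fst (X m i k)\<bar>"
  assumes J: "finite J" and kp: "\<And>i. i \<in> J \<Longrightarrow> kinetic_path \<gamma> \<sigma> (f i) (\<beta> i) (q i) (p i)"
    and g: "0 \<le> \<gamma>" and s: "0 \<le> s" "0 \<le> u" and K: "0 \<le> K'" and c: "\<And>m k. 0 \<le> c m k"
    and step: "\<And>m k. k \<le> m \<Longrightarrow> (\<Sum>i\<in>J. \<bar>f i (T m k) - G m k (fst (X m i k))\<bar>) \<le> K' * (\<Sum>i\<in>J. e m i k) + c m k"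
    and \<epsilon>: "0 < \<epsilon>"
  shows "\<exists>m0. \<forall>m\<ge>m0. \<forall>k\<le>Suc m. (\<Sum>i\<in>J. e m i k) \<le> exp ((1 + \<gamma> + K') * u) * ((u / real (Suc m)) * (\<Sum>j<Suc m. c m j)) + \<epsilon>"
proof -
  define K where "K = 1 + \<gamma> + K'"
  have K0: "0 \<le> K" using g K by (simp add: K_def)
  define d where "d = exp (K * u) * (u * (2 * real (card J)))"
  have d0: "0 \<le> d" using s by (simp add: d_def)
  \<comment> \<open>The allowed oscillation: \<open>d\<close> is the factor by which Gronwall
    amplifies it, so its total effect stays below \<open>\<epsilon>\<close>.\<close>
  define w where "w = \<epsilon> / (d + 1)"
  have w: "0 < w" "d * w \<le> \<epsilon>"
    using \<epsilon> d0 by (auto simp: w_def field_simps)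
  have "\<exists>m0. \<forall>m\<ge>m0. \<forall>k\<le>m. \<forall>r. T m k \<le> r \<longrightarrow> r \<le> T m (Suc k) \<longrightarrow> \<bar>p i r - p i (T m k)\<bar> \<le> w \<and> \<bar>f i r - f i (T m k)\<bar> \<le> w" if i: "i \<in> J" for i
  proof -
    have cont: "continuous_on {0..} (p i)" "continuous_on {0..} (f i)" using kp[OF i] by (auto simp: kinetic_path_def)
    obtain m1 m2 where "\<forall>m\<ge>m1. \<forall>k\<le>m. \<forall>r. T m k \<le> r \<longrightarrow> r \<le> T m (Suc k) \<longrightarrow> \<bar>p i r - p i (T m k)\<bar> \<le> w"
      "\<forall>m\<ge>m2. \<forall>k\<le>m. \<forall>r. T m k \<le> r \<longrightarrow> r \<le> T m (Suc k) \<longrightarrow> \<bar>f i r - f i (T m k)\<bar> \<le> w"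
      using modulus_small[OF cont(1) w(1) s] modulus_small[OF cont(2) w(1) s] unfolding T_def by blast
    then show ?thesis by (intro exI[of _ "max m1 m2"]) simp
  qed
  then obtain m0 where m0: "\<And>i m k r. i \<in> J \<Longrightarrow> m0 i \<le> m \<Longrightarrow> k \<le> m \<Longrightarrow> T m k \<le> r \<Longrightarrow> r \<le> T m (Suc k) \<Longrightarrow>
      \<bar>p i r - p i (T m k)\<bar> \<le> w \<and> \<bar>f i r - f i (T m k)\<bar> \<le> w"
    using bchoice[of J "\<lambda>i m0. \<forall>m\<ge>m0. \<forall>k\<le>m. \<forall>r. T m k \<le> r \<longrightarrow> r \<le> T m (Suc k) \<longrightarrow> \<bar>p i r - p i (T m k)\<bar> \<le> w \<and> \<bar>f i r - f i (T m k)\<bar> \<le> w"]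
    by blast
  define m1 where "m1 = (\<Sum>i\<in>J. m0 i)"
  have m01: "m0 i \<le> m1" if "i \<in> J" for i unfolding m1_def using J that by (simp add: member_le_sum)
  show ?thesis
  proof (intro exI[of _ m1] allI impI)
    fix m k assume m: "m1 \<le> m" and k: "k \<le> Suc m"
    let ?\<eta> = "u / real (Suc m)"
    let ?E = "\<lambda>i k. \<bar>(q i (T m k) - (q i s - wrap (q i s))) - fst (X m i k)\<bar> + \<bar>(p i (T m k) + \<gamma> * (q i (T m k) - (q i s - wrap (q i s)))) - snd (X m i k)\<bar>"
    have n0: "0 \<le> ?\<eta>" using s by simp
    have e0: "(\<Sum>i\<in>J. e m i k) \<le> (\<Sum>i\<in>J. ?E i k)" for k by (intro sum_mono) (simp add: e_def)
    have "(\<Sum>i\<in>J. ?E i k) \<le> exp (K * (real (Suc m) * ?\<eta>)) * (?\<eta> * (\<Sum>j<Suc m. 2 * w * real (card J) + c m j))"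
    proof (rule discrete_gronwall[OF _ _ _ n0 K0 k])
      have "?E i 0 = 0" if "i \<in> J" for i by (simp add: X_def T_def)
      then show "(\<Sum>i\<in>J. ?E i 0) \<le> 0" by simp
      show "0 \<le> 2 * w * real (card J) + c m k" for k using w(1) c by (intro add_nonneg_nonneg) auto
      fix k assume k: "k < Suc m"
      have "?E i (Suc k) \<le> (1 + ?\<eta> * (1 + \<gamma>)) * ?E i k + ?\<eta> * (2 * w + \<bar>f i (T m k) - G m k (fst (X m i k))\<bar>)" if i: "i \<in> J" for i
        unfolding T_def X_def
      proof (rule euler_error_step(2)[OF kp[OF i] g s(1) n0])
        fix r assume "s + real k * ?\<eta> \<le> r" "r \<le> s + real (Suc k) * ?\<eta>"
        then show "\<bar>p i r - p i (s + real k * ?\<eta>)\<bar> \<le> w \<and> \<bar>f i r - f i (s + real k * ?\<eta>)\<bar> \<le> w"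
          using m0[OF i, of m k r] m01[OF i] m k unfolding T_def by simp
      qed
      then have "(\<Sum>i\<in>J. ?E i (Suc k)) \<le> (\<Sum>i\<in>J. (1 + ?\<eta> * (1 + \<gamma>)) * ?E i k + ?\<eta> * (2 * w + \<bar>f i (T m k) - G m k (fst (X m i k))\<bar>))"
        by (rule sum_mono)
      also have "\<dots> = (1 + ?\<eta> * (1 + \<gamma>)) * (\<Sum>i\<in>J. ?E i k) + ?\<eta> * (2 * w * real (card J) + (\<Sum>i\<in>J. \<bar>f i (T m k) - G m k (fst (X m i k))\<bar>))"
        unfolding sum.distrib sum_distrib_left[symmetric] by (simp add: mult.commute)
      also have "\<dots> \<le> (1 + ?\<eta> * (1 + \<gamma>)) * (\<Sum>i\<in>J. ?E i k) + ?\<eta> * (2 * w * real (card J) + (K' * (\<Sum>i\<in>J. ?E i k) + c m k))"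
      proof (intro add_left_mono mult_left_mono n0)
        have "(\<Sum>i\<in>J. \<bar>f i (T m k) - G m k (fst (X m i k))\<bar>) \<le> K' * (\<Sum>i\<in>J. e m i k) + c m k" using k by (intro step) simp
        also have "K' * (\<Sum>i\<in>J. e m i k) \<le> K' * (\<Sum>i\<in>J. ?E i k)" using e0 K by (rule mult_left_mono)
        finally show "(\<Sum>i\<in>J. \<bar>f i (T m k) - G m k (fst (X m i k))\<bar>) \<le> K' * (\<Sum>i\<in>J. ?E i k) + c m k" by simp
      qed
      also have "\<dots> = (1 + ?\<eta> * K) * (\<Sum>i\<in>J. ?E i k) + ?\<eta> * (2 * w * real (card J) + c m k)"
      proof -
        have "(1 + \<eta> * (1 + \<gamma>)) * S + \<eta> * (a + (K' * S + b)) = (1 + \<eta> * K) * S + \<eta> * (a + b)" for \<eta> S a b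
          unfolding K_def by (simp add: algebra_simps)
        then show ?thesis .
      qed
      finally show "(\<Sum>i\<in>J. ?E i (Suc k)) \<le> (1 + ?\<eta> * K) * (\<Sum>i\<in>J. ?E i k) + ?\<eta> * (2 * w * real (card J) + c m k)" .
    qed
    also have "real (Suc m) * ?\<eta> = u" by simp
    also have "?\<eta> * (\<Sum>j<Suc m. 2 * w * real (card J) + c m j) = u * (2 * real (card J)) * w + ?\<eta> * (\<Sum>j<Suc m. c m j)"
    proof -
      have "?\<eta> * (\<Sum>j<Suc m. 2 * w * real (card J) + c m j) = (real (Suc m) * ?\<eta>) * (2 * w * real (card J)) + ?\<eta> * (\<Sum>j<Suc m. c m j)"
        unfolding sum.distrib by (simp only: sum_constant card_lessThan distrib_left mult.assoc mult.left_commute)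
      then show ?thesis unfolding \<open>real (Suc m) * ?\<eta> = u\<close> by (simp only: mult.assoc mult.left_commute mult.commute)
    qed
    also have "exp (K * u) * (u * (2 * real (card J)) * w + ?\<eta> * (\<Sum>j<Suc m. c m j)) = d * w + exp (K * u) * (?\<eta> * (\<Sum>j<Suc m. c m j))"
      unfolding d_def distrib_left by (simp only: mult.assoc)
    finally show "(\<Sum>i\<in>J. e m i k) \<le> exp ((1 + \<gamma> + K') * u) * (?\<eta> * (\<Sum>j<Suc m. c m j)) + \<epsilon>"
      using e0[of k] w(2) unfolding K_def by linarith
  qed
qed

lemma periodic_lift: "periodic f \<Longrightarrow> f (x - (y - wrap y)) = f x"
  using periodic_int[of f x "- \<lfloor>(y + pi) / (2 * pi)\<rfloor>"] by (simp add: wrap_shift)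

lemma periodic_lift_diff:
  assumes "periodic f"
  shows "f ((x - (a - wrap a)) - (y - (b - wrap b))) = f (x - y)"
proof -
  have "(x - (a - wrap a)) - (y - (b - wrap b)) = x - y + 2 * pi * of_int (\<lfloor>(b + pi) / (2 * pi)\<rfloor> - \<lfloor>(a + pi) / (2 * pi)\<rfloor>)"
    unfolding wrap_shift by (simp add: algebra_simps)
  then show ?thesis by (simp only: periodic_int[OF assms])
qed

section \<open>Euler chains of the McKean-Vlasov process\<close>

context mckean
begin

definition chain :: "real \<Rightarrow> real \<Rightarrow> nat \<Rightarrow> nat \<Rightarrow> 'a \<Rightarrow> real" where
  "chain s u m k w = fst (euler \<gamma> \<sigma> (\<lambda>k. drift (s + real k * (u / real (Suc m)))) s (u / real (Suc m)) (\<lambda>r. \<beta> r w) (q s w, p s w) k)"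

text \<open>The lift \<open>q\<close> may start anywhere, the chain starts in
  \<open>[-pi, pi)\<close>; the difference is a multiple of the period and is subtracted for all
  times.\<close>

definition chain_error :: "real \<Rightarrow> real \<Rightarrow> nat \<Rightarrow> nat \<Rightarrow> 'a \<Rightarrow> real" where
  "chain_error s u m k w = \<bar>(q (s + real k * (u / real (Suc m))) w - (q s w - wrap (q s w))) - chain s u m k w\<bar>"

lemma drift_measurable: "0 \<le> t \<Longrightarrow> drift t \<in> borel_measurable borel"
  using drift_lipschitz by (rule lipschitz_continuous(2))

lemma drift_periodic: "periodic (drift t)"
proof -
  have "g (x + 2 * pi - y) = g (x - y)" for x y
  proof -
    have "x + 2 * pi - y = x - y + 2 * pi" by simp
    then show ?thesis using g_periodic unfolding periodic_def by metis
  qed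
  then show ?thesis by (simp add: periodic_def drift_def)
qed

lemma grid_nonneg: "0 \<le> s \<Longrightarrow> 0 < u \<Longrightarrow> 0 \<le> s + real k * (u / real (Suc m))"
  by simp

lemma chain_measurable:
  assumes "0 \<le> s" "0 < u"
  shows "chain s u m k \<in> borel_measurable M"
proof -
  have "(\<lambda>w. euler \<gamma> \<sigma> (\<lambda>k. drift (s + real k * (u / real (Suc m)))) s (u / real (Suc m)) (\<lambda>r. \<beta> r w) (q s w, p s w) k)
      \<in> borel_measurable (F (s + real k * (u / real (Suc m))))"
    using assms by (intro euler_F brownian q_F p_F drift_measurable grid_nonneg) auto
  from measurable_compose[OF measurable_F_M[OF this] fst_snd_borel(1)]
  show ?thesis unfolding chain_def[abs_def] .
qed

lemma chain_error_measurable: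
  assumes "0 \<le> s" "0 < u"
  shows "chain_error s u m k \<in> borel_measurable M"
proof -
  have "(\<lambda>w. wrap (q s w)) \<in> borel_measurable M" using q_M[OF assms(1)] by measurable
  then show ?thesis unfolding chain_error_def[abs_def]
    using q_M[OF grid_nonneg[OF assms]] q_M[OF assms(1)] chain_measurable[OF assms] by (intro borel_measurable_abs borel_measurable_diff)
qed

lemma chain_error_nonneg: "0 \<le> chain_error s u m k w"
  by (simp add: chain_error_def)

lemma chain_error_AE:
  assumes s: "0 \<le> s" "0 < u"
  shows "AE w in M. \<forall>\<epsilon>>0. \<exists>m0. \<forall>m\<ge>m0. \<forall>k\<le>Suc m. chain_error s u m k w \<le> \<epsilon>"
  using path_AE
proof eventually_elim
  case (elim w)
  show ?case
  proof (intro allI impI)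
    fix \<epsilon> :: real assume e: "0 < \<epsilon>"
    let ?T = "\<lambda>m k. s + real k * (u / real (Suc m))"
    have "\<exists>m0. \<forall>m\<ge>m0. \<forall>k\<le>Suc m. (\<Sum>i\<in>{0::nat}. chain_error s u m k w) \<le> exp ((1 + \<gamma> + L) * u) * ((u / real (Suc m)) * (\<Sum>j<Suc m. 0)) + \<epsilon>"
      unfolding chain_error_def chain_def
    proof (rule euler_average_error[where f="\<lambda>_ r. drift r (q r w)"])
      fix m k
      let ?X = "chain s u m k w"
      have "drift (?T m k) (q (?T m k) w) = drift (?T m k) (q (?T m k) w - (q s w - wrap (q s w)))"
        using periodic_lift[OF drift_periodic] by simp
      then have "\<bar>drift (?T m k) (q (?T m k) w) - drift (?T m k) ?X\<bar> \<le> L * \<bar>(q (?T m k) w - (q s w - wrap (q s w))) - ?X\<bar>"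
        using drift_lipschitz[OF grid_nonneg[OF s]] by simp
      then show "(\<Sum>i\<in>{0::nat}. \<bar>drift (?T m k) (q (?T m k) w) - drift (?T m k) (fst (euler \<gamma> \<sigma> (\<lambda>k. drift (s + real k * (u / real (Suc m)))) s (u / real (Suc m)) (\<lambda>r. \<beta> r w) (q s w, p s w) k))\<bar>)
        \<le> L * (\<Sum>i\<in>{0::nat}. \<bar>(q (?T m k) w - (q s w - wrap (q s w))) - fst (euler \<gamma> \<sigma> (\<lambda>k. drift (s + real k * (u / real (Suc m)))) s (u / real (Suc m)) (\<lambda>r. \<beta> r w) (q s w, p s w) k)\<bar>) + 0"
        unfolding chain_def by simp
    qed (use elim \<gamma> s L_nonneg e in auto)
    then show "\<exists>m0. \<forall>m\<ge>m0. \<forall>k\<le>Suc m. chain_error s u m k w \<le> \<epsilon>" by simp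
  qed
qed

lemma chain_error_truncated_bound:
  assumes "0 \<le> b" "0 \<le> l"
  shows "0 \<le> min (2 * b) (l * chain_error s u m k w)" "min (2 * b) (l * chain_error s u m k w) \<le> 2 * b"
  using assms chain_error_nonneg by auto

text \<open>A periodic test function does not see the lattice shift. Truncation at
  \<open>2 * b\<close> makes the error bounded, so almost sure convergence of the chain is enough
  and no moments of the momentum are involved.\<close>

lemma chain_weak_error:
  assumes s: "0 \<le> s" "0 < u" and \<psi>: "periodic \<psi>" "\<psi> \<in> borel_measurable borel" "\<And>x. \<bar>\<psi> x\<bar> \<le> b" "\<And>x y. \<bar>\<psi> x - \<psi> y\<bar> \<le> l * \<bar>x - y\<bar>"
  shows "\<bar>(LINT w|M. \<psi> (chain s u m k w)) - (LINT w|M. \<psi> (q (s + real k * (u / real (Suc m))) w))\<bar>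
    \<le> (LINT w|M. min (2 * b) (l * chain_error s u m k w))"
proof -
  let ?T = "s + real k * (u / real (Suc m))"
  have b: "0 \<le> b" using order_trans[OF abs_ge_zero \<psi>(3)[of 0]] .
  have l: "0 \<le> l" using order_trans[OF abs_ge_zero \<psi>(4)[of 1 0]] by simp
  have i: "integrable M (\<lambda>w. \<psi> (chain s u m k w))" "integrable M (\<lambda>w. \<psi> (q ?T w))"
    using measurable_compose[OF chain_measurable[OF s] \<psi>(2)] measurable_compose[OF q_M[OF grid_nonneg[OF s]] \<psi>(2)] \<psi>(3)
    by (auto intro!: integrable_const_bound[where B=b])
  have eq: "(LINT w|M. \<psi> (chain s u m k w)) - (LINT w|M. \<psi> (q ?T w)) = (LINT w|M. \<psi> (chain s u m k w) - \<psi> (q ?T w))"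
    using i by simp
  show ?thesis
    unfolding eq
  proof (rule order_trans[OF integral_abs_bound integral_mono])
    fix w
    have "\<psi> (q ?T w) = \<psi> (q ?T w - (q s w - wrap (q s w)))" using periodic_lift[OF \<psi>(1)] by simp
    then have "\<bar>\<psi> (chain s u m k w) - \<psi> (q ?T w)\<bar> \<le> l * chain_error s u m k w"
      using \<psi>(4) unfolding chain_error_def by (simp add: abs_minus_commute)
    moreover have "\<bar>\<psi> (chain s u m k w) - \<psi> (q ?T w)\<bar> \<le> 2 * b"
      using \<psi>(3)[of "chain s u m k w"] \<psi>(3)[of "q ?T w"] by linarith
    ultimately show "\<bar>\<psi> (chain s u m k w) - \<psi> (q ?T w)\<bar> \<le> min (2 * b) (l * chain_error s u m k w)" by simp
  next
    show "integrable M (\<lambda>w. min (2 * b) (l * chain_error s u m k w))"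
      using chain_error_measurable[OF s, of m k] chain_error_truncated_bound[OF b l, of s u m k]
      by (intro integrable_const_bound[where B="2 * b"]) auto
  qed (use i in auto)
qed

text \<open>The first limit is for the final time, where the law of the chain is compared with that
  of the process. The second is the time average of the bias in the force, which enters the Gronwall
  sum.\<close>

lemma chain_error_tendsto:
  assumes s: "0 \<le> s" "0 < u" and b: "0 \<le> b" "0 \<le> l"
  shows "(\<lambda>m. LINT w|M. min (2 * b) (l * chain_error s u m (Suc m) w)) \<longlonglongrightarrow> 0"
    "(\<lambda>m. (u / real (Suc m)) * (\<Sum>k<Suc m. LINT w|M. min (2 * b) (l * chain_error s u m k w))) \<longlonglongrightarrow> 0"
proof -
  let ?Y = "\<lambda>m k w. min (2 * b) (l * chain_error s u m k w)"
  have Ym: "?Y m k \<in> borel_measurable M" for m k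
    using chain_error_measurable[OF s, of m k] by (intro borel_measurable_min borel_measurable_times borel_measurable_const)
  note Yb = chain_error_truncated_bound[OF b, of s u]
  have half: "norm (x - 0) < r" if "0 \<le> x" "x \<le> r / 2" "0 < r" for x r :: real using that by simp
  have small: "\<exists>m0. \<forall>m\<ge>m0. \<forall>k\<le>Suc m. ?Y m k w \<le> e"
    if err: "\<forall>\<epsilon>>0. \<exists>m0. \<forall>m\<ge>m0. \<forall>k\<le>Suc m. chain_error s u m k w \<le> \<epsilon>" and e: "0 < e" for e w
  proof -
    have "0 < e / (l + 1)" using e b by simp
    then obtain m0 where m0: "\<And>m k. m0 \<le> m \<Longrightarrow> k \<le> Suc m \<Longrightarrow> chain_error s u m k w \<le> e / (l + 1)" using err by blast
    have "?Y m k w \<le> e" if "m0 \<le> m" "k \<le> Suc m" for m k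
    proof -
      have "l * chain_error s u m k w \<le> (l + 1) * (e / (l + 1))" using m0[OF that] b chain_error_nonneg by (intro mult_mono) auto
      also have "\<dots> = e" using b by simp
      finally show ?thesis by simp
    qed
    then show ?thesis by blast
  qed
  show "(\<lambda>m. LINT w|M. ?Y m (Suc m) w) \<longlonglongrightarrow> 0"
  proof (rule expectation_tendsto_zero[where C="2 * b"])
    show "\<bar>?Y m (Suc m) w\<bar> \<le> 2 * b" for m w using Yb[of m "Suc m" w] by linarith
    show "AE w in M. (\<lambda>m. ?Y m (Suc m) w) \<longlonglongrightarrow> 0"
      using chain_error_AE[OF s]
    proof eventually_elim
      case (elim w)
      show ?case
      proof (rule LIMSEQ_I)
        fix r :: real assume r: "0 < r"
        then have "0 < r / 2" by simp
        from small[OF elim this] obtain m0 where m0: "\<And>m k. m0 \<le> m \<Longrightarrow> k \<le> Suc m \<Longrightarrow> ?Y m k w \<le> r / 2" by blast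
        have "norm (?Y m (Suc m) w - 0) < r" if "m0 \<le> m" for m
        proof -
          have "?Y m (Suc m) w \<le> r / 2" using m0 that by blast
          then show ?thesis by (rule half[OF Yb(1) _ r])
        qed
        then show "\<exists>no. \<forall>n\<ge>no. norm (?Y n (Suc n) w - 0) < r" by blast
      qed
    qed
  qed (rule Ym)
  have iY: "integrable M (?Y m k)" for m k
    using Ym Yb by (intro integrable_const_bound[where B="2 * b"]) auto
  let ?S = "\<lambda>m w. (u / real (Suc m)) * (\<Sum>k<Suc m. ?Y m k w)"
  have Sb: "0 \<le> ?S m w" for m w using s by (intro mult_nonneg_nonneg sum_nonneg Yb(1)) auto
  have Sle: "?S m w \<le> u * e" if "\<And>k. k \<le> Suc m \<Longrightarrow> ?Y m k w \<le> e" for m w e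
  proof -
    have "?S m w \<le> (u / real (Suc m)) * (\<Sum>k<Suc m. e)" using s by (intro mult_left_mono sum_mono that) auto
    also have "\<dots> = u * e" by simp
    finally show ?thesis .
  qed
  have "(\<lambda>m. LINT w|M. ?S m w) \<longlonglongrightarrow> 0"
  proof (rule expectation_tendsto_zero[where C="u * (2 * b)"])
    show "?S m \<in> borel_measurable M" for m using Ym by (intro borel_measurable_times borel_measurable_sum borel_measurable_const)
    show "\<bar>?S m w\<bar> \<le> u * (2 * b)" for m w
      unfolding abs_of_nonneg[OF Sb] by (rule Sle) (rule Yb(2))
    show "AE w in M. (\<lambda>m. ?S m w) \<longlonglongrightarrow> 0"
      using chain_error_AE[OF s]
    proof eventually_elim
      case (elim w)
      show ?case
      proof (rule LIMSEQ_I)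
        fix r :: real assume r: "0 < r"
        then have "0 < r / (2 * u)" using s by simp
        from small[OF elim this] obtain m0 where m0: "\<And>m k. m0 \<le> m \<Longrightarrow> k \<le> Suc m \<Longrightarrow> ?Y m k w \<le> r / (2 * u)" by blast
        have "norm (?S m w - 0) < r" if "m0 \<le> m" for m
        proof -
          have "?S m w \<le> u * (r / (2 * u))" by (rule Sle) (rule m0[OF that])
          then have "?S m w \<le> r / 2" using s by simp
          then show ?thesis by (rule half[OF Sb _ r])
        qed
        then show "\<exists>no. \<forall>n\<ge>no. norm (?S n w - 0) < r" by blast
      qed
    qed
  qed
  moreover have "(LINT w|M. ?S m w) = (u / real (Suc m)) * (\<Sum>k<Suc m. LINT w|M. ?Y m k w)" for m
    using iY by (simp only: integral_mult_right_zero Bochner_Integration.integral_sum)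
  ultimately show "(\<lambda>m. (u / real (Suc m)) * (\<Sum>k<Suc m. LINT w|M. ?Y m k w)) \<longlonglongrightarrow> 0" by (simp only:)
qed

end

section \<open>Propagation of chaos\<close>

lemma (in prob_space) integrable_bounded:
  fixes X :: "'a \<Rightarrow> real"
  assumes "X \<in> borel_measurable M" "\<And>w. \<bar>X w\<bar> \<le> C"
  shows "integrable M X"
  using assms by (intro integrable_const_bound[where B=C]) auto

lemma euler_measurable:
  assumes z: "(\<lambda>w. (wrap (Q w), P w)) \<in> measurable A borel" and b: "(\<lambda>w. \<lambda>t\<in>{0..}. \<beta> t w) \<in> measurable A (PiM {0..} (\<lambda>_. borel))"
    and s: "0 \<le> s" "0 < \<eta>" and G: "\<And>k. G k \<in> borel_measurable borel"
  shows "(\<lambda>w. euler \<gamma> \<sigma> G s \<eta> (\<lambda>r. \<beta> r w) (Q w, P w) k) \<in> borel_measurable A"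
proof (induction k)
  case 0
  have "(\<lambda>w. wrap (Q w)) \<in> borel_measurable A" "(\<lambda>w. P w) \<in> borel_measurable A"
    using measurable_compose[OF z fst_snd_borel(1)] measurable_compose[OF z fst_snd_borel(2)] by simp_all
  then show ?case by (auto intro!: borel_measurable_Pair)
next
  case (Suc k)
  have \<beta>: "\<beta> t \<in> borel_measurable A" if "0 \<le> t" for t
    using measurable_compose[OF b measurable_component_singleton[of t]] that by simp
  have "(\<lambda>w. \<beta> (s + real (Suc k) * \<eta>) w - \<beta> (s + real k * \<eta>) w) \<in> borel_measurable A"
    using s by (intro borel_measurable_diff \<beta>) auto
  from measurable_compose[OF measurable_Pair[OF Suc this] euler_step_measurable[OF G[of k], of \<gamma> \<sigma> \<eta>]]
  show ?case by simp
qed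

text \<open>The McKean--Vlasov process lives on its own probability space, so independent copies of it driven by
  \<open>\<beta> i\<close> are not available; their Euler chains are, and have the law of the chain on \<open>Ma\<close>.\<close>

locale particles = A: mckean Ma Fa g B L \<gamma> \<sigma> \<beta>a qa pa + filtered M F
  for Ma :: "'b measure" and Fa g B L \<gamma> \<sigma> \<beta>a qa pa and M :: "'a measure" and F +
  fixes N :: nat and W :: "real \<Rightarrow> real" and t0 :: real and \<beta> q p :: "nat \<Rightarrow> real \<Rightarrow> 'a \<Rightarrow> real"
  assumes N: "0 < N" and t0: "0 < t0" and g_eq: "g = deriv W"
    and sys: "particle_system M F N \<gamma> \<sigma> W (phase_law Ma (qa t0) (pa t0)) \<beta> q p"
begin

lemma brownian: "i < N \<Longrightarrow> brownian_motion M F (\<beta> i)"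
  and initial_law: "i < N \<Longrightarrow> phase_law M (q i 0) (p i 0) = phase_law Ma (qa t0) (pa t0)"
  and sde: "i < N \<Longrightarrow> kinetic_sde M F \<gamma> \<sigma> (\<lambda>t w. - (1 / real N) * (\<Sum>j<N. g (q i t w - q j t w))) (\<beta> i) (q i) (p i)"
  and initial_indep: "indep_vars (\<lambda>_. borel) (\<lambda>i w. (wrap (q i 0 w), p i 0 w)) {..<N}"
  and brownian_indep: "indep_vars (\<lambda>_. PiM {0..} (\<lambda>_. borel)) (\<lambda>i w. \<lambda>t\<in>{0..}. \<beta> i t w) {..<N}"
  and initial_brownian_indep: "indep_set
       (sets (vimage_algebra (space M) (\<lambda>w. \<lambda>i\<in>{..<N}. (wrap (q i 0 w), p i 0 w)) (PiM {..<N} (\<lambda>_. borel))))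
       (sets (vimage_algebra (space M) (\<lambda>w. \<lambda>(i, t)\<in>{..<N} \<times> {0..}. \<beta> i t w) (PiM ({..<N} \<times> {0..}) (\<lambda>_. borel))))"
  using sys unfolding particle_system_def g_eq by blast+

lemma q_F: "i < N \<Longrightarrow> 0 \<le> t \<Longrightarrow> q i t \<in> borel_measurable (F t)" and p_F: "i < N \<Longrightarrow> 0 \<le> t \<Longrightarrow> p i t \<in> borel_measurable (F t)"
  using sde by (auto simp: kinetic_sde_def adapted_def)

lemma q_M: "i < N \<Longrightarrow> 0 \<le> t \<Longrightarrow> q i t \<in> borel_measurable M"
  using measurable_F_M[OF q_F] .

lemma path_AE: "AE w in M. \<forall>i\<in>{..<N}. kinetic_path \<gamma> \<sigma> (\<lambda>r. - (1 / real N) * (\<Sum>j<N. g (q i r w - q j r w))) (\<lambda>r. \<beta> i r w) (\<lambda>r. q i r w) (\<lambda>r. p i r w)"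
proof -
  have "AE w in M. \<forall>i\<in>{..<N}. continuous_on {0..} (\<lambda>t. q i t w) \<and> continuous_on {0..} (\<lambda>t. p i t w) \<and>
        (\<forall>t\<ge>0. q i t w = q i 0 w + (LBINT s=0..t. p i s w) \<and>
                p i t w = p i 0 w + (LBINT s=0..t. - \<gamma> * p i s w + - (1 / real N) * (\<Sum>j<N. g (q i s w - q j s w))) + \<sigma> * \<beta> i t w)"
    using sde by (intro AE_finite_allI) (auto simp: kinetic_sde_def)
  moreover have "AE w in M. \<forall>i\<in>{..<N}. continuous_on {0..} (\<lambda>t. \<beta> i t w)"
  proof (rule AE_finite_allI)
    fix i assume "i \<in> {..<N}"
    then have "AE w in M. \<beta> i 0 w = 0 \<and> continuous_on {0..} (\<lambda>t. \<beta> i t w)" using brownian by (auto simp: brownian_motion_def)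
    then show "AE w in M. continuous_on {0..} (\<lambda>t. \<beta> i t w)" by eventually_elim blast
  qed simp
  ultimately show ?thesis
  proof eventually_elim
    case (elim w)
    show ?case
    proof
      fix i assume i: "i \<in> {..<N}"
      show "kinetic_path \<gamma> \<sigma> (\<lambda>r. - (1 / real N) * (\<Sum>j<N. g (q i r w - q j r w))) (\<lambda>r. \<beta> i r w) (\<lambda>r. q i r w) (\<lambda>r. p i r w)"
      proof (rule kinetic_pathI)
        have c: "continuous_on {0..} (\<lambda>r. q j r w)" if "j < N" for j using elim(1) that by blast
        have "continuous_on {0..} (\<lambda>r. g (q i r w - q j r w))" if "j < N" for j
          using that i by (intro continuous_on_compose2[OF A.g_continuous] continuous_on_diff c) auto
        then show "continuous_on {0..} (\<lambda>r. - (1 / real N) * (\<Sum>j<N. g (q i r w - q j r w)))"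
          by (intro continuous_on_mult continuous_on_const continuous_on_sum) auto
      qed (use elim i in blast)+
    qed
  qed
qed

text \<open>The Brownian path is read from time 0, where the particles start, but the drift from
  \<open>t0\<close>, the age of the auxiliary process at that moment. It depends on particle
  \<open>i\<close> only through its initial datum and \<open>\<beta> i\<close>.\<close>

definition particle_chain :: "real \<Rightarrow> nat \<Rightarrow> nat \<Rightarrow> nat \<Rightarrow> 'a \<Rightarrow> real" where
  "particle_chain u m k i w = fst (euler \<gamma> \<sigma> (\<lambda>k. A.drift (t0 + real k * (u / real (Suc m)))) 0 (u / real (Suc m)) (\<lambda>r. \<beta> i r w) (q i 0 w, p i 0 w) k)"

lemma drift_grid_measurable: "0 < u \<Longrightarrow> A.drift (t0 + real k * (u / real (Suc m))) \<in> borel_measurable borel"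
  using t0 by (intro A.drift_measurable A.grid_nonneg) auto

text \<open>Both chains have the law produced by \<open>euler_law\<close> from the same initial
  phase law, although they live on different spaces and begin at different times.\<close>

lemma particle_chain_distr:
  assumes i: "i < N" and u: "0 < u"
  shows "particle_chain u m k i \<in> borel_measurable M" "distr M borel (particle_chain u m k i) = distr Ma borel (A.chain t0 u m k)"
proof -
  let ?G = "\<lambda>k. A.drift (t0 + real k * (u / real (Suc m)))" and ?\<eta> = "u / real (Suc m)"
  let ?E = "\<lambda>w. euler \<gamma> \<sigma> ?G 0 ?\<eta> (\<lambda>r. \<beta> i r w) (q i 0 w, p i 0 w) k"
  let ?Ea = "\<lambda>w. euler \<gamma> \<sigma> ?G t0 ?\<eta> (\<lambda>r. \<beta>a r w) (qa t0 w, pa t0 w) k"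
  have \<eta>: "0 < ?\<eta>" using u by simp
  have E: "?E \<in> borel_measurable M"
    by (rule measurable_F_M[OF euler_F[OF brownian[OF i] _ \<eta> q_F[OF i] p_F[OF i] drift_grid_measurable[OF u]]]) auto
  have Ea: "?Ea \<in> borel_measurable Ma"
    using t0 by (intro A.measurable_F_M[OF A.euler_F[OF A.brownian _ \<eta> A.q_F A.p_F drift_grid_measurable[OF u]]]) auto
  show "particle_chain u m k i \<in> borel_measurable M"
    using measurable_compose[OF E fst_snd_borel(1)] unfolding particle_chain_def[abs_def] .
  have "distr M borel ?E = euler_law \<gamma> \<sigma> ?G ?\<eta> (phase_law M (q i 0) (p i 0)) k"
    by (rule euler_distr[OF brownian[OF i] _ \<eta> q_F[OF i] p_F[OF i] drift_grid_measurable[OF u]]) auto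
  moreover have "distr Ma borel ?Ea = euler_law \<gamma> \<sigma> ?G ?\<eta> (phase_law Ma (qa t0) (pa t0)) k"
    using t0 by (intro A.euler_distr[OF A.brownian _ \<eta> A.q_F A.p_F drift_grid_measurable[OF u]]) auto
  ultimately have "distr M borel ?E = distr Ma borel ?Ea" unfolding initial_law[OF i] by simp
  then have "distr (distr M borel ?E) borel fst = distr (distr Ma borel ?Ea) borel fst" by simp
  then show "distr M borel (particle_chain u m k i) = distr Ma borel (A.chain t0 u m k)"
    unfolding distr_distr[OF fst_snd_borel(1) E] distr_distr[OF fst_snd_borel(1) Ea] comp_def particle_chain_def[abs_def] A.chain_def[abs_def] .
qed

lemma particle_chain_expectation:
  fixes \<phi> :: "real \<Rightarrow> real"
  assumes i: "i < N" and u: "0 < u" and \<phi>: "\<phi> \<in> borel_measurable borel"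
  shows "(LINT w|M. \<phi> (particle_chain u m k i w)) = (LINT w|Ma. \<phi> (A.chain t0 u m k w))"
  using integral_distr[OF particle_chain_distr(1)[OF i u] \<phi>, of m k] integral_distr[OF A.chain_measurable \<phi>, of t0 u m k]
    particle_chain_distr(2)[OF i u, of m k] t0 u by simp

text \<open>Each chain uses the deterministic drift of the auxiliary law, so the particles do not
  interact through it, and independence of the pairs of datum and noise passes to the
  chains.\<close>

lemma particle_chain_indep:
  assumes u: "0 < u"
  shows "indep_vars (\<lambda>_. borel) (particle_chain u m k) {..<N}"
proof (rule indep_vars_from_pairs[OF _ initial_indep brownian_indep _ _ _ _ initial_brownian_indep])
  fix i assume i: "i \<in> {..<N}"
  have zm: "(\<lambda>w. (wrap (q j 0 w), p j 0 w)) \<in> borel_measurable M" if "j < N" for j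
    using initial_indep that by (auto simp: indep_vars_def)
  have "(\<lambda>w. \<lambda>i\<in>{..<N}. (wrap (q i 0 w), p i 0 w)) \<in> space M \<rightarrow> space (PiM {..<N} (\<lambda>_. borel))" by (auto simp: space_PiM)
  from measurable_compose[OF measurable_vimage_algebra1[OF this] measurable_component_singleton[of i]]
  show "(\<lambda>w. (wrap (q i 0 w), p i 0 w)) \<in> borel_measurable (vimage_algebra (space M) (\<lambda>w. \<lambda>i\<in>{..<N}. (wrap (q i 0 w), p i 0 w)) (PiM {..<N} (\<lambda>_. borel)))"
    using i by simp
  let ?V = "vimage_algebra (space M) (\<lambda>w. \<lambda>(i, t)\<in>{..<N} \<times> {0..}. \<beta> i t w) (PiM ({..<N} \<times> {0..}) (\<lambda>_. borel))"
  have V: "(\<lambda>w. \<lambda>(i, t)\<in>{..<N} \<times> {0..}. \<beta> i t w) \<in> space M \<rightarrow> space (PiM ({..<N} \<times> {0..}) (\<lambda>_. borel))" by (auto simp: space_PiM)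
  show "(\<lambda>w. \<lambda>t\<in>{0..}. \<beta> i t w) \<in> measurable ?V (PiM {0..} (\<lambda>_. borel))"
  proof (rule measurable_restrict)
    fix t :: real assume t: "t \<in> {0..}"
    then have it: "(i, t) \<in> {..<N} \<times> {0..}" using i by simp
    from measurable_compose[OF measurable_vimage_algebra1[OF V] measurable_component_singleton[OF it]]
    show "\<beta> i t \<in> measurable ?V borel" using it by simp
  qed
  fix G :: "'a measure"
  assume z: "(\<lambda>w. (wrap (q i 0 w), p i 0 w)) \<in> borel_measurable G" and b: "(\<lambda>w. \<lambda>t\<in>{0..}. \<beta> i t w) \<in> measurable G (PiM {0..} (\<lambda>_. borel))"
  show "particle_chain u m k i \<in> borel_measurable G"
    using measurable_compose[OF euler_measurable[OF z b, of 0 "u / real (Suc m)"] fst_snd_borel(1)] u drift_grid_measurable[OF u]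
    unfolding particle_chain_def[abs_def] by simp
qed auto

end

section \<open>Coupling of the particles with the independent chains\<close>

context particles
begin

text \<open>The centring of the interaction sums has to use the law of the chain, not that of the
  process. The gap to the true drift, which carries the opposite sign, is then measured by
  \<open>bias\<close> and vanishes as the mesh is refined; \<open>fluctuation\<close> is the part
  that is small because \<open>N\<close> is large.\<close>

definition mean_force :: "real \<Rightarrow> nat \<Rightarrow> nat \<Rightarrow> real \<Rightarrow> real" where
  "mean_force u m k x = (LINT w|Ma. g (x - A.chain t0 u m k w))"

definition fluctuation :: "real \<Rightarrow> nat \<Rightarrow> nat \<Rightarrow> nat \<Rightarrow> 'a \<Rightarrow> real" where
  "fluctuation u m k i w = \<bar>(1 / real N) * (\<Sum>j<N. g (particle_chain u m k i w - particle_chain u m k j w)) - mean_force u m k (particle_chain u m k i w)\<bar>"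

definition bias :: "real \<Rightarrow> nat \<Rightarrow> nat \<Rightarrow> real" where
  "bias u m k = (LINT w|Ma. min (2 * B) (L * A.chain_error t0 u m k w))"

lemma bias_nonneg: "0 \<le> bias u m k"
  unfolding bias_def using A.chain_error_truncated_bound[OF A.B_nonneg A.L_nonneg] by (intro Bochner_Integration.integral_nonneg) auto

lemma mean_force:
  assumes u: "0 < u"
  shows "\<bar>mean_force u m k x\<bar> \<le> B" "\<bar>mean_force u m k x - mean_force u m k y\<bar> \<le> L * \<bar>x - y\<bar>"
    "\<bar>mean_force u m k x + A.drift (t0 + real k * (u / real (Suc m))) x\<bar> \<le> bias u m k"
proof -
  have gm: "(\<lambda>y. g (x - y)) \<in> borel_measurable borel" for x by measurable
  have int: "integrable Ma (\<lambda>w. g (x - A.chain t0 u m k w))" for x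
    using t0 u A.g_bound by (intro A.integrable_bounded[where C=B] measurable_compose[OF A.chain_measurable gm]) auto
  have "\<bar>mean_force u m k x\<bar> \<le> (LINT w|Ma. B)"
    unfolding mean_force_def by (rule order_trans[OF integral_abs_bound integral_mono]) (use int A.g_bound in auto)
  then show "\<bar>mean_force u m k x\<bar> \<le> B" by (simp add: A.prob_space)
  have "mean_force u m k x - mean_force u m k y = (LINT w|Ma. g (x - A.chain t0 u m k w) - g (y - A.chain t0 u m k w))"
    using int by (simp add: mean_force_def)
  moreover have "\<bar>LINT w|Ma. g (x - A.chain t0 u m k w) - g (y - A.chain t0 u m k w)\<bar> \<le> (LINT w|Ma. L * \<bar>x - y\<bar>)"
  proof (rule order_trans[OF integral_abs_bound integral_mono])
    show "\<bar>g (x - A.chain t0 u m k w) - g (y - A.chain t0 u m k w)\<bar> \<le> L * \<bar>x - y\<bar>" for w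
      using A.g_lipschitz[of "x - A.chain t0 u m k w" "y - A.chain t0 u m k w"] by simp
  qed (use int in auto)
  ultimately show "\<bar>mean_force u m k x - mean_force u m k y\<bar> \<le> L * \<bar>x - y\<bar>" by (simp add: A.prob_space)
  have "periodic (\<lambda>y. g (x - y))" by (rule periodic_reflect[OF A.g_periodic])
  moreover have "\<bar>g (x - a) - g (x - b)\<bar> \<le> L * \<bar>a - b\<bar>" for a b
    using A.g_lipschitz[of "x - a" "x - b"] by (simp add: abs_minus_commute)
  ultimately show "\<bar>mean_force u m k x + A.drift (t0 + real k * (u / real (Suc m))) x\<bar> \<le> bias u m k"
    using A.chain_weak_error[of t0 u "\<lambda>y. g (x - y)" B L m k] t0 u gm A.g_bound
    by (simp add: mean_force_def A.drift_def bias_def)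
qed

lemma mean_force_measurable: "0 < u \<Longrightarrow> mean_force u m k \<in> borel_measurable borel"
  using mean_force(2) by (rule lipschitz_continuous(2))

lemma fluctuation_measurable:
  assumes u: "0 < u" and i: "i < N"
  shows "fluctuation u m k i \<in> borel_measurable M"
  unfolding fluctuation_def[abs_def] using particle_chain_distr(1)[OF _ u] i
  by (intro borel_measurable_abs borel_measurable_diff borel_measurable_times borel_measurable_const borel_measurable_sum
      measurable_compose[OF _ A.g_measurable] measurable_compose[OF _ mean_force_measurable[OF u]]) auto

lemma average_bound:
  assumes "\<And>j. j < N \<Longrightarrow> \<bar>a j\<bar> \<le> b"
  shows "\<bar>(1 / real N) * (\<Sum>j<N. a j)\<bar> \<le> b"
proof -
  have "\<bar>(1 / real N) * (\<Sum>j<N. a j)\<bar> \<le> (1 / real N) * (\<Sum>j<N. b)"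
    unfolding abs_mult using assms by (intro mult_mono order_trans[OF sum_abs] sum_mono) auto
  then show ?thesis using N by simp
qed

lemma fluctuation_bound:
  assumes u: "0 < u"
  shows "0 \<le> fluctuation u m k i w" "fluctuation u m k i w \<le> 2 * B"
proof -
  show "0 \<le> fluctuation u m k i w" by (simp add: fluctuation_def)
  show "fluctuation u m k i w \<le> 2 * B"
    unfolding fluctuation_def
    using average_bound[OF A.g_bound, of "\<lambda>j. particle_chain u m k i w - particle_chain u m k j w"]
      mean_force(1)[OF u, of m k "particle_chain u m k i w"] by linarith
qed

lemma fluctuation_expectation:
  assumes u: "0 < u" and i: "i < N"
  shows "(LINT w|M. fluctuation u m k i w) \<le> 4 * B / sqrt (real N)"
  unfolding fluctuation_def
proof (rule interaction_mean[OF particle_chain_indep[OF u] A.g_measurable A.g_bound mean_force_measurable[OF u] mean_force(1)[OF u] _ i])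
  show "(LINT w|M. g (x - particle_chain u m k j w)) = mean_force u m k x" if "j < N" for j x
    unfolding mean_force_def by (rule particle_chain_expectation[OF that u]) measurable
qed

definition particle_error :: "real \<Rightarrow> nat \<Rightarrow> nat \<Rightarrow> nat \<Rightarrow> 'a \<Rightarrow> real" where
  "particle_error u m k i w = \<bar>(q i (0 + real k * (u / real (Suc m))) w - (q i 0 w - wrap (q i 0 w))) - particle_chain u m k i w\<bar>"

definition noise_bound :: "real \<Rightarrow> nat \<Rightarrow> 'a \<Rightarrow> real" where
  "noise_bound u m w = exp ((1 + \<gamma> + 2 * L) * u) * ((u / real (Suc m)) * (\<Sum>k<Suc m. (1 / real N) * (\<Sum>i<N. fluctuation u m k i w) + bias u m k))"

text \<open>Replacing particles by chains changes the force on particle \<open>i\<close> by its own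
  error and the average error, hence \<open>2 * L\<close> after summing. The rest is fluctuation of
  independent chains and bias of their law.\<close>

lemma force_error:
  assumes u: "0 < u"
  shows "(\<Sum>i<N. \<bar>- (1 / real N) * (\<Sum>j<N. g (q i (0 + real k * (u / real (Suc m))) w - q j (0 + real k * (u / real (Suc m))) w))
      - A.drift (t0 + real k * (u / real (Suc m))) (particle_chain u m k i w)\<bar>)
    \<le> 2 * L * (\<Sum>i<N. particle_error u m k i w) + ((\<Sum>i<N. fluctuation u m k i w) + real N * bias u m k)"
proof -
  define T where "T = 0 + real k * (u / real (Suc m))"
  define X where "X i = particle_chain u m k i w" for i
  define Q where "Q i = q i T w" for i
  define e where "e i = particle_error u m k i w" for i
  have e: "e i = \<bar>(Q i - (q i 0 w - wrap (q i 0 w))) - X i\<bar>" for i by (simp add: e_def particle_error_def Q_def T_def X_def)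
  define G where "G = A.drift (t0 + real k * (u / real (Suc m)))"
  define S where "S i = fluctuation u m k i w" for i
  have one: "\<bar>- (1 / real N) * (\<Sum>j<N. g (Q i - Q j)) - G (X i)\<bar> \<le> L * e i + L * ((1 / real N) * (\<Sum>j<N. e j)) + S i + bias u m k" for i
  proof -
    have "\<bar>g (Q i - Q j) - g (X i - X j)\<bar> \<le> L * e i + L * e j" for j
    proof -
      let ?a = "Q i - (q i 0 w - wrap (q i 0 w))" and ?b = "Q j - (q j 0 w - wrap (q j 0 w))"
      have "g (Q i - Q j) = g (?a - ?b)" using periodic_lift_diff[OF A.g_periodic, of "Q i" "q i 0 w" "Q j" "q j 0 w"] by simp
      then have "\<bar>g (Q i - Q j) - g (X i - X j)\<bar> \<le> L * \<bar>(?a - ?b) - (X i - X j)\<bar>" using A.g_lipschitz by simp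
      also have "\<dots> \<le> L * (e i + e j)" unfolding e using A.L_nonneg by (intro mult_left_mono) auto
      finally show ?thesis by (simp add: distrib_left)
    qed
    then have "\<bar>\<Sum>j<N. g (Q i - Q j) - g (X i - X j)\<bar> \<le> (\<Sum>j<N. L * e i + L * e j)"
      by (intro order_trans[OF sum_abs] sum_mono) auto
    then have "(1 / real N) * \<bar>\<Sum>j<N. g (Q i - Q j) - g (X i - X j)\<bar> \<le> (1 / real N) * (\<Sum>j<N. L * e i + L * e j)"
      by (intro mult_left_mono) auto
    also have "(1 / real N) * (\<Sum>j<N. L * e i + L * e j) = L * e i + L * ((1 / real N) * (\<Sum>j<N. e j))"
      using N by (simp add: sum.distrib sum_distrib_left[symmetric] add_divide_distrib)
    finally have "(1 / real N) * \<bar>\<Sum>j<N. g (Q i - Q j) - g (X i - X j)\<bar> \<le> L * e i + L * ((1 / real N) * (\<Sum>j<N. e j))" .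
    moreover have "\<bar>(1 / real N) * (\<Sum>j<N. g (Q i - Q j)) - (1 / real N) * (\<Sum>j<N. g (X i - X j))\<bar> = (1 / real N) * \<bar>\<Sum>j<N. g (Q i - Q j) - g (X i - X j)\<bar>"
      unfolding right_diff_distrib[symmetric] abs_mult sum_subtractf by simp
    ultimately have 1: "\<bar>(1 / real N) * (\<Sum>j<N. g (Q i - Q j)) - (1 / real N) * (\<Sum>j<N. g (X i - X j))\<bar> \<le> L * e i + L * ((1 / real N) * (\<Sum>j<N. e j))"
      by (simp only:)
    have 2: "\<bar>(1 / real N) * (\<Sum>j<N. g (X i - X j)) - mean_force u m k (X i)\<bar> = S i" by (simp add: S_def fluctuation_def X_def)
    have 3: "\<bar>mean_force u m k (X i) + G (X i)\<bar> \<le> bias u m k" unfolding G_def by (rule mean_force(3)[OF u])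
    have "\<bar>- a - d\<bar> \<le> r + s + t" if "\<bar>a - b\<bar> \<le> r" "\<bar>b - c\<bar> = s" "\<bar>c + d\<bar> \<le> t" for a b c d r s t :: real using that by linarith
    from this[OF 1 2 3] show ?thesis by simp
  qed
  have "(\<Sum>i<N. \<bar>- (1 / real N) * (\<Sum>j<N. g (Q i - Q j)) - G (X i)\<bar>) \<le> (\<Sum>i<N. L * e i + L * ((1 / real N) * (\<Sum>j<N. e j)) + S i + bias u m k)"
    by (rule sum_mono) (rule one)
  also have "\<dots> = 2 * L * (\<Sum>i<N. e i) + ((\<Sum>i<N. S i) + real N * bias u m k)"
    using N by (simp add: sum.distrib sum_distrib_left[symmetric])
  finally show ?thesis unfolding e_def S_def G_def Q_def T_def X_def .
qed

text \<open>\<open>noise_bound\<close> does not vanish pathwise with the mesh; it is what the law of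
  large numbers makes small in mean. Only the remainder \<open>\<epsilon>\<close> is a
  discretisation error.\<close>

lemma particle_error_AE:
  assumes u: "0 < u"
  shows "AE w in M. \<forall>\<epsilon>>0. \<exists>m0. \<forall>m\<ge>m0. (1 / real N) * (\<Sum>i<N. particle_error u m (Suc m) i w) \<le> noise_bound u m w + \<epsilon>"
  using path_AE
proof eventually_elim
  case (elim w)
  show ?case
  proof (intro allI impI)
    fix \<epsilon> :: real assume e: "0 < \<epsilon>"
    let ?c = "\<lambda>m k. (\<Sum>i<N. fluctuation u m k i w) + real N * bias u m k"
    have "\<exists>m0. \<forall>m\<ge>m0. \<forall>k\<le>Suc m. (\<Sum>i\<in>{..<N}. particle_error u m k i w) \<le> exp ((1 + \<gamma> + 2 * L) * u) * ((u / real (Suc m)) * (\<Sum>j<Suc m. ?c m j)) + \<epsilon>"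
      unfolding particle_error_def particle_chain_def
    proof (rule euler_average_error)
      show "0 \<le> ?c m k" for m k
        using fluctuation_bound(1)[OF u] bias_nonneg by (intro add_nonneg_nonneg sum_nonneg mult_nonneg_nonneg) auto
      show "kinetic_path \<gamma> \<sigma> (\<lambda>r. - (1 / real N) * (\<Sum>j<N. g (q i r w - q j r w))) (\<lambda>r. \<beta> i r w) (\<lambda>r. q i r w) (\<lambda>r. p i r w)" if "i \<in> {..<N}" for i
        using elim that by blast
    qed (use A.\<gamma> u A.L_nonneg e force_error[OF u, unfolded particle_error_def particle_chain_def] in auto)
    then obtain m0 where m0: "\<And>m. m0 \<le> m \<Longrightarrow> (\<Sum>i<N. particle_error u m (Suc m) i w) \<le> exp ((1 + \<gamma> + 2 * L) * u) * ((u / real (Suc m)) * (\<Sum>j<Suc m. ?c m j)) + \<epsilon>"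
      by blast
    have "(1 / real N) * (\<Sum>i<N. particle_error u m (Suc m) i w) \<le> noise_bound u m w + \<epsilon>" if "m0 \<le> m" for m
    proof -
      have "(1 / real N) * (\<Sum>i<N. particle_error u m (Suc m) i w) \<le> (1 / real N) * (exp ((1 + \<gamma> + 2 * L) * u) * ((u / real (Suc m)) * (\<Sum>j<Suc m. ?c m j)) + \<epsilon>)"
        by (intro mult_left_mono m0 that) simp
      also have "\<dots> = exp ((1 + \<gamma> + 2 * L) * u) * ((u / real (Suc m)) * ((1 / real N) * (\<Sum>j<Suc m. ?c m j))) + (1 / real N) * \<epsilon>"
        by (simp only: distrib_left mult.left_commute)
      also have "(1 / real N) * (\<Sum>j<Suc m. ?c m j) = (\<Sum>k<Suc m. (1 / real N) * (\<Sum>i<N. fluctuation u m k i w) + bias u m k)"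
        unfolding sum_distrib_left[of "1 / real N" _ "{..<Suc m}"] using N by (intro sum.cong refl) (simp add: add_divide_distrib)
      also have "exp ((1 + \<gamma> + 2 * L) * u) * ((u / real (Suc m)) * \<dots>) = noise_bound u m w" by (simp only: noise_bound_def)
      also have "(1 / real N) * \<epsilon> \<le> \<epsilon>" using N e by (simp add: field_simps)
      finally show ?thesis by simp
    qed
    then show "\<exists>m0. \<forall>m\<ge>m0. (1 / real N) * (\<Sum>i<N. particle_error u m (Suc m) i w) \<le> noise_bound u m w + \<epsilon>" by blast
  qed
qed

end

context particles
begin

lemma noise_bound:
  assumes u: "0 < u"
  shows "integrable M (noise_bound u m)" "0 \<le> noise_bound u m w"
    "(LINT w|M. noise_bound u m w) \<le> exp ((1 + \<gamma> + 2 * L) * u) * (u * (4 * B / sqrt (real N)) + (u / real (Suc m)) * (\<Sum>k<Suc m. bias u m k))"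
proof -
  have \<eta>: "0 \<le> u / real (Suc m)" using u by simp
  have iF: "integrable M (fluctuation u m k i)" if "i < N" for k i
    using fluctuation_measurable[OF u that] fluctuation_bound[OF u] by (intro integrable_bounded[where C="2 * B"]) auto
  have iS: "integrable M (\<lambda>w. (1 / real N) * (\<Sum>i<N. fluctuation u m k i w) + bias u m k)" for k
    using iF by (intro Bochner_Integration.integrable_add integrable_mult_right Bochner_Integration.integrable_sum) auto
  show "integrable M (noise_bound u m)"
    unfolding noise_bound_def[abs_def] by (intro integrable_mult_right Bochner_Integration.integrable_sum iS)
  show "0 \<le> noise_bound u m w"
    unfolding noise_bound_def by (intro mult_nonneg_nonneg sum_nonneg add_nonneg_nonneg \<eta> fluctuation_bound(1)[OF u] bias_nonneg) auto
  have one: "(LINT w|M. (1 / real N) * (\<Sum>i<N. fluctuation u m k i w) + bias u m k) \<le> 4 * B / sqrt (real N) + bias u m k" for k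
  proof -
    have "(LINT w|M. (1 / real N) * (\<Sum>i<N. fluctuation u m k i w) + bias u m k)
      = (LINT w|M. (1 / real N) * (\<Sum>i<N. fluctuation u m k i w)) + (LINT w|M. bias u m k)"
      using iF by (intro Bochner_Integration.integral_add integrable_mult_right Bochner_Integration.integrable_sum) auto
    also have "(LINT w|M. (1 / real N) * (\<Sum>i<N. fluctuation u m k i w)) = (1 / real N) * (\<Sum>i<N. LINT w|M. fluctuation u m k i w)"
      unfolding integral_mult_right_zero using iF by (subst Bochner_Integration.integral_sum) auto
    also have "\<dots> \<le> (1 / real N) * (\<Sum>i<N. 4 * B / sqrt (real N))"
      by (intro mult_left_mono sum_mono fluctuation_expectation[OF u]) auto
    also have "\<dots> = 4 * B / sqrt (real N)" using N by simp
    finally show ?thesis by (simp add: prob_space)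
  qed
  have "(LINT w|M. noise_bound u m w) = exp ((1 + \<gamma> + 2 * L) * u) * ((u / real (Suc m)) * (\<Sum>k<Suc m. LINT w|M. (1 / real N) * (\<Sum>i<N. fluctuation u m k i w) + bias u m k))"
    unfolding noise_bound_def[abs_def] integral_mult_right_zero using iS by (subst Bochner_Integration.integral_sum) auto
  also have "\<dots> \<le> exp ((1 + \<gamma> + 2 * L) * u) * ((u / real (Suc m)) * (\<Sum>k<Suc m. 4 * B / sqrt (real N) + bias u m k))"
    by (intro mult_left_mono sum_mono one \<eta>) simp
  also have "(u / real (Suc m)) * (\<Sum>k<Suc m. 4 * B / sqrt (real N) + bias u m k) = u * (4 * B / sqrt (real N)) + (u / real (Suc m)) * (\<Sum>k<Suc m. bias u m k)"
  proof -
    have "(u / real (Suc m)) * (real (Suc m) * x) = u * x" for x by simp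
    then show ?thesis unfolding sum.distrib sum_constant card_lessThan distrib_left by (simp only:)
  qed
  finally show "(LINT w|M. noise_bound u m w) \<le> exp ((1 + \<gamma> + 2 * L) * u) * (u * (4 * B / sqrt (real N)) + (u / real (Suc m)) * (\<Sum>k<Suc m. bias u m k))" .
qed

lemma particle_error_measurable:
  assumes u: "0 < u" and i: "i < N"
  shows "particle_error u m k i \<in> borel_measurable M"
proof -
  have "(\<lambda>w. wrap (q i 0 w)) \<in> borel_measurable M" using q_M[OF i, of 0] by measurable
  moreover have "0 \<le> 0 + real k * (u / real (Suc m))" using u by simp
  ultimately show ?thesis unfolding particle_error_def[abs_def]
    using q_M[OF i] particle_chain_distr(1)[OF i u] by (intro borel_measurable_abs borel_measurable_diff) auto
qed

text \<open>Synchronous coupling: compare the average over particles with the average over chains,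
  this with the mean under the chain law, and that with the mean under the process. The first two
  errors are \<open>O(N^(-1/2))\<close> uniformly in the mesh, up to terms that vanish when
  \<open>m \<rightarrow> \<infinity>\<close>.\<close>

lemma propagation_of_chaos:
  assumes u: "0 < u" and \<phi>: "periodic \<phi>" "\<And>x. \<bar>\<phi> x\<bar> \<le> b" "\<And>x y. \<bar>\<phi> x - \<phi> y\<bar> \<le> l * \<bar>x - y\<bar>"
  shows "(LINT w|M. \<bar>(1 / real N) * (\<Sum>i<N. \<phi> (q i u w)) - (LINT w|Ma. \<phi> (qa (t0 + u) w))\<bar>)
    \<le> (l * (exp ((1 + \<gamma> + 2 * L) * u) * (u * (4 * B))) + 2 * b) / sqrt (real N)"
proof -
  have b: "0 \<le> b" using order_trans[OF abs_ge_zero \<phi>(2)[of 0]] .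
  have l: "0 \<le> l" using order_trans[OF abs_ge_zero \<phi>(3)[of 1 0]] by simp
  have \<phi>m: "\<phi> \<in> borel_measurable borel" using \<phi>(3) by (rule lipschitz_continuous(2))
  let ?c = "LINT w|Ma. \<phi> (qa (t0 + u) w)"
  let ?K = "exp ((1 + \<gamma> + 2 * L) * u)"
  define A where "A w = (1 / real N) * (\<Sum>i<N. \<phi> (q i u w))" for w
  define R where "R m w = (1 / real N) * (\<Sum>i<N. particle_error u m (Suc m) i w)" for m w
  \<comment> \<open>The excess of the coupling error over \<open>noise_bound\<close>, truncated. It
    tends to 0 almost surely with no rate, and boundedness carries this over to the mean.\<close>
  define Y where "Y m w = min (2 * b) (l * max 0 (R m w - noise_bound u m w))" for m w
  define Z where "Z m w = (1 / real N) * (\<Sum>i<N. \<phi> (particle_chain u m (Suc m) i w))" for m w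
  define d where "d m = (LINT w|Ma. min (2 * b) (l * A.chain_error t0 u m (Suc m) w))" for m
  have Rm: "R m \<in> borel_measurable M" for m
    unfolding R_def[abs_def] using particle_error_measurable[OF u] by (intro borel_measurable_times borel_measurable_const borel_measurable_sum) auto
  have Ym: "Y m \<in> borel_measurable M" for m
    unfolding Y_def[abs_def] using Rm[of m] noise_bound(1)[OF u, of m] by (intro borel_measurable_min borel_measurable_max borel_measurable_times borel_measurable_diff borel_measurable_const) auto
  have Yb: "0 \<le> Y m w" "Y m w \<le> 2 * b" for m w using b l by (auto simp: Y_def)
  have Y0: "(\<lambda>m. LINT w|M. Y m w) \<longlonglongrightarrow> 0"
  proof (rule expectation_tendsto_zero[where C="2 * b"])
    show "\<bar>Y m w\<bar> \<le> 2 * b" for m w using Yb[of m w] by simp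
    show "AE w in M. (\<lambda>m. Y m w) \<longlonglongrightarrow> 0"
      using particle_error_AE[OF u]
    proof eventually_elim
      case (elim w)
      show ?case
      proof (rule LIMSEQ_I)
        fix r :: real assume r: "0 < r"
        define e where "e = r / (2 * (l + 1))"
        have e: "0 < e" "l * e \<le> r / 2" using r l by (auto simp: e_def field_simps)
        obtain m0 where m0: "\<And>m. m0 \<le> m \<Longrightarrow> R m w \<le> noise_bound u m w + e" using elim[rule_format, OF e(1)] unfolding R_def by blast
        have "norm (Y m w - 0) < r" if "m0 \<le> m" for m
        proof -
          have "max 0 (R m w - noise_bound u m w) \<le> e" using m0[OF that] e(1) by simp
          then have "l * max 0 (R m w - noise_bound u m w) \<le> l * e" using l by (rule mult_left_mono)
          then have "Y m w \<le> r / 2" using e(2) unfolding Y_def by linarith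
          then show ?thesis using Yb(1)[of m w] r unfolding real_norm_def by linarith
        qed
        then show "\<exists>no. \<forall>n\<ge>no. norm (Y n w - 0) < r" by blast
      qed
    qed
  qed (rule Ym)
  have AZ: "\<bar>A w - Z m w\<bar> \<le> l * noise_bound u m w + Y m w" for m w
  proof -
    have one: "\<bar>\<phi> (q i u w) - \<phi> (particle_chain u m (Suc m) i w)\<bar> \<le> l * particle_error u m (Suc m) i w" for i
    proof -
      have "0 + real (Suc m) * (u / real (Suc m)) = u" by simp
      then show ?thesis unfolding particle_error_def using \<phi>(3) periodic_lift[OF \<phi>(1), of "q i u w" "q i 0 w"] by metis
    qed
    have AZ': "A w - Z m w = (1 / real N) * (\<Sum>i<N. \<phi> (q i u w) - \<phi> (particle_chain u m (Suc m) i w))"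
      unfolding A_def Z_def sum_subtractf by (simp add: diff_divide_distrib)
    have "\<bar>A w - Z m w\<bar> \<le> (1 / real N) * (\<Sum>i<N. l * particle_error u m (Suc m) i w)"
      unfolding AZ' abs_mult using one by (intro mult_mono order_trans[OF sum_abs] sum_mono) auto
    also have "\<dots> = l * R m w" unfolding R_def sum_distrib_left[symmetric] by (simp only: mult.left_commute)
    finally have 1: "\<bar>A w - Z m w\<bar> \<le> l * R m w" .
    have 2: "\<bar>A w - Z m w\<bar> \<le> 2 * b"
      unfolding AZ' 
    proof (rule average_bound)
      show "\<bar>\<phi> (q j u w) - \<phi> (particle_chain u m (Suc m) j w)\<bar> \<le> 2 * b" for j
        using \<phi>(2)[of "q j u w"] \<phi>(2)[of "particle_chain u m (Suc m) j w"] by linarith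
    qed
    have "l * R m w \<le> l * (noise_bound u m w + max 0 (R m w - noise_bound u m w))" using l by (intro mult_left_mono) auto
    then have 3: "l * R m w \<le> l * noise_bound u m w + l * max 0 (R m w - noise_bound u m w)" by (simp add: distrib_left)
    have 4: "0 \<le> l * noise_bound u m w" using l noise_bound(2)[OF u] by (rule mult_nonneg_nonneg)
    show ?thesis unfolding Y_def using 1 2 3 4 by linarith
  qed
  have iA: "integrable M A" unfolding A_def[abs_def]
    using q_M u \<phi>(2) \<phi>m by (intro integrable_mult_right Bochner_Integration.integrable_sum integrable_bounded[where C=b] measurable_compose[OF _ \<phi>m]) auto
  have iZ: "integrable M (Z m)" for m unfolding Z_def[abs_def]
    using particle_chain_distr(1)[OF _ u] \<phi>(2) \<phi>m by (intro integrable_mult_right Bochner_Integration.integrable_sum integrable_bounded[where C=b] measurable_compose[OF _ \<phi>m]) auto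
  have iY: "integrable M (Y m)" for m using Ym Yb by (intro integrable_bounded[where C="2 * b"]) auto
  have bound: "(LINT w|M. \<bar>A w - ?c\<bar>) \<le> l * (?K * (u * (4 * B / sqrt (real N)) + (u / real (Suc m)) * (\<Sum>k<Suc m. bias u m k))) + (LINT w|M. Y m w) + 2 * b / sqrt (real N) + d m" for m
  proof -
    define a where "a = (LINT w|Ma. \<phi> (A.chain t0 u m (Suc m) w))"
    have "t0 + real (Suc m) * (u / real (Suc m)) = t0 + u" by simp
    then have ac: "\<bar>a - ?c\<bar> \<le> d m"
      using A.chain_weak_error[OF less_imp_le[OF t0] u \<phi>(1) \<phi>m \<phi>(2,3), of m "Suc m"] unfolding a_def d_def by (simp only:)
    have "(LINT w|M. \<bar>A w - ?c\<bar>) \<le> (LINT w|M. l * noise_bound u m w + Y m w + \<bar>Z m w - a\<bar> + d m)"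
    proof (rule integral_mono)
      show "\<bar>A w - ?c\<bar> \<le> l * noise_bound u m w + Y m w + \<bar>Z m w - a\<bar> + d m" for w
        using AZ[of w m] ac by linarith
    qed (use iA iZ[of m] iY[of m] noise_bound(1)[OF u, of m] in auto)
    also have "\<dots> = l * (LINT w|M. noise_bound u m w) + (LINT w|M. Y m w) + (LINT w|M. \<bar>Z m w - a\<bar>) + d m"
      using iZ[of m] iY[of m] noise_bound(1)[OF u, of m] by (simp add: prob_space)
    also have "(LINT w|M. \<bar>Z m w - a\<bar>) \<le> 2 * b / sqrt (real N)"
      unfolding Z_def a_def by (rule independent_mean[OF particle_chain_indep[OF u] \<phi>m \<phi>(2) particle_chain_expectation[OF _ u \<phi>m] N])
    also have "l * (LINT w|M. noise_bound u m w) \<le> l * (?K * (u * (4 * B / sqrt (real N)) + (u / real (Suc m)) * (\<Sum>k<Suc m. bias u m k)))"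
      using noise_bound(3)[OF u] l by (rule mult_left_mono)
    finally show ?thesis by simp
  qed
  have "(\<lambda>m. l * (?K * (u * (4 * B / sqrt (real N)) + (u / real (Suc m)) * (\<Sum>k<Suc m. bias u m k))) + (LINT w|M. Y m w) + 2 * b / sqrt (real N) + d m)
    \<longlonglongrightarrow> l * (?K * (u * (4 * B / sqrt (real N)) + 0)) + 0 + 2 * b / sqrt (real N) + 0"
    unfolding d_def bias_def using t0
    by (intro tendsto_add tendsto_mult tendsto_const Y0 A.chain_error_tendsto u b l A.B_nonneg A.L_nonneg) auto
  then have "(LINT w|M. \<bar>A w - ?c\<bar>) \<le> l * (?K * (u * (4 * B / sqrt (real N)) + 0)) + 0 + 2 * b / sqrt (real N) + 0"
    by (rule LIMSEQ_le_const) (use bound in auto)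
  also have "\<dots> = (l * (?K * (u * (4 * B))) + 2 * b) / sqrt (real N)" by (simp add: add_divide_distrib)
  finally show ?thesis unfolding A_def .
qed

end

section \<open>Comparison of the covariances\<close>

text \<open>The geometric mean lies between \<open>a\<close> and \<open>b\<close>, so its distance
  to \<open>c\<close> is controlled by the distances of these two. This takes the place of a
  Lipschitz bound for the square root, which would fail near 0.\<close>

lemma sqrt_mult_diff_le:
  fixes a b c :: real
  assumes "0 \<le> a" "0 \<le> b" "0 \<le> c"
  shows "\<bar>sqrt a * sqrt b - c\<bar> \<le> \<bar>a - c\<bar> + \<bar>b - c\<bar>"
proof -
  have 1: "min a b \<le> sqrt a * sqrt b" "sqrt a * sqrt b \<le> max a b"
  proof -
    have "sqrt (min a b) * sqrt (min a b) \<le> sqrt a * sqrt b" using assms by (intro mult_mono) auto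
    then show "min a b \<le> sqrt a * sqrt b" using assms by simp
    have "sqrt a * sqrt b \<le> sqrt (max a b) * sqrt (max a b)" using assms by (intro mult_mono) auto
    then show "sqrt a * sqrt b \<le> max a b" using assms by simp
  qed
  show ?thesis
  proof (cases "a \<le> b")
    case True then show ?thesis using 1 by simp
  next
    case False then show ?thesis using 1 by simp
  qed
qed

lemma scale_sqrt2_bounds:
  assumes e: "0 < \<epsilon>" "\<epsilon> \<le> 1"
  shows "0 < \<epsilon> / sqrt 2" "\<epsilon> / sqrt 2 \<le> 2" "1 / (\<epsilon> / sqrt 2) \<le> 2 / \<epsilon>" "2 / (\<epsilon> / sqrt 2) ^ 3 \<le> 6 / \<epsilon> ^ 3"
    "0 < sqrt 2 * \<epsilon>" "sqrt 2 * \<epsilon> \<le> 2" "1 / (sqrt 2 * \<epsilon>) \<le> 1 / \<epsilon>"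
proof -
  have s: "1 \<le> sqrt 2" "sqrt 2 \<le> (3 / 2 :: real)" by (rule sqrt2_bounds)+
  show "0 < \<epsilon> / sqrt 2" "0 < sqrt 2 * \<epsilon>" using e by auto
  show "\<epsilon> / sqrt 2 \<le> 2"
  proof -
    have "\<epsilon> / sqrt 2 \<le> \<epsilon> / 1" using e s by (intro divide_left_mono) auto
    then show ?thesis using e by simp
  qed
  show "sqrt 2 * \<epsilon> \<le> 2" using mult_mono[OF s(2) e(2)] e by simp
  show "1 / (sqrt 2 * \<epsilon>) \<le> 1 / \<epsilon>" using e s mult_right_mono[OF s(1), of \<epsilon>] by (intro divide_left_mono) auto
  have "sqrt 2 / \<epsilon> \<le> 2 / \<epsilon>" using e s by (intro divide_right_mono) auto
  then show "1 / (\<epsilon> / sqrt 2) \<le> 2 / \<epsilon>" by simp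
  have "2 / (\<epsilon> / sqrt 2) ^ 3 = 4 * sqrt 2 / \<epsilon> ^ 3" using e by (simp add: power_divide power3_eq_cube)
  also have "\<dots> \<le> 6 / \<epsilon> ^ 3" using e s by (intro divide_right_mono) auto
  finally show "2 / (\<epsilon> / sqrt 2) ^ 3 \<le> 6 / \<epsilon> ^ 3" .
qed

text \<open>\<open>N = \<epsilon> powr (-\<theta>)\<close> gives the exponent
  \<open>\<theta> / 2 - 3\<close>, which exceeds \<open>1/2\<close> exactly when
  \<open>\<theta> > 7\<close>.\<close>

lemma sqrt_of_scaling:
  assumes e: "0 < \<epsilon>" "\<epsilon> \<le> 1" and N: "real N * \<epsilon> powr \<theta> = 1" and \<theta>: "7 < \<theta>"
  shows "0 < N" "1 / \<epsilon> ^ 3 / sqrt (real N) \<le> \<epsilon> powr (1 / 2)"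
proof -
  show "0 < N" using N by (cases N) auto
  have "real N = \<epsilon> powr (- \<theta>)" using N e by (simp add: powr_minus field_simps)
  moreover have "(\<epsilon> powr (- (\<theta> / 2)))\<^sup>2 = \<epsilon> powr (- \<theta>)" by (simp add: power2_eq_square powr_add[symmetric])
  ultimately have "sqrt (real N) = \<epsilon> powr (- (\<theta> / 2))" by (intro real_sqrt_unique) auto
  then have "1 / sqrt (real N) = \<epsilon> powr (\<theta> / 2)"
    using powr_minus[of \<epsilon> "- (\<theta> / 2)"] by (simp only: inverse_eq_divide minus_minus)
  moreover have "1 / \<epsilon> ^ 3 = \<epsilon> powr (- 3)"
    using powr_minus[of \<epsilon> 3] powr_numeral[of \<epsilon> "num.Bit1 num.One"] e by (simp only: inverse_eq_divide less_imp_le)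
  ultimately have "1 / \<epsilon> ^ 3 / sqrt (real N) = \<epsilon> powr (- 3) * \<epsilon> powr (\<theta> / 2)"
    by (metis times_divide_eq_right mult.right_neutral)
  also have "\<dots> = \<epsilon> powr (\<theta> / 2 - 3)" by (simp add: powr_add[symmetric])
  also have "\<dots> \<le> \<epsilon> powr (1 / 2)" using e \<theta> by (intro powr_mono') auto
  finally show "1 / \<epsilon> ^ 3 / sqrt (real N) \<le> \<epsilon> powr (1 / 2)" .
qed

section \<open>Densities in time of the two covariances, and their difference\<close>

context particles
begin

lemma emp_density_bounds:
  assumes e: "0 < \<epsilon>" "\<epsilon> \<le> 1"
  shows "0 \<le> emp_density N (\<epsilon> / sqrt 2) q x u w" "emp_density N (\<epsilon> / sqrt 2) q x u w \<le> 2 / \<epsilon>"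
proof -
  have v: "0 \<le> vm (\<epsilon> / sqrt 2) y" "vm (\<epsilon> / sqrt 2) y \<le> 2 / \<epsilon>" for y
    using vm_bounds[of "\<epsilon> / sqrt 2" y] scale_sqrt2_bounds[OF e] by auto
  show "0 \<le> emp_density N (\<epsilon> / sqrt 2) q x u w" unfolding emp_density_def using v by (intro mult_nonneg_nonneg sum_nonneg) auto
  have "\<bar>vm (\<epsilon> / sqrt 2) y\<bar> \<le> 2 / \<epsilon>" for y using v[of y] by simp
  from average_bound[OF this, of "\<lambda>j. x - q j u w"]
  show "emp_density N (\<epsilon> / sqrt 2) q x u w \<le> 2 / \<epsilon>" unfolding emp_density_def by linarith
qed

lemma density_chaos:
  assumes e: "0 < \<epsilon>" "\<epsilon> \<le> 1" and sc: "real N * \<epsilon> powr \<theta> = 1" "7 < \<theta>" and u: "0 < u" "u \<le> T"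
  shows "(LINT w|M. \<bar>emp_density N (\<epsilon> / sqrt 2) q x u w - (LINT w|Ma. vm (\<epsilon> / sqrt 2) (x - qa (t0 + u) w))\<bar>)
    \<le> (6 * (exp ((1 + \<gamma> + 2 * L) * T) * (T * (4 * B))) + 4) * \<epsilon> powr (1 / 2)"
proof -
  note s = scale_sqrt2_bounds[OF e]
  let ?\<phi> = "\<lambda>y. vm (\<epsilon> / sqrt 2) (x - y)"
  have b: "\<bar>?\<phi> y\<bar> \<le> 2 / \<epsilon>" for y using vm_bounds[OF s(1,2), of "x - y"] s(3) by simp
  have l: "\<bar>?\<phi> y - ?\<phi> z\<bar> \<le> 6 / \<epsilon> ^ 3 * \<bar>y - z\<bar>" for y z
  proof -
    have "\<bar>?\<phi> y - ?\<phi> z\<bar> \<le> 2 / (\<epsilon> / sqrt 2) ^ 3 * \<bar>(x - y) - (x - z)\<bar>" by (rule vm_lipschitz[OF s(1,2)])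
    also have "\<dots> \<le> 6 / \<epsilon> ^ 3 * \<bar>(x - y) - (x - z)\<bar>" by (intro mult_right_mono s(4)) simp
    also have "\<bar>(x - y) - (x - z)\<bar> = \<bar>y - z\<bar>" by simp
    finally show ?thesis .
  qed
  let ?K = "\<lambda>u. exp ((1 + \<gamma> + 2 * L) * u) * (u * (4 * B))"
  have K: "0 \<le> ?K u" "?K u \<le> ?K T"
    using u A.\<gamma> A.L_nonneg A.B_nonneg by (auto intro!: mult_mono mult_left_mono mult_right_mono)
  have "(LINT w|M. \<bar>emp_density N (\<epsilon> / sqrt 2) q x u w - (LINT w|Ma. ?\<phi> (qa (t0 + u) w))\<bar>) \<le> (6 / \<epsilon> ^ 3 * ?K u + 2 * (2 / \<epsilon>)) / sqrt (real N)"
    unfolding emp_density_def by (rule propagation_of_chaos[OF u(1) periodic_reflect[OF vm_periodic] b l])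
  also have "\<dots> \<le> ((6 * ?K T + 4) * (1 / \<epsilon> ^ 3)) / sqrt (real N)"
  proof (rule divide_right_mono)
    have "\<epsilon> ^ 3 \<le> \<epsilon> ^ 1" using e by (intro power_decreasing) auto
    then have "4 / \<epsilon> \<le> 4 / \<epsilon> ^ 3" using e by (intro divide_left_mono) auto
    moreover have "6 / \<epsilon> ^ 3 * ?K u \<le> 6 / \<epsilon> ^ 3 * ?K T" using K(2) e by (intro mult_left_mono) auto
    ultimately have "6 / \<epsilon> ^ 3 * ?K u + 2 * (2 / \<epsilon>) \<le> 6 / \<epsilon> ^ 3 * ?K T + 4 / \<epsilon> ^ 3" by linarith
    also have "\<dots> = (6 * ?K T + 4) * (1 / \<epsilon> ^ 3)" by (simp add: distrib_right add_divide_distrib)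
    finally show "6 / \<epsilon> ^ 3 * ?K u + 2 * (2 / \<epsilon>) \<le> (6 * ?K T + 4) * (1 / \<epsilon> ^ 3)" .
  qed simp
  also have "\<dots> = (6 * ?K T + 4) * (1 / \<epsilon> ^ 3 / sqrt (real N))" by simp
  also have "\<dots> \<le> (6 * ?K T + 4) * \<epsilon> powr (1 / 2)"
  proof (rule mult_left_mono[OF sqrt_of_scaling(2)[OF e sc]])
    have "0 \<le> ?K T" using K by (rule order_trans)
    then show "0 \<le> 6 * ?K T + 4" by simp
  qed
  finally show ?thesis .
qed

text \<open>Together with \<open>Y_density\<close>: up to the factor \<open>\<sigma>^2 / N\<close>,
  which both noises share, these are the integrands in time of the two covariances.\<close>

definition Z_density :: "real \<Rightarrow> real \<Rightarrow> real \<Rightarrow> real \<Rightarrow> real" where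
  "Z_density \<epsilon> x y u = (LINT w|M. (1 / real N) * (\<Sum>i<N. vm \<epsilon> (x - q i u w) * vm \<epsilon> (y - q i u w)))"

definition Y_density :: "real \<Rightarrow> real \<Rightarrow> real \<Rightarrow> real \<Rightarrow> real" where
  "Y_density \<epsilon> x y u = vm (sqrt 2 * \<epsilon>) (x - y) * (LINT w|M. sqrt (emp_density N (\<epsilon> / sqrt 2) q x u w) * sqrt (emp_density N (\<epsilon> / sqrt 2) q y u w))"

lemma emp_density_measurable: "0 \<le> u \<Longrightarrow> emp_density N \<delta> q x u \<in> borel_measurable M"
  unfolding emp_density_def[abs_def]
  by (intro borel_measurable_times borel_measurable_const borel_measurable_sum measurable_compose[OF _ vm_measurable] borel_measurable_diff q_M) auto

lemma sqrt_density_bound: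
  assumes e: "0 < \<epsilon>" "\<epsilon> \<le> 1"
  shows "0 \<le> sqrt (emp_density N (\<epsilon> / sqrt 2) q x u w) * sqrt (emp_density N (\<epsilon> / sqrt 2) q y u w)"
    "sqrt (emp_density N (\<epsilon> / sqrt 2) q x u w) * sqrt (emp_density N (\<epsilon> / sqrt 2) q y u w) \<le> 2 / \<epsilon>"
proof -
  note r = emp_density_bounds[OF e]
  show "0 \<le> sqrt (emp_density N (\<epsilon> / sqrt 2) q x u w) * sqrt (emp_density N (\<epsilon> / sqrt 2) q y u w)" using r(1) by simp
  have "sqrt (emp_density N (\<epsilon> / sqrt 2) q x u w) * sqrt (emp_density N (\<epsilon> / sqrt 2) q y u w) \<le> sqrt (2 / \<epsilon>) * sqrt (2 / \<epsilon>)"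
    using r e by (intro mult_mono real_sqrt_le_mono) auto
  then show "sqrt (emp_density N (\<epsilon> / sqrt 2) q x u w) * sqrt (emp_density N (\<epsilon> / sqrt 2) q y u w) \<le> 2 / \<epsilon>" using e by simp
qed

lemma expectation_bounds:
  fixes X :: "'a \<Rightarrow> real"
  assumes "X \<in> borel_measurable M" "\<And>w. 0 \<le> X w" "\<And>w. X w \<le> c"
  shows "0 \<le> (LINT w|M. X w)" "(LINT w|M. X w) \<le> c"
proof -
  show "0 \<le> (LINT w|M. X w)" by (intro Bochner_Integration.integral_nonneg assms)
  have "(LINT w|M. X w) \<le> (LINT w|M. c)" using assms order_trans[OF assms(2,3)] by (intro integral_mono integrable_bounded[where C=c]) (auto simp: abs_of_nonneg)
  then show "(LINT w|M. X w) \<le> c" by (simp add: prob_space)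
qed

lemma Z_density_bounds:
  assumes u: "0 \<le> u" and c: "\<And>z. vm \<epsilon> (x - z) * vm \<epsilon> (y - z) \<le> c" and e: "0 < \<epsilon>" "\<epsilon> \<le> 1"
  shows "0 \<le> Z_density \<epsilon> x y u" "Z_density \<epsilon> x y u \<le> c"
proof -
  have v: "0 \<le> vm \<epsilon> z" for z using vm_bounds(1)[of \<epsilon> z] e by simp
  have vv: "\<bar>vm \<epsilon> (x - z) * vm \<epsilon> (y - z)\<bar> \<le> c" for z using v c[of z] by (simp add: abs_mult)
  have m: "(\<lambda>w. (1 / real N) * (\<Sum>i<N. vm \<epsilon> (x - q i u w) * vm \<epsilon> (y - q i u w))) \<in> borel_measurable M"
    by (intro borel_measurable_times borel_measurable_const borel_measurable_sum measurable_compose[OF _ vm_measurable] borel_measurable_diff q_M u) auto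
  have 1: "0 \<le> (1 / real N) * (\<Sum>i<N. vm \<epsilon> (x - q i u w) * vm \<epsilon> (y - q i u w))" for w
    using v by (intro mult_nonneg_nonneg sum_nonneg) auto
  have 2: "(1 / real N) * (\<Sum>i<N. vm \<epsilon> (x - q i u w) * vm \<epsilon> (y - q i u w)) \<le> c" for w
    using average_bound[OF vv, of "\<lambda>j. q j u w"] by linarith
  show "0 \<le> Z_density \<epsilon> x y u" "Z_density \<epsilon> x y u \<le> c"
    unfolding Z_density_def by (rule expectation_bounds[OF m 1 2])+
qed

lemma Y_density_bounds:
  assumes u: "0 \<le> u" and e: "0 < \<epsilon>" "\<epsilon> \<le> 1"
  shows "0 \<le> Y_density \<epsilon> x y u" "Y_density \<epsilon> x y u \<le> vm (sqrt 2 * \<epsilon>) (x - y) * (2 / \<epsilon>)"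
proof -
  have v: "0 \<le> vm (sqrt 2 * \<epsilon>) (x - y)" using vm_bounds(1) scale_sqrt2_bounds[OF e] by (simp add: less_imp_le)
  have m: "(\<lambda>w. sqrt (emp_density N (\<epsilon> / sqrt 2) q x u w) * sqrt (emp_density N (\<epsilon> / sqrt 2) q y u w)) \<in> borel_measurable M"
    using emp_density_measurable[OF u] by simp
  note b = expectation_bounds[OF m sqrt_density_bound[OF e]]
  show "0 \<le> Y_density \<epsilon> x y u" "Y_density \<epsilon> x y u \<le> vm (sqrt 2 * \<epsilon>) (x - y) * (2 / \<epsilon>)"
    unfolding Y_density_def using b v by (intro mult_nonneg_nonneg mult_left_mono; simp)+
qed

text \<open>Three applications of chaos, at \<open>x\<close>, at \<open>y\<close> and at the
  midpoint, and two of the Hoelder bound account for \<open>3\<close> and \<open>2 * C\<close>. The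
  exponent is \<open>7/160 = 7/8 * 1/20\<close>, cutoff times Hoelder exponent.\<close>

lemma density_diff_near:
  assumes e: "0 < \<epsilon>" "\<epsilon> \<le> 1" and sc: "real N * \<epsilon> powr \<theta> = 1" "7 < \<theta>" and u: "0 < u" "u \<le> T"
    and d: "\<bar>x - y\<bar> \<le> \<epsilon> powr (7/8)"
    and compare: "\<And>z. \<bar>vm \<epsilon> (x - z) * vm \<epsilon> (y - z) - vm (sqrt 2 * \<epsilon>) (x - y) * vm (\<epsilon> / sqrt 2) ((x + y) / 2 - z)\<bar>
      \<le> vm (sqrt 2 * \<epsilon>) (x - y) * K"
    and holder: "\<And>a b. \<bar>(LINT w|Ma. vm (\<epsilon> / sqrt 2) (a - qa (t0 + u) w)) - (LINT w|Ma. vm (\<epsilon> / sqrt 2) (b - qa (t0 + u) w))\<bar> \<le> C * \<bar>a - b\<bar> powr (1/20)"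
    and C: "0 \<le> C"
  shows "\<bar>Z_density \<epsilon> x y u - Y_density \<epsilon> x y u\<bar>
    \<le> vm (sqrt 2 * \<epsilon>) (x - y) * (K + (3 * (6 * (exp ((1 + \<gamma> + 2 * L) * T) * (T * (4 * B))) + 4) + 2 * C) * \<epsilon> powr (7/160))"
proof -
  let ?w = "vm (sqrt 2 * \<epsilon>) (x - y)" and ?z = "(x + y) / 2"
  define \<rho> where "\<rho> a w = emp_density N (\<epsilon> / sqrt 2) q a u w" for a w
  define m where "m a = (LINT w|Ma. vm (\<epsilon> / sqrt 2) (a - qa (t0 + u) w))" for a
  define c where "c = 6 * (exp ((1 + \<gamma> + 2 * L) * T) * (T * (4 * B))) + 4"
  note s = scale_sqrt2_bounds[OF e]
  have w: "0 \<le> ?w" using vm_bounds(1)[OF s(5,6)] by (simp add: less_imp_le)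
  have \<rho>: "\<rho> a \<in> borel_measurable M" "0 \<le> \<rho> a w" "\<rho> a w \<le> 2 / \<epsilon>" for a w
    unfolding \<rho>_def using emp_density_measurable[of u] u emp_density_bounds[OF e] by auto
  have i\<rho>: "integrable M (\<rho> a)" for a using \<rho>(1)[of a] \<rho>(2,3)[of a] by (intro integrable_bounded[where C="2 / \<epsilon>"]) auto
  have iS: "integrable M (\<lambda>w. sqrt (\<rho> x w) * sqrt (\<rho> y w))"
    using sqrt_density_bound[OF e, of x u _ y] \<rho>(1)[of x] \<rho>(1)[of y] unfolding \<rho>_def by (intro integrable_bounded[where C="2 / \<epsilon>"]) auto
  have m0: "0 \<le> m a" for a
    unfolding m_def using vm_bounds(1)[OF s(1,2)] by (intro Bochner_Integration.integral_nonneg) (auto simp: less_imp_le)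
  have chaos: "(LINT w|M. \<bar>\<rho> a w - m a\<bar>) \<le> c * \<epsilon> powr (7/160)" for a
  proof -
    have "(LINT w|M. \<bar>\<rho> a w - m a\<bar>) \<le> c * \<epsilon> powr (1/2)"
      unfolding \<rho>_def m_def c_def by (rule density_chaos[OF e sc u])
    also have "\<dots> \<le> c * \<epsilon> powr (7/160)"
    proof (rule mult_left_mono)
      show "\<epsilon> powr (1/2) \<le> \<epsilon> powr (7/160)" using e by (intro powr_mono') auto
      show "0 \<le> c" using A.B_nonneg u by (simp add: c_def)
    qed
    finally show ?thesis .
  qed
  have mid: "\<bar>m a - m ?z\<bar> \<le> C * \<epsilon> powr (7/160)" if a: "\<bar>a - ?z\<bar> \<le> \<bar>x - y\<bar>" for a
  proof -
    have "\<bar>m a - m ?z\<bar> \<le> C * \<bar>a - ?z\<bar> powr (1/20)" unfolding m_def by (rule holder)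
    also have "\<dots> \<le> C * (\<epsilon> powr (7/8)) powr (1/20)" using a d C by (intro mult_left_mono powr_mono2) auto
    also have "(\<epsilon> powr (7/8)) powr (1/20) = \<epsilon> powr (7/160)" by (simp add: powr_powr)
    finally show ?thesis .
  qed
  have mx: "\<bar>m x - m ?z\<bar> \<le> C * \<epsilon> powr (7/160)" and my: "\<bar>m y - m ?z\<bar> \<le> C * \<epsilon> powr (7/160)"
    by (rule mid, simp add: abs_if field_simps)+
  have 1: "\<bar>Z_density \<epsilon> x y u - ?w * (LINT w|M. \<rho> ?z w)\<bar> \<le> ?w * K"
  proof -
    let ?A = "\<lambda>w. (1 / real N) * (\<Sum>i<N. vm \<epsilon> (x - q i u w) * vm \<epsilon> (y - q i u w))"
    have Am: "?A \<in> borel_measurable M"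
      using u by (intro borel_measurable_times borel_measurable_const borel_measurable_sum measurable_compose[OF _ vm_measurable] borel_measurable_diff q_M) auto
    have v: "\<bar>vm \<epsilon> z\<bar> \<le> 1 / \<epsilon>" for z using vm_bounds[of \<epsilon> z] e by simp
    have "\<bar>vm \<epsilon> (x - z) * vm \<epsilon> (y - z)\<bar> \<le> 1 / \<epsilon> * (1 / \<epsilon>)" for z
      unfolding abs_mult using e by (intro mult_mono v) auto
    then have iA: "integrable M ?A" using Am average_bound by (intro integrable_bounded[where C="1 / \<epsilon> * (1 / \<epsilon>)"]) auto
    have pw: "\<bar>?A w - ?w * \<rho> ?z w\<bar> \<le> ?w * K" for w
    proof -
      have "?A w - ?w * \<rho> ?z w = (1 / real N) * (\<Sum>i<N. vm \<epsilon> (x - q i u w) * vm \<epsilon> (y - q i u w) - ?w * vm (\<epsilon> / sqrt 2) (?z - q i u w))"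
        unfolding \<rho>_def emp_density_def sum_subtractf sum_distrib_left[symmetric] right_diff_distrib by (simp only: mult.left_commute)
      then show ?thesis using average_bound[OF compare, of "\<lambda>i. q i u w"] by simp
    qed
    have "Z_density \<epsilon> x y u - ?w * (LINT w|M. \<rho> ?z w) = (LINT w|M. ?A w - ?w * \<rho> ?z w)"
      unfolding Z_density_def using iA i\<rho>[of ?z] by simp
    moreover have "\<bar>LINT w|M. ?A w - ?w * \<rho> ?z w\<bar> \<le> (LINT w|M. ?w * K)"
      by (rule order_trans[OF integral_abs_bound integral_mono]) (use iA i\<rho>[of ?z] pw in auto)
    ultimately show ?thesis by (simp add: prob_space)
  qed
  have 2: "\<bar>(LINT w|M. \<rho> ?z w) - (LINT w|M. sqrt (\<rho> x w) * sqrt (\<rho> y w))\<bar> \<le> (3 * c + 2 * C) * \<epsilon> powr (7/160)"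
  proof -
    have "(LINT w|M. \<rho> ?z w) - (LINT w|M. sqrt (\<rho> x w) * sqrt (\<rho> y w)) = (LINT w|M. \<rho> ?z w - sqrt (\<rho> x w) * sqrt (\<rho> y w))"
      using i\<rho> iS by simp
    moreover have "\<bar>LINT w|M. \<rho> ?z w - sqrt (\<rho> x w) * sqrt (\<rho> y w)\<bar>
      \<le> (LINT w|M. \<bar>\<rho> ?z w - m ?z\<bar> + (\<bar>\<rho> x w - m x\<bar> + \<bar>\<rho> y w - m y\<bar>) + 2 * (C * \<epsilon> powr (7/160)))"
    proof (rule order_trans[OF integral_abs_bound integral_mono])
      show "\<bar>\<rho> ?z w - sqrt (\<rho> x w) * sqrt (\<rho> y w)\<bar> \<le> \<bar>\<rho> ?z w - m ?z\<bar> + (\<bar>\<rho> x w - m x\<bar> + \<bar>\<rho> y w - m y\<bar>) + 2 * (C * \<epsilon> powr (7/160))" for w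
        using sqrt_mult_diff_le[OF \<rho>(2) \<rho>(2) m0, of x w y w ?z] mx my by linarith
    qed (use i\<rho> iS in auto)
    moreover have "\<dots> = (LINT w|M. \<bar>\<rho> ?z w - m ?z\<bar>) + ((LINT w|M. \<bar>\<rho> x w - m x\<bar>) + (LINT w|M. \<bar>\<rho> y w - m y\<bar>)) + 2 * (C * \<epsilon> powr (7/160))"
      using i\<rho> by (simp add: prob_space)
    moreover have "\<dots> \<le> (3 * c + 2 * C) * \<epsilon> powr (7/160)"
      using chaos[of ?z] chaos[of x] chaos[of y] by (simp add: distrib_right)
    ultimately show ?thesis by simp
  qed
  have "Z_density \<epsilon> x y u - Y_density \<epsilon> x y u = (Z_density \<epsilon> x y u - ?w * (LINT w|M. \<rho> ?z w))
     + ?w * ((LINT w|M. \<rho> ?z w) - (LINT w|M. sqrt (\<rho> x w) * sqrt (\<rho> y w)))"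
    unfolding Y_density_def \<rho>_def by (simp add: right_diff_distrib)
  also have "\<bar>\<dots>\<bar> \<le> ?w * K + ?w * ((3 * c + 2 * C) * \<epsilon> powr (7/160))"
    using 1 mult_left_mono[OF 2 w] w by (intro order_trans[OF abs_triangle_ineq] add_mono) (auto simp: abs_mult)
  finally show ?thesis unfolding c_def distrib_left .
qed

end

lemma vm_continuous: "0 < \<epsilon> \<Longrightarrow> \<epsilon> \<le> 2 \<Longrightarrow> continuous_on UNIV (vm \<epsilon>)"
  using vm_lipschitz by (rule lipschitz_continuous(1))

context particles
begin

text \<open>Three regimes, each paid for by its own summands of \<open>K\<close>: near the diagonal,
  far from it, and \<open>\<epsilon> > e0\<close>. Outside the first one, all errors are
  \<open>O(\<epsilon>)\<close>, and \<open>\<epsilon> \<le> \<epsilon> powr \<alpha>\<close> because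
  \<open>\<alpha> < 1\<close>; they go into the term without kernel.\<close>

lemma density_diff:
  assumes e: "0 < \<epsilon>" "\<epsilon> \<le> 1" and sc: "real N * \<epsilon> powr \<theta> = 1" "7 < \<theta>" and u: "0 < u" "u \<le> T" and \<alpha>: "\<alpha> < 1"
    and e0: "0 < e0" "e0 \<le> 1"
    and compare: "\<forall>\<epsilon> x y z. 0 < \<epsilon> \<and> \<epsilon> \<le> e0 \<and> \<bar>x - y\<bar> \<le> \<epsilon> powr (7/8) \<longrightarrow>
      \<bar>vm \<epsilon> (x - z) * vm \<epsilon> (y - z) - vm (sqrt 2 * \<epsilon>) (x - y) * vm (\<epsilon> / sqrt 2) ((x + y) / 2 - z)\<bar>
      \<le> vm (sqrt 2 * \<epsilon>) (x - y) * (90 * (\<epsilon> powr (1/2) + \<epsilon> powr \<alpha>))"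
    and C: "0 \<le> C" and holder: "\<forall>t\<ge>t0. \<forall>\<epsilon> x y. 0 < \<epsilon> \<and> \<epsilon> \<le> 2 \<longrightarrow>
      \<bar>(LINT \<omega>|Ma. vm \<epsilon> (x - qa t \<omega>)) - (LINT \<omega>|Ma. vm \<epsilon> (y - qa t \<omega>))\<bar> \<le> C * \<bar>x - y\<bar> powr (1/20)"
  defines "K \<equiv> 90 + (3 * (6 * (exp ((1 + \<gamma> + 2 * L) * T) * (T * (4 * B))) + 4) + 2 * C) + 3 * 256 ^ 16 + 3 / e0 ^ 3"
  shows "\<bar>Z_density \<epsilon> x y u - Y_density \<epsilon> x y u\<bar> \<le> K * (vm (sqrt 2 * \<epsilon>) (x - y) * (\<epsilon> powr (7/160) + \<epsilon> powr \<alpha>) + \<epsilon> powr \<alpha>)"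
proof -
  \<comment> \<open>The representative of \<open>y\<close> nearest to \<open>x\<close>. Both
    densities are periodic in \<open>y\<close>, but the midpoint and the real distance
    \<open>\<bar>x - y\<bar>\<close> in the kernel estimates are not.\<close>
  define y' where "y' = x - wrap (x - y)"
  have shift: "vm \<delta> (y' - z) = vm \<delta> (y - z)" for \<delta> z
    using periodic_diff_wrap[OF vm_periodic, of \<delta> "x - z" "x - y"] by (simp add: y'_def algebra_simps)
  have w': "vm (sqrt 2 * \<epsilon>) (x - y') = vm (sqrt 2 * \<epsilon>) (x - y)" by (simp add: y'_def periodic_wrap[OF vm_periodic])
  have xy': "\<bar>x - y'\<bar> \<le> pi" using wrap_range[of "x - y"] by (simp add: y'_def abs_le_iff)
  have "Z_density \<epsilon> x y' u = Z_density \<epsilon> x y u" "Y_density \<epsilon> x y' u = Y_density \<epsilon> x y u"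
    unfolding Z_density_def Y_density_def emp_density_def shift w' by simp_all
  moreover have "\<bar>Z_density \<epsilon> x y' u - Y_density \<epsilon> x y' u\<bar> \<le> K * (vm (sqrt 2 * \<epsilon>) (x - y') * (\<epsilon> powr (7/160) + \<epsilon> powr \<alpha>) + \<epsilon> powr \<alpha>)"
  proof -
    define k where "k = 3 * (6 * (exp ((1 + \<gamma> + 2 * L) * T) * (T * (4 * B))) + 4) + 2 * C"
    define w where "w = vm (sqrt 2 * \<epsilon>) (x - y')"
    define b where "b = \<epsilon> powr (7/160)"
    define d where "d = \<epsilon> powr \<alpha>"
    note s = scale_sqrt2_bounds[OF e]
    have k0: "0 \<le> k" using C u A.B_nonneg unfolding k_def by (intro add_nonneg_nonneg mult_nonneg_nonneg) auto
    have w: "0 \<le> w" "w \<le> 1 / \<epsilon>" unfolding w_def using vm_bounds[OF s(5,6), of "x - y'"] s(7) by auto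
    have b: "0 \<le> b" and d: "0 \<le> d" "\<epsilon> \<le> d"
    proof -
      have "\<epsilon> powr 1 \<le> \<epsilon> powr \<alpha>" using e \<alpha> by (intro powr_mono') auto
      then show "\<epsilon> \<le> d" using e by (simp add: d_def)
    qed (auto simp: b_def d_def)
    have inv: "0 \<le> 3 / e0 ^ 3" using e0 by simp
    have "90 + k \<le> 90 + k + 3 * P + r \<and> 3 * P \<le> 90 + k + 3 * P + r \<and> r \<le> 90 + k + 3 * P + r \<and> 0 \<le> 90 + k + 3 * P + r"
      if "0 \<le> P" "0 \<le> r" for P r using that k0 by auto
    from this[OF _ inv, of "256 ^ 16"] have "90 + k \<le> K \<and> 3 * 256 ^ 16 \<le> K \<and> 3 / e0 ^ 3 \<le> K \<and> 0 \<le> K"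
      unfolding K_def k_def by simp
    then have K: "90 + k \<le> K" "3 * 256 ^ 16 \<le> K" "3 / e0 ^ 3 \<le> K" "0 \<le> K" by blast+
    have tail: "K' * d \<le> K * (w * (b + d) + d)" if "0 \<le> K'" "K' \<le> K" for K'
    proof -
      have "K' * d \<le> K * d" using that d by (intro mult_right_mono) auto
      also have "\<dots> \<le> K * (w * (b + d) + d)" using K w b d by (intro mult_left_mono) auto
      finally show ?thesis .
    qed
    have diff_le: "\<bar>a - a'\<bar> \<le> h + h'" if "0 \<le> a" "a \<le> h" "0 \<le> a'" "a' \<le> h'" for a a' h h' :: real using that by linarith
    have u0: "0 \<le> u" using u by simp
    have "\<bar>Z_density \<epsilon> x y' u - Y_density \<epsilon> x y' u\<bar> \<le> K * (w * (b + d) + d)"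
    proof (cases "\<epsilon> \<le> e0")
      case small: True
      show ?thesis
      proof (cases "\<bar>x - y'\<bar> \<le> \<epsilon> powr (7/8)")
        case True
        have "\<bar>Z_density \<epsilon> x y' u - Y_density \<epsilon> x y' u\<bar> \<le> w * (90 * (\<epsilon> powr (1/2) + d) + k * b)"
          unfolding w_def d_def k_def b_def
        proof (rule density_diff_near[OF e sc u True _ _ C])
          show "\<bar>vm \<epsilon> (x - z) * vm \<epsilon> (y' - z) - vm (sqrt 2 * \<epsilon>) (x - y') * vm (\<epsilon> / sqrt 2) ((x + y') / 2 - z)\<bar>
            \<le> vm (sqrt 2 * \<epsilon>) (x - y') * (90 * (\<epsilon> powr (1/2) + \<epsilon> powr \<alpha>))" for z
            using compare[rule_format, of \<epsilon> x y' z] e small True by blast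
          show "\<bar>(LINT \<omega>|Ma. vm (\<epsilon> / sqrt 2) (a - qa (t0 + u) \<omega>)) - (LINT \<omega>|Ma. vm (\<epsilon> / sqrt 2) (b - qa (t0 + u) \<omega>))\<bar> \<le> C * \<bar>a - b\<bar> powr (1/20)" for a b
            using holder[rule_format, of "t0 + u" "\<epsilon> / sqrt 2" a b] u0 s(1,2) by simp
        qed
        also have "\<dots> \<le> w * (K * (b + d))"
        proof (intro mult_left_mono w)
          have "\<epsilon> powr (1/2) \<le> b" unfolding b_def using e by (intro powr_mono') auto
          moreover have "0 \<le> k * d" using k0 d by simp
          ultimately have "90 * (\<epsilon> powr (1/2) + d) + k * b \<le> (90 + k) * (b + d)" by (simp add: algebra_simps)
          also have "\<dots> \<le> K * (b + d)" using K b d by (intro mult_right_mono) auto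
          finally show "90 * (\<epsilon> powr (1/2) + d) + k * b \<le> K * (b + d)" .
        qed
        also have "\<dots> \<le> K * (w * (b + d) + d)" using K d by (simp add: distrib_left mult.left_commute)
        finally show ?thesis .
      next
        case False
        then have far: "\<epsilon> powr (7/8) \<le> \<bar>x - y'\<bar>" by simp
        note v = vm_far[OF e far xy']
        have "\<bar>Z_density \<epsilon> x y' u - Y_density \<epsilon> x y' u\<bar> \<le> 256 ^ 16 * \<epsilon>\<^sup>2 + 256 ^ 16 * \<epsilon>\<^sup>2 * (2 / \<epsilon>)"
        proof (rule diff_le)
          show "0 \<le> Z_density \<epsilon> x y' u" "Z_density \<epsilon> x y' u \<le> 256 ^ 16 * \<epsilon>\<^sup>2" by (rule Z_density_bounds[OF u0 v(2) e])+
          show "0 \<le> Y_density \<epsilon> x y' u" by (rule Y_density_bounds(1)[OF u0 e])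
          show "Y_density \<epsilon> x y' u \<le> 256 ^ 16 * \<epsilon>\<^sup>2 * (2 / \<epsilon>)"
            using v(1) e by (intro order_trans[OF Y_density_bounds(2)[OF u0 e]] mult_right_mono) auto
        qed
        also have "\<dots> = 256 ^ 16 * (\<epsilon> * \<epsilon> + 2 * \<epsilon>)" using e by (simp add: power2_eq_square distrib_left)
        also have "\<dots> \<le> 256 ^ 16 * (3 * d)"
        proof (rule mult_left_mono)
          have "\<epsilon> * \<epsilon> \<le> 1 * \<epsilon>" using e by (intro mult_right_mono) auto
          then show "\<epsilon> * \<epsilon> + 2 * \<epsilon> \<le> 3 * d" using d by linarith
        qed simp
        also have "\<dots> = 3 * 256 ^ 16 * d" by (simp only: mult.assoc mult.left_commute)
        also have "\<dots> \<le> K * (w * (b + d) + d)" using K(2) by (intro tail) auto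
        finally show ?thesis .
      qed
    next
      \<comment> \<open>No asymptotics are available for \<open>\<epsilon> > e0\<close>. The sizes
        of the kernels bound the difference by \<open>3 / \<epsilon>^2\<close>, rewritten as
        \<open>3 / \<epsilon>^3 * \<epsilon>\<close> to match the term
        \<open>\<epsilon> powr \<alpha>\<close>.\<close>
      case False
      have v: "vm \<epsilon> (x - z) * vm \<epsilon> (y' - z) \<le> 1 / \<epsilon> * (1 / \<epsilon>)" for z
        using vm_bounds[of \<epsilon>] e by (intro mult_mono) (auto simp: less_imp_le)
      have "\<bar>Z_density \<epsilon> x y' u - Y_density \<epsilon> x y' u\<bar> \<le> 1 / \<epsilon> * (1 / \<epsilon>) + 1 / \<epsilon> * (2 / \<epsilon>)"
      proof (rule diff_le)
        show "0 \<le> Z_density \<epsilon> x y' u" "Z_density \<epsilon> x y' u \<le> 1 / \<epsilon> * (1 / \<epsilon>)" by (rule Z_density_bounds[OF u0 v e])+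
        show "0 \<le> Y_density \<epsilon> x y' u" by (rule Y_density_bounds(1)[OF u0 e])
        show "Y_density \<epsilon> x y' u \<le> 1 / \<epsilon> * (2 / \<epsilon>)"
          using w e unfolding w_def by (intro order_trans[OF Y_density_bounds(2)[OF u0 e]] mult_right_mono) auto
      qed
      also have "\<dots> = 3 / \<epsilon> ^ 3 * \<epsilon>" using e by (simp add: power3_eq_cube)
      also have "\<dots> \<le> 3 / e0 ^ 3 * d"
      proof (rule mult_mono)
        show "3 / \<epsilon> ^ 3 \<le> 3 / e0 ^ 3" using False e0 e by (intro divide_left_mono power_mono mult_pos_pos) auto
      qed (use d e inv in auto)
      also have "\<dots> \<le> K * (w * (b + d) + d)" using K(3) inv by (intro tail) auto
      finally show ?thesis .
    qed
    then show ?thesis unfolding w_def b_def d_def .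
  qed
  ultimately show ?thesis unfolding w' by simp
qed

lemma q_continuous_AE: "AE \<omega> in M. \<forall>i\<in>{..<N}. continuous_on {0..} (\<lambda>u. q i u \<omega>)"
  using path_AE by eventually_elim (auto simp: kinetic_path_def)

lemma regular_vm:
  assumes i: "i < N" and e: "0 < \<epsilon>" "\<epsilon> \<le> 2"
  shows "regular (\<lambda>u \<omega>. c * vm \<epsilon> (x - q i u \<omega>))"
  unfolding regular_def
proof (intro conjI allI impI)
  show "(\<lambda>\<omega>. c * vm \<epsilon> (x - q i u \<omega>)) \<in> borel_measurable (F u)" if "0 \<le> u" for u
    using q_F[OF i that] by (intro borel_measurable_times borel_measurable_const measurable_compose[OF _ vm_measurable] borel_measurable_diff)
  have "\<bar>c * vm \<epsilon> z\<bar> \<le> \<bar>c\<bar> * (1 / \<epsilon>)" for z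
    unfolding abs_mult using vm_bounds[OF e, of z] by (intro mult_left_mono) auto
  then show "\<exists>B. \<forall>u. \<forall>\<omega>\<in>space M. \<bar>c * vm \<epsilon> (x - q i u \<omega>)\<bar> \<le> B" by blast
  show "AE \<omega> in M. continuous_on {0..} (\<lambda>u. c * vm \<epsilon> (x - q i u \<omega>))"
    using q_continuous_AE
  proof eventually_elim
    case (elim \<omega>)
    then have "continuous_on {0..} (\<lambda>u. q i u \<omega>)" using i by blast
    then show ?case
      by (intro continuous_on_mult continuous_on_const continuous_on_compose2[OF vm_continuous[OF e]] continuous_on_diff) auto
  qed
qed

lemma regular_sqrt_density:
  assumes e: "0 < \<epsilon>" "\<epsilon> \<le> 1"
  shows "regular (\<lambda>u \<omega>. c * sqrt (emp_density N (\<epsilon> / sqrt 2) q x u \<omega>))"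
  unfolding regular_def
proof (intro conjI allI impI)
  note s = scale_sqrt2_bounds[OF e]
  show "(\<lambda>\<omega>. c * sqrt (emp_density N (\<epsilon> / sqrt 2) q x u \<omega>)) \<in> borel_measurable (F u)" if "0 \<le> u" for u
  proof -
    have "(\<lambda>\<omega>. emp_density N (\<epsilon> / sqrt 2) q x u \<omega>) \<in> borel_measurable (F u)"
      unfolding emp_density_def using q_F[OF _ that]
      by (intro borel_measurable_times borel_measurable_const borel_measurable_sum measurable_compose[OF _ vm_measurable] borel_measurable_diff) auto
    then show ?thesis by measurable
  qed
  have "\<bar>c * sqrt (emp_density N (\<epsilon> / sqrt 2) q x u \<omega>)\<bar> \<le> \<bar>c\<bar> * sqrt (2 / \<epsilon>)" for u \<omega>
    unfolding abs_mult using emp_density_bounds[OF e, of x u \<omega>] by (intro mult_left_mono) auto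
  then show "\<exists>B. \<forall>u. \<forall>\<omega>\<in>space M. \<bar>c * sqrt (emp_density N (\<epsilon> / sqrt 2) q x u \<omega>)\<bar> \<le> B" by blast
  show "AE \<omega> in M. continuous_on {0..} (\<lambda>u. c * sqrt (emp_density N (\<epsilon> / sqrt 2) q x u \<omega>))"
    using q_continuous_AE
  proof eventually_elim
    case (elim \<omega>)
    then show ?case unfolding emp_density_def
      by (intro continuous_on_mult continuous_on_const continuous_on_real_sqrt continuous_on_sum continuous_on_compose2[OF vm_continuous[OF s(1,2)]] continuous_on_diff) auto
  qed
qed

lemma Z_density_eq:
  assumes u: "0 \<le> u" and e: "0 < \<epsilon>" "\<epsilon> \<le> 1"
  shows "Z_density \<epsilon> x y u = (1 / real N) * (\<Sum>i<N. LINT \<omega>|M. vm \<epsilon> (x - q i u \<omega>) * vm \<epsilon> (y - q i u \<omega>))"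
proof -
  have v: "\<bar>vm \<epsilon> z\<bar> \<le> 1 / \<epsilon>" for z using vm_bounds[of \<epsilon> z] e by simp
  have "integrable M (\<lambda>\<omega>. vm \<epsilon> (x - q i u \<omega>) * vm \<epsilon> (y - q i u \<omega>))" if "i < N" for i
  proof (rule integrable_bounded[where C="1 / \<epsilon> * (1 / \<epsilon>)"])
    show "(\<lambda>\<omega>. vm \<epsilon> (x - q i u \<omega>) * vm \<epsilon> (y - q i u \<omega>)) \<in> borel_measurable M"
      by (intro borel_measurable_times borel_measurable_const measurable_compose[OF _ vm_measurable] borel_measurable_diff q_M that u)
    show "\<bar>vm \<epsilon> (x - q i u \<omega>) * vm \<epsilon> (y - q i u \<omega>)\<bar> \<le> 1 / \<epsilon> * (1 / \<epsilon>)" for \<omega>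
      unfolding abs_mult using e by (intro mult_mono v) auto
  qed
  then show ?thesis unfolding Z_density_def integral_mult_right_zero by (subst Bochner_Integration.integral_sum) auto
qed

lemma vm_product_Leb:
  assumes i: "i < N" and e: "0 < \<epsilon>" "\<epsilon> \<le> 1"
  shows "integrable (Leb t) (\<lambda>u. LINT \<omega>|M. vm \<epsilon> (x - q i u \<omega>) * vm \<epsilon> (y - q i u \<omega>))"
proof (rule integrable_Leb)
  have "\<epsilon> \<le> 2" using e by simp
  then show "(\<lambda>u. LINT \<omega>|M. vm \<epsilon> (x - q i u \<omega>) * vm \<epsilon> (y - q i u \<omega>)) \<in> borel_measurable (Leb t)"
    using measurable_restrict_continuous[OF regular_pair_continuous[OF regular_vm[OF i e(1), of 1 x] regular_vm[OF i e(1), of 1 y]]] by simp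
  have v: "0 \<le> vm \<epsilon> z" "vm \<epsilon> z \<le> 1 / \<epsilon>" for z using vm_bounds[of \<epsilon> z] e by auto
  fix u :: real assume u: "0 \<le> u"
  have m: "(\<lambda>\<omega>. vm \<epsilon> (x - q i u \<omega>) * vm \<epsilon> (y - q i u \<omega>)) \<in> borel_measurable M"
    by (intro borel_measurable_times borel_measurable_const measurable_compose[OF _ vm_measurable] borel_measurable_diff q_M i u)
  have "vm \<epsilon> (x - q i u \<omega>) * vm \<epsilon> (y - q i u \<omega>) \<le> 1 / \<epsilon> * (1 / \<epsilon>)" for \<omega>
    using v e by (intro mult_mono) auto
  moreover have "0 \<le> vm \<epsilon> (x - q i u \<omega>) * vm \<epsilon> (y - q i u \<omega>)" for \<omega> using v by simp
  ultimately show "\<bar>LINT \<omega>|M. vm \<epsilon> (x - q i u \<omega>) * vm \<epsilon> (y - q i u \<omega>)\<bar> \<le> 1 / \<epsilon> * (1 / \<epsilon>)"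
    using expectation_bounds[OF m] by (simp add: abs_le_iff)
qed

end

section \<open>The covariances as integrals of these densities\<close>

context particles
begin

lemma Z_density_integrable:
  assumes e: "0 < \<epsilon>" "\<epsilon> \<le> 1"
  shows "integrable (Leb t) (Z_density \<epsilon> x y)"
proof -
  have "integrable (Leb t) (\<lambda>u. (1 / real N) * (\<Sum>i<N. LINT w|M. vm \<epsilon> (x - q i u w) * vm \<epsilon> (y - q i u w)))"
    by (intro integrable_mult_right Bochner_Integration.integrable_sum vm_product_Leb e) auto
  also have "?this \<longleftrightarrow> ?thesis"
    by (intro Bochner_Integration.integrable_cong refl Z_density_eq[symmetric] e) (simp add: space_restrict_space)
  finally show ?thesis .
qed

lemma Y_density_integrable:
  assumes e: "0 < \<epsilon>" "\<epsilon> \<le> 1"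
  shows "integrable (Leb t) (Y_density \<epsilon> x y)"
proof (rule integrable_Leb)
  show "Y_density \<epsilon> x y \<in> borel_measurable (Leb t)"
    unfolding Y_density_def[abs_def]
    using measurable_restrict_continuous[OF regular_pair_continuous[OF regular_sqrt_density[OF e, of 1 x] regular_sqrt_density[OF e, of 1 y]]]
    by (intro borel_measurable_times borel_measurable_const) simp
  show "\<bar>Y_density \<epsilon> x y u\<bar> \<le> vm (sqrt 2 * \<epsilon>) (x - y) * (2 / \<epsilon>)" if "0 \<le> u" for u
    using Y_density_bounds[OF that e, of x y] by simp
qed

text \<open>The isometry applied to each pair of particles. Different Brownian motions have
  covariation 0, and the \<open>N\<close> diagonal terms with weight \<open>(\<sigma> / N)^2\<close>
  average to \<open>\<sigma>^2 / N\<close>.\<close>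

lemma Z_covariance:
  assumes e: "0 < \<epsilon>" "\<epsilon> \<le> 1" and t: "0 \<le> t"
  shows "(LINT w|M. noise_Z M F N \<epsilon> \<sigma> \<beta> q x t w * noise_Z M F N \<epsilon> \<sigma> \<beta> q y t w) = \<sigma>\<^sup>2 / real N * (LINT u|Leb t. Z_density \<epsilon> x y u)"
proof -
  have e2: "\<epsilon> \<le> 2" using e by simp
  define f where "f z i = (\<lambda>u w. \<sigma> / real N * vm \<epsilon> (z - q i u w))" for z i
  define I where "I z i = ito_integral M F (\<beta> i) (f z i) t" for z i
  have regular: "regular (f z i)" if "i < N" for z i unfolding f_def by (rule regular_vm[OF that e(1) e2])
  have ito: "has_ito_integral M F (\<beta> i) (f z i) t (I z i)" if "i < N" for z i
    unfolding I_def by (rule ito_integral_exists[OF brownian_incr[OF brownian] brownian_cov_rate[OF brownian] regular t]) (rule that)+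
  have rate: "cov_rate (\<beta> i) (\<beta> j) (of_bool (i = j))" if "i < N" "j < N" for i j
  proof (cases "i = j")
    case True
    then show ?thesis using brownian_cov_rate[OF brownian[OF that(1)]] by simp
  next
    case False
    have "indep_var (PiM {0..} (\<lambda>_. borel)) (\<lambda>w. \<lambda>t\<in>{0..}. \<beta> i t w) (PiM {0..} (\<lambda>_. borel)) (\<lambda>w. \<lambda>t\<in>{0..}. \<beta> j t w)"
      using that False by (intro indep_vars_pair[OF brownian_indep]) auto
    then show ?thesis using brownian_cross_cov_rate[OF brownian[OF that(1)] brownian[OF that(2)]] False by simp
  qed
  have iso: "integrable M (\<lambda>w. I x i w * I y j w)"
    "(LINT w|M. I x i w * I y j w) = of_bool (i = j) * (LINT u|Leb t. LINT w|M. f x i u w * f y j u w)" if "i < N" "j < N" for i j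
    using ito_isometry[OF brownian_incr[OF brownian[OF that(1)]] brownian_incr[OF brownian[OF that(2)]] rate[OF that] t regular[OF that(1)] regular[OF that(2)] ito[OF that(1)] ito[OF that(2)]] by auto
  have ff: "(LINT u|Leb t. LINT w|M. f x i u w * f y i u w) = (\<sigma> / real N)\<^sup>2 * (LINT u|Leb t. LINT w|M. vm \<epsilon> (x - q i u w) * vm \<epsilon> (y - q i u w))" for i
  proof -
    have "f x i u w * f y i u w = (\<sigma> / real N)\<^sup>2 * (vm \<epsilon> (x - q i u w) * vm \<epsilon> (y - q i u w))" for u w
      unfolding f_def power2_eq_square by (simp only: mult.assoc mult.left_commute)
    then show ?thesis by (simp only: integral_mult_right_zero)
  qed
  have "(LINT w|M. noise_Z M F N \<epsilon> \<sigma> \<beta> q x t w * noise_Z M F N \<epsilon> \<sigma> \<beta> q y t w) = (LINT w|M. (\<Sum>i<N. \<Sum>j<N. I x i w * I y j w))"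
    unfolding noise_Z_def sum_product I_def f_def ..
  also have "\<dots> = (\<Sum>i<N. LINT w|M. (\<Sum>j<N. I x i w * I y j w))"
    by (intro Bochner_Integration.integral_sum Bochner_Integration.integrable_sum iso) auto
  also have "\<dots> = (\<Sum>i<N. \<Sum>j<N. LINT w|M. I x i w * I y j w)"
    by (intro sum.cong refl Bochner_Integration.integral_sum iso) auto
  also have "\<dots> = (\<Sum>i<N. \<Sum>j<N. of_bool (i = j) * (LINT u|Leb t. LINT w|M. f x i u w * f y j u w))"
    by (intro sum.cong refl iso(2)) auto
  also have "\<dots> = (\<Sum>i<N. (\<sigma> / real N)\<^sup>2 * (LINT u|Leb t. LINT w|M. vm \<epsilon> (x - q i u w) * vm \<epsilon> (y - q i u w)))"
  proof (rule sum.cong[OF refl])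
    fix i assume i: "i \<in> {..<N}"
    have "(\<Sum>j<N. of_bool (i = j) * (LINT u|Leb t. LINT w|M. f x i u w * f y j u w))
      = (\<Sum>j<N. if j = i then LINT u|Leb t. LINT w|M. f x i u w * f y i u w else 0)" by (intro sum.cong refl) auto
    also have "\<dots> = (LINT u|Leb t. LINT w|M. f x i u w * f y i u w)" using i by simp
    finally show "(\<Sum>j<N. of_bool (i = j) * (LINT u|Leb t. LINT w|M. f x i u w * f y j u w))
      = (\<sigma> / real N)\<^sup>2 * (LINT u|Leb t. LINT w|M. vm \<epsilon> (x - q i u w) * vm \<epsilon> (y - q i u w))" unfolding ff .
  qed
  also have "\<dots> = \<sigma>\<^sup>2 / real N * ((1 / real N) * (\<Sum>i<N. LINT u|Leb t. LINT w|M. vm \<epsilon> (x - q i u w) * vm \<epsilon> (y - q i u w)))"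
    unfolding sum_distrib_left[symmetric] by (simp add: power_divide power2_eq_square)
  also have "(\<Sum>i<N. LINT u|Leb t. LINT w|M. vm \<epsilon> (x - q i u w) * vm \<epsilon> (y - q i u w))
      = (LINT u|Leb t. (\<Sum>i<N. LINT w|M. vm \<epsilon> (x - q i u w) * vm \<epsilon> (y - q i u w)))"
    by (intro Bochner_Integration.integral_sum[symmetric] vm_product_Leb e) auto
  also have "(1 / real N) * \<dots> = (LINT u|Leb t. (1 / real N) * (\<Sum>i<N. LINT w|M. vm \<epsilon> (x - q i u w) * vm \<epsilon> (y - q i u w)))"
    by (rule integral_mult_right_zero[symmetric])
  also have "\<dots> = (LINT u|Leb t. Z_density \<epsilon> x y u)"
    by (intro Bochner_Integration.integral_cong refl Z_density_eq[symmetric] e) (simp add: space_restrict_space)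
  finally show ?thesis .
qed

text \<open>For fixed points the noise is an integral against a scalar process. The spatial
  correlation of \<open>V\<close> appears as the covariation rate
  \<open>vm (sqrt 2 * \<epsilon>) (x - y)\<close>, a constant in time.\<close>

lemma Y_covariance:
  assumes e: "0 < \<epsilon>" "\<epsilon> \<le> 1" and t: "0 \<le> t" and V: "Q_wiener_process M F (conv (vm (sqrt 2 * \<epsilon>))) V"
  shows "(LINT w|M. noise_Y M F N \<epsilon> \<sigma> V q x t w * noise_Y M F N \<epsilon> \<sigma> V q y t w) = \<sigma>\<^sup>2 / real N * (LINT u|Leb t. Y_density \<epsilon> x y u)"
proof -
  note s = scale_sqrt2_bounds[OF e]
  interpret V: filtered_kernel M F "vm (sqrt 2 * \<epsilon>)" "2 / (sqrt 2 * \<epsilon>) ^ 3" V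
    using vm_lipschitz[OF s(5,6)] vm_bounds(1)[OF s(5,6)] V by unfold_locales (auto simp: vm_periodic vm_even less_imp_le)
  let ?c = "\<sigma> * real N powr (-1/2)"
  let ?f = "\<lambda>z u w. ?c * sqrt (emp_density N (\<epsilon> / sqrt 2) q z u w)"
  have regular: "regular (?f z)" for z by (rule regular_sqrt_density[OF e])
  have ito: "has_ito_integral M F (\<lambda>u w. V u w z) (?f z) t (noise_Y M F N \<epsilon> \<sigma> V q z t)" for z
    unfolding noise_Y_def by (rule ito_integral_exists[OF V.Q_wiener_incr V.Q_wiener_cov_rate regular t])
  have "(LINT w|M. noise_Y M F N \<epsilon> \<sigma> V q x t w * noise_Y M F N \<epsilon> \<sigma> V q y t w)
    = vm (sqrt 2 * \<epsilon>) (x - y) * (LINT u|Leb t. LINT w|M. ?f x u w * ?f y u w)"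
    by (rule ito_isometry(2)[OF V.Q_wiener_incr V.Q_wiener_incr V.Q_wiener_cov_rate t regular regular ito ito])
  also have "(LINT u|Leb t. LINT w|M. ?f x u w * ?f y u w)
    = (LINT u|Leb t. LINT w|M. ?c\<^sup>2 * (sqrt (emp_density N (\<epsilon> / sqrt 2) q x u w) * sqrt (emp_density N (\<epsilon> / sqrt 2) q y u w)))"
    unfolding power2_eq_square by (simp only: mult.assoc mult.left_commute)
  also have "\<dots> = ?c\<^sup>2 * (LINT u|Leb t. LINT w|M. sqrt (emp_density N (\<epsilon> / sqrt 2) q x u w) * sqrt (emp_density N (\<epsilon> / sqrt 2) q y u w))"
    by (simp only: integral_mult_right_zero)
  also have "?c\<^sup>2 = \<sigma>\<^sup>2 / real N"
  proof -
    have "(real N powr (-1/2))\<^sup>2 = real N powr (-1)" by (simp add: power2_eq_square powr_add[symmetric])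
    also have "\<dots> = 1 / real N" using N by (simp add: powr_neg_one)
    finally show ?thesis unfolding power_mult_distrib by simp
  qed
  finally show ?thesis unfolding Y_density_def integral_mult_right_zero by (simp only: mult.left_commute)
qed

lemma covariance_diff:
  assumes e: "0 < \<epsilon>" "\<epsilon> \<le> 1" and t: "0 \<le> t" "t \<le> T" and V: "Q_wiener_process M F (conv (vm (sqrt 2 * \<epsilon>))) V"
    and D: "\<And>u. 0 < u \<Longrightarrow> u \<le> T \<Longrightarrow> \<bar>Z_density \<epsilon> x y u - Y_density \<epsilon> x y u\<bar> \<le> D" and D0: "0 \<le> D"
  shows "\<bar>(LINT w|M. noise_Z M F N \<epsilon> \<sigma> \<beta> q x t w * noise_Z M F N \<epsilon> \<sigma> \<beta> q y t w)
      - (LINT w|M. noise_Y M F N \<epsilon> \<sigma> V q x t w * noise_Y M F N \<epsilon> \<sigma> V q y t w)\<bar> \<le> \<sigma>\<^sup>2 / real N * (T * D)"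
proof -
  have eq: "(LINT w|M. noise_Z M F N \<epsilon> \<sigma> \<beta> q x t w * noise_Z M F N \<epsilon> \<sigma> \<beta> q y t w)
      - (LINT w|M. noise_Y M F N \<epsilon> \<sigma> V q x t w * noise_Y M F N \<epsilon> \<sigma> V q y t w)
    = \<sigma>\<^sup>2 / real N * (LINT u|Leb t. Z_density \<epsilon> x y u - Y_density \<epsilon> x y u)"
    unfolding Z_covariance[OF e t(1)] Y_covariance[OF e t(1) V]
      Bochner_Integration.integral_diff[OF Z_density_integrable[OF e] Y_density_integrable[OF e]] by (simp only: right_diff_distrib)
  interpret L: finite_measure "Leb t" by (rule finite_Leb)
  \<comment> \<open>The estimate of the densities is available for \<open>u > 0\<close> only, since
    chaos is proved over an interval of positive length.\<close>
  have "AE u in lborel. u \<noteq> (0::real)" by (rule AE_lborel_singleton)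
  then have "AE u in lborel. u \<in> {0..t} \<longrightarrow> \<bar>Z_density \<epsilon> x y u - Y_density \<epsilon> x y u\<bar> \<le> D"
    by eventually_elim (use D t in auto)
  then have ae: "AE u in Leb t. \<bar>Z_density \<epsilon> x y u - Y_density \<epsilon> x y u\<bar> \<le> D" by (subst AE_restrict_space_iff) auto
  have "\<bar>LINT u|Leb t. Z_density \<epsilon> x y u - Y_density \<epsilon> x y u\<bar> \<le> (LINT u|Leb t. D)"
    by (rule order_trans[OF integral_abs_bound integral_mono_AE])
      (use ae Z_density_integrable[OF e] Y_density_integrable[OF e] in auto)
  also have "\<dots> = t * D" using t by (simp add: measure_restrict_space space_restrict_space)
  also have "\<dots> \<le> T * D" using t D0 by (intro mult_right_mono)
  finally have "\<bar>LINT u|Leb t. Z_density \<epsilon> x y u - Y_density \<epsilon> x y u\<bar> \<le> T * D" .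
  then have "\<sigma>\<^sup>2 / real N * \<bar>LINT u|Leb t. Z_density \<epsilon> x y u - Y_density \<epsilon> x y u\<bar> \<le> \<sigma>\<^sup>2 / real N * (T * D)" by (rule mult_left_mono) simp
  then show ?thesis unfolding eq abs_mult by simp
qed

end

lemma torus_dist_nonneg: "0 \<le> torus_dist x y"
  unfolding torus_dist_def by (rule cINF_greatest) auto

theorem proposition3p7:
  fixes \<gamma> \<sigma> \<alpha> t\<^sub>0 :: real and W :: "real \<Rightarrow> real" and f\<^sub>0 :: "real \<times> real \<Rightarrow> real"
    and M\<^sub>a :: "'b measure" and F\<^sub>a :: "real \<Rightarrow> 'b measure"
    and \<beta>\<^sub>a q\<^sub>a p\<^sub>a :: "real \<Rightarrow> 'b \<Rightarrow> real"
  assumes "\<gamma> > 0" and "\<sigma> > 0" and "C2_torus W"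
    and "vm_gauss_exponent \<alpha>"
    and "t\<^sub>0 > 0" and "admissible_density f\<^sub>0"
    and "mckean_vlasov M\<^sub>a F\<^sub>a \<gamma> \<sigma> W \<beta>\<^sub>a q\<^sub>a p\<^sub>a"
    and "phase_law M\<^sub>a (q\<^sub>a 0) (p\<^sub>a 0) = density_law f\<^sub>0"
  shows "\<exists>\<theta>\<^sub>0. \<forall>\<theta>>\<theta>\<^sub>0. \<exists>c\<^sub>1>0. \<exists>c\<^sub>2>0. \<forall>T>0. \<exists>C>0.
    \<forall>(\<epsilon>::real) (N::nat) (M :: 'a measure) F \<beta> q p V (x\<^sub>1::real) (x\<^sub>2::real) (t::real).
      0 < \<epsilon> \<and> \<epsilon> \<le> 1 \<and> real N * \<epsilon> powr \<theta> = 1 \<and> 0 \<le> t \<and> t \<le> T \<and>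
      particle_system M F N \<gamma> \<sigma> W (phase_law M\<^sub>a (q\<^sub>a t\<^sub>0) (p\<^sub>a t\<^sub>0)) \<beta> q p \<and>
      Q_wiener_process M F (conv (vm (sqrt 2 * \<epsilon>))) V
      \<longrightarrow>
      \<bar>(LINT \<omega>|M. noise_Z M F N \<epsilon> \<sigma> \<beta> q x\<^sub>1 t \<omega> * noise_Z M F N \<epsilon> \<sigma> \<beta> q x\<^sub>2 t \<omega>)
        - (LINT \<omega>|M. noise_Y M F N \<epsilon> \<sigma> V q x\<^sub>1 t \<omega> * noise_Y M F N \<epsilon> \<sigma> V q x\<^sub>2 t \<omega>)\<bar>
      \<le> C * \<sigma>\<^sup>2 / real N * vm (sqrt 2 * \<epsilon>) (x\<^sub>1 - x\<^sub>2) *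
          (torus_dist x\<^sub>1 x\<^sub>2 + \<epsilon> powr c\<^sub>1 + \<epsilon> powr \<alpha> + \<epsilon> powr c\<^sub>2 * torus_dist x\<^sub>1 x\<^sub>2 powr (1/2))
        + C * \<sigma>\<^sup>2 / real N * \<epsilon> powr \<alpha>"
proof -
  obtain B L where f: "force (deriv W) B L" using C2_torus_force[OF assms(3)] by blast
  interpret fo: force "deriv W" B L by (rule f)
  have fa: "filtered M\<^sub>a F\<^sub>a" using assms(7) by (auto simp: mckean_vlasov_def intro: filtered_prob_spaceD)
  have A: "mckean M\<^sub>a F\<^sub>a (deriv W) B L \<gamma> \<sigma> \<beta>\<^sub>a q\<^sub>a p\<^sub>a"
    using assms(1,2,7) by (intro mckean.intro fa f mckean_axioms.intro) (auto simp: mckean_vlasov_def)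
  obtain e0 where e0: "0 < e0" "e0 \<le> 1" and compare: "\<forall>\<epsilon> x y z. 0 < \<epsilon> \<and> \<epsilon> \<le> e0 \<and> \<bar>x - y\<bar> \<le> \<epsilon> powr (7/8) \<longrightarrow>
      \<bar>vm \<epsilon> (x - z) * vm \<epsilon> (y - z) - vm (sqrt 2 * \<epsilon>) (x - y) * vm (\<epsilon> / sqrt 2) ((x + y) / 2 - z)\<bar>
      \<le> vm (sqrt 2 * \<epsilon>) (x - y) * (90 * (\<epsilon> powr (1/2) + \<epsilon> powr \<alpha>))"
    using kernel_compare[OF assms(4)] by blast
  obtain C where C: "0 \<le> C" and holder: "\<forall>t\<ge>t\<^sub>0. \<forall>\<epsilon> x y. 0 < \<epsilon> \<and> \<epsilon> \<le> 2 \<longrightarrow>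
      \<bar>(LINT \<omega>|M\<^sub>a. vm \<epsilon> (x - q\<^sub>a t \<omega>)) - (LINT \<omega>|M\<^sub>a. vm \<epsilon> (y - q\<^sub>a t \<omega>))\<bar> \<le> C * \<bar>x - y\<bar> powr (1/20)"
    using mckean.law_holder[OF A assms(5)] by blast
  have \<alpha>: "\<alpha> < 1" using assms(4) by (simp add: vm_gauss_exponent_def)
  \<comment> \<open>Built from \<open>\<gamma>\<close>, \<open>T\<close>, the bounds of
    \<open>deriv W\<close>, the Hoelder constant of the auxiliary law and \<open>e0\<close>; all are
    fixed before \<open>\<epsilon>\<close>, \<open>N\<close> and the particle space are chosen,
    which gives the uniformity of the constant.\<close>
  define K where "K T = 90 + (3 * (6 * (exp ((1 + \<gamma> + 2 * L) * T) * (T * (4 * B))) + 4) + 2 * C) + 3 * 256 ^ 16 + 3 / e0 ^ 3" for T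
  have K: "0 < T * K T" if "0 < T" for T
  proof -
    have "0 \<le> exp ((1 + \<gamma> + 2 * L) * T) * (T * (4 * B))" "0 < e0 ^ 3" using that fo.B_nonneg e0 by auto
    then have "0 < K T" using C unfolding K_def by (intro add_pos_pos add_pos_nonneg) auto
    then show ?thesis using that by simp
  qed
  have bound: "\<bar>(LINT \<omega>|M. noise_Z M F N \<epsilon> \<sigma> \<beta> q x t \<omega> * noise_Z M F N \<epsilon> \<sigma> \<beta> q y t \<omega>)
        - (LINT \<omega>|M. noise_Y M F N \<epsilon> \<sigma> V q x t \<omega> * noise_Y M F N \<epsilon> \<sigma> V q y t \<omega>)\<bar>
      \<le> T * K T * \<sigma>\<^sup>2 / real N * vm (sqrt 2 * \<epsilon>) (x - y) *
          (torus_dist x y + \<epsilon> powr (7/160) + \<epsilon> powr \<alpha> + \<epsilon> powr 1 * torus_dist x y powr (1/2))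
        + T * K T * \<sigma>\<^sup>2 / real N * \<epsilon> powr \<alpha>"
    if \<theta>: "7 < \<theta>" and T: "0 < T" and h: "0 < \<epsilon> \<and> \<epsilon> \<le> 1 \<and> real N * \<epsilon> powr \<theta> = 1 \<and> 0 \<le> t \<and> t \<le> T \<and>
      particle_system M F N \<gamma> \<sigma> W (phase_law M\<^sub>a (q\<^sub>a t\<^sub>0) (p\<^sub>a t\<^sub>0)) \<beta> q p \<and> Q_wiener_process M F (conv (vm (sqrt 2 * \<epsilon>))) V"
    for \<theta> T \<epsilon> N \<beta> q p V x y t and M :: "'a measure" and F
  proof -
    have e: "0 < \<epsilon>" "\<epsilon> \<le> 1" and sc: "real N * \<epsilon> powr \<theta> = 1" and t: "0 \<le> t" "t \<le> T"
      and sys: "particle_system M F N \<gamma> \<sigma> W (phase_law M\<^sub>a (q\<^sub>a t\<^sub>0) (p\<^sub>a t\<^sub>0)) \<beta> q p"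
      and V: "Q_wiener_process M F (conv (vm (sqrt 2 * \<epsilon>))) V" using h by blast+
    have fM: "filtered M F" using sys by (auto simp: particle_system_def intro: filtered_prob_spaceD)
    interpret particles M\<^sub>a F\<^sub>a "deriv W" B L \<gamma> \<sigma> \<beta>\<^sub>a q\<^sub>a p\<^sub>a M F N W t\<^sub>0 \<beta> q p
      by (intro particles.intro A fM particles_axioms.intro sqrt_of_scaling(1)[OF e sc \<theta>] assms(5) refl sys)
    let ?w = "vm (sqrt 2 * \<epsilon>) (x - y)" and ?d = "torus_dist x y"
    let ?D = "K T * (?w * (\<epsilon> powr (7/160) + \<epsilon> powr \<alpha>) + \<epsilon> powr \<alpha>)"
    have w: "0 \<le> ?w" using vm_bounds(1) scale_sqrt2_bounds(5,6)[OF e] by (simp add: less_imp_le)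
    have K0: "0 \<le> K T" using K[OF T] T by (simp add: zero_less_mult_iff)
    have "\<bar>(LINT \<omega>|M. noise_Z M F N \<epsilon> \<sigma> \<beta> q x t \<omega> * noise_Z M F N \<epsilon> \<sigma> \<beta> q y t \<omega>)
        - (LINT \<omega>|M. noise_Y M F N \<epsilon> \<sigma> V q x t \<omega> * noise_Y M F N \<epsilon> \<sigma> V q y t \<omega>)\<bar> \<le> \<sigma>\<^sup>2 / real N * (T * ?D)"
    proof (rule covariance_diff[OF e t V])
      show "\<bar>Z_density \<epsilon> x y u - Y_density \<epsilon> x y u\<bar> \<le> ?D" if "0 < u" "u \<le> T" for u
        unfolding K_def by (rule density_diff[OF e sc \<theta> that \<alpha> e0 compare C holder])
      show "0 \<le> ?D" using K0 w by (intro mult_nonneg_nonneg add_nonneg_nonneg) auto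
    qed
    also have "\<dots> \<le> \<sigma>\<^sup>2 / real N * (T * (K T * (?w * (?d + \<epsilon> powr (7/160) + \<epsilon> powr \<alpha> + \<epsilon> powr 1 * ?d powr (1/2)) + \<epsilon> powr \<alpha>)))"
    proof (intro mult_left_mono add_right_mono w)
      \<comment> \<open>The terms with the distance are nonnegative, so the sharper bound without
        them implies the stated one.\<close>
      have "0 \<le> \<epsilon> powr 1 * ?d powr (1/2)" by simp
      then show "\<epsilon> powr (7/160) + \<epsilon> powr \<alpha> \<le> ?d + \<epsilon> powr (7/160) + \<epsilon> powr \<alpha> + \<epsilon> powr 1 * ?d powr (1/2)"
        using torus_dist_nonneg[of x y] by linarith
    qed (use K0 T in auto)
    also have "s / n * (T * (k * (w * x + a))) = T * k * s / n * w * x + T * k * s / n * a" for s n w x a k :: real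
      by (simp add: distrib_left add_divide_distrib mult_ac)
    finally show ?thesis .
  qed
  \<comment> \<open>The witnesses are \<open>7\<close> for the threshold, \<open>7/160\<close> and
    \<open>1\<close> for the two exponents, and \<open>T * K T\<close> for the constant; the second
    exponent may be any positive number.\<close>
  show ?thesis
    by (rule exI[of _ 7], intro allI impI, rule exI[of _ "7/160"], rule conjI, simp, rule exI[of _ 1], rule conjI, simp,
        intro allI impI, rule exI, rule conjI, erule K, intro allI impI, rule bound)
qed

end
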